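(* Let $n\ge2$ and let $\Omega\subset\mathbb{R}^n$ be a bounded domain with sufficiently smooth boundary. Let $\rho\in C^1(\bar\Omega)$ with $2\le\rho^-\le\rho(x)\le\rho^+<\infty$, let $m$ be a number with $\rho(x)\ge m\ge2$ for a.e. $x\in\Omega$, put $m_1=\frac m{m-1}$ with $m_1<n$, $\psi(x)=\frac{\rho(x)-m}{m-1}$, and let $\varphi:\Omega\to\mathbb{R}$ be measurable with $1\le\varphi^-\le\varphi(x)\le\varphi^+<\infty$. Let $T_0$ and $\tilde T_0$ be the function classes defined in the context. Then: (a) the function $\phi:\Omega\times\mathbb{R}\to\mathbb{R}$, $\phi(x,\tau)=|\tau|^{\rho(x)-2}\tau$, is (via $u\mapsto\phi(\cdot,u(\cdot))$) a bijection between $T_0$ and $W_0^{1,m_1}(\Omega)\cap L^{\frac{\varphi(x)+\psi(x)}{(m-1)(\psi(x)+1)}}(\Omega)$; (b) the function $\tilde\phi:\Omega\times\mathbb{R}\to\mathbb{R}$, $\tilde\phi(x,\tau)=|\tau|^{\psi(x)}\tau$, is (via $u\mapsto\tilde\phi(\cdot,u(\cdot))$) a bijection between $\tilde T_0$ and $W_0^{1,m}(\Omega)\cap L^{\frac{\varphi(x)+\psi(x)}{\psi(x)+1}}(\Omega)$.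
   Context: $r^-,r^+$ denote essential infimum and supremum of a function $r$; $D_i=\partial/\partial x_i$. For a bounded measurable positive exponent $r$, $L^{r(x)}(\Omega)$ is the set of measurable $u$ with $\sigma_r(u)=\int_\Omega|u|^{r(x)}dx<\infty$ (the exponent in (a) may be less than $1$ at some points; the same definition is used); for $r\ge1$ it carries the Luxemburg norm $\inf\{\lambda>0:\sigma_r(u/\lambda)\le1\}$. The classes of functions $u:\Omega\to\mathbb{R}$ are $$\tilde T_0=\Big\{u\in L^1(\Omega):\sum_{i=1}^n\big\||u|^{\psi(x)}D_iu\big\|_{L^m(\Omega)}+\|u\|_{L^{\frac{nm_1(\rho(x)-1)}{n-m_1}}(\Omega)}<\infty\Big\}\cap L^{\varphi(x)+\psi(x)}(\Omega)\cap\{u|_{\partial\Omega}=0\},$$ $$T_0=\Big\{u\in L^1(\Omega):\sum_{i=1}^n\big\||u|^{\rho(x)-2}D_iu\big\|_{L^{m_1}(\Omega)}+\|u\|_{L^{\frac{nm_1(\rho(x)-1)}{n-m_1}}(\Omega)}<\infty\Big\}\cap L^{\varphi(x)+\psi(x)}(\Omega)\cap\{u|_{\partial\Omega}=0\}.$$ The weighted derivatives are understood through the chain rule (with $0\ln0=0$): $D_i(|u|^{\rho-2}u)=(\rho-1)|u|^{\rho-2}D_iu+(D_i\rho)|u|^{\rho-2}u\ln|u|$ in $T_0$, and $D_i(|u|^{\psi}u)=(\psi+1)|u|^{\psi}D_iu+(D_i\psi)|u|^{\psi}u\ln|u|$ in $\tilde T_0$; the boundary condition is vanishing trace of $|u|^{\rho-2}u$,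 respectively of $|u|^\psi u$. *)

theory Defs
  imports "HOL-Analysis.Analysis" "HOL-Probability.Essential_Supremum"
begin

text \<open>Functions on a set \<open>\<Omega>\<close> are total functions whose values outside \<open>\<Omega>\<close> (or outside its closure,
  where boundary values matter) are irrelevant; measurability, integrals and
  "almost everywhere" refer to the measure space \<open>lebesgue_on \<Omega>\<close>.\<close>


section \<open>Classical derivatives, smoothness, domains\<close>

definition D :: "'n \<Rightarrow> (real^'n \<Rightarrow> real) \<Rightarrow> real^'n \<Rightarrow> real" where
  "D i f x = frechet_derivative f (at x) (axis i 1)"

primrec Ck :: "nat \<Rightarrow> (real^'n \<Rightarrow> real) \<Rightarrow> bool" where
  "Ck 0 f \<longleftrightarrow> continuous_on UNIV f"
| "Ck (Suc k) f \<longleftrightarrow> (\<forall>x. f differentiable (at x)) \<and> (\<forall>i. Ck k (D i f))"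

definition test_function :: "(real^'n) set \<Rightarrow> (real^'n \<Rightarrow> real) \<Rightarrow> bool" where
  "test_function \<Omega> \<eta> \<longleftrightarrow> (\<forall>k. Ck k \<eta>) \<and> compact (closure {x. \<eta> x \<noteq> 0}) \<and> closure {x. \<eta> x \<noteq> 0} \<subseteq> \<Omega>"

definition C1_closure :: "(real^'n) set \<Rightarrow> (real^'n \<Rightarrow> real) \<Rightarrow> bool" where
  "C1_closure \<Omega> f \<longleftrightarrow> continuous_on (closure \<Omega>) f \<and> (\<forall>x\<in>\<Omega>. f differentiable (at x)) \<and>
     (\<forall>i. \<exists>h. continuous_on (closure \<Omega>) h \<and> (\<forall>x\<in>\<Omega>. h x = D i f x))"

text \<open>Near each boundary point, \<open>\<Omega>\<close> is the region above the graph of a \<open>C\<^sup>1\<close> function in some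
  rotated coordinate system: the unit vector \<open>e\<close> is the vertical axis, and a function of the
  remaining \<open>n - 1\<close> coordinates is a function on the whole space that is constant along \<open>e\<close>.\<close>
definition C1_boundary :: "(real^'n) set \<Rightarrow> bool" where
  "C1_boundary \<Omega> \<longleftrightarrow> (\<forall>x0\<in>frontier \<Omega>. \<exists>r>0. \<exists>e \<gamma>. norm e = 1 \<and> Ck 1 \<gamma> \<and>
     (\<forall>x t. \<gamma> (x + t *\<^sub>R e) = \<gamma> x) \<and> \<Omega> \<inter> ball x0 r = {x \<in> ball x0 r. \<gamma> x < x \<bullet> e})"

definition bounded_C1_domain :: "(real^'n) set \<Rightarrow> bool" where
  "bounded_C1_domain \<Omega> \<longleftrightarrow> open \<Omega> \<and> connected \<Omega> \<and> \<Omega> \<noteq> {} \<and> bounded \<Omega> \<and> C1_boundary \<Omega>"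


section \<open>Lebesgue spaces with variable exponent\<close>

definition ess_sup :: "(real^'n) set \<Rightarrow> (real^'n \<Rightarrow> real) \<Rightarrow> ereal" where
  "ess_sup \<Omega> r = esssup (lebesgue_on \<Omega>) (\<lambda>x. ereal (r x))"

definition ess_inf :: "(real^'n) set \<Rightarrow> (real^'n \<Rightarrow> real) \<Rightarrow> ereal" where
  "ess_inf \<Omega> r = - esssup (lebesgue_on \<Omega>) (\<lambda>x. ereal (- r x))"

definition modular :: "(real^'n) set \<Rightarrow> (real^'n \<Rightarrow> real) \<Rightarrow> (real^'n \<Rightarrow> real) \<Rightarrow> ennreal" where
  "modular \<Omega> r u = (\<integral>\<^sup>+x. ennreal (\<bar>u x\<bar> powr r x) \<partial>lebesgue_on \<Omega>)"

definition Lvar :: "(real^'n) set \<Rightarrow> (real^'n \<Rightarrow> real) \<Rightarrow> (real^'n \<Rightarrow> real) set" where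
  "Lvar \<Omega> r = {u \<in> borel_measurable (lebesgue_on \<Omega>). modular \<Omega> r u < \<infinity>}"

text \<open>The Luxemburg norm; for a constant exponent \<open>p \<ge> 1\<close> this is the usual \<open>L\<^sup>p\<close> norm.\<close>
definition Lnorm :: "(real^'n) set \<Rightarrow> (real^'n \<Rightarrow> real) \<Rightarrow> (real^'n \<Rightarrow> real) \<Rightarrow> ennreal" where
  "Lnorm \<Omega> r u = Inf {ennreal l |l. l > 0 \<and> modular \<Omega> r (\<lambda>x. u x / l) \<le> 1}"


section \<open>Weak derivatives and Sobolev spaces\<close>

definition loc_integrable :: "(real^'n) set \<Rightarrow> (real^'n \<Rightarrow> real) \<Rightarrow> bool" where
  "loc_integrable \<Omega> u \<longleftrightarrow> (\<forall>K. compact K \<and> K \<subseteq> \<Omega> \<longrightarrow> integrable (lebesgue_on K) u)"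

definition weak_deriv :: "(real^'n) set \<Rightarrow> (real^'n \<Rightarrow> real) \<Rightarrow> 'n \<Rightarrow> (real^'n \<Rightarrow> real) \<Rightarrow> bool" where
  "weak_deriv \<Omega> v i g \<longleftrightarrow> loc_integrable \<Omega> v \<and> loc_integrable \<Omega> g \<and>
     (\<forall>\<eta>. test_function \<Omega> \<eta> \<longrightarrow>
        (LINT x|lebesgue_on \<Omega>. v x * D i \<eta> x) = - (LINT x|lebesgue_on \<Omega>. g x * \<eta> x))"

definition W1 :: "(real^'n) set \<Rightarrow> real \<Rightarrow> (real^'n \<Rightarrow> real) set" where
  "W1 \<Omega> p = {v \<in> Lvar \<Omega> (\<lambda>_. p). \<forall>i. \<exists>g \<in> Lvar \<Omega> (\<lambda>_. p). weak_deriv \<Omega> v i g}"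

text \<open>A representative of the weak derivative, which is unique up to null sets.\<close>
definition wD :: "(real^'n) set \<Rightarrow> 'n \<Rightarrow> (real^'n \<Rightarrow> real) \<Rightarrow> real^'n \<Rightarrow> real" where
  "wD \<Omega> i v = (SOME g. weak_deriv \<Omega> v i g)"

definition W1_norm :: "(real^'n) set \<Rightarrow> real \<Rightarrow> (real^'n \<Rightarrow> real) \<Rightarrow> ennreal" where
  "W1_norm \<Omega> p v = Lnorm \<Omega> (\<lambda>_. p) v + (\<Sum>i\<in>UNIV. Lnorm \<Omega> (\<lambda>_. p) (wD \<Omega> i v))"

definition W1_0 :: "(real^'n) set \<Rightarrow> real \<Rightarrow> (real^'n \<Rightarrow> real) set" where
  "W1_0 \<Omega> p = {v \<in> W1 \<Omega> p. \<forall>\<epsilon>>0. \<exists>\<eta>. test_function \<Omega> \<eta> \<and> W1_norm \<Omega> p (\<lambda>x. v x - \<eta> x) < \<epsilon>}"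


section \<open>Boundary traces\<close>

text \<open>Hausdorff measure, normalised so that in dimension \<open>n - 1\<close> it is the surface measure on
  \<open>C\<^sup>1\<close> hypersurfaces. For \<open>s = 0\<close> the covering sum would have to treat the empty set separately;
  only \<open>s = n - 1 \<ge> 1\<close> is used below.\<close>
definition hausdorff_pre :: "nat \<Rightarrow> real \<Rightarrow> (real^'n) set \<Rightarrow> ennreal" where
  "hausdorff_pre s \<delta> A =
     (INF U \<in> {U :: nat \<Rightarrow> (real^'n) set. A \<subseteq> (\<Union>j. U j) \<and> (\<forall>j. bounded (U j) \<and> diameter (U j) \<le> \<delta>)}.
        \<Sum>j. ennreal (unit_ball_vol (real s) * (diameter (U j) / 2) ^ s))"

definition hausdorff_measure :: "nat \<Rightarrow> (real^'n) measure" where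
  "hausdorff_measure s = measure_of UNIV (sets borel) (\<lambda>A. SUP \<delta>\<in>{0<..}. hausdorff_pre s \<delta> A)"

definition surface_measure :: "(real^'n) measure" where
  "surface_measure = hausdorff_measure (CARD('n) - 1)"

text \<open>The trace operator \<open>W\<^sup>1\<^sup>,\<^sup>1(\<Omega>) \<rightarrow> L\<^sup>1(\<partial>\<Omega>)\<close> is the continuous extension of the restriction map on
  \<open>C\<^sup>1\<close> functions up to the boundary; \<open>has_trace \<Omega> v b\<close> says that it maps \<open>v\<close> to \<open>b\<close>. On a bounded
  domain the trace on \<open>W\<^sup>1\<^sup>,\<^sup>p(\<Omega>)\<close>, \<open>p \<ge> 1\<close>, is its restriction.\<close>
definition has_trace :: "(real^'n) set \<Rightarrow> (real^'n \<Rightarrow> real) \<Rightarrow> (real^'n \<Rightarrow> real) \<Rightarrow> bool" where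
  "has_trace \<Omega> v b \<longleftrightarrow> v \<in> W1 \<Omega> 1 \<and> set_integrable surface_measure (frontier \<Omega>) b \<and>
     (\<exists>f :: nat \<Rightarrow> real^'n \<Rightarrow> real. (\<forall>k. C1_closure \<Omega> (f k)) \<and>
        (\<lambda>k. W1_norm \<Omega> 1 (\<lambda>x. f k x - v x)) \<longlonglongrightarrow> 0 \<and>
        (\<lambda>k. \<integral>\<^sup>+x\<in>frontier \<Omega>. ennreal \<bar>f k x - b x\<bar> \<partial>surface_measure) \<longlonglongrightarrow> 0)"


section \<open>The nonlinear classes\<close>

text \<open>The map \<open>\<tau> \<mapsto> \<bar>\<tau>\<bar>\<^sup>r\<^sup>(\<^sup>x\<^sup>) \<tau>\<close>. The convention \<open>0 powr 0 = 0\<close> is harmless because of the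
  factor \<open>\<tau>\<close>.\<close>
definition spow :: "(real^'n \<Rightarrow> real) \<Rightarrow> real^'n \<Rightarrow> real \<Rightarrow> real" where
  "spow r x \<tau> = \<bar>\<tau>\<bar> powr r x * \<tau>"

text \<open>\<open>weighted_deriv \<Omega> r u i G\<close>: the function \<open>G\<close> is \<open>\<bar>u\<bar>\<^sup>r D\<^sub>i u\<close>, in the sense that the weak
  derivative of \<open>\<bar>u\<bar>\<^sup>r u\<close> is given by the chain rule. The function \<open>u\<close> itself need not have weak
  derivatives. In the library \<open>ln 0 = 0\<close>, so \<open>0 ln 0 = 0\<close>.\<close>
definition weighted_deriv ::
  "(real^'n) set \<Rightarrow> (real^'n \<Rightarrow> real) \<Rightarrow> (real^'n \<Rightarrow> real) \<Rightarrow> 'n \<Rightarrow> (real^'n \<Rightarrow> real) \<Rightarrow> bool" where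
  "weighted_deriv \<Omega> r u i G \<longleftrightarrow> weak_deriv \<Omega> (\<lambda>x. spow r x (u x)) i
     (\<lambda>x. (r x + 1) * G x + D i r x * spow r x (u x) * ln \<bar>u x\<bar>)"

definition conj_exp :: "real \<Rightarrow> real" where
  "conj_exp m = m / (m - 1)"

definition psi :: "real \<Rightarrow> (real^'n \<Rightarrow> real) \<Rightarrow> real^'n \<Rightarrow> real" where
  "psi m \<rho> x = (\<rho> x - m) / (m - 1)"

definition crit_exp :: "real \<Rightarrow> (real^'n \<Rightarrow> real) \<Rightarrow> real^'n \<Rightarrow> real" where
  "crit_exp m \<rho> x = real CARD('n) * conj_exp m * (\<rho> x - 1) / (real CARD('n) - conj_exp m)"

definition T0 :: "(real^'n) set \<Rightarrow> real \<Rightarrow> (real^'n \<Rightarrow> real) \<Rightarrow> (real^'n \<Rightarrow> real) \<Rightarrow> (real^'n \<Rightarrow> real) set" where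
  "T0 \<Omega> m \<rho> \<phi> =
     {u \<in> Lvar \<Omega> (\<lambda>_. 1). \<exists>G. (\<forall>i. weighted_deriv \<Omega> (\<lambda>x. \<rho> x - 2) u i (G i)) \<and>
        (\<Sum>i\<in>UNIV. Lnorm \<Omega> (\<lambda>_. conj_exp m) (G i)) + Lnorm \<Omega> (crit_exp m \<rho>) u < \<infinity>}
     \<inter> Lvar \<Omega> (\<lambda>x. \<phi> x + psi m \<rho> x)
     \<inter> {u. has_trace \<Omega> (\<lambda>x. spow (\<lambda>x. \<rho> x - 2) x (u x)) (\<lambda>_. 0)}"

definition T0_tilde :: "(real^'n) set \<Rightarrow> real \<Rightarrow> (real^'n \<Rightarrow> real) \<Rightarrow> (real^'n \<Rightarrow> real) \<Rightarrow> (real^'n \<Rightarrow> real) set" where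
  "T0_tilde \<Omega> m \<rho> \<phi> =
     {u \<in> Lvar \<Omega> (\<lambda>_. 1). \<exists>G. (\<forall>i. weighted_deriv \<Omega> (psi m \<rho>) u i (G i)) \<and>
        (\<Sum>i\<in>UNIV. Lnorm \<Omega> (\<lambda>_. m) (G i)) + Lnorm \<Omega> (crit_exp m \<rho>) u < \<infinity>}
     \<inter> Lvar \<Omega> (\<lambda>x. \<phi> x + psi m \<rho> x)
     \<inter> {u. has_trace \<Omega> (\<lambda>x. spow (psi m \<rho>) x (u x)) (\<lambda>_. 0)}"


section \<open>Identification of functions that agree almost everywhere\<close>

definition ae_rel :: "(real^'n) set \<Rightarrow> ((real^'n \<Rightarrow> real) \<times> (real^'n \<Rightarrow> real)) set" where
  "ae_rel \<Omega> = {(u, v). u \<in> borel_measurable (lebesgue_on \<Omega>) \<and> v \<in> borel_measurable (lebesgue_on \<Omega>) \<and>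
     (AE x in lebesgue_on \<Omega>. u x = v x)}"

text \<open>The superposition operator \<open>u \<mapsto> f(\<cdot>, u(\<cdot>))\<close> on equivalence classes.\<close>
definition superpos ::
  "(real^'n) set \<Rightarrow> (real^'n \<Rightarrow> real \<Rightarrow> real) \<Rightarrow> (real^'n \<Rightarrow> real) set \<Rightarrow> (real^'n \<Rightarrow> real) set" where
  "superpos \<Omega> f U = (\<Union>u\<in>U. ae_rel \<Omega> `` {\<lambda>x. f x (u x)})"

end

theory Submission imports Defs begin

text \<open>Both maps are invertible pointwise, and with \<open>v = \<bar>u\<bar>\<^sup>r u\<close> every modular of \<open>u\<close> is a modular of \<open>v\<close>.
  The logarithmic term of the chain rule is \<open>D\<^sub>i r \<cdot> v ln \<bar>v\<bar> / (r + 1)\<close>. Since \<open>t ln t = O(1 + t\<^sup>q\<^sup>/\<^sup>p)\<close>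
  for \<open>q > p\<close>, it lies in \<open>L\<^sup>p\<close> as soon as \<open>v \<in> L\<^sup>q\<close>, which one class contains by definition
  and the other by the Sobolev inequality. The inequality is proved after Gagliardo and Nirenberg, via
  Loomis--Whitney.

  It remains to identify \<open>W\<^sub>0\<^sup>1\<^sup>,\<^sup>p\<close> with the functions of vanishing trace. For the harder inclusion, a
  thin layer along the boundary is covered by cylinders over a covering of the boundary, so its
  measure is at most a constant times its thickness times the Hausdorff measure of the boundary. Hence the boundary term in
  an integration by parts is controlled by the trace; if the trace vanishes, the extension by zero is
  weakly differentiable across the boundary. Each piece of a partition of unity is then
  shifted into \<open>\<Omega>\<close> and mollified.\<close>

section \<open>Smooth functions and test functions\<close>

text \<open>Since \<open>u\<close> need not have weak derivatives, everything is read off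
  \<open>v\<close>. Parts (a) and (b) are one theorem with a weight exponent r and a gradient
  exponent p: r = \<rho> - 2, p = m_1 in (a), and r = \<psi>, p = m in (b). Both times
  \<open>crit_exp\<close> equals q (r + 1) with some q > p, so its term in the class says exactly
  that v lies in L^q. In (a), q is the Sobolev conjugate of p; in (b), it is the Sobolev conjugate
  of an exponent s below p. The obstacle is the trace: \<open>has_trace\<close> only speaks of L^1
  convergence for the Hausdorff measure, and no Gauss-Green formula is proved. For a zero trace an
  inequality is enough, and its constant may be bad, because it multiplies boundary integrals that
  tend to 0. It is proved only for derivatives along directions w in the interior cone, since shifts
  along such w can be compared with the boundary; these w fill a ball, and a linear form that
  vanishes on a ball is zero, so all partial derivatives are covered.\<close>

lemma has_derivative_axis:
  "(f has_derivative F) (at x) \<Longrightarrow> D i f x = F (axis i 1)"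
  by (simp add: D_def frechet_derivative_at[symmetric])

lemma Ck_SucI:
  assumes "\<And>x. (f has_derivative F x) (at x)" and "\<And>i. Ck k (\<lambda>x. F x (axis i 1))"
  shows "Ck (Suc k) f"
proof -
  have "D i f = (\<lambda>x. F x (axis i 1))" for i
    using has_derivative_axis[OF assms(1)] by blast
  then show ?thesis
    using assms by (auto simp: differentiable_def)
qed

lemma has_derivative_D_sum:
  fixes f :: "real^'n \<Rightarrow> real"
  assumes "f differentiable (at x)"
  shows "(f has_derivative (\<lambda>h. \<Sum>i\<in>UNIV. h $ i * D i f x)) (at x)"
proof -
  let ?F = "frechet_derivative f (at x)"
  have F: "(f has_derivative ?F) (at x)" 
    using assms frechet_derivative_works by blast
  interpret linear ?F by (rule linear_frechet_derivative[OF assms])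
  have "?F h = (\<Sum>i\<in>UNIV. h $ i * D i f x)" for h
  proof -
    have "?F h = ?F (\<Sum>i\<in>UNIV. (h $ i) *\<^sub>R axis i 1)" 
      by (simp add: basis_expansion scalar_mult_eq_scaleR[symmetric])
    also have "\<dots> = (\<Sum>i\<in>UNIV. h $ i * D i f x)"
      by (simp add: sum scale D_def)
    finally show ?thesis .
  qed
  then have "?F = (\<lambda>h. \<Sum>i\<in>UNIV. h $ i * D i f x)" by blast
  with F show ?thesis by metis
qed

section \<open>Algebra of C^k functions\<close>

lemma Ck_Suc_imp: "Ck (Suc k) f \<Longrightarrow> Ck k f"
proof (induction k arbitrary: f)
  case 0
  then show ?case
    by (auto intro!: differentiable_imp_continuous_on simp: differentiable_on_def
        intro: differentiable_at_withinI)
next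
  case (Suc k)
  then show ?case by (metis Ck.simps(2))
qed

lemma Ck_const [simp]: "Ck k (\<lambda>_. c)"
proof (induction k arbitrary: c)
  case (Suc k)
  show ?case by (rule Ck_SucI[where F="\<lambda>_ _. 0"]) (auto simp: Suc.IH)
qed simp

lemma D_add: "f differentiable (at x) \<Longrightarrow> g differentiable (at x) \<Longrightarrow>
    D i (\<lambda>x. f x + g x) x = D i f x + D i g x"
  using has_derivative_axis[OF has_derivative_add, of f _ x g _ i]
  by (simp add: frechet_derivative_works D_def)

lemma D_mult: 
  fixes f g :: "real^'n \<Rightarrow> real"
  assumes "f differentiable (at x)" "g differentiable (at x)" 
  shows "D i (\<lambda>x. f x * g x) x = f x * D i g x + D i f x * g x"
proof -
  have "((\<lambda>x. f x * g x) has_derivative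
      (\<lambda>h. f x * frechet_derivative g (at x) h + frechet_derivative f (at x) h * g x)) (at x)"
    using assms by (intro has_derivative_mult) (auto simp: frechet_derivative_works)
  from has_derivative_axis[OF this] show ?thesis by (simp add: D_def)
qed

lemma Ck_add: "Ck k f \<Longrightarrow> Ck k g \<Longrightarrow> Ck k (\<lambda>x. f x + g x)"
proof (induction k arbitrary: f g)
  case 0 then show ?case by (simp add: continuous_on_add)
next
  case (Suc k)
  have "D i (\<lambda>x. f x + g x) = (\<lambda>x. D i f x + D i g x)" for i
    using Suc.prems by (auto simp: D_add)
  then show ?case using Suc by (auto intro!: differentiable_add)
qed

lemma Ck_mult: "Ck k f \<Longrightarrow> Ck k g \<Longrightarrow> Ck k (\<lambda>x. f x * g x)"
proof (induction k arbitrary: f g)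
  case 0 then show ?case by (simp add: continuous_on_mult)
next
  case (Suc k)
  have "D i (\<lambda>x. f x * g x) = (\<lambda>x. f x * D i g x + D i f x * g x)" for i
    using Suc.prems by (auto simp: D_mult)
  moreover have "Ck k f" "Ck k g" using Suc.prems Ck_Suc_imp by blast+
  ultimately show ?case using Suc by (auto intro!: differentiable_mult Ck_add)
qed

lemma Ck_cmult: "Ck k f \<Longrightarrow> Ck k (\<lambda>x. c * f x)" for c :: real
  by (intro Ck_mult Ck_const)

lemma Ck_diff: "Ck k f \<Longrightarrow> Ck k g \<Longrightarrow> Ck k (\<lambda>x. f x - g x)"
  using Ck_add[OF _ Ck_cmult[of k g "-1"], of f] by simp

lemma D_affine:
  fixes f :: "real^'n \<Rightarrow> real"
  assumes "f differentiable (at (a + c *\<^sub>R x))"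
  shows "((\<lambda>x. f (a + c *\<^sub>R x)) has_derivative (\<lambda>h. c * frechet_derivative f (at (a + c *\<^sub>R x)) h)) (at x)"
    and "D i (\<lambda>x. f (a + c *\<^sub>R x)) x = c * D i f (a + c *\<^sub>R x)"
proof -
  let ?F = "frechet_derivative f (at (a + c *\<^sub>R x))"
  have "((\<lambda>x. a + c *\<^sub>R x) has_derivative (\<lambda>h. c *\<^sub>R h)) (at x)"
    by (auto intro!: derivative_eq_intros)
  from diff_chain_at[OF this] assms
  have "((\<lambda>x. f (a + c *\<^sub>R x)) has_derivative (\<lambda>h. ?F (c *\<^sub>R h))) (at x)"
    by (simp add: frechet_derivative_works o_def)
  then show *: "((\<lambda>x. f (a + c *\<^sub>R x)) has_derivative (\<lambda>h. c * ?F h)) (at x)"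
    using linear_scale[OF linear_frechet_derivative[OF assms]] by simp
  show "D i (\<lambda>x. f (a + c *\<^sub>R x)) x = c * D i f (a + c *\<^sub>R x)"
    using has_derivative_axis[OF *] by (simp add: D_def)
qed

lemma Ck_affine:
  fixes f :: "real^'n \<Rightarrow> real"
  shows "Ck k f \<Longrightarrow> Ck k (\<lambda>x. f (a + c *\<^sub>R x))"
proof (induction k arbitrary: f)
  case 0 then show ?case by (auto intro!: continuous_intros continuous_on_compose2[of UNIV f])
next
  case (Suc k)
  have "D i (\<lambda>x. f (a + c *\<^sub>R x)) = (\<lambda>x. c * D i f (a + c *\<^sub>R x))" for i
    using Suc.prems by (auto simp: D_affine(2))
  moreover have "(\<lambda>x. f (a + c *\<^sub>R x)) differentiable (at x)" for x
    using D_affine(1)[of f a c x] Suc.prems unfolding differentiable_def[where f="\<lambda>x. f (a + c *\<^sub>R x)"] by auto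
  ultimately show ?case using Suc by (auto intro!: Ck_cmult)
qed

text \<open>The derivative of \<open>G j\<close> composed with q contains \<open>G (Suc j)\<close>,
  so the induction on k has to treat all members of a family closed under differentiation at
  once.\<close>

lemma Ck_compose_family:
  fixes G :: "nat \<Rightarrow> real \<Rightarrow> real" and q :: "real^'n \<Rightarrow> real"
  assumes G: "\<And>j t. (G j has_real_derivative G (Suc j) t) (at t)"
    and q: "\<And>k. Ck k q"
  shows "Ck k (\<lambda>x. G j (q x))"
proof (induction k arbitrary: j)
  case 0
  have "continuous_on UNIV (G j)"
    using G by (intro continuous_at_imp_continuous_on) (auto intro: DERIV_isCont)
  then show ?case using q[of 0] by (auto intro: continuous_on_compose2)
next
  case (Suc k)
  have q': "(q has_derivative frechet_derivative q (at x)) (at x)" for x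
    using q[of "Suc 0"] by (simp add: frechet_derivative_works)
  have "((\<lambda>x. G j (q x)) has_derivative (\<lambda>h. G (Suc j) (q x) * frechet_derivative q (at x) h)) (at x)" for x
    using diff_chain_at[OF q' G[unfolded has_field_derivative_def]] by (simp add: o_def)
  moreover have "Ck k (\<lambda>x. G (Suc j) (q x) * D i q x)" for i
    using q[of "Suc k"] by (intro Ck_mult Suc.IH) simp
  ultimately show ?case
    by (intro Ck_SucI) (auto simp: D_def)
qed

lemma Ck_norm_square:
  fixes a :: "real^'n"
  shows "Ck k (\<lambda>x. (x - a) \<bullet> (x - a))"
proof -
  have coord: "Ck k (\<lambda>x. x $ i - a $ i)" for k i
  proof (cases k)
    case 0 then show ?thesis by (auto intro!: continuous_intros)
  next
    case (Suc k')
    show ?thesis unfolding Suc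
      by (rule Ck_SucI[where F="\<lambda>_ h. h $ i"]) (auto intro!: derivative_eq_intros bounded_linear_vec_nth bounded_linear_imp_has_derivative)
  qed
  show ?thesis
  proof (cases k)
    case 0 then show ?thesis by (auto intro!: continuous_intros)
  next
    case (Suc k')
    have *: "((\<lambda>x. (x - a) \<bullet> (x - a)) has_derivative (\<lambda>h. 2 * ((x - a) \<bullet> h))) (at x)" for x
      by (auto intro!: derivative_eq_intros simp: inner_commute)
    show ?thesis unfolding Suc
      by (rule Ck_SucI[OF *]) (use Ck_cmult[OF coord, of _ 2] in \<open>auto simp: inner_axis algebra_simps\<close>)
  qed
qed

text \<open>Polynomials in \<open>1 / t\<close> times \<open>exp (- 1 / t)\<close> are closed under differentiation, so all of these functions are smooth.\<close>
definition flat :: "real poly \<Rightarrow> real \<Rightarrow> real" where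
  "flat P t = (if t > 0 then poly P (1 / t) * exp (- 1 / t) else 0)"

lemma tendsto_poly_div_exp: "((\<lambda>x. poly P x / exp x) \<longlongrightarrow> (0::real)) at_top"
proof -
  have "((\<lambda>x. \<Sum>i\<le>degree P. coeff P i * (x ^ i / exp x)) \<longlongrightarrow> (\<Sum>i\<le>degree P. coeff P i * 0)) at_top"
    by (intro tendsto_intros tendsto_power_div_exp_0)
  then show ?thesis by (simp add: poly_altdef sum_divide_distrib)
qed

text \<open>With s = 1/t the chain rule gives d/dt (P(s) exp(-s)) = s^2 (P(s) - P'(s)) exp(-s); the
  factor \<open>[:0, 0, 1:]\<close> is s^2.\<close>

definition flat_deriv :: "real poly \<Rightarrow> real poly" where
  "flat_deriv P = [:0, 0, 1:] * (P - pderiv P)"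

lemma flat_has_derivative: "(flat P has_real_derivative flat (flat_deriv P) t) (at t)"
proof -
  consider "t > 0" | "t < 0" | "t = 0" by linarith
  then show ?thesis
  proof cases
    case 1
    have "((\<lambda>t. poly P (1 / t) * exp (- 1 / t)) has_real_derivative
        flat (flat_deriv P) t) (at t)"
      using 1 unfolding flat_def flat_deriv_def
      by (auto intro!: derivative_eq_intros poly_DERIV[THEN DERIV_chain2] simp: field_simps power2_eq_square)
    from has_field_derivative_transform_within_open[OF this, of "{0<..}" "flat P"] 1
    show ?thesis by (auto simp: flat_def)
  next
    case 2
    have "((\<lambda>t. 0) has_real_derivative flat (flat_deriv P) t) (at t)"
      using 2 by (simp add: flat_def)
    from has_field_derivative_transform_within_open[OF this, of "{..<0}" "flat P"] 2
    show ?thesis by (auto simp: flat_def)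
  next
    case 3
    \<comment> \<open>With s = 1/h the difference quotient at 0 is s P(s) exp(-s); the extra factor
      s is the polynomial \<open>[:0, 1:]\<close>.\<close>
    have "((\<lambda>h. poly ([:0, 1:] * P) (inverse h) / exp (inverse h)) \<longlongrightarrow> 0) (at_right 0)"
      by (rule filterlim_compose[OF tendsto_poly_div_exp filterlim_inverse_at_top_right])
    moreover have "\<forall>\<^sub>F h in at_right 0. poly ([:0, 1:] * P) (inverse h) / exp (inverse h) = (flat P h - flat P 0) / h"
      by (auto simp: eventually_at_filter flat_def field_simps exp_minus)
    ultimately have R: "((\<lambda>h. (flat P h - flat P 0) / h) \<longlongrightarrow> 0) (at_right 0)"
      using tendsto_cong by force
    have L: "((\<lambda>h. (flat P h - flat P 0) / h) \<longlongrightarrow> 0) (at_left 0)"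
      by (rule tendsto_eventually) (auto simp: eventually_at_filter flat_def)
    have "((\<lambda>h. (flat P h - flat P 0) / h) \<longlongrightarrow> 0) (at 0)"
      using L R by (simp add: filterlim_split_at)
    moreover have "flat (flat_deriv P) 0 = 0" by (simp add: flat_def)
    ultimately show ?thesis
      unfolding 3 by (simp add: DERIV_def)
  qed
qed

lemma Ck_flat:
  assumes "\<And>k. Ck k q"
  shows "Ck k (\<lambda>x. flat P (q x))"
proof -
  have "Ck k (\<lambda>x. (\<lambda>j. flat ((flat_deriv ^^ j) P)) 0 (q x))"
    by (rule Ck_compose_family) (use assms flat_has_derivative in auto)
  then show ?thesis by simp
qed

section \<open>Supports, bounds and uniform continuity of test functions\<close>

lemma D_zero_outside:
  assumes "x \<notin> closure {x. f x \<noteq> 0}"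
  shows "D i f x = 0"
proof -
  have "((\<lambda>_. 0) has_derivative (\<lambda>_. 0)) (at x)" by simp
  then have "(f has_derivative (\<lambda>_. 0)) (at x)"
    by (rule has_derivative_transform_within_open[where s="- closure {x. f x \<noteq> 0}"])
      (use assms closure_subset[of "{x. f x \<noteq> 0}"] in auto)
  from has_derivative_axis[OF this] show ?thesis by simp
qed

lemma closure_D_support: "closure {x. D i f x \<noteq> 0} \<subseteq> closure {x. f x \<noteq> 0}"
  by (rule closure_minimal) (use D_zero_outside in fastforce)+

lemma compact_closed_subset: "compact B \<Longrightarrow> closed A \<Longrightarrow> A \<subseteq> B \<Longrightarrow> compact A"
  for A B :: "'a::t2_space set"
  using compact_Int_closed[of B A] by (simp add: inf.absorb2)

lemma test_function_D: "test_function \<Omega> f \<Longrightarrow> test_function \<Omega> (D i f)"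
  unfolding test_function_def
proof safe
  fix k assume "\<forall>k. Ck k f" then have "Ck (Suc k) f" by blast
  then show "Ck k (D i f)" by simp
next
  assume "compact (closure {x. f x \<noteq> 0})"
  then show "compact (closure {x. D i f x \<noteq> 0})"
    by (rule compact_closed_subset) (auto simp: closure_D_support)
next
  fix x assume "x \<in> closure {x. D i f x \<noteq> 0}" "closure {x. f x \<noteq> 0} \<subseteq> \<Omega>"
  then show "x \<in> \<Omega>" using closure_D_support by blast
qed

lemma test_function_mult:
  assumes "test_function \<Omega> f" "\<And>k. Ck k g"
  shows "test_function \<Omega> (\<lambda>x. g x * f x)"
proof -
  have "closure {x. g x * f x \<noteq> 0} \<subseteq> closure {x. f x \<noteq> 0}"
    by (rule closure_mono) auto
  then show ?thesis
    using assms compact_closed_subset[OF _ closed_closure, of "closure {x. f x \<noteq> 0}" "{x. g x * f x \<noteq> 0}"]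
    unfolding test_function_def by (blast intro: Ck_mult)
qed

lemma test_function_UNIV: "test_function \<Omega> f \<Longrightarrow> test_function UNIV f"
  by (simp add: test_function_def)

lemma test_functionD:
  assumes "test_function \<Omega> f"
  shows "Ck k f" "f differentiable (at x)" "continuous_on UNIV f" "f \<in> borel_measurable borel"
    "(f has_derivative (\<lambda>h. \<Sum>i\<in>UNIV. h $ i * D i f x)) (at x)"
    "continuous_on UNIV (D i f)" "D i f \<in> borel_measurable borel"
proof -
  show 1: "Ck k f" for k using assms by (simp add: test_function_def)
  from 1[of 0] show c: "continuous_on UNIV f" by simp
  then show "f \<in> borel_measurable borel" by (rule borel_measurable_continuous_onI)
  from 1[of 1] show "f differentiable (at x)" by simp
  then show "(f has_derivative (\<lambda>h. \<Sum>i\<in>UNIV. h $ i * D i f x)) (at x)" by (rule has_derivative_D_sum)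
  from 1[of 1] show c: "continuous_on UNIV (D i f)" by simp
  then show "D i f \<in> borel_measurable borel" by (rule borel_measurable_continuous_onI)
qed

lemma test_function_add: 
  assumes "test_function \<Omega> f" "test_function \<Omega> g" shows "test_function \<Omega> (\<lambda>x. f x + g x)"
proof -
  have "closure {x. f x + g x \<noteq> 0} \<subseteq> closure ({x. f x \<noteq> 0} \<union> {x. g x \<noteq> 0})"
    by (rule closure_mono) auto
  then have *: "closure {x. f x + g x \<noteq> 0} \<subseteq> closure {x. f x \<noteq> 0} \<union> closure {x. g x \<noteq> 0}"
    by simp
  have "compact (closure {x. f x \<noteq> 0} \<union> closure {x. g x \<noteq> 0})"
    using assms by (intro compact_Un) (auto simp: test_function_def)
  then have "compact (closure {x. f x + g x \<noteq> 0})"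
    by (rule compact_closed_subset) (use * in auto)
  moreover have "Ck k (\<lambda>x. f x + g x)" for k
    using assms by (intro Ck_add) (auto simp: test_function_def)
  moreover have "closure {x. f x + g x \<noteq> 0} \<subseteq> \<Omega>"
    using assms * unfolding test_function_def by blast
  ultimately show ?thesis
    by (simp add: test_function_def)
qed

lemma test_function_bounded:
  assumes "test_function \<Omega> f"
  obtains B where "B > 0" "\<And>x. \<bar>f x\<bar> \<le> B"
proof -
  let ?K = "closure {x. f x \<noteq> 0}"
  have "compact (f ` ?K)"
    using assms test_functionD(3)[OF assms] by (auto simp: test_function_def intro!: compact_continuous_image intro: continuous_on_subset)
  then obtain B where B: "B > 0" "\<And>y. y \<in> f ` ?K \<Longrightarrow> norm y \<le> B"
    using compact_imp_bounded bounded_pos by metis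
  have "\<bar>f x\<bar> \<le> B" for x
    using B closure_subset[of "{x. f x \<noteq> 0}"] by (cases "f x = 0") auto
  then show ?thesis using that B(1) by blast
qed

lemma test_function_support_cball:
  assumes "test_function \<Omega> f"
  obtains R where "R > 0" "\<And>x. f x \<noteq> 0 \<Longrightarrow> norm x \<le> R"
proof -
  have "bounded (closure {x. f x \<noteq> 0})"
    using assms by (auto simp: test_function_def compact_imp_bounded)
  then obtain R where "R > 0" "\<And>x. x \<in> closure {x. f x \<noteq> 0} \<Longrightarrow> norm x \<le> R"
    using bounded_pos by metis
  then show ?thesis using that closure_subset[of "{x. f x \<noteq> 0}"] by blast
qed

text \<open>Uniform continuity on the ball of radius R + 1 suffices: two points at distance below 1
  that do not both lie in that ball have norm above R, where f vanishes.\<close>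

lemma test_function_uniformly_continuous:
  assumes "test_function \<Omega> f" "e > 0"
  obtains d where "d > 0" "\<And>x y. dist x y < d \<Longrightarrow> \<bar>f x - f y\<bar> < e"
proof -
  obtain R where R: "R > 0" "\<And>x. f x \<noteq> 0 \<Longrightarrow> norm x \<le> R"
    using test_function_support_cball[OF assms(1)] by metis
  have "uniformly_continuous_on (cball 0 (R+1)) f"
    using test_functionD(3)[OF assms(1)] by (intro compact_uniformly_continuous) (auto intro: continuous_on_subset)
  then obtain d where d: "d > 0" "\<And>x y. x \<in> cball 0 (R+1) \<Longrightarrow> y \<in> cball 0 (R+1) \<Longrightarrow> dist y x < d \<Longrightarrow> dist (f y) (f x) < e"
    using assms(2) unfolding uniformly_continuous_on_def by metis
  have "\<bar>f x - f y\<bar> < e" if "dist x y < min d 1" for x y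
  proof (cases "x \<in> cball 0 (R+1) \<and> y \<in> cball 0 (R+1)")
    case True then show ?thesis using d(2)[of y x] that by (auto simp: dist_real_def)
  next
    case False
    have "\<bar>norm x - norm y\<bar> < 1" using that norm_triangle_ineq3[of x y] by (auto simp: dist_norm)
    then have "norm x > R" "norm y > R" using False by auto
    then have "f x = 0" "f y = 0" using R(2) by (meson not_le)+
    then show ?thesis using assms by simp
  qed
  then show ?thesis using that[of "min d 1"] d by auto
qed

lemma integrable_bounded_support:
  fixes f :: "'a::euclidean_space \<Rightarrow> real"
  assumes "f \<in> borel_measurable borel" "\<And>x. \<bar>f x\<bar> \<le> B" "\<And>x. f x \<noteq> 0 \<Longrightarrow> norm x \<le> R"
  shows "integrable lborel f"
proof -
  have 1: "integrable lborel (\<lambda>x. B * indicator (cball 0 R) x :: real)"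
    by (auto intro!: integrable_mult_right integrable_real_indicator simp: emeasure_bounded_finite[OF bounded_cball, simplified])
  have 2: "norm (f x) \<le> norm (B * indicator (cball 0 R) x :: real)" for x
    using assms(2)[of x] assms(3)[of x] by (cases "f x = 0") auto
  show ?thesis
    by (rule Bochner_Integration.integrable_bound[OF 1]) (use assms(1) 2 in auto)
qed

lemma test_function_integrable: "test_function \<Omega> f \<Longrightarrow> integrable lborel f"
  by (metis integrable_bounded_support test_functionD(4) test_function_bounded test_function_support_cball)

text \<open>This is exp(-1/(r^2 - |x - a|^2)), extended by 0 and normalised. The centre a is left
  free because the final approximation uses a kernel that sits off the origin and thereby also
  shifts the support.\<close>

lemma kernel_exists:
  fixes a :: "real^'n"
  assumes "r > 0"
  obtains k where "test_function UNIV k" "\<And>x. k x \<ge> 0" "\<And>x. k x \<noteq> 0 \<Longrightarrow> x \<in> ball a r" "integral\<^sup>L lborel k = 1"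
proof -
  define q where "q = (\<lambda>x. flat 1 (r\<^sup>2 - (x - a) \<bullet> (x - a)))"
  have q: "Ck k q" for k unfolding q_def
    by (intro Ck_flat Ck_diff Ck_const Ck_norm_square)
  have iff: "r\<^sup>2 - (x - a) \<bullet> (x - a) > 0 \<longleftrightarrow> x \<in> ball a r" for x
  proof -
    have "(x - a) \<bullet> (x - a) = (dist a x)\<^sup>2"
      by (metis dist_norm norm_minus_commute power2_norm_eq_inner)
    moreover have "(dist a x)\<^sup>2 < r\<^sup>2 \<longleftrightarrow> dist a x < r"
      using assms power_strict_mono[of "dist a x" r 2] power2_less_imp_less[of "dist a x" r] by auto
    ultimately show ?thesis by simp
  qed
  have q0: "q x > 0 \<longleftrightarrow> x \<in> ball a r" "q x \<ge> 0" "q x = 0 \<longleftrightarrow> x \<notin> ball a r" for x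
    unfolding q_def flat_def iff by auto
  have supp: "closure {x. q x \<noteq> 0} \<subseteq> cball a r"
    by (rule closure_minimal) (auto simp: q0)
  then have t: "test_function UNIV q"
    using compact_closed_subset[OF compact_cball closed_closure supp] by (simp add: test_function_def q)
  have "integral\<^sup>L lborel q \<noteq> 0"
  proof
    assume "integral\<^sup>L lborel q = 0"
    then have "AE x in lborel. q x = 0"
      using integral_nonneg_eq_0_iff_AE[OF test_function_integrable[OF t]] q0(2) by auto
    then have "AE x in lborel. x \<notin> ball a r" by (simp add: q0)
    then have "emeasure lborel (ball a r) = 0"
      by (subst (asm) AE_iff_measurable[of "ball a r"]) auto
    then show False using assms content_ball_pos[of r a] by (simp add: measure_def)
  qed
  moreover have "integral\<^sup>L lborel q \<ge> 0" using q0 by simp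
  ultimately have I: "integral\<^sup>L lborel q > 0" by simp
  show ?thesis
    by (rule that[of "\<lambda>x. inverse (integral\<^sup>L lborel q) * q x"])
       (use I q0 test_function_mult[OF t Ck_const] in auto)
qed

section \<open>Mollification\<close>

lemma lborel_nn_integral_shift:
  fixes f :: "'a::euclidean_space \<Rightarrow> ennreal"
  assumes [measurable]: "f \<in> borel_measurable borel"
  shows "(\<integral>\<^sup>+x. f (x + a) \<partial>lborel) = integral\<^sup>N lborel f"
proof -
  have "integral\<^sup>N lborel f = integral\<^sup>N (distr lborel borel ((+) a)) f"
    by (simp add: lborel_distr_plus)
  also have "\<dots> = (\<integral>\<^sup>+x. f (x + a) \<partial>lborel)"
    by (subst nn_integral_distr) (auto simp: add.commute)
  finally show ?thesis by simp
qed

lemma lborel_distr_reflect: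
  fixes a :: "'a::euclidean_space"
  shows "distr lborel borel (\<lambda>x. a - x) = lborel"
  by (subst (2) lborel_affine[of "-1" a]) (auto simp: density_1)

lemma lborel_integral_reflect:
  fixes f :: "'a::euclidean_space \<Rightarrow> real"
  assumes [measurable]: "f \<in> borel_measurable borel"
  shows "(LINT x|lborel. f (a - x)) = integral\<^sup>L lborel f"
proof -
  have "integral\<^sup>L lborel f = integral\<^sup>L (distr lborel borel (\<lambda>x. a - x)) f"
    by (simp add: lborel_distr_reflect)
  also have "\<dots> = (LINT x|lborel. f (a - x))"
    by (subst integral_distr) auto
  finally show ?thesis by simp
qed

lemma lborel_integrable_reflect:
  fixes f :: "'a::euclidean_space \<Rightarrow> real"
  assumes "integrable lborel f"
  shows "integrable lborel (\<lambda>x. f (a - x))"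
proof -
  have "integrable (distr lborel borel (\<lambda>x. a - x)) f"
    using assms by (simp add: lborel_distr_reflect)
  then show ?thesis
    by (subst (asm) integrable_distr_eq) (use assms in auto)
qed

section \<open>Smoothness and support of convolutions\<close>

definition conv :: "(real^'n \<Rightarrow> real) \<Rightarrow> (real^'n \<Rightarrow> real) \<Rightarrow> real^'n \<Rightarrow> real" where
  "conv k f x = (LINT y|lborel. k (x - y) * f y)"

lemma integrable_mult_bounded:
  fixes f g :: "'a \<Rightarrow> real"
  assumes f: "integrable M f" and g: "g \<in> borel_measurable M" "\<And>x. \<bar>g x\<bar> \<le> B"
  shows "integrable M (\<lambda>x. g x * f x)"
proof (rule Bochner_Integration.integrable_bound)
  show "integrable M (\<lambda>x. B * f x)" using f by simp
  show "(\<lambda>x. g x * f x) \<in> borel_measurable M" using f g by simp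
  have "\<bar>g x\<bar> \<le> \<bar>B\<bar>" for x using g(2)[of x] by linarith
  then show "AE x in M. norm (g x * f x) \<le> norm (B * f x)"
    by (auto simp: abs_mult intro!: mult_right_mono)
qed

lemma integrable_conv_integrand:
  assumes "test_function UNIV k" "integrable lborel f"
  shows "integrable lborel (\<lambda>y. k (x - y) * f y)"
proof -
  obtain B where "\<And>x. \<bar>k x\<bar> \<le> B" using test_function_bounded[OF assms(1)] by metis
  then show ?thesis
    using assms(2) test_functionD(4)[OF assms(1)] by (intro integrable_mult_bounded[of _ _ _ B]) auto
qed

text \<open>The point is uniformity in z: the estimate can then be integrated against an arbitrary
  integrable function. It comes from the mean value theorem and the uniform continuity of the
  partial derivatives.\<close>

lemma test_function_remainder:
  fixes k :: "real^'n \<Rightarrow> real"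
  assumes k: "test_function \<Omega> k" and "e > 0"
  obtains d where "d > 0"
    "\<And>z h. norm h < d \<Longrightarrow> \<bar>k (z + h) - k z - (\<Sum>i\<in>UNIV. h $ i * D i k z)\<bar> \<le> e * norm h"
proof -
  let ?e = "e / CARD('n)"
  have "\<exists>d>0. \<forall>x y. dist x y < d \<longrightarrow> \<bar>D i k x - D i k y\<bar> < ?e" for i
    by (rule test_function_uniformly_continuous[OF test_function_D[OF k, of i], of ?e]) (use \<open>e > 0\<close> in auto)
  then obtain \<delta> where \<delta>: "\<And>i. \<delta> i > 0" "\<And>i x y. dist x y < \<delta> i \<Longrightarrow> \<bar>D i k x - D i k y\<bar> < ?e"
    by metis
  define d where "d = Min (range \<delta>)"
  have d: "d > 0" "\<And>i. d \<le> \<delta> i" using \<delta>(1) unfolding d_def by auto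
  show ?thesis
  proof (rule that[OF d(1)])
    fix z h :: "real^'n" assume h: "norm h < d"
    define \<phi> where "\<phi> s = k (z + s *\<^sub>R h)" for s
    have lin: "((\<lambda>s. z + s *\<^sub>R h) has_derivative (\<lambda>s. s *\<^sub>R h)) (at s)" for s
      by (auto intro!: derivative_eq_intros)
    have \<phi>: "(\<phi> has_real_derivative (\<Sum>i\<in>UNIV. h $ i * D i k (z + s *\<^sub>R h))) (at s)" for s
      unfolding \<phi>_def has_field_derivative_def
      by (rule has_derivative_eq_rhs[OF diff_chain_at[OF lin test_functionD(5)[OF k], unfolded o_def]]) (simp_all add: fun_eq_iff sum_distrib_left mult_ac)
    obtain s where s: "0 < s" "s < 1" "\<phi> 1 - \<phi> 0 = (1 - 0) * (\<Sum>i\<in>UNIV. h $ i * D i k (z + s *\<^sub>R h))"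
      using MVT2[of 0 1 \<phi>, OF _ \<phi>] by auto
    have "\<bar>k (z + h) - k z - (\<Sum>i\<in>UNIV. h $ i * D i k z)\<bar> =
        \<bar>\<Sum>i\<in>UNIV. h $ i * (D i k (z + s *\<^sub>R h) - D i k z)\<bar>"
      using s(3) by (simp add: \<phi>_def right_diff_distrib sum_subtractf)
    also have "\<dots> \<le> (\<Sum>i\<in>UNIV. \<bar>h $ i * (D i k (z + s *\<^sub>R h) - D i k z)\<bar>)"
      by (rule sum_abs)
    also have "\<dots> \<le> (\<Sum>i\<in>(UNIV :: 'n set). norm h * ?e)"
    proof (rule sum_mono)
      fix i
      have "s * norm h \<le> norm h" using s by (simp add: mult_left_le_one_le)
      then have "dist (z + s *\<^sub>R h) z < \<delta> i" using h d(2)[of i] s(1) by (simp add: dist_norm)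
      then show "\<bar>h $ i * (D i k (z + s *\<^sub>R h) - D i k z)\<bar> \<le> norm h * ?e"
        unfolding abs_mult using \<delta>(2) component_le_norm_cart by (intro mult_mono) (auto intro: less_imp_le)
    qed
    also have "\<dots> = e * norm h" by simp
    finally show "\<bar>k (z + h) - k z - (\<Sum>i\<in>UNIV. h $ i * D i k z)\<bar> \<le> e * norm h" .
  qed
qed

text \<open>Differentiation under the integral sign: the first-order remainder of k is uniformly
  small compared with norm h, and integrating it against f costs only the L^1 norm of f.\<close>

lemma has_derivative_conv:
  fixes k :: "real^'n \<Rightarrow> real"
  assumes k: "test_function UNIV k" and f: "integrable lborel f"
  shows "(conv k f has_derivative (\<lambda>h. \<Sum>i\<in>UNIV. h $ i * conv (D i k) f x)) (at x)"
  unfolding has_derivative_at_alt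
proof (intro conjI allI impI)
  show "bounded_linear (\<lambda>h. \<Sum>i\<in>UNIV. h $ i * conv (D i k) f x)"
    by (intro bounded_linear_sum bounded_linear_mult_const bounded_linear_vec_nth)
next
  fix e :: real assume "e > 0"
  let ?I = "1 + (LINT y|lborel. \<bar>f y\<bar>)"
  have I: "?I > 0" by (simp add: add_pos_nonneg)
  \<comment> \<open>The summand 1 in \<open>?I\<close> keeps the divisor positive when f vanishes
    almost everywhere.\<close>
  obtain d where d: "d > 0"
    "\<And>z h. norm h < d \<Longrightarrow> \<bar>k (z + h) - k z - (\<Sum>i\<in>UNIV. h $ i * D i k z)\<bar> \<le> (e / ?I) * norm h"
    by (rule test_function_remainder[OF k, of "e / ?I"]) (use \<open>e > 0\<close> I in auto)
  have "norm (conv k f y - conv k f x - (\<Sum>i\<in>UNIV. (y - x) $ i * conv (D i k) f x)) \<le> e * norm (y - x)"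
    if y: "norm (y - x) < d" for y
  proof -
    define R where "R w = k (x - w + (y - x)) - k (x - w) - (\<Sum>i\<in>UNIV. (y - x) $ i * D i k (x - w))" for w
    have R: "\<bar>R w\<bar> \<le> (e / ?I) * norm (y - x)" for w unfolding R_def by (rule d(2)[OF y])
    note int = integrable_conv_integrand[OF k f] integrable_conv_integrand[OF test_function_D[OF k] f]
    have "conv k f y - conv k f x - (\<Sum>i\<in>UNIV. (y - x) $ i * conv (D i k) f x) = (LINT w|lborel. R w * f w)"
      unfolding conv_def R_def using int
      by (simp add: left_diff_distrib sum_distrib_right mult.assoc)
    also have "norm \<dots> \<le> (LINT w|lborel. (e / ?I) * norm (y - x) * \<bar>f w\<bar>)"
      unfolding real_norm_def
    proof (rule integral_abs_bound_integral)
      have "R \<in> borel_measurable borel"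
        using test_functionD(4)[OF k] test_functionD(7)[OF k] unfolding R_def[abs_def] by measurable
      then show "integrable lborel (\<lambda>w. R w * f w)"
        using R by (intro integrable_mult_bounded[OF f]) auto
      show "\<bar>R w * f w\<bar> \<le> e / ?I * norm (y - x) * \<bar>f w\<bar>" for w
        using R[of w] unfolding abs_mult by (rule mult_right_mono) simp
    qed (use f in auto)
    also have "\<dots> = e * norm (y - x) * ((LINT y|lborel. \<bar>f y\<bar>) / ?I)" by simp
    also have "\<dots> \<le> e * norm (y - x) * 1"
      using \<open>e > 0\<close> I by (intro mult_left_mono) auto
    finally show ?thesis by simp
  qed
  then show "\<exists>d>0. \<forall>y. norm (y - x) < d \<longrightarrow>
      norm (conv k f y - conv k f x - (\<Sum>i\<in>UNIV. (y - x) $ i * conv (D i k) f x)) \<le> e * norm (y - x)"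
    using d(1) by blast
qed

lemma D_conv:
  assumes "test_function UNIV k" "integrable lborel f"
  shows "D i (conv k f) = conv (D i k) f"
proof
  fix x
  have *: "(\<Sum>j\<in>UNIV. axis i 1 $ j * conv (D j k) f x) = conv (D i k) f x"
    by (subst sum.remove[of _ i]) (auto simp: axis_def intro!: sum.neutral)
  show "D i (conv k f) x = conv (D i k) f x"
    using has_derivative_axis[OF has_derivative_conv[OF assms], of i x] * by simp
qed

lemma Ck_conv:
  assumes "test_function UNIV k" "integrable lborel f"
  shows "Ck j (conv k f)"
  using assms(1)
proof (induction j arbitrary: k)
  case 0
  then have "conv k f differentiable (at x)" for x
    using has_derivative_conv[OF _ assms(2)] differentiable_def by blast
  then show ?case
    by (auto intro!: differentiable_imp_continuous_on simp: differentiable_on_def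
        intro: differentiable_at_withinI)
next
  case (Suc j)
  then have "conv k f differentiable (at x)" for x
    using has_derivative_conv[OF _ assms(2)] differentiable_def by blast
  then show ?case using Suc by (simp add: D_conv[OF _ assms(2)] test_function_D)
qed

lemma conv_nonzero:
  assumes "conv k f x \<noteq> 0" obtains y where "k (x - y) \<noteq> 0" "f y \<noteq> 0"
proof (rule ccontr)
  assume "\<not> thesis"
  then have "(\<lambda>y. k (x - y) * f y) = (\<lambda>_. 0)" using that by fastforce
  then show False using assms by (simp add: conv_def)
qed

lemma test_function_conv:
  assumes k: "test_function UNIV k" and f: "integrable lborel f"
    and K: "compact K" "K \<subseteq> \<Omega>" "\<And>x y. k (x - y) \<noteq> 0 \<Longrightarrow> f y \<noteq> 0 \<Longrightarrow> x \<in> K"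
  shows "test_function \<Omega> (conv k f)"
proof -
  have "closure {x. conv k f x \<noteq> 0} \<subseteq> K"
    by (rule closure_minimal) (use K compact_imp_closed in \<open>auto elim!: conv_nonzero\<close>)
  then show ?thesis
    using K Ck_conv[OF k f] compact_closed_subset[OF K(1) closed_closure] by (auto simp: test_function_def)
qed

section \<open>Approximation in L^p and continuity of translations\<close>

lemma abs_add_powr_le:
  fixes a b p :: real
  assumes "p \<ge> 0"
  shows "\<bar>a + b\<bar> powr p \<le> 2 powr p * (\<bar>a\<bar> powr p + \<bar>b\<bar> powr p)"
proof -
  have "\<bar>a + b\<bar> powr p \<le> (2 * max \<bar>a\<bar> \<bar>b\<bar>) powr p"
    using assms by (intro powr_mono2) auto
  also have "\<dots> = 2 powr p * (max \<bar>a\<bar> \<bar>b\<bar>) powr p" by (simp add: powr_mult)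
  also have "\<dots> \<le> 2 powr p * (\<bar>a\<bar> powr p + \<bar>b\<bar> powr p)"
    by (intro mult_left_mono) (auto simp: max_def)
  finally show ?thesis .
qed

text \<open>Stands in for Minkowski's inequality: it applies to modulars directly and for every p >=
  0, and the factor 2^p is absorbed in the choice of the error bounds.\<close>

lemma nn_integral_powr_add_le:
  fixes f g :: "'a \<Rightarrow> real"
  assumes "p \<ge> 0" and [measurable]: "f \<in> borel_measurable M" "g \<in> borel_measurable M"
  shows "(\<integral>\<^sup>+x. ennreal (\<bar>f x + g x\<bar> powr p) \<partial>M) \<le>
    ennreal (2 powr p) * ((\<integral>\<^sup>+x. ennreal (\<bar>f x\<bar> powr p) \<partial>M) + (\<integral>\<^sup>+x. ennreal (\<bar>g x\<bar> powr p) \<partial>M))"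
proof -
  have "(\<integral>\<^sup>+x. ennreal (\<bar>f x + g x\<bar> powr p) \<partial>M) \<le>
      (\<integral>\<^sup>+x. ennreal (2 powr p) * (ennreal (\<bar>f x\<bar> powr p) + ennreal (\<bar>g x\<bar> powr p)) \<partial>M)"
    by (intro nn_integral_mono) (use abs_add_powr_le[OF assms(1)] in \<open>simp flip: ennreal_mult ennreal_plus\<close>)
  also have "\<dots> = ennreal (2 powr p) * ((\<integral>\<^sup>+x. ennreal (\<bar>f x\<bar> powr p) \<partial>M) + (\<integral>\<^sup>+x. ennreal (\<bar>g x\<bar> powr p) \<partial>M))"
    by (subst nn_integral_cmult) (auto simp: nn_integral_add)
  finally show ?thesis .
qed

lemma AE_lborel_negligible: "negligible N \<Longrightarrow> AE x in lborel. x \<notin> N"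
  using AE_not_in[of N lebesgue] by (simp add: negligible_iff_null_sets AE_completion_iff)

lemma tendsto_powr_diff_0:
  assumes "(a \<longlongrightarrow> b) F" "p > 0"
  shows "((\<lambda>n. \<bar>a n - b\<bar> powr p) \<longlongrightarrow> (0::real)) F"
proof -
  have "((\<lambda>n. \<bar>a n - b\<bar>) \<longlongrightarrow> \<bar>b - b\<bar>) F" by (intro tendsto_intros assms)
  then have "((\<lambda>n. \<bar>a n - b\<bar> powr p) \<longlongrightarrow> 0 powr p) F"
    using assms(2) by (intro tendsto_powr') auto
  then show ?thesis by simp
qed

lemma Lp_dominated_convergence:
  fixes u :: "nat \<Rightarrow> 'a \<Rightarrow> real"
  assumes p: "p > 0" and [measurable]: "\<And>n. u n \<in> borel_measurable M" "f \<in> borel_measurable M" "w \<in> borel_measurable M"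
    and w: "(\<integral>\<^sup>+x. ennreal (w x) \<partial>M) < \<infinity>" and bd: "\<And>n. AE x in M. \<bar>u n x - f x\<bar> powr p \<le> w x"
    and lim: "AE x in M. (\<lambda>n. u n x) \<longlonglongrightarrow> f x"
  shows "(\<lambda>n. \<integral>\<^sup>+x. ennreal (\<bar>u n x - f x\<bar> powr p) \<partial>M) \<longlonglongrightarrow> 0"
proof -
  have "(\<lambda>n. \<integral>\<^sup>+x. ennreal (\<bar>u n x - f x\<bar> powr p) \<partial>M) \<longlonglongrightarrow> (\<integral>\<^sup>+x. 0 \<partial>M)"
  proof (rule nn_integral_dominated_convergence[where w="\<lambda>x. ennreal (w x)"])
    show "AE x in M. (\<lambda>n. ennreal (\<bar>u n x - f x\<bar> powr p)) \<longlonglongrightarrow> 0"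
      using lim
    proof eventually_elim
      case (elim x)
      show ?case using tendsto_ennrealI[OF tendsto_powr_diff_0[OF elim p]] by simp
    qed
    show "AE x in M. ennreal (\<bar>u j x - f x\<bar> powr p) \<le> ennreal (w x)" for j
      using bd[of j] by eventually_elim (rule ennreal_leI)
  qed (use w in auto)
  then show ?thesis by simp
qed

text \<open>Two dominated limits. First f is truncated at height N. The truncation is then an a.e.
  limit of continuous functions, and clamping these to height N and cutting them off outside a ball
  supplies the integrable majorant.\<close>

lemma Lp_approx_continuous:
  fixes f :: "'a::euclidean_space \<Rightarrow> real"
  assumes p: "p > 0" and f[measurable]: "f \<in> borel_measurable borel"
    and fin: "(\<integral>\<^sup>+x. ennreal (\<bar>f x\<bar> powr p) \<partial>lborel) < \<infinity>"
    and supp: "\<And>x. f x \<noteq> 0 \<Longrightarrow> norm x \<le> R" and e: "(e::ennreal) > 0"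
  obtains g where "continuous_on UNIV g" "\<And>x. g x \<noteq> 0 \<Longrightarrow> norm x \<le> R + 1"
    "(\<integral>\<^sup>+x. ennreal (\<bar>g x - f x\<bar> powr p) \<partial>lborel) < e"
proof -
  define clamp where "clamp c t = max (-c) (min c t)" for c t :: real
  have clamp_le: "\<bar>clamp c t\<bar> \<le> c" if "c \<ge> 0" for c t using that by (auto simp: clamp_def)
  have [measurable]: "clamp c \<in> borel_measurable borel" for c unfolding clamp_def[abs_def] by measurable
  have cont_clamp: "continuous_on UNIV (clamp c)" for c 
    unfolding clamp_def[abs_def] by (intro continuous_intros)
  \<comment> \<open>Two errors below e' combine to less than 2^p (e' + e') = e in the quasi-triangle
    inequality.\<close>
  define e' where "e' = e / ennreal (2 powr p) / 2"
  have e': "e' > 0" using e by (auto simp: e'_def ennreal_zero_less_divide)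
  have "(\<lambda>n. \<integral>\<^sup>+x. ennreal (\<bar>clamp (real n) (f x) - f x\<bar> powr p) \<partial>lborel) \<longlonglongrightarrow> 0"
  proof (rule Lp_dominated_convergence[OF p, where w="\<lambda>x. \<bar>f x\<bar> powr p"])
    show "AE x in lborel. (\<lambda>n. clamp (real n) (f x)) \<longlonglongrightarrow> f x"
    proof (rule AE_I2)
      fix x
      obtain m where "\<bar>f x\<bar> \<le> real m" using real_arch_simple by blast
      then have "\<forall>\<^sub>F n in sequentially. clamp (real n) (f x) = f x"
        by (intro eventually_sequentiallyI[of m]) (auto simp: clamp_def)
      then show "(\<lambda>n. clamp (real n) (f x)) \<longlonglongrightarrow> f x" by (rule tendsto_eventually)
    qed
    have "\<bar>clamp (real n) (f x) - f x\<bar> \<le> \<bar>f x\<bar>" for n x by (auto simp: clamp_def)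
    then show "AE x in lborel. \<bar>clamp (real n) (f x) - f x\<bar> powr p \<le> \<bar>f x\<bar> powr p" for n
      using p by (auto intro!: AE_I2 powr_mono2)
  qed (use fin in auto)
  from order_tendstoD(2)[OF this e'] obtain N where
    N: "(\<integral>\<^sup>+x. ennreal (\<bar>clamp (real N) (f x) - f x\<bar> powr p) \<partial>lborel) < e'"
    by (auto simp: eventually_sequentially)
  define h where "h x = clamp (real N) (f x)" for x
  have h_meas[measurable]: "h \<in> borel_measurable borel" unfolding h_def by measurable
  define \<theta> :: "'a \<Rightarrow> real" where "\<theta> x = max 0 (min 1 (R + 1 - norm x))" for x
  have \<theta>: "0 \<le> \<theta> x" "\<theta> x \<le> 1" "norm x \<le> R \<Longrightarrow> \<theta> x = 1" "\<theta> x \<noteq> 0 \<Longrightarrow> norm x \<le> R + 1" for x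
    by (auto simp: \<theta>_def max_def min_def split: if_splits)
  have cont_\<theta>: "continuous_on UNIV \<theta>" unfolding \<theta>_def[abs_def] by (intro continuous_intros)
  have h\<theta>: "h x * \<theta> x = h x" for x
    using supp[of x] \<theta>(3)[of x] by (cases "f x = 0") (auto simp: h_def clamp_def)
  \<comment> \<open>\<open>measurable_on\<close> provides continuous functions that converge to f
    off a negligible set.\<close>
  have "f measurable_on UNIV"
    using f by (intro lebesgue_measurable_imp_measurable_on_real) (auto simp: measurable_completion)
  then obtain Z G where Z: "negligible Z" and G: "\<And>n. continuous_on UNIV (G n)"
    "\<And>x. x \<notin> Z \<Longrightarrow> (\<lambda>n. G n x) \<longlonglongrightarrow> f x"
    unfolding measurable_on_def by auto
  define g where "g n x = clamp (real N) (G n x) * \<theta> x" for n x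
  have g_cont: "continuous_on UNIV (g n)" for n
    unfolding g_def[abs_def]
    by (intro continuous_intros cont_\<theta> continuous_on_compose2[OF cont_clamp G(1)]) auto
  have g_meas[measurable]: "g n \<in> borel_measurable borel" for n
    by (intro borel_measurable_continuous_onI g_cont)
  have "(\<lambda>n. \<integral>\<^sup>+x. ennreal (\<bar>g n x - h x\<bar> powr p) \<partial>lborel) \<longlonglongrightarrow> 0"
  proof (rule Lp_dominated_convergence[OF p, where w="\<lambda>x. (2 * real N) powr p * indicator (cball 0 (R+1)) x"])
    have "(\<integral>\<^sup>+x. ennreal ((2 * real N) powr p * indicator (cball (0::'a) (R+1)) x) \<partial>lborel) =
        ennreal ((2 * real N) powr p) * emeasure lborel (cball (0::'a) (R+1))"
      by (subst nn_integral_cmult_indicator[symmetric]) (auto intro!: nn_integral_cong simp: indicator_def)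
    then show "(\<integral>\<^sup>+x. ennreal ((2 * real N) powr p * indicator (cball (0::'a) (R+1)) x) \<partial>lborel) < \<infinity>"
      using emeasure_bounded_finite[OF bounded_cball[of "0::'a" "R+1"]] by (simp add: ennreal_mult_less_top)
    show "AE x in lborel. \<bar>g n x - h x\<bar> powr p \<le> (2 * real N) powr p * indicator (cball 0 (R+1)) x" for n
    proof (rule AE_I2)
      fix x
      show "\<bar>g n x - h x\<bar> powr p \<le> (2 * real N) powr p * indicator (cball 0 (R+1)) x"
      proof (cases "norm x \<le> R + 1")
        case True
        have "\<bar>g n x\<bar> \<le> real N" unfolding g_def abs_mult
          using clamp_le[of "real N" "G n x"] \<theta>(1,2)[of x] mult_mono[of "\<bar>clamp (real N) (G n x)\<bar>" "real N" "\<bar>\<theta> x\<bar>" 1] by auto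
        moreover have "\<bar>h x\<bar> \<le> real N" unfolding h_def by (rule clamp_le) simp
        ultimately show ?thesis using True p by (auto intro!: powr_mono2)
      next
        case False
        then have "g n x = 0" "h x = 0" using \<theta>(4)[of x] h\<theta>[of x] by (auto simp: g_def)
        then show ?thesis by simp
      qed
    qed
    show "AE x in lborel. (\<lambda>n. g n x) \<longlonglongrightarrow> h x"
      using AE_lborel_negligible[OF Z]
    proof eventually_elim
      case (elim x)
      have "(\<lambda>n. g n x) \<longlonglongrightarrow> clamp (real N) (f x) * \<theta> x"
        unfolding g_def by (intro tendsto_mult tendsto_const continuous_on_tendsto_compose[OF cont_clamp G(2)[OF elim]]) auto
      moreover have "clamp (real N) (f x) * \<theta> x = h x" using h\<theta>[of x] unfolding h_def .
      ultimately show ?case by simp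
    qed
    show "g n \<in> borel_measurable lborel" for n unfolding measurable_lborel2 by (rule g_meas)
    show "h \<in> borel_measurable lborel" unfolding measurable_lborel2 by (rule h_meas)
    have ind: "(indicator (cball (0::'a) (R+1)) :: 'a \<Rightarrow> real) \<in> borel_measurable borel"
      by (rule borel_measurable_indicator) simp
    show "(\<lambda>x. (2 * real N) powr p * indicator (cball (0::'a) (R+1)) x) \<in> borel_measurable lborel"
      unfolding measurable_lborel2 by (rule borel_measurable_times[OF borel_measurable_const ind])
  qed
  from order_tendstoD(2)[OF this e'] have "\<forall>\<^sub>F n in sequentially. (\<integral>\<^sup>+x. ennreal (\<bar>g n x - h x\<bar> powr p) \<partial>lborel) < e'" .
  then obtain n where
    n: "(\<integral>\<^sup>+x. ennreal (\<bar>g n x - h x\<bar> powr p) \<partial>lborel) < e'"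
    using eventually_happens' sequentially_bot by blast
  show ?thesis
  proof (rule that[OF g_cont[of n]])
    show "g n x \<noteq> 0 \<Longrightarrow> norm x \<le> R + 1" for x using \<theta>(4)[of x] by (auto simp: g_def)
    have "(\<integral>\<^sup>+x. ennreal (\<bar>(g n x - h x) + (h x - f x)\<bar> powr p) \<partial>lborel) \<le> ennreal (2 powr p) *
       ((\<integral>\<^sup>+x. ennreal (\<bar>g n x - h x\<bar> powr p) \<partial>lborel) + (\<integral>\<^sup>+x. ennreal (\<bar>h x - f x\<bar> powr p) \<partial>lborel))"
      using p by (intro nn_integral_powr_add_le) auto
    also have "\<dots> < ennreal (2 powr p) * (e' + e')"
      using n N by (intro ennreal_mult_strict_left_mono add_strict_mono) (auto simp: h_def)
    also have "\<dots> = e"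
    proof -
      have "e' + e' = e / ennreal (2 powr p)"
        unfolding e'_def by (metis mult_2_right ennreal_divide_times ennreal_divide_self ennreal_numeral ennreal_less_top mult.right_neutral zero_neq_numeral)
      then show ?thesis by (simp add: ennreal_times_divide ennreal_mult_divide_eq mult.commute)
    qed
    finally show "(\<integral>\<^sup>+x. ennreal (\<bar>g n x - f x\<bar> powr p) \<partial>lborel) < e" by simp
  qed
qed

lemma continuous_support_uniformly_continuous:
  fixes g :: "'a::euclidean_space \<Rightarrow> real"
  assumes g: "continuous_on UNIV g" "\<And>x. g x \<noteq> 0 \<Longrightarrow> norm x \<le> R" and "e > 0"
  obtains d where "d > 0" "\<And>x y. dist x y < d \<Longrightarrow> \<bar>g x - g y\<bar> < e"
proof -
  have "uniformly_continuous_on (cball 0 (R+1)) g"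
    using g(1) by (intro compact_uniformly_continuous) (auto intro: continuous_on_subset)
  then obtain d where d: "d > 0" "\<And>x y. x \<in> cball 0 (R+1) \<Longrightarrow> y \<in> cball 0 (R+1) \<Longrightarrow> dist y x < d \<Longrightarrow> dist (g y) (g x) < e"
    using assms(3) unfolding uniformly_continuous_on_def by metis
  have "\<bar>g x - g y\<bar> < e" if "dist x y < min d 1" for x y
  proof (cases "x \<in> cball 0 (R+1) \<and> y \<in> cball 0 (R+1)")
    case True then show ?thesis using d(2)[of y x] that by (auto simp: dist_real_def)
  next
    case False
    have "\<bar>norm x - norm y\<bar> < 1" using that norm_triangle_ineq3[of x y] by (auto simp: dist_norm)
    then have "norm x > R" "norm y > R" using False by auto
    then have "g x = 0" "g y = 0" using g(2) by (meson not_le)+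
    then show ?thesis using assms by simp
  qed
  then show ?thesis using that[of "min d 1"] d by auto
qed

lemma Lp_translation_continuous:
  fixes f :: "'a::euclidean_space \<Rightarrow> real"
  assumes p: "p > 0" and f[measurable]: "f \<in> borel_measurable borel"
    and fin: "(\<integral>\<^sup>+x. ennreal (\<bar>f x\<bar> powr p) \<partial>lborel) < \<infinity>"
    and supp: "\<And>x. f x \<noteq> 0 \<Longrightarrow> norm x \<le> R" and e: "e > (0::real)"
  obtains d where "d > 0"
    "\<And>z. norm z < d \<Longrightarrow> (\<integral>\<^sup>+x. ennreal (\<bar>f (x - z) - f x\<bar> powr p) \<partial>lborel) \<le> ennreal e"
proof -
  define C where "C = 2 powr p"
  have C: "C > 0" by (simp add: C_def)
  \<comment> \<open>The three differences f(x-z) - g(x-z), g(x-z) - g(x), g(x) - f(x) are joined by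
    two uses of the quasi-triangle inequality. This gives C (a + C (a + a)), which is at most (2 C +
    2 C^2) a = e.\<close>
  define a where "a = e / (2 * C + 2 * C * C)"
  have a: "a > 0" using e C by (simp add: a_def add_pos_pos)
  obtain g where g: "continuous_on UNIV g" "\<And>x. g x \<noteq> 0 \<Longrightarrow> norm x \<le> R + 1"
    "(\<integral>\<^sup>+x. ennreal (\<bar>g x - f x\<bar> powr p) \<partial>lborel) < ennreal a"
    by (rule Lp_approx_continuous[OF p f fin supp, of "ennreal a"]) (use a in auto)
  have [measurable]: "g \<in> borel_measurable borel" using g(1) by (rule borel_measurable_continuous_onI)
  define V where "V = measure lborel (cball (0::'a) (R + 2))"
  have V: "emeasure lborel (cball (0::'a) (R + 2)) = ennreal V" "V \<ge> 0"
    using emeasure_bounded_finite[OF bounded_cball[of "0::'a" "R+2"]]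
    by (auto simp: V_def emeasure_eq_ennreal_measure)
  \<comment> \<open>A pointwise bound b for the translation error of g, raised to the power p and
    integrated over a ball of volume V, gives at most a.\<close>
  define b where "b = (a / (V + 1)) powr (1 / p)"
  have b: "b > 0" using a V by (simp add: b_def)
  obtain d where d: "d > 0" "\<And>x y. dist x y < d \<Longrightarrow> \<bar>g x - g y\<bar> < b"
    using continuous_support_uniformly_continuous[OF g(1,2) b] by blast
  have "(\<integral>\<^sup>+x. ennreal (\<bar>f (x - z) - f x\<bar> powr p) \<partial>lborel) \<le> ennreal e" if z: "norm z < min d 1" for z
  proof -
    have bd: "\<bar>g (x - z) - g x\<bar> powr p \<le> a / (V + 1)" for x
    proof -
      have "\<bar>g (x - z) - g x\<bar> powr p \<le> b powr p"
        using d(2)[of "x - z" x] z p by (intro powr_mono2) (auto simp: dist_norm)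
      also have "\<dots> = a / (V + 1)" using p a V by (simp add: b_def powr_powr)
      finally show ?thesis .
    qed
    have out: "\<bar>g (x - z) - g x\<bar> powr p = 0" if "norm x > R + 2" for x
    proof -
      have "norm (x - z) > R + 1" using that z norm_triangle_ineq2[of x z] by linarith
      then have "g x = 0" "g (x - z) = 0" using g(2)[of x] g(2)[of "x - z"] that by (auto simp: not_le[symmetric])
      then show ?thesis by simp
    qed
    have "(\<integral>\<^sup>+x. ennreal (\<bar>g (x - z) - g x\<bar> powr p) \<partial>lborel) \<le>
        (\<integral>\<^sup>+x. ennreal (a / (V + 1)) * indicator (cball (0::'a) (R + 2)) x \<partial>lborel)"
    proof (intro nn_integral_mono)
      fix x
      show "ennreal (\<bar>g (x - z) - g x\<bar> powr p) \<le> ennreal (a / (V + 1)) * indicator (cball (0::'a) (R + 2)) x"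
        using bd[of x] out[of x] by (cases "norm x > R + 2") (auto simp: ennreal_leI)
    qed
    also have "\<dots> = ennreal (a / (V + 1)) * ennreal V"
      by (simp add: nn_integral_cmult_indicator V(1))
    also have "\<dots> = ennreal (a * (V / (V + 1)))" using a V by (simp flip: ennreal_mult)
    also have "\<dots> \<le> ennreal a" using a V by (intro ennreal_leI) (simp add: field_simps)
    finally have 2: "(\<integral>\<^sup>+x. ennreal (\<bar>g (x - z) - g x\<bar> powr p) \<partial>lborel) \<le> ennreal a" .
    have 1: "(\<integral>\<^sup>+x. ennreal (\<bar>f (x - z) - g (x - z)\<bar> powr p) \<partial>lborel) \<le> ennreal a"
      using lborel_nn_integral_shift[of "\<lambda>x. ennreal (\<bar>f x - g x\<bar> powr p)" "- z"] g(3)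
      by (simp add: abs_minus_commute)
    have "(\<integral>\<^sup>+x. ennreal (\<bar>f (x - z) - f x\<bar> powr p) \<partial>lborel)
        = (\<integral>\<^sup>+x. ennreal (\<bar>(f (x - z) - g (x - z)) + ((g (x - z) - g x) + (g x - f x))\<bar> powr p) \<partial>lborel)" by simp
    also have "\<dots> \<le> ennreal C * ((\<integral>\<^sup>+x. ennreal (\<bar>f (x - z) - g (x - z)\<bar> powr p) \<partial>lborel) +
         (\<integral>\<^sup>+x. ennreal (\<bar>(g (x - z) - g x) + (g x - f x)\<bar> powr p) \<partial>lborel))"
      unfolding C_def using p by (intro nn_integral_powr_add_le) auto
    also have "\<dots> \<le> ennreal C * (ennreal a + ennreal C * ((\<integral>\<^sup>+x. ennreal (\<bar>g (x - z) - g x\<bar> powr p) \<partial>lborel) +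
         (\<integral>\<^sup>+x. ennreal (\<bar>g x - f x\<bar> powr p) \<partial>lborel)))"
      unfolding C_def using p by (intro mult_left_mono add_mono 1 nn_integral_powr_add_le) auto
    also have "\<dots> \<le> ennreal C * (ennreal a + ennreal C * (ennreal a + ennreal a))"
      using g(3) by (intro mult_left_mono add_mono 2) auto
    also have "\<dots> = ennreal (C * (a + C * (a + a)))"
    proof -
      have "ennreal a + ennreal a = ennreal (a + a)"
        using a by (intro ennreal_plus[symmetric]) auto
      then have "ennreal a + ennreal C * (ennreal a + ennreal a) = ennreal (a + C * (a + a))"
        using a C by (simp add: ennreal_mult'[symmetric] ennreal_plus[symmetric] del: ennreal_plus)
      then show ?thesis using C by (simp add: ennreal_mult')
    qed
    also have "C * (a + C * (a + a)) \<le> e"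
    proof -
      have "C * (a + C * (a + a)) \<le> (2 * C + 2 * C * C) * a"
        using C a by (simp add: algebra_simps)
      also have "\<dots> = e"
      proof -
        have "2 * C + 2 * C * C > 0" using C by (simp add: add_pos_pos)
        then show ?thesis unfolding a_def by simp
      qed
      finally show ?thesis .
    qed
    finally show ?thesis by (simp add: ennreal_leI)
  qed
  then show ?thesis using that[of "min d 1"] d(1) by auto
qed

section \<open>Jensen's inequality and the error of mollification\<close>

lemma powr_tangent_le:
  fixes A t p :: real
  assumes "p \<ge> 1" "A \<ge> 0" "t \<ge> 0"
  shows "p * A powr (p - 1) * t \<le> t powr p + (p - 1) * A powr p"
proof (cases "p = 1")
  case True then show ?thesis using assms by (cases "A = 0") auto
next
  case False
  define q where "q = p / (p - 1)"
  have p: "p > 1" using assms False by simp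
  then have q: "q > 1" "1 / p + 1 / q = 1" by (auto simp: q_def field_simps)
  have "t * A powr (p - 1) \<le> t powr p / p + (A powr (p - 1)) powr q / q"
    using p q assms by (intro Youngs_inequality) auto
  also have "(A powr (p - 1)) powr q = A powr p"
    using p by (simp add: powr_powr q_def)
  finally have "p * (t * A powr (p - 1)) \<le> p * (t powr p / p + A powr p / q)"
    using p by (intro mult_left_mono) auto
  also have "\<dots> = t powr p + (p - 1) * A powr p"
    using p by (simp add: q_def field_simps)
  finally show ?thesis by (simp add: mult_ac)
qed

text \<open>\<open>powr_tangent_le\<close> says that t^p lies above its tangent at A. With t = |g x|
  and A the k-average of |g|, integrating against k leaves p A^p on the left and (p - 1) A^p on the
  right, and the difference is A^p. The right-hand side may be infinite, hence the
  \<open>ennreal\<close> form.\<close>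

lemma jensen_powr:
  fixes k g :: "'a \<Rightarrow> real"
  assumes p: "p \<ge> 1" and [measurable]: "k \<in> borel_measurable M" "g \<in> borel_measurable M"
    and k: "\<And>x. k x \<ge> 0" "integrable M k" "integral\<^sup>L M k = 1"
    and int: "integrable M (\<lambda>x. k x * g x)"
  shows "ennreal (\<bar>LINT x|M. k x * g x\<bar> powr p) \<le> (\<integral>\<^sup>+x. ennreal (k x * \<bar>g x\<bar> powr p) \<partial>M)"
proof -
  define A where "A = (LINT x|M. k x * \<bar>g x\<bar>)"
  have intabs: "integrable M (\<lambda>x. k x * \<bar>g x\<bar>)"
    using integrable_abs[OF int] k(1) by (simp add: abs_mult)
  have A: "A \<ge> 0" "\<bar>LINT x|M. k x * g x\<bar> \<le> A"
    using k(1) integral_abs_bound[of M "\<lambda>x. k x * g x"] by (auto simp: A_def abs_mult)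
  have "ennreal (p * A powr p) = ennreal (LINT x|M. p * A powr (p - 1) * (k x * \<bar>g x\<bar>))"
  proof -
    have "(LINT x|M. p * A powr (p - 1) * (k x * \<bar>g x\<bar>)) = p * A powr (p - 1) * A"
      by (simp only: integral_mult_right_zero A_def[symmetric])
    also have "\<dots> = p * A powr p"
      using A powr_mult_base[of A "p - 1"] by (cases "A = 0") (auto simp: mult_ac)
    finally show ?thesis by (simp only:)
  qed
  also have "\<dots> = (\<integral>\<^sup>+x. ennreal (p * A powr (p - 1) * (k x * \<bar>g x\<bar>)) \<partial>M)"
    using p k(1) intabs by (intro nn_integral_eq_integral[symmetric]) auto
  also have "\<dots> \<le> (\<integral>\<^sup>+x. ennreal (k x * \<bar>g x\<bar> powr p) + ennreal ((p - 1) * A powr p * k x) \<partial>M)"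
  proof (intro nn_integral_mono)
    fix x
    have *: "k x * (p * A powr (p - 1) * \<bar>g x\<bar>) \<le> k x * (\<bar>g x\<bar> powr p + (p - 1) * A powr p)"
      using p A k(1) by (intro mult_left_mono powr_tangent_le) auto
    show "ennreal (p * A powr (p - 1) * (k x * \<bar>g x\<bar>)) \<le> ennreal (k x * \<bar>g x\<bar> powr p) + ennreal ((p - 1) * A powr p * k x)"
    proof -
      have "0 \<le> (p - 1) * A powr p * k x" "0 \<le> k x * \<bar>g x\<bar> powr p" using p k(1)[of x] by auto
      then have "ennreal (k x * \<bar>g x\<bar> powr p) + ennreal ((p - 1) * A powr p * k x) =
          ennreal (k x * \<bar>g x\<bar> powr p + (p - 1) * A powr p * k x)" by (simp add: ennreal_plus)
      then show ?thesis using * by (auto intro!: ennreal_leI simp: algebra_simps)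
    qed
  qed
  also have "\<dots> = (\<integral>\<^sup>+x. ennreal (k x * \<bar>g x\<bar> powr p) \<partial>M) + (\<integral>\<^sup>+x. ennreal ((p - 1) * A powr p * k x) \<partial>M)"
    by (rule nn_integral_add) auto
  also have "(\<integral>\<^sup>+x. ennreal ((p - 1) * A powr p * k x) \<partial>M) = ennreal ((p - 1) * A powr p)"
    using p k by (subst nn_integral_eq_integral) auto
  finally have *: "ennreal (p * A powr p) \<le> (\<integral>\<^sup>+x. ennreal (k x * \<bar>g x\<bar> powr p) \<partial>M) + ennreal ((p - 1) * A powr p)" .
  have "ennreal (A powr p) + ennreal ((p - 1) * A powr p) = ennreal (p * A powr p)"
  proof -
    have "0 \<le> A powr p" "0 \<le> (p - 1) * A powr p" using p by auto
    then show ?thesis by (subst ennreal_plus[symmetric]) (auto simp: algebra_simps)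
  qed
  with * have "ennreal (A powr p) + ennreal ((p - 1) * A powr p) \<le> (\<integral>\<^sup>+x. ennreal (k x * \<bar>g x\<bar> powr p) \<partial>M) + ennreal ((p - 1) * A powr p)"
    by simp
  \<comment> \<open>The summand (p - 1) A^p is moved to the front so that it can be cancelled; this
    is sound in \<open>ennreal\<close> because it is finite.\<close>
  then have "ennreal ((p - 1) * A powr p) + ennreal (A powr p) \<le> ennreal ((p - 1) * A powr p) + (\<integral>\<^sup>+x. ennreal (k x * \<bar>g x\<bar> powr p) \<partial>M)"
    by (simp only: add.commute)
  then have "ennreal (A powr p) \<le> (\<integral>\<^sup>+x. ennreal (k x * \<bar>g x\<bar> powr p) \<partial>M)"
    unfolding ennreal_add_left_cancel_le by simp
  moreover have "ennreal (\<bar>LINT x|M. k x * g x\<bar> powr p) \<le> ennreal (A powr p)"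
    using p A by (intro ennreal_leI powr_mono2) auto
  ultimately show ?thesis by order
qed

text \<open>By Jensen and Fubini the error is at most a k-average of translation errors. Only the
  translations by z with k z \<noteq> 0 enter, so an off-centre kernel close to the origin serves as
  well as a centred one.\<close>

lemma conv_mollify:
  fixes f :: "real^'n \<Rightarrow> real"
  assumes p: "p \<ge> 1" and f: "integrable lborel f"
    and k: "test_function UNIV k" "\<And>x. k x \<ge> 0" "integral\<^sup>L lborel k = 1"
    and close: "\<And>z. k z \<noteq> 0 \<Longrightarrow> (\<integral>\<^sup>+x. ennreal (\<bar>f (x - z) - f x\<bar> powr p) \<partial>lborel) \<le> ennreal e"
  shows "(\<integral>\<^sup>+x. ennreal (\<bar>conv k f x - f x\<bar> powr p) \<partial>lborel) \<le> ennreal e"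
proof -
  note [measurable] = borel_measurable_integrable[OF f] test_functionD(4)[OF k(1)]
  have fm: "f \<in> borel_measurable borel" using f by auto
  note [measurable] = fm
  have ki: "integrable lborel k" by (rule test_function_integrable[OF k(1)])
  have kf: "integrable lborel (\<lambda>z. k z * f (x - z))" for x
    using lborel_integrable_reflect[OF integrable_conv_integrand[OF k(1) f, of x], of x] by simp
  have conv: "conv k f x = (LINT z|lborel. k z * f (x - z))" for x
    unfolding conv_def using lborel_integral_reflect[of "\<lambda>y. k (x - y) * f y" x] by simp
  have diff: "conv k f x - f x = (LINT z|lborel. k z * (f (x - z) - f x))" for x
    using kf[of x] ki k(3) by (simp add: conv right_diff_distrib)
  have "(\<integral>\<^sup>+x. ennreal (\<bar>conv k f x - f x\<bar> powr p) \<partial>lborel) \<le>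
      (\<integral>\<^sup>+x. (\<integral>\<^sup>+z. ennreal (k z * \<bar>f (x - z) - f x\<bar> powr p) \<partial>lborel) \<partial>lborel)"
    unfolding diff using kf ki by (intro nn_integral_mono jensen_powr[OF p _ _ k(2) ki k(3)]) (auto simp: right_diff_distrib)
  also have "\<dots> = (\<integral>\<^sup>+z. (\<integral>\<^sup>+x. ennreal (k z * \<bar>f (x - z) - f x\<bar> powr p) \<partial>lborel) \<partial>lborel)"
    by (rule lborel_pair.Fubini') measurable
  also have "\<dots> = (\<integral>\<^sup>+z. ennreal (k z) * (\<integral>\<^sup>+x. ennreal (\<bar>f (x - z) - f x\<bar> powr p) \<partial>lborel) \<partial>lborel)"
    by (intro nn_integral_cong) (simp add: ennreal_mult k(2) nn_integral_cmult)
  also have "\<dots> \<le> (\<integral>\<^sup>+z. ennreal (k z) * ennreal e \<partial>lborel)"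
  proof (intro nn_integral_mono)
    fix z
    show "ennreal (k z) * (\<integral>\<^sup>+x. ennreal (\<bar>f (x - z) - f x\<bar> powr p) \<partial>lborel) \<le> ennreal (k z) * ennreal e"
      using close[of z] by (cases "k z = 0") (auto intro: mult_left_mono)
  qed
  also have "\<dots> = (\<integral>\<^sup>+z. ennreal (k z) \<partial>lborel) * ennreal e"
    by (rule nn_integral_multc) auto
  also have "\<dots> = ennreal e"
    using k ki by (subst nn_integral_eq_integral) auto
  finally show ?thesis .
qed

section \<open>Weak derivatives\<close>

lemma lebesgue_on_open_nn_integral:
  fixes F :: "'a::euclidean_space \<Rightarrow> ennreal"
  assumes "open \<Omega>" "F \<in> borel_measurable borel" "\<And>x. x \<notin> \<Omega> \<Longrightarrow> F x = 0"
  shows "(\<integral>\<^sup>+x. F x \<partial>lebesgue_on \<Omega>) = (\<integral>\<^sup>+x. F x \<partial>lborel)"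
proof -
  have "(\<integral>\<^sup>+x. F x \<partial>lebesgue_on \<Omega>) = (\<integral>\<^sup>+x. F x * indicator \<Omega> x \<partial>lebesgue)"
    using assms(1) by (subst nn_integral_restrict_space) auto
  also have "\<dots> = (\<integral>\<^sup>+x. F x \<partial>lebesgue)"
    using assms(3) by (intro nn_integral_cong) (auto simp: indicator_def)
  also have "\<dots> = (\<integral>\<^sup>+x. F x \<partial>lborel)"
    using assms(2) by (subst nn_integral_completion) auto
  finally show ?thesis .
qed

lemma lebesgue_on_open_integral:
  fixes F :: "'a::euclidean_space \<Rightarrow> real"
  assumes "open \<Omega>" "F \<in> borel_measurable borel" "\<And>x. x \<notin> \<Omega> \<Longrightarrow> F x = 0"
  shows "integral\<^sup>L (lebesgue_on \<Omega>) F = integral\<^sup>L lborel F"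
    "integrable (lebesgue_on \<Omega>) F \<longleftrightarrow> integrable lborel F"
proof -
  have *: "(\<lambda>x. indicator \<Omega> x *\<^sub>R F x) = F"
    using assms(3) by (auto simp: indicator_def fun_eq_iff)
  show "integral\<^sup>L (lebesgue_on \<Omega>) F = integral\<^sup>L lborel F"
    using assms(1,2) by (subst integral_restrict_space) (simp_all add: * integral_completion del: real_scaleR_def)
  show "integrable (lebesgue_on \<Omega>) F \<longleftrightarrow> integrable lborel F"
    using assms(1,2) by (subst integrable_restrict_space) (simp_all add: * integrable_completion del: real_scaleR_def)
qed

text \<open>Spaces on \<open>lebesgue_on\<close> contain merely Lebesgue measurable functions, while
  convolution and Fubini are used for Borel functions on \<open>lborel\<close>. Passing to a Borel
  version extended by zero bridges the two.\<close>

lemma borel_representative: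
  fixes v :: "'a::euclidean_space \<Rightarrow> real"
  assumes "open \<Omega>" "v \<in> borel_measurable (lebesgue_on \<Omega>)"
  obtains V where "V \<in> borel_measurable borel" "\<And>x. x \<notin> \<Omega> \<Longrightarrow> V x = 0"
    "AE x in lebesgue_on \<Omega>. V x = v x"
proof -
  have "(\<lambda>x. if x \<in> \<Omega> then v x else 0) \<in> borel_measurable lebesgue"
    using assms by (subst borel_measurable_if) auto
  then obtain W where W: "W \<in> borel_measurable lborel" "AE x in lborel. (if x \<in> \<Omega> then v x else 0) = W x"
    using completion_ex_borel_measurable_real[of "\<lambda>x. if x \<in> \<Omega> then v x else 0" lborel] by auto
  define V where "V x = (if x \<in> \<Omega> then W x else 0)" for x
  have "V \<in> borel_measurable borel"
    unfolding V_def using W(1) assms(1) by (intro measurable_If_set) auto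
  moreover have "AE x in lebesgue. x \<in> \<Omega> \<longrightarrow> V x = v x"
    using AE_completion[OF W(2)] by eventually_elim (auto simp: V_def)
  then have "AE x in lebesgue_on \<Omega>. V x = v x"
    using assms(1) by (subst AE_restrict_space_iff) auto
  ultimately show ?thesis using that[of V] by (simp add: V_def)
qed

lemma borel_measurable_lebesgue_on: "f \<in> borel_measurable borel \<Longrightarrow> f \<in> borel_measurable (lebesgue_on \<Omega>)"
  by (rule measurable_restrict_space1) (simp add: measurable_completion)

text \<open>The indicator of the 2d-neighbourhood of K is mollified at scale d: averages over
  d-balls centred in K see only the value 1, and the result is supported in the 3d-neighbourhood,
  which lies in \<Omega>.\<close>

lemma cutoff_exists:
  fixes K :: "(real^'n) set"
  assumes K: "compact K" and \<Omega>: "open \<Omega>" "K \<subseteq> \<Omega>"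
  obtains \<zeta> where "test_function \<Omega> \<zeta>" "\<And>x. 0 \<le> \<zeta> x" "\<And>x. \<zeta> x \<le> 1" "\<And>x. x \<in> K \<Longrightarrow> \<zeta> x = 1"
proof (cases "K = {}")
  case True
  then show ?thesis by (intro that[of "\<lambda>_. 0"]) (auto simp: test_function_def)
next
  case ne: False
  obtain e where e: "e > 0" "(\<Union>x\<in>K. cball x e) \<subseteq> \<Omega>"
    using compact_subset_open_imp_cball_epsilon_subset[OF K \<Omega>] by metis
  have e\<Omega>: "{x. infdist x K \<le> e} \<subseteq> \<Omega>"
  proof safe
    fix x assume "infdist x K \<le> e"
    moreover obtain y where "y \<in> K" "infdist x K = dist x y"
      using infdist_attains_inf[OF compact_imp_closed[OF K] ne] by metis
    ultimately have "y \<in> K" "x \<in> cball y e" by (auto simp: dist_commute)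
    then show "x \<in> \<Omega>" using e(2) by blast
  qed
  define d where "d = e / 3"
  have d: "d > 0" "e = 3 * d" using e by (auto simp: d_def)
  define f :: "real^'n \<Rightarrow> real" where "f = indicator {x. infdist x K \<le> 2 * d}"
  have cl: "compact {x. infdist x K \<le> c}" if "c > 0" for c
    using K ne that by (intro compact_infdist_le) auto
  have f: "integrable lborel f"
    unfolding f_def using cl[of "2 * d"] d(1) emeasure_bounded_finite[OF compact_imp_bounded[OF cl[of "2*d"]]]
    by (intro integrable_real_indicator) (auto simp: compact_imp_closed)
  obtain k where k: "test_function UNIV k" "\<And>x. k x \<ge> 0" "\<And>x. k x \<noteq> 0 \<Longrightarrow> x \<in> ball (0::real^'n) d" "integral\<^sup>L lborel k = 1"
    using kernel_exists[OF d(1), of 0] by metis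
  have ki: "integrable lborel (\<lambda>y. k (x - y))" for x
    by (rule lborel_integrable_reflect[OF test_function_integrable[OF k(1)]])
  have kint: "(LINT y|lborel. k (x - y)) = 1" for x
    using lborel_integral_reflect[of k x] test_functionD(4)[OF k(1)] k(4) by simp
  have near: "infdist x K \<le> infdist y K + d" if "k (x - y) \<noteq> 0" for x y
    using infdist_triangle[of x K y] k(3)[OF that] by (simp add: dist_norm norm_minus_commute)
  show ?thesis
  proof (rule that[of "conv k f"])
    show "test_function \<Omega> (conv k f)"
    proof (rule test_function_conv[OF k(1) f cl[OF e(1)] e\<Omega>])
      fix x y assume "k (x - y) \<noteq> 0" "f y \<noteq> 0"
      then show "x \<in> {x. infdist x K \<le> e}" using near[of x y] d by (auto simp: f_def indicator_def split: if_splits)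
    qed
    show "0 \<le> conv k f x" for x unfolding conv_def by (simp add: k(2) f_def)
    show "conv k f x \<le> 1" for x
    proof -
      have "conv k f x \<le> (LINT y|lborel. k (x - y))" unfolding conv_def
        using k(2) by (intro integral_mono integrable_conv_integrand k(1) f ki) (auto simp: f_def indicator_def)
      then show ?thesis by (simp add: kint)
    qed
    show "conv k f x = 1" if "x \<in> K" for x
    proof -
      have "f y = 1" if "k (x - y) \<noteq> 0" for y
        using infdist_triangle[of y K x] k(3)[OF that] d \<open>x \<in> K\<close> by (simp add: f_def dist_norm norm_minus_commute)
      then have "(\<lambda>y. k (x - y) * f y) = (\<lambda>y. k (x - y))" by (auto simp: fun_eq_iff)
      then show ?thesis by (simp add: conv_def kint)
    qed
  qed
qed

section \<open>The fundamental lemma of the calculus of variations\<close>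

lemma loc_integrable_measurable:
  fixes \<Omega> :: "(real^'n) set"
  assumes "loc_integrable \<Omega> u" "open \<Omega>"
  shows "u \<in> borel_measurable (lebesgue_on \<Omega>)"
proof -
  obtain \<D> where \<D>: "countable \<D>" "\<D> \<subseteq> Pow \<Omega>" "\<And>X. X \<in> \<D> \<Longrightarrow> \<exists>a b. X = cbox a b" "\<Union>\<D> = \<Omega>"
    using open_countable_Union_open_cbox[OF assms(2)] by metis
  show ?thesis
  proof (rule measurable_piecewise_restrict[OF \<D>(1)])
    show "space (lebesgue_on \<Omega>) \<subseteq> \<Union>\<D>" using \<D>(4) by simp
    fix X assume X: "X \<in> \<D>"
    then obtain a b where ab: "X = cbox a b" using \<D>(3) by blast
    have sub: "X \<subseteq> \<Omega>" using X \<D>(2) by blast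
    then show "X \<inter> space (lebesgue_on \<Omega>) \<in> sets (lebesgue_on \<Omega>)"
      using ab assms(2) by (auto simp: sets_restrict_space_iff Int_absorb2)
    have "integrable (lebesgue_on X) u"
      using assms(1) sub ab by (auto simp: loc_integrable_def)
    then show "u \<in> borel_measurable (restrict_space (lebesgue_on \<Omega>) X)"
      using sub by (simp add: restrict_restrict_space Int_absorb1 assms(2) ab)
  qed
qed

lemma loc_integrable_test_function:
  fixes \<Omega> :: "(real^'n) set"
  assumes u: "loc_integrable \<Omega> u" and \<Omega>: "open \<Omega>" and \<eta>: "test_function \<Omega> \<eta>"
  shows "integrable (lebesgue_on \<Omega>) (\<lambda>x. u x * \<eta> x)"
proof -
  let ?K = "closure {x. \<eta> x \<noteq> 0}"
  have K: "compact ?K" "?K \<subseteq> \<Omega>" using \<eta> by (auto simp: test_function_def)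
  have Ks: "?K \<in> sets lebesgue" using K(1) by (simp add: compact_imp_closed)
  obtain B where B: "\<And>x. \<bar>\<eta> x\<bar> \<le> B" using test_function_bounded[OF \<eta>] by metis
  have "integrable (lebesgue_on ?K) u"
    using u K by (auto simp: loc_integrable_def)
  then have "integrable (lebesgue_on ?K) (\<lambda>x. \<eta> x * u x)"
    using B borel_measurable_lebesgue_on[OF test_functionD(4)[OF \<eta>]] by (intro integrable_mult_bounded)
  then have "integrable lebesgue (\<lambda>x. indicator ?K x *\<^sub>R (\<eta> x * u x))"
    using Ks by (subst (asm) integrable_restrict_space) auto
  also have "(\<lambda>x. indicator ?K x *\<^sub>R (\<eta> x * u x)) = (\<lambda>x. indicator \<Omega> x *\<^sub>R (u x * \<eta> x))"
    using K(2) closure_subset[of "{x. \<eta> x \<noteq> 0}"] by (auto simp: fun_eq_iff indicator_def)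
  finally show ?thesis
    using \<Omega> by (subst integrable_restrict_space) auto
qed

text \<open>For a test function \<zeta> of \<Omega>, the function y \<mapsto> k(x - y) \<zeta>(y) is
  again one. Hence u \<zeta>, extended by zero, has vanishing convolution with every smooth kernel
  k, while such convolutions approximate it in L^1; so u \<zeta> = 0 a.e. Countably many \<zeta>,
  each equal to 1 on one box, exhaust \<Omega>.\<close>

lemma test_orthogonal_imp_AE_zero:
  fixes \<Omega> :: "(real^'n) set"
  assumes u: "loc_integrable \<Omega> u" and \<Omega>: "open \<Omega>"
    and orth: "\<And>\<eta>. test_function \<Omega> \<eta> \<Longrightarrow> (LINT x|lebesgue_on \<Omega>. u x * \<eta> x) = 0"
  shows "AE x in lebesgue_on \<Omega>. u x = 0"
proof -
  have zero: "AE x in lebesgue_on \<Omega>. u x * \<zeta> x = 0" if \<zeta>: "test_function \<Omega> \<zeta>" for \<zeta>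
  proof -
    have int: "integrable (lebesgue_on \<Omega>) (\<lambda>x. u x * \<zeta> x)" by (rule loc_integrable_test_function[OF u \<Omega> \<zeta>])
    then have "(\<lambda>x. u x * \<zeta> x) \<in> borel_measurable (lebesgue_on \<Omega>)" by simp
    then obtain F where F: "F \<in> borel_measurable borel" "\<And>x. x \<notin> \<Omega> \<Longrightarrow> F x = 0"
      "AE x in lebesgue_on \<Omega>. F x = u x * \<zeta> x"
      using borel_representative[OF \<Omega>] by blast
    obtain R where R: "R > 0" "\<And>x. \<zeta> x \<noteq> 0 \<Longrightarrow> norm x \<le> R" using test_function_support_cball[OF \<zeta>] by metis
    \<comment> \<open>\<open>Lp_translation_continuous\<close> asks for bounded support, and
      \<Omega> may be unbounded here; the ball contains the support of \<zeta>, so nothing changes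
      almost everywhere.\<close>
    define G where "G x = F x * indicator (cball 0 R) x" for x
    have G: "G \<in> borel_measurable borel" "\<And>x. x \<notin> \<Omega> \<Longrightarrow> G x = 0" "\<And>x. G x \<noteq> 0 \<Longrightarrow> norm x \<le> R"
      using F(1,2) by (auto simp: G_def[abs_def] indicator_def)
    have GAE: "AE x in lebesgue_on \<Omega>. G x = u x * \<zeta> x"
      using F(3) by eventually_elim (use R(2) in \<open>auto simp: G_def indicator_def\<close>)
    have "integrable (lebesgue_on \<Omega>) G"
      using int GAE borel_measurable_lebesgue_on[OF G(1)]
      by (subst integrable_cong_AE[where g="\<lambda>x. u x * \<zeta> x"]) auto
    then have Gi: "integrable lborel G" using lebesgue_on_open_integral(2)[OF \<Omega> G(1,2)] by simp
    have conv0: "conv k G x = 0" if k: "test_function UNIV k" for k x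
    proof -
      have kx: "\<And>j. Ck j (\<lambda>y. k (x - y))"
        using Ck_affine[OF test_functionD(1)[OF k], of _ x "-1"] by simp
      have "conv k G x = (LINT y|lebesgue_on \<Omega>. k (x - y) * G y)"
        unfolding conv_def using G test_functionD(4)[OF k]
        by (intro lebesgue_on_open_integral(1)[symmetric, OF \<Omega>]) auto
      also have "\<dots> = (LINT y|lebesgue_on \<Omega>. u y * (k (x - y) * \<zeta> y))"
      proof (rule integral_cong_AE)
        show "AE y in lebesgue_on \<Omega>. k (x - y) * G y = u y * (k (x - y) * \<zeta> y)"
          using GAE by eventually_elim (simp add: mult_ac)
        have "(\<lambda>y. k (x - y) * G y) \<in> borel_measurable borel"
          using G(1) test_functionD(4)[OF k] by measurable
        then show "(\<lambda>y. k (x - y) * G y) \<in> borel_measurable (lebesgue_on \<Omega>)" by (rule borel_measurable_lebesgue_on)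
        show "(\<lambda>y. u y * (k (x - y) * \<zeta> y)) \<in> borel_measurable (lebesgue_on \<Omega>)"
          using loc_integrable_test_function[OF u \<Omega> test_function_mult[OF \<zeta> kx]] by auto
      qed
      also have "\<dots> = 0" by (rule orth[OF test_function_mult[OF \<zeta> kx]])
      finally show ?thesis .
    qed
    have small: "(\<integral>\<^sup>+x. ennreal (\<bar>G x\<bar> powr 1) \<partial>lborel) \<le> ennreal e" if e: "e > 0" for e
    proof -
      have fin: "(\<integral>\<^sup>+x. ennreal (\<bar>G x\<bar> powr 1) \<partial>lborel) < \<infinity>"
        using Gi by (simp add: integrable_iff_bounded)
      obtain d where d: "d > 0" "\<And>z. norm z < d \<Longrightarrow> (\<integral>\<^sup>+x. ennreal (\<bar>G (x - z) - G x\<bar> powr 1) \<partial>lborel) \<le> ennreal e"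
        by (rule Lp_translation_continuous[OF _ G(1) fin G(3) e]) auto
      obtain k where k: "test_function UNIV k" "\<And>x. k x \<ge> 0" "\<And>x. k x \<noteq> 0 \<Longrightarrow> x \<in> ball (0::real^'n) d" "integral\<^sup>L lborel k = 1"
        using kernel_exists[OF d(1), of 0] by metis
      have "(\<integral>\<^sup>+x. ennreal (\<bar>conv k G x - G x\<bar> powr 1) \<partial>lborel) \<le> ennreal e"
        by (rule conv_mollify[OF _ Gi k(1,2,4)]) (use d(2) k(3) in auto)
      then show ?thesis by (simp add: conv0[OF k(1)])
    qed
    have "(\<integral>\<^sup>+x. ennreal (\<bar>G x\<bar> powr 1) \<partial>lborel) \<le> 0"
    proof (rule ennreal_le_epsilon)
      fix e :: real assume "0 < e"
      from small[OF this] show "(\<integral>\<^sup>+x. ennreal (\<bar>G x\<bar> powr 1) \<partial>lborel) \<le> 0 + ennreal e" by (simp only: add_0)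
    qed
    then have "(\<integral>\<^sup>+x. ennreal (\<bar>G x\<bar> powr 1) \<partial>lborel) = 0" by (simp only: le_zero_eq)
    moreover have "(\<lambda>x. ennreal (\<bar>G x\<bar> powr 1)) \<in> borel_measurable lborel" using G(1) by simp
    ultimately have "AE x in lborel. ennreal (\<bar>G x\<bar> powr 1) = 0" by (simp only: nn_integral_0_iff_AE)
    then have "AE x in lborel. G x = 0" by eventually_elim auto
    then have "AE x in lebesgue. G x = 0" by (rule AE_completion)
    then have "AE x in lebesgue. x \<in> \<Omega> \<longrightarrow> G x = 0" by eventually_elim auto
    then have "AE x in lebesgue_on \<Omega>. G x = 0" using \<Omega> by (subst AE_restrict_space_iff) auto
    with GAE show ?thesis by eventually_elim auto
  qed
  obtain \<D> where \<D>: "countable \<D>" "\<D> \<subseteq> Pow \<Omega>" "\<And>X. X \<in> \<D> \<Longrightarrow> \<exists>a b. X = cbox a b" "\<Union>\<D> = \<Omega>"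
    using open_countable_Union_open_cbox[OF \<Omega>] by metis
  have "AE x in lebesgue_on \<Omega>. x \<in> X \<longrightarrow> u x = 0" if X: "X \<in> \<D>" for X
  proof -
    obtain a b where "X = cbox a b" using X \<D>(3) by blast
    then have "compact X" "X \<subseteq> \<Omega>" using X \<D>(2) by auto
    then obtain \<zeta> where \<zeta>: "test_function \<Omega> \<zeta>" "\<And>x. x \<in> X \<Longrightarrow> \<zeta> x = 1"
      using cutoff_exists[OF _ \<Omega>] by metis
    show ?thesis using zero[OF \<zeta>(1)] by eventually_elim (use \<zeta>(2) in auto)
  qed
  then have "AE x in lebesgue_on \<Omega>. \<forall>X\<in>\<D>. x \<in> X \<longrightarrow> u x = 0"
    by (subst AE_ball_countable[OF \<D>(1)]) blast
  moreover have "AE x in lebesgue_on \<Omega>. x \<in> \<Omega>" by (rule AE_I2) simp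
  ultimately show ?thesis by eventually_elim (use \<D>(4) in blast)
qed

section \<open>Calculus of weak derivatives\<close>

lemma loc_integrable_mult_continuous:
  fixes \<Omega> :: "(real^'n) set"
  assumes u: "loc_integrable \<Omega> u" and c: "continuous_on \<Omega> \<zeta>"
  shows "loc_integrable \<Omega> (\<lambda>x. \<zeta> x * u x)"
  unfolding loc_integrable_def
proof safe
  fix K assume K: "compact K" "K \<subseteq> \<Omega>"
  have int: "integrable (lebesgue_on K) u" using u K by (auto simp: loc_integrable_def)
  have cK: "continuous_on K \<zeta>" using c K(2) by (rule continuous_on_subset)
  then have "bounded (\<zeta> ` K)" by (intro compact_imp_bounded compact_continuous_image K)
  then obtain B where B: "\<And>x. x \<in> K \<Longrightarrow> \<bar>\<zeta> x\<bar> \<le> B" unfolding bounded_iff by auto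
  have m: "\<zeta> \<in> borel_measurable (lebesgue_on K)"
    using cK K(1) by (intro continuous_imp_measurable_on_sets_lebesgue) (auto simp: compact_imp_closed)
  show "integrable (lebesgue_on K) (\<lambda>x. \<zeta> x * u x)"
  proof (rule Bochner_Integration.integrable_bound)
    show "integrable (lebesgue_on K) (\<lambda>x. B * u x)" using int by simp
    show "(\<lambda>x. \<zeta> x * u x) \<in> borel_measurable (lebesgue_on K)" using m int by simp
    show "AE x in lebesgue_on K. norm (\<zeta> x * u x) \<le> norm (B * u x)"
    proof (rule AE_I2)
      fix x assume "x \<in> space (lebesgue_on K)"
      then have "\<bar>\<zeta> x\<bar> \<le> \<bar>B\<bar>" using B[of x] by auto
      then show "norm (\<zeta> x * u x) \<le> norm (B * u x)" by (simp add: abs_mult mult_right_mono)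
    qed
  qed
qed

lemma continuous_imp_loc_integrable:
  fixes \<Omega> :: "(real^'n) set"
  assumes "continuous_on \<Omega> f" shows "loc_integrable \<Omega> f"
proof -
  have "loc_integrable \<Omega> (\<lambda>_. 1 :: real)"
    unfolding loc_integrable_def
  proof safe
    fix K :: "(real^'n) set" assume "compact K"
    then have "emeasure lborel K < \<infinity>" by (intro emeasure_bounded_finite compact_imp_bounded)
    then have "emeasure lebesgue K < \<infinity>" using \<open>compact K\<close> by (simp add: compact_imp_closed)
    then show "integrable (lebesgue_on K) (\<lambda>_. 1 :: real)"
      using \<open>compact K\<close> by (intro finite_measure.integrable_const finite_measureI)
        (auto simp: emeasure_restrict_space compact_imp_closed)
  qed
  from loc_integrable_mult_continuous[OF this assms] show ?thesis by simp
qed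

lemma loc_integrable_add_scaled:
  "loc_integrable \<Omega> u \<Longrightarrow> loc_integrable \<Omega> v \<Longrightarrow> loc_integrable \<Omega> (\<lambda>x. u x + c * v x)"
  unfolding loc_integrable_def by auto

lemma weak_deriv_add_scaled:
  fixes \<Omega> :: "(real^'n) set"
  assumes \<Omega>: "open \<Omega>" and u: "weak_deriv \<Omega> u i g" and v: "weak_deriv \<Omega> v i h"
  shows "weak_deriv \<Omega> (\<lambda>x. u x + c * v x) i (\<lambda>x. g x + c * h x)"
proof -
  have l: "loc_integrable \<Omega> u" "loc_integrable \<Omega> g" "loc_integrable \<Omega> v" "loc_integrable \<Omega> h"
    using u v by (auto simp: weak_deriv_def)
  have "(LINT x|lebesgue_on \<Omega>. (u x + c * v x) * D i \<eta> x) = - (LINT x|lebesgue_on \<Omega>. (g x + c * h x) * \<eta> x)"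
    if \<eta>: "test_function \<Omega> \<eta>" for \<eta>
  proof -
    note int = loc_integrable_test_function[OF _ \<Omega> \<eta>] loc_integrable_test_function[OF _ \<Omega> test_function_D[OF \<eta>, of i]]
    have "(LINT x|lebesgue_on \<Omega>. (u x + c * v x) * D i \<eta> x) =
        (LINT x|lebesgue_on \<Omega>. u x * D i \<eta> x) + c * (LINT x|lebesgue_on \<Omega>. v x * D i \<eta> x)"
      using int(2)[OF l(1)] int(2)[OF l(3)] by (simp add: distrib_right mult.assoc)
    also have "\<dots> = - ((LINT x|lebesgue_on \<Omega>. g x * \<eta> x) + c * (LINT x|lebesgue_on \<Omega>. h x * \<eta> x))"
      using u v \<eta> by (simp add: weak_deriv_def)
    also have "\<dots> = - (LINT x|lebesgue_on \<Omega>. (g x + c * h x) * \<eta> x)"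
      using int(1)[OF l(2)] int(1)[OF l(4)] by (simp add: distrib_right mult.assoc)
    finally show ?thesis .
  qed
  then show ?thesis using l by (auto simp: weak_deriv_def loc_integrable_add_scaled)
qed

lemma weak_deriv_unique:
  fixes \<Omega> :: "(real^'n) set"
  assumes \<Omega>: "open \<Omega>" and u: "weak_deriv \<Omega> u i g" and v: "weak_deriv \<Omega> u i h"
  shows "AE x in lebesgue_on \<Omega>. g x = h x"
proof -
  have w: "weak_deriv \<Omega> (\<lambda>x. u x + (-1) * u x) i (\<lambda>x. g x + (-1) * h x)"
    by (rule weak_deriv_add_scaled[OF \<Omega> u v])
  have "AE x in lebesgue_on \<Omega>. g x + (-1) * h x = 0"
    by (rule test_orthogonal_imp_AE_zero[OF _ \<Omega>]) (use w in \<open>auto simp: weak_deriv_def\<close>)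
  then show ?thesis by eventually_elim simp
qed

lemma weak_deriv_mult_smooth:
  fixes \<Omega> :: "(real^'n) set"
  assumes \<Omega>: "open \<Omega>" and u: "weak_deriv \<Omega> u i g" and \<zeta>: "\<And>k. Ck k \<zeta>"
  shows "weak_deriv \<Omega> (\<lambda>x. \<zeta> x * u x) i (\<lambda>x. \<zeta> x * g x + D i \<zeta> x * u x)"
proof -
  have l: "loc_integrable \<Omega> u" "loc_integrable \<Omega> g" using u by (auto simp: weak_deriv_def)
  have D\<zeta>: "Ck k (D i \<zeta>)" for k using \<zeta>[of "Suc k"] by simp
  have cont: "continuous_on \<Omega> \<zeta>" "continuous_on \<Omega> (D i \<zeta>)"
    using \<zeta>[of 0] D\<zeta>[of 0] by (auto intro: continuous_on_subset)
  have diff: "\<zeta> differentiable (at x)" for x using \<zeta>[of 1] by simp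
  have "(LINT x|lebesgue_on \<Omega>. (\<zeta> x * u x) * D i \<eta> x) = - (LINT x|lebesgue_on \<Omega>. (\<zeta> x * g x + D i \<zeta> x * u x) * \<eta> x)"
    if \<eta>: "test_function \<Omega> \<eta>" for \<eta>
  proof -
    let ?\<theta> = "\<lambda>x. \<zeta> x * \<eta> x"
    have t: "test_function \<Omega> ?\<theta>" "test_function \<Omega> (\<lambda>x. D i \<zeta> x * \<eta> x)" 
      using \<eta> \<zeta> D\<zeta> by (auto intro: test_function_mult)
    have D\<theta>: "D i ?\<theta> x = \<zeta> x * D i \<eta> x + D i \<zeta> x * \<eta> x" for x
      by (rule D_mult[OF diff test_functionD(2)[OF \<eta>]])
    note int = loc_integrable_test_function[OF _ \<Omega>]
    have "(LINT x|lebesgue_on \<Omega>. (\<zeta> x * u x) * D i \<eta> x) =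
        (LINT x|lebesgue_on \<Omega>. u x * D i ?\<theta> x - u x * (D i \<zeta> x * \<eta> x))"
      by (intro Bochner_Integration.integral_cong refl) (simp only: D\<theta>, simp add: algebra_simps)
    also have "\<dots> = (LINT x|lebesgue_on \<Omega>. u x * D i ?\<theta> x) - (LINT x|lebesgue_on \<Omega>. u x * (D i \<zeta> x * \<eta> x))"
      by (intro Bochner_Integration.integral_diff int l t test_function_D)
    also have "\<dots> = - (LINT x|lebesgue_on \<Omega>. g x * ?\<theta> x) - (LINT x|lebesgue_on \<Omega>. u x * (D i \<zeta> x * \<eta> x))"
      using u t(1) by (simp add: weak_deriv_def)
    also have "\<dots> = - (LINT x|lebesgue_on \<Omega>. g x * ?\<theta> x + u x * (D i \<zeta> x * \<eta> x))"
      by (subst Bochner_Integration.integral_add) (auto intro!: int l t)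
    also have "\<dots> = - (LINT x|lebesgue_on \<Omega>. (\<zeta> x * g x + D i \<zeta> x * u x) * \<eta> x)"
      by (intro arg_cong[of _ _ uminus] Bochner_Integration.integral_cong) (auto simp: algebra_simps)
    finally show ?thesis .
  qed
  moreover have "loc_integrable \<Omega> (\<lambda>x. \<zeta> x * g x + 1 * (D i \<zeta> x * u x))"
    by (intro loc_integrable_add_scaled loc_integrable_mult_continuous l cont)
  ultimately show ?thesis
    using loc_integrable_mult_continuous[OF l(1) cont(1)] by (simp add: weak_deriv_def)
qed

section \<open>Classical derivatives as weak derivatives\<close>

lemma has_real_derivative_line:
  fixes f :: "real^'n \<Rightarrow> real"
  assumes "f differentiable (at (x + s *\<^sub>R w))"
  shows "((\<lambda>s. f (x + s *\<^sub>R w)) has_real_derivative (\<Sum>i\<in>UNIV. w $ i * D i f (x + s *\<^sub>R w))) (at s)"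
proof -
  have lin: "((\<lambda>s. x + s *\<^sub>R w) has_derivative (\<lambda>s. s *\<^sub>R w)) (at s)"
    by (auto intro!: derivative_eq_intros)
  show ?thesis
    unfolding has_field_derivative_def
    by (rule has_derivative_eq_rhs[OF diff_chain_at[OF lin has_derivative_D_sum[OF assms], unfolded o_def]])
       (simp_all add: fun_eq_iff sum_distrib_left mult_ac)
qed

lemma sum_axis_mult: "(\<Sum>j\<in>UNIV. axis i (1::real) $ j * f j) = f i"
  by (subst sum.remove[of _ i]) (auto simp: axis_def intro!: sum.neutral)

lemma difference_quotient_tendsto:
  fixes f :: "real^'n \<Rightarrow> real"
  assumes "f differentiable (at x)" and h: "\<And>m. h m > 0" "h \<longlonglongrightarrow> 0"
  shows "(\<lambda>m. (f (x + h m *\<^sub>R w) - f x) / h m) \<longlonglongrightarrow> (\<Sum>i\<in>UNIV. w $ i * D i f x)"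
proof -
  have "((\<lambda>s. f (x + s *\<^sub>R w)) has_real_derivative (\<Sum>i\<in>UNIV. w $ i * D i f x)) (at 0)"
    using has_real_derivative_line[of f x 0 w] assms(1) by simp
  then have "((\<lambda>s. (f (x + s *\<^sub>R w) - f x) / s) \<longlongrightarrow> (\<Sum>i\<in>UNIV. w $ i * D i f x)) (at 0)"
    by (simp add: DERIV_def)
  moreover have "filterlim h (at 0) sequentially"
    using h by (auto simp: filterlim_at intro!: always_eventually less_imp_neq[symmetric])
  ultimately show ?thesis by (rule filterlim_compose)
qed

text \<open>Difference quotients have integral 0 by translation invariance, and the mean value
  theorem bounds them by B on a fixed ball, so dominated convergence carries the value 0 over to the
  derivative. Measurability of \<open>D i g\<close> comes from the same limit.\<close>

lemma integral_D_compact_support: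
  fixes g :: "real^'n \<Rightarrow> real"
  assumes diff: "\<And>x. g differentiable (at x)" and supp: "\<And>x. g x \<noteq> 0 \<Longrightarrow> norm x \<le> R"
    and B: "\<And>x. \<bar>D i g x\<bar> \<le> B"
  shows "D i g \<in> borel_measurable borel" "integral\<^sup>L lborel (D i g) = 0"
proof -
  let ?e = "axis i 1 :: real^'n"
  define h where "h m = 1 / real (Suc m)" for m
  have h: "h m > 0" "h m \<le> 1" for m by (auto simp: h_def)
  have hlim: "h \<longlonglongrightarrow> 0" unfolding h_def using LIMSEQ_inverse_real_of_nat by (simp add: inverse_eq_divide)
  have cont: "continuous_on UNIV g"
    using diff by (intro differentiable_imp_continuous_on) (auto simp: differentiable_on_def intro: differentiable_at_withinI)
  have [measurable]: "g \<in> borel_measurable borel" by (rule borel_measurable_continuous_onI[OF cont])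
  define q where "q m x = (g (x + h m *\<^sub>R ?e) - g x) / h m" for m x
  have qm: "q m \<in> borel_measurable borel" for m unfolding q_def by measurable
  have lim: "(\<lambda>m. q m x) \<longlonglongrightarrow> D i g x" for x
    using difference_quotient_tendsto[OF diff h(1) hlim, of x ?e] unfolding q_def sum_axis_mult .
  show meas: "D i g \<in> borel_measurable borel"
    by (rule borel_measurable_LIMSEQ_real[OF lim qm])
  have bound: "\<bar>q m x\<bar> \<le> B * indicator (cball 0 (R + 1)) x" for m x
  proof (cases "norm x \<le> R + 1")
    case True
    have "\<exists>s. 0 < s \<and> s < h m \<and> g (x + h m *\<^sub>R ?e) - g (x + 0 *\<^sub>R ?e) = (h m - 0) * (\<Sum>j\<in>UNIV. ?e $ j * D j g (x + s *\<^sub>R ?e))"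
      using h(1)[of m] by (intro MVT2 has_real_derivative_line diff) auto
    then obtain s where "q m x = D i g (x + s *\<^sub>R ?e)"
      using h(1)[of m] by (auto simp: q_def sum_axis_mult)
    then show ?thesis using B True by simp
  next
    case False
    have "norm (h m *\<^sub>R ?e) \<le> 1" using h[of m] by simp
    then have "norm (x + h m *\<^sub>R ?e) > R" using False norm_triangle_ineq2[of x "- (h m *\<^sub>R ?e)"] by simp
    then have "g x = 0" "g (x + h m *\<^sub>R ?e) = 0" using supp[of x] supp[of "x + h m *\<^sub>R ?e"] False by auto
    then show ?thesis using False by (simp add: q_def)
  qed
  have "(\<lambda>m. integral\<^sup>L lborel (q m)) \<longlonglongrightarrow> integral\<^sup>L lborel (D i g)"
  proof (rule integral_dominated_convergence[where w="\<lambda>x. B * indicator (cball 0 (R + 1)) x"])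
    show "integrable lborel (\<lambda>x::real^'n. B * indicator (cball 0 (R + 1)) x)"
      by (intro integrable_mult_right integrable_real_indicator)
         (auto simp: emeasure_bounded_finite[OF bounded_cball, simplified])
  qed (use meas qm lim bound in auto)
  moreover have "integral\<^sup>L lborel (q m) = 0" for m
  proof -
    have "bounded (g ` cball 0 R)"
      by (intro compact_imp_bounded compact_continuous_image continuous_on_subset[OF cont]) auto
    then obtain C where C: "\<And>x. x \<in> cball 0 R \<Longrightarrow> \<bar>g x\<bar> \<le> C" unfolding bounded_iff by (metis image_eqI real_norm_def)
    have "\<bar>g x\<bar> \<le> \<bar>C\<bar>" for x using C[of x] supp[of x] by (cases "g x = 0") auto
    then have gi: "integrable lborel g" using supp by (intro integrable_bounded_support) auto
    let ?c = "h m *\<^sub>R ?e"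
    have "integrable (distr lborel borel ((+) ?c)) g" "integral\<^sup>L (distr lborel borel ((+) ?c)) g = integral\<^sup>L lborel g"
      using gi by (simp_all add: lborel_distr_plus)
    then have "integrable lborel (\<lambda>x. g (?c + x))" "(LINT x|lborel. g (?c + x)) = integral\<^sup>L lborel g"
      by (simp_all add: integrable_distr_eq integral_distr)
    then show ?thesis unfolding q_def using gi by (simp add: add.commute)
  qed
  ultimately have "(\<lambda>m. 0) \<longlonglongrightarrow> integral\<^sup>L lborel (D i g)" by simp
  then show "integral\<^sup>L lborel (D i g) = 0" by (simp add: LIMSEQ_const_iff)
qed

lemma weak_deriv_classical:
  fixes \<Omega> :: "(real^'n) set"
  assumes \<Omega>: "open \<Omega>" and diff: "\<And>x. x \<in> \<Omega> \<Longrightarrow> f differentiable (at x)" and cont: "continuous_on \<Omega> (D i f)"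
  shows "weak_deriv \<Omega> f i (D i f)"
proof -
  have cf: "continuous_on \<Omega> f"
    using diff by (intro differentiable_imp_continuous_on) (auto simp: differentiable_on_def intro: differentiable_at_withinI)
  have l: "loc_integrable \<Omega> f" "loc_integrable \<Omega> (D i f)"
    using cf cont by (auto intro: continuous_imp_loc_integrable)
  have "(LINT x|lebesgue_on \<Omega>. f x * D i \<eta> x) = - (LINT x|lebesgue_on \<Omega>. D i f x * \<eta> x)"
    if \<eta>: "test_function \<Omega> \<eta>" for \<eta>
  proof -
    let ?K = "closure {x. \<eta> x \<noteq> 0}"
    have K: "compact ?K" "?K \<subseteq> \<Omega>" using \<eta> by (auto simp: test_function_def)
    have sub: "\<eta> x = 0" "D i \<eta> x = 0" if "x \<notin> ?K" for x
      using that closure_subset[of "{x. \<eta> x \<noteq> 0}"] D_zero_outside[OF that] by auto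
    define g where "g x = f x * \<eta> x" for x
    have g0: "x \<in> ?K" if "g x \<noteq> 0" for x using that sub(1)[of x] by (auto simp: g_def)
    have clg: "closure {x. g x \<noteq> 0} \<subseteq> ?K" by (rule closure_minimal) (use g0 in auto)
    have Dg: "D i g x = f x * D i \<eta> x + D i f x * \<eta> x" if "x \<in> \<Omega>" for x
      unfolding g_def by (rule D_mult[OF diff[OF that] test_functionD(2)[OF \<eta>]])
    have Dg0: "D i g x = 0" if "x \<notin> ?K" for x using that clg D_zero_outside[of x g i] by blast
    \<comment> \<open>Outside \<Omega> nothing is known about f, but there g vanishes in a
      neighbourhood, namely off the support of \<eta>.\<close>
    have dg: "g differentiable (at x)" for x
    proof (cases "x \<in> \<Omega>")
      case True
      then show ?thesis unfolding g_def[abs_def] using diff test_functionD(2)[OF \<eta>] by (intro differentiable_mult)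
    next
      case False
      then have x: "x \<in> - ?K" using K(2) by blast
      have "((\<lambda>_. 0 :: real) has_derivative (\<lambda>_. 0)) (at x)" by simp
      then have "(g has_derivative (\<lambda>_. 0)) (at x)"
        by (rule has_derivative_transform_within_open[OF _ _ x]) (use g0 in auto)
      then show ?thesis by (auto simp: differentiable_def)
    qed
    obtain R where R: "R > 0" "\<And>x. \<eta> x \<noteq> 0 \<Longrightarrow> norm x \<le> R" using test_function_support_cball[OF \<eta>] by metis
    have "continuous_on ?K (\<lambda>x. f x * D i \<eta> x + D i f x * \<eta> x)"
      using test_functionD(3,6)[OF \<eta>] cf cont K(2)
      by (intro continuous_intros) (auto intro: continuous_on_subset)
    then have "bounded ((\<lambda>x. f x * D i \<eta> x + D i f x * \<eta> x) ` ?K)"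
      by (intro compact_imp_bounded compact_continuous_image K)
    then obtain B where B: "\<And>x. x \<in> ?K \<Longrightarrow> \<bar>f x * D i \<eta> x + D i f x * \<eta> x\<bar> \<le> B" unfolding bounded_iff by auto
    have bd: "\<bar>D i g x\<bar> \<le> \<bar>B\<bar>" for x
      using B[of x] Dg[of x] Dg0[of x] K(2) by (cases "x \<in> ?K") force+
    note I = integral_D_compact_support[OF dg _ bd, of R]
    have I: "D i g \<in> borel_measurable borel" "integral\<^sup>L lborel (D i g) = 0"
      using I R(2) by (auto simp: g_def)
    have "integral\<^sup>L (lebesgue_on \<Omega>) (D i g) = 0"
      using lebesgue_on_open_integral(1)[OF \<Omega> I(1)] I(2) Dg0 K(2) by auto
    also have "integral\<^sup>L (lebesgue_on \<Omega>) (D i g) = (LINT x|lebesgue_on \<Omega>. f x * D i \<eta> x + D i f x * \<eta> x)"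
      by (intro Bochner_Integration.integral_cong) (auto simp: Dg)
    also have "\<dots> = (LINT x|lebesgue_on \<Omega>. f x * D i \<eta> x) + (LINT x|lebesgue_on \<Omega>. D i f x * \<eta> x)"
      by (intro Bochner_Integration.integral_add loc_integrable_test_function l \<Omega> \<eta> test_function_D)
    finally show ?thesis by simp
  qed
  then show ?thesis using l by (simp add: weak_deriv_def)
qed

lemma weak_deriv_smooth:
  assumes "open \<Omega>" "\<And>k. Ck k f"
  shows "weak_deriv \<Omega> f i (D i f)"
  by (rule weak_deriv_classical[OF assms(1)]) (use assms(2)[of "Suc 0"] in \<open>auto intro: continuous_on_subset\<close>)

section \<open>The Loomis--Whitney inequality\<close>

text \<open>The arithmetic-geometric mean inequality raised to the power \<open>card S\<close>.
  Without roots it makes sense, and stays true, for infinite values in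
  \<open>ennreal\<close>.\<close>

lemma prod_le_mean_power:
  fixes y :: "'i \<Rightarrow> ennreal"
  assumes "finite S" "S \<noteq> {}"
  shows "(\<Prod>i\<in>S. y i) \<le> ((\<Sum>i\<in>S. y i) / of_nat (card S)) ^ card S"
proof (cases "\<exists>i\<in>S. y i = top")
  case True
  then obtain i where i: "i \<in> S" "y i = top" by blast
  then have "(\<Sum>i\<in>S. y i) = top" using member_le_sum[of i S y] assms(1) by (simp add: top_unique)
  then have "((\<Sum>i\<in>S. y i) / of_nat (card S)) = top"
    by (simp add: ennreal_top_divide of_nat_less_top less_top[symmetric])
  then show ?thesis using assms by (simp add: power_eq_top_ennreal[THEN iffD2] card_gt_0_iff)
next
  case False
  then obtain r where r: "\<And>i. i \<in> S \<Longrightarrow> y i = ennreal (r i)" "\<And>i. r i \<ge> 0"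
    by (intro that[of "\<lambda>i. enn2real (y i)"]) (auto simp: less_top)
  let ?k = "card S"
  have k: "?k > 0" using assms by (simp add: card_gt_0_iff)
  have root: "q = (q powr (1 / ?k)) ^ ?k" if "q \<ge> 0" for q :: real
    using k that by (cases "q = 0") (auto simp: powr_powr simp flip: powr_realpow)
  have "(\<Prod>i\<in>S. r i) = ((\<Prod>i\<in>S. r i) powr (1 / ?k)) ^ ?k"
    by (rule root) (simp add: prod_nonneg r(2))
  also have "\<dots> \<le> (\<Sum>i\<in>S. r i / ?k) ^ ?k"
    using arith_geom_mean[OF assms r(2)] by (intro power_mono) auto
  finally have "(\<Prod>i\<in>S. r i) \<le> ((\<Sum>i\<in>S. r i) / ?k) ^ ?k" by (simp add: sum_divide_distrib)
  then have "ennreal (\<Prod>i\<in>S. r i) \<le> ennreal (((\<Sum>i\<in>S. r i) / ?k) ^ ?k)" by (rule ennreal_leI)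
  moreover have "(\<Prod>i\<in>S. y i) = ennreal (\<Prod>i\<in>S. r i)"
    using r by (simp add: prod_ennreal)
  moreover have "(\<Sum>i\<in>S. y i) = ennreal (\<Sum>i\<in>S. r i)"
    using r by (simp add: sum_ennreal)
  ultimately show ?thesis
    using k r(2) by (simp add: ennreal_power sum_nonneg divide_ennreal ennreal_of_nat_eq_real_of_nat)
qed

lemma ennreal_power_mono_iff:
  fixes a b :: ennreal
  assumes "k > 0" "a ^ k \<le> b ^ k" shows "a \<le> b"
proof (rule ccontr)
  assume "\<not> a \<le> b"
  then have ba: "b < a" by simp
  then obtain r where r: "b = ennreal r" "r \<ge> 0" by (cases b) auto
  have "b ^ k < a ^ k"
  proof (cases a)
    case (real s)
    then have "r < s" using ba r by (simp add: ennreal_less_iff)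
    then have "r ^ k < s ^ k" using r assms by (intro power_strict_mono) auto
    then show ?thesis using r real by (simp add: ennreal_power ennreal_less_iff)
  next
    case top
    then show ?thesis using r assms(1) by (simp add: ennreal_power power_eq_top_ennreal[THEN iffD2])
  qed
  then show False using assms(2) by simp
qed

lemma prod_ennreal_nonzero:
  fixes f :: "'i \<Rightarrow> ennreal"
  shows "(\<And>i. i \<in> S \<Longrightarrow> f i \<noteq> 0) \<Longrightarrow> prod f S \<noteq> 0"
  by (induction S rule: infinite_finite_induct) auto

lemma prod_ennreal_finite:
  fixes f :: "'i \<Rightarrow> ennreal"
  shows "(\<And>i. i \<in> S \<Longrightarrow> f i \<noteq> top) \<Longrightarrow> prod f S \<noteq> top"
  by (induction S rule: infinite_finite_induct) (auto simp: ennreal_mult_eq_top_iff)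

text \<open>Hoelder's inequality for \<open>card S\<close> factors in root-free form. Once each
  \<open>h i\<close> is divided by its integral, the arithmetic-geometric mean inequality holds
  pointwise, and every normalised factor integrates to 1.\<close>

lemma holder_power:
  fixes h :: "'i \<Rightarrow> 'a \<Rightarrow> ennreal"
  assumes S: "finite S" "S \<noteq> {}"
    and [measurable]: "\<And>i. i \<in> S \<Longrightarrow> h i \<in> borel_measurable M" "H \<in> borel_measurable M"
    and le: "\<And>x. x \<in> space M \<Longrightarrow> H x ^ card S \<le> c * (\<Prod>i\<in>S. h i x)"
  shows "(\<integral>\<^sup>+x. H x \<partial>M) ^ card S \<le> c * (\<Prod>i\<in>S. \<integral>\<^sup>+x. h i x \<partial>M)"
proof -
  let ?k = "card S"
  have k: "?k > 0" using S by (simp add: card_gt_0_iff)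
  let ?A = "\<lambda>i. \<integral>\<^sup>+x. h i x \<partial>M"
  \<comment> \<open>Vanishing factors come before infinite ones: in \<open>ennreal\<close> the
    product 0 * top is 0, so an infinite factor makes the bound trivial only when no factor is
    0.\<close>
  consider (zero) i where "i \<in> S" "?A i = 0" | (c0) "c = 0"
    | (top) "\<And>i. i \<in> S \<Longrightarrow> ?A i \<noteq> 0" "c \<noteq> 0" "c = top \<or> (\<exists>i\<in>S. ?A i = top)"
    | (fin) "\<And>i. i \<in> S \<Longrightarrow> ?A i \<noteq> 0" "c \<noteq> 0" "c \<noteq> top" "\<And>i. i \<in> S \<Longrightarrow> ?A i \<noteq> top"
  proof (cases "c = 0 \<or> (\<exists>i\<in>S. ?A i = 0)")
    case True then show ?thesis using zero c0 by auto
  next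
    case False then show ?thesis using top fin by (cases "c = top \<or> (\<exists>i\<in>S. ?A i = top)") auto
  qed
  then show ?thesis
  proof cases
    case zero
    then have "AE x in M. h i x = 0" by (simp add: nn_integral_0_iff_AE)
    then have "AE x in M. H x = 0"
    proof (rule AE_mp, intro AE_I2 impI)
      fix x assume x: "x \<in> space M" "h i x = 0"
      then have "(\<Prod>i\<in>S. h i x) = 0" using S zero(1) by (intro prod_zero) auto
      then have "H x ^ ?k \<le> 0" using le[OF x(1)] by (simp only: mult_zero_right)
      then show "H x = 0" by simp
    qed
    then have "(\<integral>\<^sup>+x. H x \<partial>M) = 0" by (simp add: nn_integral_0_iff_AE)
    then show ?thesis by (simp only: zero_power[OF k] zero_le)
  next
    case c0
    have "H x = 0" if "x \<in> space M" for x
    proof -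
      have "H x ^ ?k \<le> 0" using le[OF that] by (simp only: c0 mult_zero_left)
      then show ?thesis by simp
    qed
    then have "(\<integral>\<^sup>+x. H x \<partial>M) = (\<integral>\<^sup>+x. 0 \<partial>M)" by (intro nn_integral_cong) auto
    then show ?thesis by (simp only: zero_power[OF k] zero_le nn_integral_const mult_zero_left)
  next
    case top
    have "c * (\<Prod>i\<in>S. ?A i) = top"
    proof (cases "\<exists>i\<in>S. ?A i = top")
      case True
      then obtain i where i: "i \<in> S" "?A i = top" by blast
      have "(\<Prod>j\<in>S. ?A j) = ?A i * (\<Prod>j\<in>S - {i}. ?A j)" using i S by (simp add: prod.remove)
      also have "\<dots> = top"
      proof -
        have "(\<Prod>j\<in>S - {i}. ?A j) \<noteq> 0" using top(1) by (intro prod_ennreal_nonzero) auto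
        then show ?thesis unfolding i(2) by (simp only: ennreal_top_mult if_False)
      qed
      finally show ?thesis using top(2) by (simp only: ennreal_mult_top if_False)
    next
      case False
      then have "c = top" using top(3) by blast
      moreover have "(\<Prod>j\<in>S. ?A j) \<noteq> 0" using top(1) by (intro prod_ennreal_nonzero) auto
      ultimately show ?thesis by (simp only: ennreal_top_mult if_False)
    qed
    then show ?thesis by (simp only: top_greatest)
  next
    case fin
    define P where "P = c * (\<Prod>i\<in>S. ?A i)"
    have "(\<Prod>i\<in>S. ?A i) \<noteq> top" using fin(4) by (intro prod_ennreal_finite) auto
    then have Pt: "P \<noteq> top" unfolding P_def using fin(3) by (auto simp only: ennreal_mult_eq_top_iff)
    then obtain p where p: "P = ennreal p" "p \<ge> 0" by (cases P) auto
    define K where "K = ennreal (root ?k p)"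
    have K: "K ^ ?k = P" using p k by (simp add: K_def ennreal_power real_root_pow_pos2)
    have ptw: "H x \<le> K * ((\<Sum>i\<in>S. h i x / ?A i) / of_nat ?k)" if x: "x \<in> space M" for x
    proof (rule ennreal_power_mono_iff[OF k])
      have "H x ^ ?k \<le> c * (\<Prod>i\<in>S. ?A i * (h i x / ?A i))"
      proof -
        have "?A i * (h i x / ?A i) = h i x" if "i \<in> S" for i
          using fin(1,4)[OF that] by (metis ennreal_divide_times ennreal_divide_self less_top mult.commute mult.right_neutral)
        then have "(\<Prod>i\<in>S. ?A i * (h i x / ?A i)) = (\<Prod>i\<in>S. h i x)" by (intro prod.cong) auto
        then show ?thesis using le[OF x] by simp
      qed
      also have "\<dots> = P * (\<Prod>i\<in>S. h i x / ?A i)" by (simp add: P_def prod.distrib mult.assoc)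
      also have "\<dots> \<le> P * ((\<Sum>i\<in>S. h i x / ?A i) / of_nat ?k) ^ ?k"
        by (intro mult_left_mono prod_le_mean_power S) auto
      finally show "H x ^ ?k \<le> (K * ((\<Sum>i\<in>S. h i x / ?A i) / of_nat ?k)) ^ ?k"
        by (simp only: power_mult_distrib K)
    qed
    have "(\<integral>\<^sup>+x. H x \<partial>M) \<le> (\<integral>\<^sup>+x. K * ((\<Sum>i\<in>S. h i x / ?A i) / of_nat ?k) \<partial>M)"
      by (intro nn_integral_mono ptw)
    also have "\<dots> = K * ((\<integral>\<^sup>+x. (\<Sum>i\<in>S. h i x / ?A i) \<partial>M) / of_nat ?k)"
      by (subst nn_integral_cmult, measurable, subst nn_integral_divide, measurable)
    also have "(\<integral>\<^sup>+x. (\<Sum>i\<in>S. h i x / ?A i) \<partial>M) = (\<Sum>i\<in>S. \<integral>\<^sup>+x. h i x / ?A i \<partial>M)"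
      by (rule nn_integral_sum) measurable
    also have "\<dots> = (\<Sum>i\<in>S. 1)"
    proof (rule sum.cong[OF refl])
      fix i assume i: "i \<in> S"
      have "(\<integral>\<^sup>+x. h i x / ?A i \<partial>M) = ?A i / ?A i" using i by (intro nn_integral_divide) measurable
      also have "\<dots> = 1" using fin(1,4)[OF i] by (intro ennreal_divide_self) (auto simp: less_top)
      finally show "(\<integral>\<^sup>+x. h i x / ?A i \<partial>M) = 1" .
    qed
    also have "K * ((\<Sum>i\<in>S. 1) / of_nat ?k) = K"
    proof -
      have "(of_nat ?k :: ennreal) / of_nat ?k = 1"
        using k by (intro ennreal_divide_self) (auto simp: of_nat_less_top)
      then show ?thesis by simp
    qed
    finally have "(\<integral>\<^sup>+x. H x \<partial>M) ^ ?k \<le> K ^ ?k" by (rule power_mono) simp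
    then show ?thesis unfolding K P_def .
  qed
qed

text \<open>The coordinates in J are integrated out and the others frozen at x. The result is still
  a function of a full point x, so that partial integrals over different J can be multiplied. The
  restriction to I keeps the argument of F in the extensional product space.\<close>

definition partial_integral :: "'b set \<Rightarrow> 'b set \<Rightarrow> (('b \<Rightarrow> real) \<Rightarrow> ennreal) \<Rightarrow> ('b \<Rightarrow> real) \<Rightarrow> ennreal" where
  "partial_integral I J F x = (\<integral>\<^sup>+y. F (\<lambda>i\<in>I. if i \<in> J then y i else x i) \<partial>(\<Pi>\<^sub>M i\<in>J. lborel))"

abbreviation borelP :: "'b set \<Rightarrow> ('b \<Rightarrow> real) measure" where
  "borelP I \<equiv> (\<Pi>\<^sub>M i\<in>I. lborel)"

interpretation lborelP: product_sigma_finite "\<lambda>_ :: 'b. lborel :: real measure" ..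

lemma borel_measurable_partial_integral:
  assumes F: "F \<in> borel_measurable (borelP I)" and J: "finite J" "J \<subseteq> I"
  shows "partial_integral I J F \<in> borel_measurable (borelP I)"
proof -
  interpret finite_product_sigma_finite "\<lambda>_. lborel" J by standard (rule J(1))
  have "(\<lambda>(x, y). (\<lambda>i\<in>I. if i \<in> J then y i else x i)) \<in> borelP I \<Otimes>\<^sub>M borelP J \<rightarrow>\<^sub>M borelP I"
    unfolding case_prod_beta
  proof (rule measurable_restrict)
    fix i assume i: "i \<in> I"
    show "(\<lambda>z. if i \<in> J then snd z i else fst z i) \<in> borelP I \<Otimes>\<^sub>M borelP J \<rightarrow>\<^sub>M lborel"
      using i by (cases "i \<in> J") auto
  qed
  from measurable_compose[OF this F] 
  have "(\<lambda>(x, y). F (\<lambda>i\<in>I. if i \<in> J then y i else x i)) \<in> borel_measurable (borelP I \<Otimes>\<^sub>M borelP J)"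
    by (simp add: case_prod_beta)
  then show ?thesis unfolding partial_integral_def[abs_def] by (rule borel_measurable_nn_integral)
qed

lemma partial_integral_upd:
  assumes "j \<in> J" shows "partial_integral I J F (x(j := t)) = partial_integral I J F x"
  unfolding partial_integral_def using assms
  by (intro nn_integral_cong arg_cong[of _ _ F]) (auto simp: fun_eq_iff restrict_def)

lemma partial_integral_insert:
  assumes F: "F \<in> borel_measurable (borelP I)" and J: "finite J" "insert j J \<subseteq> I" "j \<notin> J"
  shows "partial_integral I (insert j J) F x = (\<integral>\<^sup>+t. partial_integral I J F (x(j := t)) \<partial>lborel)"
proof -
  have "(\<lambda>y. (\<lambda>i\<in>I. if i \<in> insert j J then y i else x i)) \<in> borelP (insert j J) \<rightarrow>\<^sub>M borelP I"
  proof (rule measurable_restrict)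
    fix i assume i: "i \<in> I"
    show "(\<lambda>y. if i \<in> insert j J then y i else x i) \<in> borelP (insert j J) \<rightarrow>\<^sub>M lborel"
      by (cases "i \<in> insert j J") auto
  qed
  from measurable_compose[OF this F] 
  have m: "(\<lambda>y. F (\<lambda>i\<in>I. if i \<in> insert j J then y i else x i)) \<in> borel_measurable (borelP (insert j J))" .
  have "partial_integral I (insert j J) F x =
      (\<integral>\<^sup>+t. (\<integral>\<^sup>+y. F (\<lambda>i\<in>I. if i \<in> insert j J then (y(j := t)) i else x i) \<partial>borelP J) \<partial>lborel)"
    unfolding partial_integral_def
    by (rule lborelP.product_nn_integral_insert_rev[OF J(1) J(3) m])
  also have "\<dots> = (\<integral>\<^sup>+t. partial_integral I J F (x(j := t)) \<partial>lborel)"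
    unfolding partial_integral_def using J(3)
    by (intro nn_integral_cong arg_cong[of _ _ F]) (auto simp: fun_eq_iff restrict_def)
  finally show ?thesis .
qed

text \<open>Integrate one further coordinate j. The factor for i = j no longer depends on that
  coordinate and can be pulled out as the constant of \<open>holder_power\<close>; exactly
  \<open>card I - 1\<close> factors remain, which is the exponent on the left.\<close>

lemma loomis_whitney_step:
  fixes H :: "('b \<Rightarrow> real) \<Rightarrow> ennreal"
  assumes I: "finite I" "card I \<ge> 2" and H: "H \<in> borel_measurable (borelP I)"
    and a: "\<And>i. i \<in> I \<Longrightarrow> a i \<in> borel_measurable (borelP I)"
    and le: "\<And>x. x \<in> space (borelP I) \<Longrightarrow> H x ^ (card I - 1) \<le> (\<Prod>i\<in>I. partial_integral I {i} (a i) x)"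
    and J: "finite J" "J \<subseteq> I" and x: "x \<in> space (borelP I)"
  shows "partial_integral I J H x ^ (card I - 1) \<le> (\<Prod>i\<in>I. partial_integral I (insert i J) (a i) x)"
  using J x
proof (induction J arbitrary: x rule: finite_induct)
  case empty
  have "partial_integral I {} H x = H (\<lambda>i\<in>I. x i)"
    by (simp add: partial_integral_def nn_integral_empty PiM_empty nn_integral_count_space_finite)
  also have "(\<lambda>i\<in>I. x i) = x" using empty by (auto simp: space_PiM)
  finally show ?case using le empty by simp
next
  case (insert j J)
  let ?S = "I - {j}"
  have jI: "j \<in> I" "J \<subseteq> I" using insert.prems by auto
  have cardS: "card ?S = card I - 1" using jI I(1) by (simp add: card_Diff_singleton)
  then have "?S \<noteq> {}" using I(2) by (intro notI) simp
  note S = finite_Diff[OF I(1), of "{j}"] cardS this jI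
  have upd: "(\<lambda>t. x(j := t)) \<in> lborel \<rightarrow>\<^sub>M borelP I"
  proof -
    have "(\<lambda>t. \<lambda>i\<in>I. (x(j := t)) i) \<in> lborel \<rightarrow>\<^sub>M borelP I"
      by (rule measurable_restrict) auto
    moreover have "(\<lambda>i\<in>I. (x(j := t)) i) = x(j := t)" for t
      using insert.prems S(4) by (auto simp: space_PiM restrict_def fun_eq_iff PiE_def extensional_def)
    ultimately show ?thesis by (simp only:)
  qed
  have upd_sp: "x(j := t) \<in> space (borelP I)" for t
    using measurable_space[OF upd, of t] by simp
  have meas: "(\<lambda>t. partial_integral I K F (x(j := t))) \<in> borel_measurable lborel"
    if "F \<in> borel_measurable (borelP I)" "K \<subseteq> I" for F K
    using measurable_compose[OF upd borel_measurable_partial_integral[OF that(1) _ that(2)]] finite_subset[OF that(2) I(1)] by simp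
  have "(\<integral>\<^sup>+t. partial_integral I J H (x(j := t)) \<partial>lborel) ^ card ?S \<le>
      partial_integral I (insert j J) (a j) x * (\<Prod>i\<in>?S. \<integral>\<^sup>+t. partial_integral I (insert i J) (a i) (x(j := t)) \<partial>lborel)"
  proof (rule holder_power[OF S(1,3)])
    fix t
    have "partial_integral I J H (x(j := t)) ^ card ?S \<le> (\<Prod>i\<in>I. partial_integral I (insert i J) (a i) (x(j := t)))"
      unfolding S(2) by (rule insert.IH[OF S(5) upd_sp])
    also have "\<dots> = partial_integral I (insert j J) (a j) (x(j := t)) * (\<Prod>i\<in>?S. partial_integral I (insert i J) (a i) (x(j := t)))"
      by (rule prod.remove[OF I(1) S(4)])
    also have "partial_integral I (insert j J) (a j) (x(j := t)) = partial_integral I (insert j J) (a j) x"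
      by (rule partial_integral_upd) simp
    finally show "partial_integral I J H (x(j := t)) ^ card ?S \<le>
      partial_integral I (insert j J) (a j) x * (\<Prod>i\<in>?S. partial_integral I (insert i J) (a i) (x(j := t)))" .
  next
    show "(\<lambda>t. partial_integral I J H (x(j := t))) \<in> borel_measurable lborel"
      by (rule meas[OF H S(5)])
    show "(\<lambda>t. partial_integral I (insert i J) (a i) (x(j := t))) \<in> borel_measurable lborel" if "i \<in> ?S" for i
      using that S(5) by (intro meas a) auto
  qed
  also have "(\<Prod>i\<in>?S. \<integral>\<^sup>+t. partial_integral I (insert i J) (a i) (x(j := t)) \<partial>lborel)
      = (\<Prod>i\<in>?S. partial_integral I (insert i (insert j J)) (a i) x)"
  proof (rule prod.cong[OF refl])
    fix i assume i: "i \<in> ?S"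
    have "insert i (insert j J) = insert j (insert i J)" by auto
    moreover have "partial_integral I (insert j (insert i J)) (a i) x =
        (\<integral>\<^sup>+t. partial_integral I (insert i J) (a i) (x(j := t)) \<partial>lborel)"
      by (rule partial_integral_insert[OF a]) (use i insert.hyps S in auto)
    ultimately show "(\<integral>\<^sup>+t. partial_integral I (insert i J) (a i) (x(j := t)) \<partial>lborel) =
        partial_integral I (insert i (insert j J)) (a i) x" by (simp only:)
  qed
  also have "partial_integral I (insert j J) (a j) x * (\<Prod>i\<in>?S. partial_integral I (insert i (insert j J)) (a i) x) =
      (\<Prod>i\<in>I. partial_integral I (insert i (insert j J)) (a i) x)"
    using prod.remove[OF I(1) S(4), of "\<lambda>i. partial_integral I (insert i (insert j J)) (a i) x"] by simp
  also have "(\<integral>\<^sup>+t. partial_integral I J H (x(j := t)) \<partial>lborel) = partial_integral I (insert j J) H x"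
    by (rule partial_integral_insert[OF H, symmetric]) (use insert.hyps insert.prems in auto)
  finally show ?case by (simp only: S(2))
qed

lemma nn_integral_lborel_PiM:
  fixes F :: "'a::euclidean_space \<Rightarrow> ennreal"
  assumes "F \<in> borel_measurable borel"
  shows "integral\<^sup>N lborel F = (\<integral>\<^sup>+f. F (\<Sum>b\<in>Basis. f b *\<^sub>R b) \<partial>borelP Basis)"
  using assms unfolding lborel_def[where 'a='a] lborel_eq_real by (subst nn_integral_distr) auto

text \<open>The case J = Basis of \<open>loomis_whitney_step\<close>, where inserting i into J
  changes nothing and every partial integral is a full one. The pointwise hypothesis, with integrals
  along the lines through x parallel to the axes, is the form that the Sobolev inequality
  supplies.\<close>

lemma loomis_whitney:
  fixes H :: "'a::euclidean_space \<Rightarrow> ennreal"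
  assumes n: "DIM('a) \<ge> 2" and H: "H \<in> borel_measurable borel"
    and a: "\<And>b. b \<in> Basis \<Longrightarrow> a b \<in> borel_measurable borel"
    and le: "\<And>x. H x ^ (DIM('a) - 1) \<le> (\<Prod>b\<in>Basis. \<integral>\<^sup>+t. a b (x + (t - x \<bullet> b) *\<^sub>R b) \<partial>lborel)"
  shows "integral\<^sup>N lborel H ^ (DIM('a) - 1) \<le> (\<Prod>b\<in>Basis. integral\<^sup>N lborel (a b))"
proof -
  let ?I = "Basis :: 'a set"
  define S :: "('a \<Rightarrow> real) \<Rightarrow> 'a" where "S f = (\<Sum>b\<in>Basis. f b *\<^sub>R b)" for f
  have S: "S \<in> borelP ?I \<rightarrow>\<^sub>M borel" unfolding S_def[abs_def] by measurable
  have comp: "(\<lambda>f. F (S f)) \<in> borel_measurable (borelP ?I)" if "F \<in> borel_measurable borel" for F :: "'a \<Rightarrow> ennreal"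
    using measurable_compose[OF S that] .
  have single: "partial_integral ?I {b} (\<lambda>f. a b (S f)) f = (\<integral>\<^sup>+t. a b (S f + (t - S f \<bullet> b) *\<^sub>R b) \<partial>lborel)"
    if b: "b \<in> ?I" for b f
  proof -
    have "partial_integral ?I {b} (\<lambda>f. a b (S f)) f = (\<integral>\<^sup>+t. partial_integral ?I {} (\<lambda>f. a b (S f)) (f(b := t)) \<partial>lborel)"
      using b comp[OF a[OF b]] by (intro partial_integral_insert) auto
    also have "\<dots> = (\<integral>\<^sup>+t. a b (S f + (t - S f \<bullet> b) *\<^sub>R b) \<partial>lborel)"
    proof (intro nn_integral_cong)
      fix t
      have "S (f(b := t)) = S f + (t - S f \<bullet> b) *\<^sub>R b"
      proof (rule euclidean_eqI)
        fix c :: 'a assume "c \<in> Basis"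
        then show "S (f(b := t)) \<bullet> c = (S f + (t - S f \<bullet> b) *\<^sub>R b) \<bullet> c"
          using b by (auto simp: S_def inner_sum_left_Basis inner_add_left inner_Basis)
      qed
      moreover have "S (\<lambda>i\<in>?I. g i) = S g" for g unfolding S_def by (intro sum.cong) auto
      moreover have "partial_integral ?I {} (\<lambda>f. a b (S f)) g = a b (S (restrict g ?I))" for g
        by (simp add: partial_integral_def PiM_empty nn_integral_count_space_finite)
      ultimately show "partial_integral ?I {} (\<lambda>f. a b (S f)) (f(b := t)) = a b (S f + (t - S f \<bullet> b) *\<^sub>R b)"
        by (simp only:)
    qed
    finally show ?thesis .
  qed
  let ?x = "\<lambda>b\<in>?I. 0 :: real"
  have "partial_integral ?I ?I (\<lambda>f. H (S f)) ?x ^ (card ?I - 1) \<le> (\<Prod>b\<in>?I. partial_integral ?I (insert b ?I) (\<lambda>f. a b (S f)) ?x)"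
    using n H a le by (intro loomis_whitney_step comp) (auto simp: single space_PiM)
  moreover have full: "partial_integral ?I ?I (\<lambda>f. F (S f)) ?x = integral\<^sup>N lborel F" if "F \<in> borel_measurable borel" for F :: "'a \<Rightarrow> ennreal"
    unfolding nn_integral_lborel_PiM[OF that] partial_integral_def S_def
    by (intro nn_integral_cong arg_cong[of _ _ F] sum.cong) auto
  moreover have "insert b ?I = ?I" if "b \<in> ?I" for b using that by auto
  ultimately show ?thesis using a H by simp
qed

section \<open>Hausdorff measure\<close>

text \<open>The set function inside \<open>hausdorff_measure\<close>, considered on all sets.
  \<open>measure_of\<close> returns it as a measure only because it is countably additive on the
  Borel sets; this is established below by Caratheodory's method.\<close>

definition hausdorff_outer :: "nat \<Rightarrow> (real^'n) set \<Rightarrow> ennreal" where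
  "hausdorff_outer s A = (SUP \<delta>\<in>{0<..}. hausdorff_pre s \<delta> A)"

abbreviation hcover :: "real \<Rightarrow> (real^'n) set \<Rightarrow> (nat \<Rightarrow> (real^'n) set) \<Rightarrow> bool" where
  "hcover \<delta> A U \<equiv> A \<subseteq> (\<Union>j. U j) \<and> (\<forall>j. bounded (U j) \<and> diameter (U j) \<le> \<delta>)"

abbreviation hterm :: "nat \<Rightarrow> (real^'n) set \<Rightarrow> ennreal" where
  "hterm s U \<equiv> ennreal (unit_ball_vol (real s) * (diameter U / 2) ^ s)"

lemma hausdorff_pre_le:
  "hcover \<delta> A U \<Longrightarrow> hausdorff_pre s \<delta> A \<le> (\<Sum>j. hterm s (U j))"
  unfolding hausdorff_pre_def by (intro INF_lower) auto

lemma hausdorff_pre_less: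
  assumes "hausdorff_pre s \<delta> A < c"
  obtains U where "hcover \<delta> A U" "(\<Sum>j. hterm s (U j)) < c"
  using assms unfolding hausdorff_pre_def INF_less_iff by auto

lemma hausdorff_pre_mono: "A \<subseteq> B \<Longrightarrow> hausdorff_pre s \<delta> A \<le> hausdorff_pre s \<delta> B"
  unfolding hausdorff_pre_def by (intro INF_superset_mono) auto

lemma hausdorff_pre_antimono: "\<delta> \<le> \<delta>' \<Longrightarrow> hausdorff_pre s \<delta>' A \<le> hausdorff_pre s \<delta> A"
  unfolding hausdorff_pre_def by (intro INF_superset_mono) (auto intro: order_trans)

lemma hausdorff_pre_empty: 
  assumes "s > 0" "\<delta> > 0" shows "hausdorff_pre s \<delta> ({} :: (real^'n) set) = 0"
proof -
  have "hausdorff_pre s \<delta> ({} :: (real^'n) set) \<le> (\<Sum>j. hterm s ((\<lambda>_. {} :: (real^'n) set) j))"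
    by (rule hausdorff_pre_le) (use assms in auto)
  then show ?thesis using assms by (simp add: zero_power)
qed

lemma hausdorff_pre_Union:
  fixes A :: "nat \<Rightarrow> (real^'n) set"
  shows "hausdorff_pre s \<delta> (\<Union>i. A i) \<le> (\<Sum>i. hausdorff_pre s \<delta> (A i))"
proof (rule ennreal_le_epsilon)
  fix e :: real assume fin: "(\<Sum>i. hausdorff_pre s \<delta> (A i)) < top" and "0 < e"
  have "\<exists>U. hcover \<delta> (A i) U \<and> (\<Sum>j. hterm s (U j)) \<le> hausdorff_pre s \<delta> (A i) + ennreal (e * (1/2) ^ Suc i)" for i
  proof -
    have "hausdorff_pre s \<delta> (A i) \<noteq> top"
    proof
      assume "hausdorff_pre s \<delta> (A i) = top"
      then have "(\<Sum>i. hausdorff_pre s \<delta> (A i)) \<ge> top"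
        using sum_le_suminf[OF summableI, of "{i}" "\<lambda>i. hausdorff_pre s \<delta> (A i)"] by simp
      then show False using fin by simp
    qed
    then have "hausdorff_pre s \<delta> (A i) < hausdorff_pre s \<delta> (A i) + ennreal (e * (1/2) ^ Suc i)"
      using \<open>0 < e\<close> ennreal_add_left_cancel_less[of "hausdorff_pre s \<delta> (A i)" 0] by (auto simp: zero_less_mult_iff)
    from hausdorff_pre_less[OF this] show ?thesis by (metis less_imp_le)
  qed
  then obtain U where U: "\<And>i. hcover \<delta> (A i) (U i)"
    "\<And>i. (\<Sum>j. hterm s (U i j)) \<le> hausdorff_pre s \<delta> (A i) + ennreal (e * (1/2) ^ Suc i)"
    by metis
  define V where "V j = (case prod_decode j of (a, b) \<Rightarrow> U a b)" for j
  have "hcover \<delta> (\<Union>i. A i) V"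
  proof (intro conjI allI subsetI)
    fix x assume "x \<in> (\<Union>i. A i)"
    then obtain i j where "x \<in> U i j" using U(1) by blast
    then have "x \<in> V (prod_encode (i, j))" by (simp add: V_def)
    then show "x \<in> (\<Union>j. V j)" by blast
  qed (use U(1) in \<open>auto simp: V_def split: prod.split\<close>)
  then have "hausdorff_pre s \<delta> (\<Union>i. A i) \<le> (\<Sum>j. hterm s (V j))"
    by (rule hausdorff_pre_le)
  also have "\<dots> = (\<Sum>j. (\<lambda>(a, b). hterm s (U a b)) (prod_decode j))"
    by (intro suminf_cong) (auto simp: V_def split: prod.split)
  also have "\<dots> = (\<Sum>i. \<Sum>j. hterm s (U i j))"
    by (rule suminf_ennreal_2dimen) simp
  also have "\<dots> \<le> (\<Sum>i. hausdorff_pre s \<delta> (A i) + ennreal (e * (1/2) ^ Suc i))"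
    by (intro suminf_le U(2)) auto
  also have "\<dots> = (\<Sum>i. hausdorff_pre s \<delta> (A i)) + (\<Sum>i. ennreal (e * (1/2) ^ Suc i))"
    by (intro suminf_add[symmetric]) auto
  also have "(\<Sum>i. ennreal (e * (1/2) ^ Suc i)) = ennreal e"
    using \<open>0 < e\<close> sums_mult[OF power_half_series, of e]
    by (intro suminf_ennreal_eq) auto
  finally show "hausdorff_pre s \<delta> (\<Union>i. A i) \<le> (\<Sum>i. hausdorff_pre s \<delta> (A i)) + ennreal e" .
qed

lemma hausdorff_outer_mono: "A \<subseteq> B \<Longrightarrow> hausdorff_outer s A \<le> hausdorff_outer s B"
  unfolding hausdorff_outer_def by (intro SUP_mono) (meson hausdorff_pre_mono)

lemma hausdorff_outer_empty: "s > 0 \<Longrightarrow> hausdorff_outer s {} = 0"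
  unfolding hausdorff_outer_def by (simp add: hausdorff_pre_empty)

lemma hausdorff_pre_le_outer: "\<delta> > 0 \<Longrightarrow> hausdorff_pre s \<delta> A \<le> hausdorff_outer s A"
  unfolding hausdorff_outer_def by (rule SUP_upper) simp

lemma hausdorff_outer_Union:
  "hausdorff_outer s (\<Union>i. A i) \<le> (\<Sum>i. hausdorff_outer s (A i))"
  unfolding hausdorff_outer_def[of s "\<Union>i. A i"]
proof (rule SUP_least)
  fix \<delta> :: real assume \<delta>: "\<delta> \<in> {0<..}"
  have "hausdorff_pre s \<delta> (\<Union>i. A i) \<le> (\<Sum>i. hausdorff_pre s \<delta> (A i))"
    by (rule hausdorff_pre_Union)
  also have "\<dots> \<le> (\<Sum>i. hausdorff_outer s (A i))"
    using \<delta> by (intro suminf_le hausdorff_pre_le_outer) auto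
  finally show "hausdorff_pre s \<delta> (\<Union>i. A i) \<le> (\<Sum>i. hausdorff_outer s (A i))" .
qed

section \<open>Caratheodory measurability of Borel sets\<close>

lemma outer_measure_space_hausdorff:
  "s > 0 \<Longrightarrow> outer_measure_space (Pow UNIV) (hausdorff_outer s)"
  unfolding outer_measure_space_def positive_def increasing_def countably_subadditive_def
  by (auto simp: hausdorff_outer_empty hausdorff_outer_mono hausdorff_outer_Union)

lemma hausdorff_outer_Un:
  assumes "s > 0"
  shows "hausdorff_outer s (A \<union> B) \<le> hausdorff_outer s A + hausdorff_outer s B"
proof -
  define F where "F i = (if i = 0 then A else if i = Suc 0 then B else {})" for i :: nat
  have "A \<union> B = (\<Union>i. F i)"
    by (auto simp: F_def split: if_splits)
  then have "hausdorff_outer s (A \<union> B) \<le> (\<Sum>i. hausdorff_outer s (F i))"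
    using hausdorff_outer_Union[of s F] by simp
  also have "\<dots> = (\<Sum>i\<in>{0, Suc 0}. hausdorff_outer s (F i))"
    using assms by (intro suminf_finite) (auto simp: F_def hausdorff_outer_empty)
  also have "\<dots> = hausdorff_outer s A + hausdorff_outer s B" by (simp add: F_def)
  finally show ?thesis .
qed

text \<open>A set of diameter below d cannot meet both A and B. A fine covering of the union
  therefore splits into a covering of A and one of B without any set being counted twice.\<close>

lemma hausdorff_outer_metric:
  fixes A B :: "(real^'n) set"
  assumes s: "s > 0" and d: "d > 0" "\<And>x y. x \<in> A \<Longrightarrow> y \<in> B \<Longrightarrow> d \<le> dist x y"
  shows "hausdorff_outer s A + hausdorff_outer s B \<le> hausdorff_outer s (A \<union> B)"
proof -
  have pre: "hausdorff_pre s \<delta> A + hausdorff_pre s \<delta> B \<le> hausdorff_outer s (A \<union> B)" if \<delta>: "0 < \<delta>" "\<delta> < d" for \<delta>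
  proof -
    have "hausdorff_pre s \<delta> A + hausdorff_pre s \<delta> B \<le> hausdorff_pre s \<delta> (A \<union> B)"
      unfolding hausdorff_pre_def[of s \<delta> "A \<union> B"]
    proof (rule INF_greatest)
      fix U assume "U \<in> {U. hcover \<delta> (A \<union> B) U}"
      then have U: "hcover \<delta> (A \<union> B) U" by simp
      define P where "P j = (if U j \<inter> A = {} then {} else U j)" for j
      define Q where "Q j = (if U j \<inter> B = {} then {} else U j)" for j
      have "hcover \<delta> A P" "hcover \<delta> B Q"
        using U \<delta>(1) by (auto simp: P_def Q_def split: if_splits) blast+
      then have "hausdorff_pre s \<delta> A + hausdorff_pre s \<delta> B \<le> (\<Sum>j. hterm s (P j)) + (\<Sum>j. hterm s (Q j))"
        by (intro add_mono hausdorff_pre_le)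
      also have "\<dots> = (\<Sum>j. hterm s (P j) + hterm s (Q j))"
        by (intro suminf_add) auto
      also have "\<dots> \<le> (\<Sum>j. hterm s (U j))"
      proof (intro suminf_le summableI)
        fix j
        show "hterm s (P j) + hterm s (Q j) \<le> hterm s (U j)"
        proof (cases "U j \<inter> A = {} \<or> U j \<inter> B = {}")
          case True
          then show ?thesis using s by (auto simp: P_def Q_def zero_power)
        next
          case False
          then obtain x y where "x \<in> U j" "x \<in> A" "y \<in> U j" "y \<in> B" by blast
          then have "d \<le> diameter (U j)"
            using d(2)[of x y] diameter_bounded_bound[of "U j" x y] U by auto
          then have False using U \<delta>(2) by (meson leD order_trans)
          then show ?thesis ..
        qed
      qed
      finally show "hausdorff_pre s \<delta> A + hausdorff_pre s \<delta> B \<le> (\<Sum>j. hterm s (U j))" .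
    qed
    also have "\<dots> \<le> hausdorff_outer s (A \<union> B)" using \<delta> by (intro hausdorff_pre_le_outer)
    finally show ?thesis .
  qed
  \<comment> \<open>Only small \<delta> matter for the supremum, because
    \<open>hausdorff_pre\<close> grows as \<delta> shrinks. This is applied first to A and then to
    B.\<close>
  have SA: "hausdorff_outer s A + c \<le> t" if "\<And>\<delta>. 0 < \<delta> \<Longrightarrow> \<delta> < d \<Longrightarrow> hausdorff_pre s \<delta> A + c \<le> t" for A :: "(real^'n) set" and c t
  proof -
    have "hausdorff_outer s A + c = (SUP \<delta>\<in>{0<..}. hausdorff_pre s \<delta> A + c)"
      unfolding hausdorff_outer_def by (subst ennreal_SUP_add_left) (auto simp: add.commute)
    also have "\<dots> \<le> t"
    proof (rule SUP_least)
      fix \<delta> :: real assume "\<delta> \<in> {0<..}"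
      then have "hausdorff_pre s \<delta> A + c \<le> hausdorff_pre s (min \<delta> (d/2)) A + c"
        by (intro add_mono hausdorff_pre_antimono) auto
      also have "\<dots> \<le> t" using \<open>\<delta> \<in> {0<..}\<close> d(1) by (intro that) auto
      finally show "hausdorff_pre s \<delta> A + c \<le> t" .
    qed
    finally show ?thesis .
  qed
  have "hausdorff_pre s \<delta>' B + hausdorff_outer s A \<le> hausdorff_outer s (A \<union> B)" if \<delta>': "0 < \<delta>'" "\<delta>' < d" for \<delta>'
  proof -
    have "hausdorff_outer s A + hausdorff_pre s \<delta>' B \<le> hausdorff_outer s (A \<union> B)"
    proof (rule SA)
      fix \<delta> assume \<delta>: "0 < \<delta>" "\<delta> < d"
      have "hausdorff_pre s \<delta> A + hausdorff_pre s \<delta>' B \<le> hausdorff_pre s (min \<delta> \<delta>') A + hausdorff_pre s (min \<delta> \<delta>') B"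
        by (intro add_mono hausdorff_pre_antimono) auto
      also have "\<dots> \<le> hausdorff_outer s (A \<union> B)" using \<delta> \<delta>' by (intro pre) auto
      finally show "hausdorff_pre s \<delta> A + hausdorff_pre s \<delta>' B \<le> hausdorff_outer s (A \<union> B)" .
    qed
    then show ?thesis by (simp add: add.commute)
  qed
  from SA[OF this] show ?thesis by (simp add: add.commute)
qed

text \<open>The sets \<open>Ek k\<close> have positive distance from A, so additivity holds for
  them. What is missing of E - A is a union of rings \<open>R j\<close>. Rings of the same parity
  are separated, so each of the two parity sums is at most the outer measure of E; the series of all
  rings converges and its tail is negligible.\<close>

lemma closed_hausdorff_caratheodory:
  fixes A E :: "(real^'n) set"
  assumes s: "s > 0" and A: "closed A"
  shows "hausdorff_outer s (E \<inter> A) + hausdorff_outer s (E - A) \<le> hausdorff_outer s E"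
proof (cases "A = {} \<or> hausdorff_outer s E = top")
  case True then show ?thesis using s by (auto simp: hausdorff_outer_empty)
next
  case False
  then have ne: "A \<noteq> {}" and fin: "hausdorff_outer s E < top" by (auto simp: top.not_eq_extremum)
  let ?H = "hausdorff_outer s"
  define Ek where "Ek k = {x \<in> E. infdist x A \<ge> 1 / real (Suc k)}" for k
  define R where "R k = Ek (Suc k) - Ek k" for k
  have Ek_mono: "Ek i \<subseteq> Ek j" if "i \<le> j" for i j
  proof -
    have "1 / real (Suc j) \<le> 1 / real (Suc i)" using that by (intro divide_left_mono) auto
    then show ?thesis unfolding Ek_def by auto
  qed
  have R: "x \<in> R k \<longleftrightarrow> x \<in> E \<and> 1 / real (Suc (Suc k)) \<le> infdist x A \<and> infdist x A < 1 / real (Suc k)" for x k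
    by (auto simp: R_def Ek_def)
  have EA: "E - A = Ek k \<union> (\<Union>i. R (k + i))" for k
  proof (intro equalityI subsetI)
    fix x assume x: "x \<in> E - A"
    then have "infdist x A > 0"
      using A ne in_closed_iff_infdist_zero[of A x] infdist_nonneg[of x A] by auto
    then obtain n where "1 / real (Suc n) < infdist x A"
      using nat_approx_posE by (metis)
    then have "x \<in> Ek n" using x by (auto simp: Ek_def)
    then have ex: "\<exists>n. x \<in> Ek n" by blast
    define m where "m = (LEAST n. x \<in> Ek n)"
    have m: "x \<in> Ek m" using ex unfolding m_def by (rule LeastI_ex)
    show "x \<in> Ek k \<union> (\<Union>i. R (k + i))"
    proof (cases "m \<le> k")
      case True then show ?thesis using m Ek_mono by blast
    next
      case False
      then have "m - 1 < m" by simp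
      then have "x \<notin> Ek (m - 1)" unfolding m_def by (rule not_less_Least)
      then have "x \<in> R (k + (m - 1 - k))" using m False by (auto simp: R_def)
      then show ?thesis by blast
    qed
  next
    fix x assume "x \<in> Ek k \<union> (\<Union>i. R (k + i))"
    then obtain j where j: "x \<in> Ek j" unfolding R_def by blast
    moreover have "1 / real (Suc j) > 0" by simp
    ultimately have "infdist x A > 0" "x \<in> E" unfolding Ek_def using less_le_trans by blast+
    then show "x \<in> E - A" by auto
  qed
  have odd_even: "(\<Sum>i<n. ?H (R (2 * i + c))) \<le> ?H (E \<inter> (\<Union>i<n. R (2 * i + c)))" for n c
  proof (induction n)
    case (Suc n)
    have "(\<Sum>i<Suc n. ?H (R (2 * i + c))) \<le> ?H (E \<inter> (\<Union>i<n. R (2 * i + c))) + ?H (R (2 * n + c))"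
      using Suc by (simp add: add_mono)
    also have "\<dots> \<le> ?H ((E \<inter> (\<Union>i<n. R (2 * i + c))) \<union> R (2 * n + c))"
    \<comment> \<open>For n = 0 the left set is empty and any positive distance serves. The general
      expression is wrong there, since 1 / 0 = 0 makes it negative when c = 0.\<close>
    proof (rule hausdorff_outer_metric[OF s, where d="if n = 0 then 1 else 1 / real (2 * n + c) - 1 / real (Suc (2 * n + c))"])
      show "0 < (if n = 0 then 1 else 1 / real (2 * n + c) - 1 / real (Suc (2 * n + c)))"
        by (auto simp: frac_less2)
    next
      fix x y assume "x \<in> E \<inter> (\<Union>i<n. R (2 * i + c))" and y: "y \<in> R (2 * n + c)"
      then obtain i where i: "i < n" "x \<in> R (2 * i + c)" by blast
      have "1 / real (2 * n + c) \<le> 1 / real (Suc (Suc (2 * i + c)))"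
        using i(1) by (intro divide_left_mono) auto
      also have "\<dots> \<le> infdist x A" using i(2) unfolding R by blast
      also have "\<dots> \<le> infdist y A + dist x y" by (rule infdist_triangle)
      also have "\<dots> \<le> 1 / real (Suc (2 * n + c)) + dist x y" using y unfolding R by simp
      finally show "(if n = 0 then 1 else 1 / real (2 * n + c) - 1 / real (Suc (2 * n + c))) \<le> dist x y"
        using i(1) by simp
    qed
    also have "(E \<inter> (\<Union>i<n. R (2 * i + c))) \<union> R (2 * n + c) = E \<inter> (\<Union>i<Suc n. R (2 * i + c))"
      by (auto simp: lessThan_Suc R)
    finally show ?case .
  qed simp
  have oe: "(\<Sum>i<n. ?H (R (2 * i + c))) \<le> ?H E" for n c
    by (rule order_trans[OF odd_even hausdorff_outer_mono]) auto
  have split: "(\<Sum>j<2*n. ?H (R j)) = (\<Sum>i<n. ?H (R (2 * i + 0))) + (\<Sum>i<n. ?H (R (2 * i + 1)))" for n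
    by (induction n) (auto simp: add_ac)
  have partial: "(\<Sum>j<n. ?H (R j)) \<le> ?H E + ?H E" for n
  proof -
    have "(\<Sum>j<n. ?H (R j)) \<le> (\<Sum>j<2*n. ?H (R j))" by (intro sum_mono2) auto
    also have "\<dots> \<le> ?H E + ?H E" unfolding split by (intro add_mono oe)
    finally show ?thesis .
  qed
  then have sumfin: "(\<Sum>j. ?H (R j)) < top"
    using fin by (intro le_less_trans[OF suminf_le_const[OF summableI partial]]) simp
  define r where "r j = enn2real (?H (R j))" for j
  have Hr: "?H (R j) = ennreal (r j)" for j
  proof -
    have "?H (R j) \<le> ?H E" by (intro hausdorff_outer_mono) (auto simp: R)
    then show ?thesis using fin unfolding r_def by (simp add: ennreal_enn2real_if top.not_eq_extremum)
  qed
  have r0: "r j \<ge> 0" for j by (simp add: r_def)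
  have summ: "summable r"
    using sumfin r0 unfolding Hr by (intro summable_suminf_not_top) auto
  show ?thesis
  proof (rule ennreal_le_epsilon)
    fix e :: real assume "0 < e"
    obtain k where "norm (\<Sum>i. r (i + k)) < e" using suminf_exist_split[OF \<open>0 < e\<close> summ] by blast
    then have tail: "(\<Sum>i. ?H (R (k + i))) \<le> ennreal e"
      using summ r0 unfolding Hr by (subst suminf_ennreal2) (auto intro!: ennreal_leI simp: add.commute summable_iff_shift)
    have "?H (E - A) \<le> ?H (Ek k) + ?H (\<Union>i. R (k + i))"
      unfolding EA[of k] by (rule hausdorff_outer_Un[OF s])
    also have "\<dots> \<le> ?H (Ek k) + ennreal e"
      using hausdorff_outer_Union[of s "\<lambda>i. R (k + i)"] tail by (intro add_left_mono) (rule order_trans)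
    finally have "?H (E \<inter> A) + ?H (E - A) \<le> (?H (E \<inter> A) + ?H (Ek k)) + ennreal e"
      by (simp add: add_left_mono add.assoc)
    also have "?H (E \<inter> A) + ?H (Ek k) \<le> ?H (E \<inter> A \<union> Ek k)"
    proof (rule hausdorff_outer_metric[OF s, where d="1 / real (Suc k)"])
      fix x y assume "x \<in> E \<inter> A" "y \<in> Ek k"
      then show "1 / real (Suc k) \<le> dist x y"
        using infdist_le[of x A y] by (auto simp: Ek_def dist_commute)
    qed simp
    also have "\<dots> \<le> ?H E" by (intro hausdorff_outer_mono) (auto simp: Ek_def)
    finally show "?H (E \<inter> A) + ?H (E - A) \<le> ?H E + ennreal e" by (simp add: add_right_mono)
  qed
qed

text \<open>The sets satisfying Caratheodory's condition form a sigma-algebra on which the outer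
  measure is a measure; it contains the closed sets, and these generate the Borel sets.\<close>

lemma emeasure_hausdorff_measure:
  fixes A :: "(real^'n) set"
  assumes s: "s > 0" and A: "A \<in> sets borel"
  shows "emeasure (hausdorff_measure s) A = hausdorff_outer s A"
proof -
  let ?L = "lambda_system UNIV (Pow UNIV) (hausdorff_outer s :: (real^'n) set \<Rightarrow> ennreal)"
  interpret P: sigma_algebra "UNIV :: (real^'n) set" "Pow UNIV"
    by (rule sigma_algebra_Pow)
  have oms: "outer_measure_space (Pow UNIV) (hausdorff_outer s :: (real^'n) set \<Rightarrow> ennreal)"
    using outer_measure_space_hausdorff[OF s] by simp
  have ms: "measure_space (UNIV :: (real^'n) set) ?L (hausdorff_outer s)"
    by (rule P.caratheodory_lemma[OF oms]) 
  have closed_L: "C \<in> ?L" if "closed C" for C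
    unfolding P.lambda_system_eq
  proof safe
    fix E :: "(real^'n) set"
    show "hausdorff_outer s (E \<inter> C) + hausdorff_outer s (E - C) = hausdorff_outer s E"
    proof (rule antisym[OF closed_hausdorff_caratheodory[OF s that]])
      have "hausdorff_outer s ((E \<inter> C) \<union> (E - C)) \<le> hausdorff_outer s (E \<inter> C) + hausdorff_outer s (E - C)"
        by (rule hausdorff_outer_Un[OF s])
      then show "hausdorff_outer s E \<le> hausdorff_outer s (E \<inter> C) + hausdorff_outer s (E - C)"
        by (simp add: Int_Diff_Un)
    qed
  qed auto
  have "sigma_algebra (UNIV :: (real^'n) set) ?L" using ms by (simp add: measure_space_def)
  then have sub: "sets borel \<subseteq> ?L"
    unfolding borel_eq_closed using closed_L sigma_algebra.sigma_sets_subset[of UNIV ?L "Collect closed"] by auto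
  have "measure_space (UNIV :: (real^'n) set) (sets borel) (hausdorff_outer s)"
    by (rule measure_down[OF ms _ sub]) (metis sets.sigma_algebra_axioms space_borel)
  then show ?thesis
    using A unfolding hausdorff_measure_def hausdorff_outer_def[abs_def, symmetric]
    by (subst emeasure_measure_of_sigma) (auto simp: measure_space_def hausdorff_outer_def[abs_def])
qed

lemma sets_hausdorff_measure [simp, measurable_cong]: "sets (hausdorff_measure s :: (real^'n) measure) = sets borel"
  unfolding hausdorff_measure_def by (simp add: sets.sigma_sets_eq[of borel, simplified])

section \<open>The Sobolev inequality for test functions\<close>

text \<open>The odd power sgn(t) |t|^c, which for c > 0 is the derivative of |t|^(c+1) up to the
  factor c + 1. In terms of \<open>max\<close> its continuity for c > 0 follows from that of
  \<open>powr\<close> on nonnegative bases.\<close>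

definition pos_powr :: "real \<Rightarrow> real \<Rightarrow> real" where
  "pos_powr c t = (max t 0) powr c - (max (- t) 0) powr c"

lemma continuous_pos_powr: "c > 0 \<Longrightarrow> continuous_on UNIV (pos_powr c)"
  unfolding pos_powr_def[abs_def] by (intro continuous_on_diff continuous_on_powr' continuous_intros) auto

lemma abs_pos_powr: "\<bar>pos_powr c t\<bar> = \<bar>t\<bar> powr c"
  unfolding pos_powr_def by (cases "t \<ge> 0") (auto simp: max_def)

lemma abs_powr_has_derivative:
  assumes "c > 1"
  shows "((\<lambda>t. \<bar>t\<bar> powr c) has_real_derivative c * pos_powr (c - 1) t) (at t)"
proof -
  consider "t > 0" | "t < 0" | "t = 0" by linarith
  then show ?thesis
  proof cases
    case 1
    have "((\<lambda>t. t powr c) has_real_derivative c * pos_powr (c - 1) t) (at t)"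
      using 1 by (auto intro!: derivative_eq_intros simp: pos_powr_def)
    from has_field_derivative_transform_within_open[OF this, of "{0<..}" "\<lambda>t. \<bar>t\<bar> powr c"] 1
    show ?thesis by auto
  next
    case 2
    have "((\<lambda>t. (- t) powr c) has_real_derivative c * pos_powr (c - 1) t) (at t)"
      using 2 by (auto intro!: derivative_eq_intros simp: pos_powr_def max_def)
    from has_field_derivative_transform_within_open[OF this, of "{..<0}" "\<lambda>t. \<bar>t\<bar> powr c"] 2
    show ?thesis by auto
  next
    case 3
    have "((\<lambda>h. \<bar>h\<bar> powr (c - 1)) \<longlongrightarrow> \<bar>0\<bar> powr (c - 1)) (at (0::real))"
      using assms by (intro tendsto_powr' tendsto_intros) auto
    then have "((\<lambda>h. \<bar>h\<bar> powr (c - 1)) \<longlongrightarrow> 0) (at (0::real))" by simp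
    then have "((\<lambda>h. (\<bar>h\<bar> powr c - 0) / h) \<longlongrightarrow> 0) (at 0)"
    proof (rule Lim_null_comparison[rotated])
      have "norm ((\<bar>h\<bar> powr c - 0) / h) \<le> \<bar>h\<bar> powr (c - 1)" if "h \<noteq> 0" for h :: real
        using that powr_mult_base[of "\<bar>h\<bar>" "c - 1"] by (simp add: abs_divide field_simps)
      then show "\<forall>\<^sub>F h in at 0. norm ((\<bar>h\<bar> powr c - 0) / h) \<le> \<bar>h\<bar> powr (c - 1)"
        by (auto simp: eventually_at_filter)
    qed
    then show ?thesis unfolding 3 using assms by (simp add: DERIV_def pos_powr_def)
  qed
qed

text \<open>The fundamental theorem of calculus for |\<phi>|^c from a to b. The condition c > 1
  makes |\<phi>|^c differentiable at the zeros of \<phi> too.\<close>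

lemma abs_powr_le_line_integral:
  fixes \<phi> :: "real \<Rightarrow> real"
  assumes c: "c > 1" and \<phi>: "\<And>s. (\<phi> has_real_derivative \<phi>' s) (at s)" "continuous_on UNIV \<phi>'"
    and z: "\<phi> a = 0" "a \<le> b"
  shows "ennreal (\<bar>\<phi> b\<bar> powr c) \<le> (\<integral>\<^sup>+s. ennreal (c * \<bar>\<phi> s\<bar> powr (c - 1) * \<bar>\<phi>' s\<bar>) \<partial>lborel)"
proof -
  define f where "f s = c * pos_powr (c - 1) (\<phi> s) * \<phi>' s" for s
  have c\<phi>: "continuous_on UNIV \<phi>"
    using \<phi>(1) by (intro continuous_at_imp_continuous_on) (auto intro: DERIV_isCont)
  have fc: "continuous_on UNIV f"
    unfolding f_def using c by (intro continuous_intros \<phi>(2) continuous_on_compose2[OF continuous_pos_powr c\<phi>]) auto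
  have d: "((\<lambda>s. \<bar>\<phi> s\<bar> powr c) has_real_derivative f s) (at s)" for s
    unfolding f_def by (rule DERIV_chain2[OF abs_powr_has_derivative[OF c] \<phi>(1)])
  have "has_bochner_integral lborel (\<lambda>s. indicator {a..b} s *\<^sub>R f s) (\<bar>\<phi> b\<bar> powr c - \<bar>\<phi> a\<bar> powr c)"
  proof (rule has_bochner_integral_FTC_Icc[OF z(2)])
    show "((\<lambda>s. \<bar>\<phi> s\<bar> powr c) has_vector_derivative f s) (at s within {a..b})" for s
      using d[of s] by (simp add: has_real_derivative_iff_has_vector_derivative has_vector_derivative_at_within)
    show "continuous_on {a..b} f" using fc by (rule continuous_on_subset) simp
  qed
  then have I: "integrable lborel (\<lambda>s. indicator {a..b} s *\<^sub>R f s)" "(LINT s|lborel. indicator {a..b} s *\<^sub>R f s) = \<bar>\<phi> b\<bar> powr c"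
    using z(1) c by (auto simp: has_bochner_integral_iff)
  have "ennreal (\<bar>\<phi> b\<bar> powr c) = ennreal (norm (LINT s|lborel. indicator {a..b} s *\<^sub>R f s))" using I(2) by simp
  also have "\<dots> \<le> (\<integral>\<^sup>+s. norm (indicator {a..b} s *\<^sub>R f s) \<partial>lborel)" by (rule integral_norm_bound_ennreal[OF I(1)])
  also have "\<dots> \<le> (\<integral>\<^sup>+s. ennreal (c * \<bar>\<phi> s\<bar> powr (c - 1) * \<bar>\<phi>' s\<bar>) \<partial>lborel)"
    using c by (intro nn_integral_mono ennreal_leI) (auto simp: f_def abs_mult abs_pos_powr indicator_def)
  finally show ?thesis .
qed

text \<open>After integration, the free weight s can be chosen to balance the two terms; this takes
  the place of Hoelder's inequality.\<close>

lemma young_scaled: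
  fixes p s a b :: real
  assumes "p > 1" "s > 0" "a \<ge> 0" "b \<ge> 0"
  shows "a * b \<le> s * a powr (p / (p - 1)) + s powr (1 - p) * b powr p"
proof -
  define q where "q = p / (p - 1)"
  have q: "q > 1" "1 / p + 1 / q = 1" "1 / q + 1 / p = 1" using assms(1) by (auto simp: q_def field_simps)
  have pq: "- p / q = 1 - p" using assms(1) by (simp add: q_def field_simps)
  have "(s powr (1 / q) * a) * (s powr (- 1 / q) * b) \<le>
      (s powr (1 / q) * a) powr q / q + (s powr (- 1 / q) * b) powr p / p"
    using assms q by (intro Youngs_inequality) auto
  also have "(s powr (1 / q) * a) * (s powr (- 1 / q) * b) = (s powr (1 / q) * s powr (- 1 / q)) * (a * b)"
    by (simp only: mult_ac)
  also have "s powr (1 / q) * s powr (- 1 / q) = 1"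
    using assms by (simp flip: powr_add)
  also have "(s powr (1 / q) * a) powr q = s * a powr q"
    using assms q by (simp add: powr_mult powr_powr)
  also have "(s powr (- 1 / q) * b) powr p = s powr (1 - p) * b powr p"
    using assms q pq by (simp add: powr_mult powr_powr)
  finally have "a * b \<le> s * a powr q / q + s powr (1 - p) * b powr p / p" by simp
  moreover have "s * a powr q / q \<le> s * a powr q" "s powr (1 - p) * b powr p / p \<le> s powr (1 - p) * b powr p"
  proof -
    have "x / c \<le> x" if "x \<ge> 0" "c > 1" for x c :: real
      using that by (simp add: divide_le_eq mult_le_cancel_left1)
    then show "s * a powr q / q \<le> s * a powr q" "s powr (1 - p) * b powr p / p \<le> s powr (1 - p) * b powr p"
      using assms q by auto
  qed
  ultimately show ?thesis unfolding q_def by linarith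
qed

text \<open>Loomis-Whitney is applied to line integrals of the derivative of |\<eta>|^\<gamma>. The
  exponent \<gamma> satisfies both q (n - 1) = \<gamma> n, so the left side is a power of the
  integral X of |\<eta>|^q, and (\<gamma> - 1) p/(p - 1) = q, so Young's inequality produces the
  same X on the right. It appears there to a lower power and can be absorbed.\<close>

lemma sobolev_test_function:
  fixes \<eta> :: "real^'n \<Rightarrow> real" and p M :: real
  assumes n: "CARD('n) \<ge> 2" and p: "1 < p" "p < CARD('n)"
    and \<eta>: "test_function UNIV \<eta>"
    and M: "M \<ge> 0" "\<And>i. (\<integral>\<^sup>+x. ennreal (\<bar>D i \<eta> x\<bar> powr p) \<partial>lborel) \<le> ennreal M"
  shows "(\<integral>\<^sup>+x. ennreal (\<bar>\<eta> x\<bar> powr (CARD('n) * p / (CARD('n) - p))) \<partial>lborel) \<le>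
    ennreal (((p * (CARD('n) - 1) / (CARD('n) - p)) * (1 + M)) powr (CARD('n) * p / (CARD('n) - p)))"
proof -
  define n where "n = real CARD('n)"
  define q where "q = n * p / (n - p)"
  define \<gamma> where "\<gamma> = p * (n - 1) / (n - p)"
  have n2: "n \<ge> 2" "p < n" using n p by (auto simp: n_def)
  have \<gamma>: "\<gamma> > 1" using p n2 by (simp add: \<gamma>_def field_simps)
  have q: "q > 0" using p n2 by (simp add: q_def)
  have \<gamma>q: "(\<gamma> - 1) * (p / (p - 1)) = q"
  proof -
    have "\<gamma> - 1 = n * (p - 1) / (n - p)" using n2 by (simp add: \<gamma>_def field_simps)
    then show ?thesis using p by (simp add: q_def)
  qed
  have \<gamma>n: "q * (n - 1) = \<gamma> * n" using n2 by (simp add: q_def \<gamma>_def)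
  have e: "n / p - 1 = n / q" using p n2 by (simp add: q_def field_simps)
  note [measurable] = test_functionD(4)[OF \<eta>] test_functionD(7)[OF \<eta>]
  obtain R where R: "R > 0" "\<And>x. \<eta> x \<noteq> 0 \<Longrightarrow> norm x \<le> R" using test_function_support_cball[OF \<eta>] by metis
  obtain B where B: "B > 0" "\<And>x. \<bar>\<eta> x\<bar> \<le> B" using test_function_bounded[OF \<eta>] by metis
  have qi: "integrable lborel (\<lambda>x. \<bar>\<eta> x\<bar> powr q)"
    using B R q by (intro integrable_bounded_support[where B="B powr q" and R=R]) (auto intro!: powr_mono2)
  define X where "X = (LINT x|lborel. \<bar>\<eta> x\<bar> powr q)"
  have X: "X \<ge> 0" "(\<integral>\<^sup>+x. ennreal (\<bar>\<eta> x\<bar> powr q) \<partial>lborel) = ennreal X"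
    using qi by (auto simp: X_def nn_integral_eq_integral)
  define i where "i b = (THE i. axis i (1::real) = (b :: real^'n))" for b
  have i: "axis (i b) 1 = b" if "b \<in> Basis" for b
    using that unfolding i_def by (auto simp: Basis_vec_def axis_eq_axis intro!: the_equality)
  define a where "a b x = ennreal (\<gamma> * \<bar>\<eta> x\<bar> powr (\<gamma> - 1) * \<bar>D (i b) \<eta> x\<bar>)" for b x
  have line: "ennreal (\<bar>\<eta> x\<bar> powr \<gamma>) \<le> (\<integral>\<^sup>+t. a b (x + (t - x \<bullet> b) *\<^sub>R b) \<partial>lborel)" if b: "b \<in> Basis" for b x
  proof -
    let ?w = "x - (x \<bullet> b) *\<^sub>R b"
    have eq: "x + (t - x \<bullet> b) *\<^sub>R b = ?w + t *\<^sub>R b" for t by (simp add: algebra_simps)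
    have der: "((\<lambda>t. \<eta> (?w + t *\<^sub>R b)) has_real_derivative D (i b) \<eta> (?w + t *\<^sub>R b)) (at t)" for t
    proof -
      have "((\<lambda>s. \<eta> (?w + s *\<^sub>R axis (i b) 1)) has_real_derivative
          (\<Sum>j\<in>UNIV. axis (i b) 1 $ j * D j \<eta> (?w + t *\<^sub>R axis (i b) 1))) (at t)"
        by (rule has_real_derivative_line[OF test_functionD(2)[OF \<eta>]])
      then show ?thesis unfolding sum_axis_mult by (simp only: i[OF b])
    qed
    have cont: "continuous_on UNIV (\<lambda>t. D (i b) \<eta> (?w + t *\<^sub>R b))"
      by (intro continuous_on_compose2[OF test_functionD(6)[OF \<eta>]] continuous_intros) auto
    \<comment> \<open>A starting point of the line integral that is not beyond x and whose
      b-coordinate is already outside [-R, R], so that \<eta> vanishes there.\<close>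
    define t0 where "t0 = min (x \<bullet> b) (- R - 1)"
    have "\<bar>(?w + t0 *\<^sub>R b) \<bullet> b\<bar> \<le> norm (?w + t0 *\<^sub>R b)" by (rule Basis_le_norm[OF b])
    moreover have "(?w + t0 *\<^sub>R b) \<bullet> b = t0" using b by (simp add: inner_diff_left inner_add_left)
    ultimately have "norm (?w + t0 *\<^sub>R b) > R" by (auto simp: t0_def)
    then have z: "\<eta> (?w + t0 *\<^sub>R b) = 0" using R(2) by (meson not_le)
    have "ennreal (\<bar>\<eta> (?w + (x \<bullet> b) *\<^sub>R b)\<bar> powr \<gamma>) \<le>
       (\<integral>\<^sup>+t. ennreal (\<gamma> * \<bar>\<eta> (?w + t *\<^sub>R b)\<bar> powr (\<gamma> - 1) * \<bar>D (i b) \<eta> (?w + t *\<^sub>R b)\<bar>) \<partial>lborel)"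
      by (rule abs_powr_le_line_integral[OF \<gamma> der cont z]) (simp add: t0_def)
    then show ?thesis unfolding a_def eq by simp
  qed
  have "integral\<^sup>N lborel (\<lambda>x. ennreal (\<bar>\<eta> x\<bar> powr q)) ^ (DIM(real^'n) - 1) \<le> (\<Prod>b\<in>Basis. integral\<^sup>N lborel (a b))"
  proof (rule loomis_whitney)
    show "a b \<in> borel_measurable borel" for b unfolding a_def[abs_def] by measurable
    fix x
    have "(\<bar>\<eta> x\<bar> powr q) ^ (CARD('n) - 1) = (\<bar>\<eta> x\<bar> powr \<gamma>) ^ CARD('n)"
    proof (cases "\<eta> x = 0")
      case True then show ?thesis using n by (simp add: power_0_left)
    next
      case False
      have "real (CARD('n) - 1) = n - 1" using n by (simp add: n_def)
      then have "(\<bar>\<eta> x\<bar> powr q) ^ (CARD('n) - 1) = \<bar>\<eta> x\<bar> powr (q * (n - 1))"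
        using False by (simp add: powr_powr flip: powr_realpow)
      also have "\<dots> = (\<bar>\<eta> x\<bar> powr \<gamma>) ^ CARD('n)"
        using False unfolding \<gamma>n by (simp add: n_def powr_powr flip: powr_realpow)
      finally show ?thesis .
    qed
    then have "ennreal (\<bar>\<eta> x\<bar> powr q) ^ (DIM(real^'n) - 1) = (\<Prod>b\<in>(Basis :: (real^'n) set). ennreal (\<bar>\<eta> x\<bar> powr \<gamma>))"
      by (simp add: ennreal_power)
    also have "\<dots> \<le> (\<Prod>b\<in>Basis. \<integral>\<^sup>+t. a b (x + (t - x \<bullet> b) *\<^sub>R b) \<partial>lborel)"
      by (intro prod_mono_ennreal line) 
    finally show "ennreal (\<bar>\<eta> x\<bar> powr q) ^ (DIM(real^'n) - 1) \<le> (\<Prod>b\<in>Basis. \<integral>\<^sup>+t. a b (x + (t - x \<bullet> b) *\<^sub>R b) \<partial>lborel)" .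
  qed (use n in auto)
  then have LW: "ennreal X ^ (CARD('n) - 1) \<le> (\<Prod>b\<in>(Basis :: (real^'n) set). integral\<^sup>N lborel (a b))" by (simp add: X(2))
  have "X \<le> (\<gamma> * (1 + M)) powr q"
  proof (cases "X = 0")
    case False
    then have X0: "X > 0" using X(1) by simp
    define K where "K = \<gamma> * ((1 + M) * X powr (1 - 1 / p))"
    have K: "K > 0" unfolding K_def using \<gamma> M X0 by (intro mult_pos_pos) auto
    \<comment> \<open>The balancing weight: s X and s^(1-p) both become X^(1 - 1/p), and this is why
      K has the factor 1 + M.\<close>
    define s where "s = X powr (- 1 / p)"
    have s: "s > 0" "s * X = X powr (1 - 1 / p)" "s powr (1 - p) = X powr (1 - 1 / p)"
    proof -
      show "s > 0" using X0 by (simp add: s_def)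
      show "s * X = X powr (1 - 1 / p)" 
        using X0 powr_mult_base[of X "- 1 / p"] by (simp add: s_def mult.commute)
      have "- 1 / p * (1 - p) = 1 - 1 / p" using p by (simp add: field_simps)
      then show "s powr (1 - p) = X powr (1 - 1 / p)" by (simp add: s_def powr_powr)
    qed
    have ab: "integral\<^sup>N lborel (a b) \<le> ennreal K" for b
    proof -
      have "integral\<^sup>N lborel (a b) \<le> (\<integral>\<^sup>+x. ennreal \<gamma> * (ennreal s * ennreal (\<bar>\<eta> x\<bar> powr q) + ennreal (s powr (1 - p)) * ennreal (\<bar>D (i b) \<eta> x\<bar> powr p)) \<partial>lborel)"
      proof (intro nn_integral_mono)
        fix x
        have "\<bar>\<eta> x\<bar> powr (\<gamma> - 1) * \<bar>D (i b) \<eta> x\<bar> \<le> s * (\<bar>\<eta> x\<bar> powr (\<gamma> - 1)) powr (p / (p - 1)) + s powr (1 - p) * \<bar>D (i b) \<eta> x\<bar> powr p"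
          using p s by (intro young_scaled) auto
        also have "(\<bar>\<eta> x\<bar> powr (\<gamma> - 1)) powr (p / (p - 1)) = \<bar>\<eta> x\<bar> powr q" unfolding powr_powr \<gamma>q ..
        finally have "\<gamma> * (\<bar>\<eta> x\<bar> powr (\<gamma> - 1) * \<bar>D (i b) \<eta> x\<bar>) \<le> \<gamma> * (s * \<bar>\<eta> x\<bar> powr q + s powr (1 - p) * \<bar>D (i b) \<eta> x\<bar> powr p)"
          using \<gamma> by (intro mult_left_mono) auto
        then have "a b x \<le> ennreal (\<gamma> * (s * \<bar>\<eta> x\<bar> powr q + s powr (1 - p) * \<bar>D (i b) \<eta> x\<bar> powr p))"
          unfolding a_def by (intro ennreal_leI) (simp add: mult.assoc)
        also have "\<dots> = ennreal \<gamma> * (ennreal s * ennreal (\<bar>\<eta> x\<bar> powr q) + ennreal (s powr (1 - p)) * ennreal (\<bar>D (i b) \<eta> x\<bar> powr p))"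
          using \<gamma> s(1) by (simp add: ennreal_mult')
        finally show "a b x \<le> ennreal \<gamma> * (ennreal s * ennreal (\<bar>\<eta> x\<bar> powr q) + ennreal (s powr (1 - p)) * ennreal (\<bar>D (i b) \<eta> x\<bar> powr p))" .
      qed
      also have "\<dots> = ennreal \<gamma> * (ennreal s * ennreal X + ennreal (s powr (1 - p)) * (\<integral>\<^sup>+x. ennreal (\<bar>D (i b) \<eta> x\<bar> powr p) \<partial>lborel))"
        by (simp add: nn_integral_cmult nn_integral_add X(2))
      also have "\<dots> \<le> ennreal \<gamma> * (ennreal s * ennreal X + ennreal (s powr (1 - p)) * ennreal M)"
        by (intro mult_left_mono add_left_mono M(2)) auto
      also have "\<dots> = ennreal (\<gamma> * (s * X + s powr (1 - p) * M))"
        using \<gamma> s(1) X(1) M(1) by (simp add: ennreal_mult')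
      also have "\<gamma> * (s * X + s powr (1 - p) * M) = K"
        unfolding K_def s by (simp add: algebra_simps)
      finally show ?thesis .
    qed
    have "ennreal X ^ (CARD('n) - 1) \<le> (\<Prod>b\<in>(Basis :: (real^'n) set). ennreal K)"
      using LW by (rule order_trans) (intro prod_mono_ennreal ab)
    then have "ennreal (X ^ (CARD('n) - 1)) \<le> ennreal (K ^ CARD('n))" using X(1) K by (simp add: ennreal_power)
    then have "X ^ (CARD('n) - 1) \<le> K ^ CARD('n)" using K by (simp add: ennreal_le_iff)
    then have "X powr (n - 1) \<le> K powr n"
      using X0 K n by (simp add: powr_realpow[symmetric] n_def of_nat_diff)
    also have "K powr n = (\<gamma> * (1 + M)) powr n * X powr (n * (1 - 1 / p))"
      using \<gamma> M X0 by (simp add: K_def powr_mult powr_powr mult.commute mult.assoc[symmetric])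
    \<comment> \<open>X is finite and positive, so its power on the right can be divided off. The
      exponent left on the other side is n - 1 - n (1 - 1/p) = n/p - 1 = n/q.\<close>
    finally have "X powr (n - 1) * X powr (- (n * (1 - 1 / p))) \<le> (\<gamma> * (1 + M)) powr n * X powr (n * (1 - 1 / p)) * X powr (- (n * (1 - 1 / p)))"
      by (intro mult_right_mono) auto
    then have "X powr (n - 1 + - (n * (1 - 1 / p))) \<le> (\<gamma> * (1 + M)) powr n * (X powr (n * (1 - 1 / p) + - (n * (1 - 1 / p))))"
      by (simp only: powr_add mult.assoc)
    moreover have "n - 1 + - (n * (1 - 1 / p)) = n / q" using e by (simp add: algebra_simps)
    ultimately have "X powr (n / q) \<le> (\<gamma> * (1 + M)) powr n" using X0 by simp
    then have "(X powr (n / q)) powr (q / n) \<le> ((\<gamma> * (1 + M)) powr n) powr (q / n)"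
      using q n2 by (intro powr_mono2) auto
    then show ?thesis using q n2 X0 by (simp add: powr_powr)
  qed simp
  then show ?thesis
    using X(2) unfolding q_def \<gamma>_def n_def by (simp add: ennreal_leI)
qed

section \<open>Boundary layers\<close>

text \<open>The uniform interior cone condition; nothing else about the \<open>C\<^sup>1\<close> boundary is used.\<close>
definition graph_cone :: "(real^'n) set \<Rightarrow> real^'n \<Rightarrow> real \<Rightarrow> real^'n \<Rightarrow> real \<Rightarrow> bool" where
  "graph_cone \<Omega> x0 r e \<delta> \<longleftrightarrow> r > 0 \<and> \<delta> > 0 \<and> \<delta> \<le> 1 \<and> norm e = 1 \<and>
     (\<forall>w\<in>ball e \<delta>. \<forall>x s. s > 0 \<longrightarrow> x \<in> closure \<Omega> \<longrightarrow> x \<in> ball x0 r \<longrightarrow> x + s *\<^sub>R w \<in> ball x0 r \<longrightarrow>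
        x + s *\<^sub>R w \<in> \<Omega>)"

text \<open>The height h = x \<bullet> e - \<gamma> x above the graph is nonnegative on the closure
  near x0. Since \<gamma> is constant along e and its gradient is bounded, h has slope at least 1 -
  \<delta> (1 + B) along every w in the \<delta>-ball about e; the choice of \<delta> makes this
  1/2, so h becomes positive.\<close>

lemma C1_boundary_graph_cone:
  fixes \<Omega> :: "(real^'n) set"
  assumes "C1_boundary \<Omega>" "x0 \<in> frontier \<Omega>"
  obtains r e \<delta> where "graph_cone \<Omega> x0 r e \<delta>"
proof -
  obtain r e \<gamma> where r: "r > 0" and e: "norm e = 1" and \<gamma>: "Ck 1 \<gamma>"
    and inv: "\<And>x t. \<gamma> (x + t *\<^sub>R e) = \<gamma> x"
    and graph: "\<Omega> \<inter> ball x0 r = {x \<in> ball x0 r. \<gamma> x < x \<bullet> e}"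
  proof -
    have "\<exists>r>0. \<exists>e \<gamma>. norm e = 1 \<and> Ck 1 \<gamma> \<and>
     (\<forall>x t. \<gamma> (x + t *\<^sub>R e) = \<gamma> x) \<and> \<Omega> \<inter> ball x0 r = {x \<in> ball x0 r. \<gamma> x < x \<bullet> e}"
      using assms(1)[unfolded C1_boundary_def, rule_format, OF assms(2)] .
    then show ?thesis by (elim exE conjE) (rule that, assumption+, simp, assumption)
  qed
  have diff: "\<gamma> differentiable (at x)" for x using \<gamma> by simp
  have c\<gamma>: "continuous_on UNIV \<gamma>" using Ck_Suc_imp[of 0 \<gamma>] \<gamma> by simp
  have cD: "continuous_on UNIV (D i \<gamma>)" for i using \<gamma> by simp
  have De: "(\<Sum>i\<in>UNIV. e $ i * D i \<gamma> x) = 0" for x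
  proof -
    have "((\<lambda>s. \<gamma> (x + s *\<^sub>R e)) has_real_derivative (\<Sum>i\<in>UNIV. e $ i * D i \<gamma> (x + 0 *\<^sub>R e))) (at 0)"
      by (rule has_real_derivative_line[OF diff])
    moreover have "((\<lambda>s. \<gamma> (x + s *\<^sub>R e)) has_real_derivative 0) (at 0)" unfolding inv by simp
    ultimately show ?thesis using DERIV_unique by fastforce
  qed
  have "continuous_on (cball x0 r) (\<lambda>x. \<Sum>i\<in>UNIV. \<bar>D i \<gamma> x\<bar>)"
    by (intro continuous_intros continuous_on_subset[OF cD]) auto
  then have "bounded ((\<lambda>x. \<Sum>i\<in>UNIV. \<bar>D i \<gamma> x\<bar>) ` cball x0 r)"
    by (intro compact_imp_bounded compact_continuous_image) auto
  then obtain B where B: "\<And>x. x \<in> cball x0 r \<Longrightarrow> \<bar>\<Sum>i\<in>UNIV. \<bar>D i \<gamma> x\<bar>\<bar> \<le> B"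
    unfolding bounded_iff by (metis image_eqI real_norm_def)
  have "B \<ge> 0" using order_trans[OF abs_ge_zero B[of x0]] r by simp
  define \<delta> where "\<delta> = 1 / (2 * (1 + B))"
  have \<delta>: "\<delta> > 0" "\<delta> \<le> 1" using \<open>B \<ge> 0\<close> by (auto simp: \<delta>_def)
  define h where "h x = x \<bullet> e - \<gamma> x" for x
  have hcl: "h x \<ge> 0" if x: "x \<in> closure \<Omega>" "x \<in> ball x0 r" for x
  proof (rule ccontr)
    assume "\<not> 0 \<le> h x"
    then have hx: "h x < 0" by simp
    have "continuous_on UNIV h" unfolding h_def[abs_def] by (intro continuous_intros c\<gamma>)
    then have "open {x. h x < 0}" by (intro open_Collect_less) auto
    then have "open ({x. h x < 0} \<inter> ball x0 r)" by (intro open_Int) auto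
    then have "({x. h x < 0} \<inter> ball x0 r) \<inter> \<Omega> \<noteq> {}"
      using x hx open_Int_closure_eq_empty[of "{x. h x < 0} \<inter> ball x0 r" \<Omega>] by auto
    then obtain y where "h y < 0" "y \<in> ball x0 r" "y \<in> \<Omega>" by auto
    then have "y \<in> \<Omega> \<inter> ball x0 r" by auto
    then have "\<gamma> y < y \<bullet> e" unfolding graph by auto
    then show False using \<open>h y < 0\<close> by (simp add: h_def)
  qed
  have "x + s *\<^sub>R w \<in> \<Omega>" if w: "w \<in> ball e \<delta>" and s: "s > 0" and x: "x \<in> closure \<Omega>" "x \<in> ball x0 r" "x + s *\<^sub>R w \<in> ball x0 r" for w x s
  proof -
    have der: "((\<lambda>s. h (x + s *\<^sub>R w)) has_real_derivative (w \<bullet> e - (\<Sum>i\<in>UNIV. w $ i * D i \<gamma> (x + s *\<^sub>R w)))) (at s)" for s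
      unfolding h_def
      by (auto intro!: derivative_eq_intros has_real_derivative_line diff simp: inner_add_left)
    obtain \<xi> where \<xi>: "0 < \<xi>" "\<xi> < s" "h (x + s *\<^sub>R w) - h (x + 0 *\<^sub>R w) = (s - 0) * (w \<bullet> e - (\<Sum>i\<in>UNIV. w $ i * D i \<gamma> (x + \<xi> *\<^sub>R w)))"
      using MVT2[OF s der] by blast
    let ?y = "x + \<xi> *\<^sub>R w"
    have "?y = (1 - \<xi> / s) *\<^sub>R x + (\<xi> / s) *\<^sub>R (x + s *\<^sub>R w)" using s by (simp add: algebra_simps)
    also have "\<dots> \<in> ball x0 r" using \<xi> s x by (intro convexD_alt convex_ball) auto
    finally have y: "?y \<in> cball x0 r" by auto
    have "w \<bullet> e = e \<bullet> e + (w - e) \<bullet> e" by (simp add: inner_diff_left)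
    moreover have "\<bar>(w - e) \<bullet> e\<bar> \<le> \<delta>" using Cauchy_Schwarz_ineq2[of "w - e" e] w e by (simp add: dist_norm norm_minus_commute)
    ultimately have 1: "w \<bullet> e \<ge> 1 - \<delta>" using e by (simp add: norm_eq_1)
    have "(\<Sum>i\<in>UNIV. w $ i * D i \<gamma> ?y) = (\<Sum>i\<in>UNIV. e $ i * D i \<gamma> ?y) + (\<Sum>i\<in>UNIV. (w - e) $ i * D i \<gamma> ?y)"
      by (simp add: sum.distrib[symmetric] algebra_simps)
    also have "\<dots> = (\<Sum>i\<in>UNIV. (w - e) $ i * D i \<gamma> ?y)" by (simp add: De)
    also have "\<dots> \<le> (\<Sum>i\<in>UNIV. \<delta> * \<bar>D i \<gamma> ?y\<bar>)"
    proof (rule sum_mono)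
      fix i
      have "(w - e) $ i * D i \<gamma> ?y \<le> \<bar>(w - e) $ i\<bar> * \<bar>D i \<gamma> ?y\<bar>" by (simp add: abs_mult[symmetric])
      also have "\<dots> \<le> \<delta> * \<bar>D i \<gamma> ?y\<bar>"
        using w component_le_norm_cart[of "w - e" i] by (intro mult_right_mono) (auto simp: dist_norm norm_minus_commute)
      finally show "(w - e) $ i * D i \<gamma> ?y \<le> \<delta> * \<bar>D i \<gamma> ?y\<bar>" .
    qed
    also have "\<dots> = \<delta> * (\<Sum>i\<in>UNIV. \<bar>D i \<gamma> ?y\<bar>)" by (simp add: sum_distrib_left)
    also have "\<dots> \<le> \<delta> * B" using B[OF y] \<delta> by (intro mult_left_mono) auto
    finally have "w \<bullet> e - (\<Sum>i\<in>UNIV. w $ i * D i \<gamma> ?y) \<ge> 1 - \<delta> * (1 + B)" using 1 by (simp add: algebra_simps)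
    moreover have "\<delta> * (1 + B) = 1 / 2" using \<open>B \<ge> 0\<close> by (simp add: \<delta>_def)
    ultimately have "w \<bullet> e - (\<Sum>i\<in>UNIV. w $ i * D i \<gamma> ?y) > 0" by simp
    then have "h (x + s *\<^sub>R w) - h x > 0" using \<xi>(3) s by simp
    then have "\<gamma> (x + s *\<^sub>R w) < (x + s *\<^sub>R w) \<bullet> e" using hcl[OF x(1,2)] by (simp add: h_def)
    then have "x + s *\<^sub>R w \<in> \<Omega> \<inter> ball x0 r" unfolding graph using x(3) by simp
    then show ?thesis by simp
  qed
  then show ?thesis using that[of r e \<delta>] r e \<delta> unfolding graph_cone_def by blast
qed

section \<open>Volume of tubes over subsets of the boundary\<close>

definition tube :: "real \<Rightarrow> 'a::real_vector \<Rightarrow> 'a set \<Rightarrow> 'a set" where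
  "tube t w A = {y - s *\<^sub>R w |y s. y \<in> A \<and> 0 \<le> s \<and> s \<le> t}"

text \<open>About t/d balls of radius comparable to d suffice, each of volume comparable to d^n. The
  total is of order t d^(n-1), and d^(n-1) is what the Hausdorff sums in dimension n - 1 add
  up.\<close>

lemma tube_cover:
  fixes U :: "(real^'n) set"
  assumes n: "CARD('n) \<ge> 2" and w: "norm w \<le> 2" and U: "bounded U" and d: "diameter U \<le> d" "0 < d" "d \<le> t"
  obtains V where "open V" "tube t w U \<subseteq> V"
    "emeasure lborel V \<le> ennreal (3 * unit_ball_vol (CARD('n)) * 4 ^ CARD('n) * t * d ^ (CARD('n) - 1))"
proof (cases "U = {}")
  case True
  then show ?thesis using that[of "{}"] by (auto simp: tube_def)
next
  case False
  then obtain y0 where y0: "y0 \<in> U" by blast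
  let ?n = "CARD('n)"
  define N where "N = nat \<lceil>t / d\<rceil>"
  \<comment> \<open>A tube point differs from the nearest centre by at most d from the diameter of U
    and by d * 2 from the step along w, which has norm at most 2; 3 d < 4 d. There are N + 1 <= t/d
    + 2 <= 3 t/d balls because d <= t.\<close>
  define V where "V = (\<Union>j\<le>N. ball (y0 - (real j * d) *\<^sub>R w) (4 * d))"
  have N: "t / d \<le> real N" "real N \<le> t / d + 1"
    using d by (auto simp: N_def) 
  show ?thesis
  proof (rule that[of V])
    show "open V" unfolding V_def by auto
    show "tube t w U \<subseteq> V"
    proof
      fix x assume "x \<in> tube t w U"
      then obtain y s where ys: "x = y - s *\<^sub>R w" "y \<in> U" "0 \<le> s" "s \<le> t" by (auto simp: tube_def)
      define j where "j = nat \<lfloor>s / d\<rfloor>"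
      have fl: "real j \<le> s / d" "s / d < real j + 1" using ys d by (auto simp: j_def)
      have "s / d \<le> t / d" using ys d by (intro divide_right_mono) auto
      then have "real j \<le> real N" using fl N by linarith
      then have jN: "j \<le> N" by simp
      have "real j * d \<le> s" "s < (real j + 1) * d" using fl d by (simp_all add: field_simps)
      then have sd: "\<bar>real j * d - s\<bar> \<le> d" by (auto simp: algebra_simps)
      have "norm (y0 - (real j * d) *\<^sub>R w - x) = norm ((y0 - y) - (real j * d - s) *\<^sub>R w)"
        by (simp add: ys algebra_simps)
      also have "\<dots> \<le> norm (y0 - y) + \<bar>real j * d - s\<bar> * norm w"
        using norm_triangle_ineq4[of "y0 - y" "(real j * d - s) *\<^sub>R w"] by simp
      also have "\<dots> \<le> d + d * 2"
        using diameter_bounded_bound[OF U y0 ys(2)] d sd w by (intro add_mono mult_mono) (auto simp: dist_norm)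
      also have "\<dots> < 4 * d" using d by simp
      finally show "x \<in> V" unfolding V_def using jN by (auto simp: dist_norm)
    qed
    have "emeasure lborel V \<le> (\<Sum>j\<le>N. emeasure lborel (ball (y0 - (real j * d) *\<^sub>R w) (4 * d)))"
      unfolding V_def by (intro emeasure_subadditive_finite) auto
    also have "\<dots> = ennreal (\<Sum>j\<le>N. unit_ball_vol (real ?n) * (4 * d) ^ ?n)"
      using d by (subst sum_ennreal[symmetric]) (auto simp: emeasure_ball)
    also have "(\<Sum>j\<le>N. unit_ball_vol (real ?n) * (4 * d) ^ ?n) = (real N + 1) * (unit_ball_vol (real ?n) * (4 * d) ^ ?n)"
      by simp
    also have "\<dots> \<le> (3 * t / d) * (unit_ball_vol (real ?n) * (4 * d) ^ ?n)"
    proof (intro mult_right_mono)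
      have "1 \<le> t / d" using d by simp
      then show "real N + 1 \<le> 3 * t / d" using N by simp
    qed (use d in auto)
    also have "\<dots> = 3 * unit_ball_vol (real ?n) * 4 ^ ?n * t * d ^ (?n - 1)"
      using d n power_Suc[of d "?n - 1"] by (simp add: power_mult_distrib)
    finally show "emeasure lborel V \<le> ennreal (3 * unit_ball_vol (real ?n) * 4 ^ ?n * t * d ^ (?n - 1))"
      by (auto intro: ennreal_leI order_trans)
  qed
qed

text \<open>Far from sharp (for a smooth boundary and small \<open>t\<close> the factor \<open>norm w\<close> would do), but only finiteness matters.\<close>
definition tube_const :: "'n::finite itself \<Rightarrow> real" where
  "tube_const _ = 3 * unit_ball_vol (CARD('n)) * 4 ^ CARD('n) * 2 ^ (CARD('n) - 1) / unit_ball_vol (real (CARD('n) - 1))"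

text \<open>\<open>tube_cover\<close> is summed over a covering of A by sets of diameter at most t.
  Working at the single scale \<delta> = t is enough, because \<open>hausdorff_pre\<close> at any
  scale is a lower bound for the outer measure.\<close>

lemma tube_measure:
  fixes A S :: "(real^'n) set"
  assumes n: "CARD('n) \<ge> 2" and w: "norm w \<le> 2" and t: "t > 0" and S: "S \<in> sets borel" "S \<subseteq> tube t w A"
  shows "emeasure lborel S \<le> ennreal (tube_const TYPE('n) * t) * hausdorff_outer (CARD('n) - 1) A"
proof -
  let ?n = "CARD('n)"
  let ?K = "3 * unit_ball_vol (real ?n) * 4 ^ ?n"
  have tc: "tube_const TYPE('n) > 0" by (simp add: tube_const_def)
  have term_eq: "ennreal (?K * t * diameter U ^ (?n - 1)) = ennreal (tube_const TYPE('n) * t) * hterm (?n - 1) U"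
    if "bounded U" for U :: "(real^'n) set"
  proof -
    have "?K * t * diameter U ^ (?n - 1) = (tube_const TYPE('n) * t) * (unit_ball_vol (real (?n - 1)) * (diameter U / 2) ^ (?n - 1))"
    proof -
      define \<kappa> where "\<kappa> = unit_ball_vol (real (?n - 1))"
      have "\<kappa> > 0" unfolding \<kappa>_def by (rule unit_ball_vol_pos) simp
      then show ?thesis unfolding tube_const_def \<kappa>_def[symmetric] by (simp add: power_divide)
    qed
    moreover have "0 \<le> tube_const TYPE('n) * t" using tc t by simp
    ultimately show ?thesis by (simp only: ennreal_mult')
  qed
  have "emeasure lborel S \<le> ennreal (tube_const TYPE('n) * t) * (\<Sum>j. hterm (?n - 1) (U j))" if U: "hcover t A U" for U
  proof (rule ennreal_le_epsilon)
    fix \<epsilon> :: real assume \<epsilon>: "\<epsilon> > 0"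
    have "\<exists>V. open V \<and> tube t w (U j) \<subseteq> V \<and> emeasure lborel V \<le> ennreal (tube_const TYPE('n) * t) * hterm (?n - 1) (U j) + ennreal (\<epsilon> * (1/2) ^ Suc j)" for j
    proof (cases "diameter (U j) = 0")
      case False
      then have "diameter (U j) > 0" using diameter_ge_0[of "U j"] U by (auto simp: less_le)
      then obtain V where V: "open V" "tube t w (U j) \<subseteq> V" "emeasure lborel V \<le> ennreal (?K * t * diameter (U j) ^ (?n - 1))"
        using tube_cover[OF n w, of "U j" "diameter (U j)" t] U by blast
      have "bounded (U j)" using U by blast
      then have "emeasure lborel V \<le> ennreal (tube_const TYPE('n) * t) * hterm (?n - 1) (U j)"
        using V(3) by (simp only: term_eq)
      then show ?thesis using V(1,2) by (intro exI[of _ V] conjI add_increasing2) auto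
    next
      \<comment> \<open>A covering set of diameter 0 contributes nothing to the Hausdorff sum, but
        its tube still has to be covered. It is treated as a set of tiny diameter d and charged to
        the j-th share of \<epsilon>; d <= 1 and n >= 2 give d^(n-1) <= d.\<close>
      case True
      have K: "?K * t > 0" using t by simp
      define d where "d = min 1 (min t (\<epsilon> * (1/2) ^ Suc j / (?K * t)))"
      have d: "d > 0" "d \<le> t" "d \<le> 1" "?K * t * d \<le> \<epsilon> * (1/2) ^ Suc j"
      proof -
        have "d \<le> \<epsilon> * (1/2) ^ Suc j / (?K * t)" by (simp add: d_def)
        then show "?K * t * d \<le> \<epsilon> * (1/2) ^ Suc j" using K by (simp only: pos_le_divide_eq mult.commute)
        show "d > 0" using t \<epsilon> K unfolding d_def by (simp only: min_less_iff_conj) (auto intro!: divide_pos_pos)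
      qed (auto simp: d_def)
      obtain V where V: "open V" "tube t w (U j) \<subseteq> V" "emeasure lborel V \<le> ennreal (?K * t * d ^ (?n - 1))"
        using tube_cover[OF n w, of "U j" d t] U True d by auto
      have "d ^ (?n - 1) \<le> d ^ 1" using d n by (intro power_decreasing) auto
      then have "?K * t * d ^ (?n - 1) \<le> \<epsilon> * (1/2) ^ Suc j"
        using K d(4) by (intro order_trans[OF mult_left_mono d(4)]) auto
      then have "emeasure lborel V \<le> ennreal (\<epsilon> * (1/2) ^ Suc j)"
        by (intro order_trans[OF V(3)] ennreal_leI)
      then show ?thesis using V(1,2) by (intro exI[of _ V] conjI add_increasing) auto
    qed
    then obtain V where V: "\<And>j. open (V j)" "\<And>j. tube t w (U j) \<subseteq> V j"
      "\<And>j. emeasure lborel (V j) \<le> ennreal (tube_const TYPE('n) * t) * hterm (?n - 1) (U j) + ennreal (\<epsilon> * (1/2) ^ Suc j)"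
      by metis
    have "S \<subseteq> (\<Union>j. V j)"
    proof
      fix x assume "x \<in> S"
      then obtain y s where "x = y - s *\<^sub>R w" "y \<in> A" "0 \<le> s" "s \<le> t" using S(2) by (auto simp: tube_def)
      moreover then obtain j where "y \<in> U j" using U by blast
      ultimately have "x \<in> tube t w (U j)" by (auto simp: tube_def)
      then show "x \<in> (\<Union>j. V j)" using V(2) by blast
    qed
    then have "emeasure lborel S \<le> emeasure lborel (\<Union>j. V j)"
      using V(1) by (intro emeasure_mono) auto
    also have "\<dots> \<le> (\<Sum>j. emeasure lborel (V j))"
      using V(1) by (intro emeasure_subadditive_countably) auto
    also have "\<dots> \<le> (\<Sum>j. ennreal (tube_const TYPE('n) * t) * hterm (?n - 1) (U j) + ennreal (\<epsilon> * (1/2) ^ Suc j))"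
      by (intro suminf_le V(3)) auto
    also have "\<dots> = (\<Sum>j. ennreal (tube_const TYPE('n) * t) * hterm (?n - 1) (U j)) + (\<Sum>j. ennreal (\<epsilon> * (1/2) ^ Suc j))"
      by (intro suminf_add[symmetric]) auto
    also have "(\<Sum>j. ennreal (\<epsilon> * (1/2) ^ Suc j)) = ennreal \<epsilon>"
      using \<epsilon> sums_mult[OF power_half_series, of \<epsilon>] by (intro suminf_ennreal_eq) auto
    also have "(\<Sum>j. ennreal (tube_const TYPE('n) * t) * hterm (?n - 1) (U j)) = ennreal (tube_const TYPE('n) * t) * (\<Sum>j. hterm (?n - 1) (U j))"
      by (rule ennreal_suminf_cmult)
    finally show "emeasure lborel S \<le> ennreal (tube_const TYPE('n) * t) * (\<Sum>j. hterm (?n - 1) (U j)) + ennreal \<epsilon>" .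
  qed
  then have "emeasure lborel S / ennreal (tube_const TYPE('n) * t) \<le> hausdorff_pre (?n - 1) t A"
    unfolding hausdorff_pre_def using tc t
    by (intro INF_greatest) (auto simp: divide_le_posI_ennreal mult.commute)
  also have "\<dots> \<le> hausdorff_outer (?n - 1) A" by (rule hausdorff_pre_le_outer[OF t])
  finally have "ennreal (tube_const TYPE('n) * t) * (emeasure lborel S / ennreal (tube_const TYPE('n) * t)) \<le> ennreal (tube_const TYPE('n) * t) * hausdorff_outer (?n - 1) A"
    by (rule mult_left_mono) simp
  then show ?thesis using tc t
    by (simp add: ennreal_times_divide ennreal_mult_divide_eq mult.commute)
qed

text \<open>A layer-cake decomposition with finitely many levels. Together with
  \<open>staircase_lower\<close> it turns comparisons of superlevel sets into a comparison of
  integrals.\<close>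

lemma staircase_upper:
  fixes a \<epsilon> :: real
  assumes "\<epsilon> > 0" "a \<le> real N * \<epsilon>"
  shows "a \<le> (\<Sum>j<N. \<epsilon> * of_bool (real j * \<epsilon> < a))"
  using assms(2)
proof (induction N)
  case (Suc N)
  show ?case
  proof (cases "a \<le> real N * \<epsilon>")
    case True
    then show ?thesis using Suc.IH assms(1) by (simp add: add_increasing2)
  next
    case False
    have "real j * \<epsilon> < a" if "j < Suc N" for j
    proof -
      have "real j * \<epsilon> \<le> real N * \<epsilon>" using that assms(1) by (intro mult_right_mono) auto
      then show ?thesis using False by simp
    qed
    then have "(\<Sum>j<Suc N. \<epsilon> * of_bool (real j * \<epsilon> < a)) = (\<Sum>j<Suc N. \<epsilon>)" by (intro sum.cong) auto
    then show ?thesis using Suc.prems by simp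
  qed
qed simp

lemma staircase_lower:
  fixes a \<epsilon> :: real
  assumes "\<epsilon> > 0" "a \<ge> 0"
  shows "(\<Sum>j<N. \<epsilon> * of_bool (real (Suc j) * \<epsilon> < a)) \<le> a"
proof (induction N)
  case (Suc N)
  show ?case
  proof (cases "real (Suc N) * \<epsilon> < a")
    case True
    have "(\<Sum>j<Suc N. \<epsilon> * of_bool (real (Suc j) * \<epsilon> < a)) \<le> (\<Sum>j<Suc N. \<epsilon>)"
      using assms(1) by (intro sum_mono) auto
    then show ?thesis using True by simp
  next
    case False
    then show ?thesis using Suc by simp
  qed
qed (use assms in simp)

section \<open>The layer outside \<Omega>: its measure and integrals over it\<close>

lemma lborel_emeasure_translate:
  fixes S :: "'a::euclidean_space set"
  assumes "S \<in> sets borel"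
  shows "(\<lambda>x. x + a) ` S \<in> sets borel" "emeasure lborel ((\<lambda>x. x + a) ` S) = emeasure lborel S"
proof -
  have eq: "(\<lambda>x. x + a) ` S = (+) (- a) -` S"
  proof (intro equalityI subsetI)
    fix y assume "y \<in> (+) (- a) -` S"
    then have "- a + y \<in> S" by simp
    moreover have "y = (- a + y) + a" by simp
    ultimately show "y \<in> (\<lambda>x. x + a) ` S" by (rule image_eqI[rotated])
  qed auto
  have m: "(+) (- a) \<in> borel \<rightarrow>\<^sub>M borel" by measurable
  show "(\<lambda>x. x + a) ` S \<in> sets borel" unfolding eq using measurable_sets[OF m assms] by simp
  have "emeasure lborel S = emeasure (distr lborel borel ((+) (- a))) S" by (simp add: lborel_distr_plus)
  also have "\<dots> = emeasure lborel ((\<lambda>x. x + a) ` S)"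
    unfolding eq using assms by (subst emeasure_distr) auto
  finally show "emeasure lborel ((\<lambda>x. x + a) ` S) = emeasure lborel S" by simp
qed

lemma frontier_on_segment:
  fixes x w :: "'a::real_normed_vector"
  assumes "x \<notin> \<Omega>" "x + t *\<^sub>R w \<in> \<Omega>" "t \<ge> 0" "open \<Omega>"
  obtains s where "0 \<le> s" "s \<le> t" "x + s *\<^sub>R w \<in> frontier \<Omega>"
proof -
  have "connected ((\<lambda>s. x + s *\<^sub>R w) ` {0..t})"
    by (intro connected_continuous_image continuous_intros) auto
  moreover have "x + t *\<^sub>R w \<in> (\<lambda>s. x + s *\<^sub>R w) ` {0..t}" "x + 0 *\<^sub>R w \<in> (\<lambda>s. x + s *\<^sub>R w) ` {0..t}"
    using assms(3) by (intro imageI; simp)+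
  ultimately have "(\<lambda>s. x + s *\<^sub>R w) ` {0..t} \<inter> frontier \<Omega> \<noteq> {}"
    using assms(1,2) by (intro connected_Int_frontier) auto
  then show ?thesis using that by auto
qed

text \<open>The layer \<open>S\<close> is pushed into \<open>\<Omega>\<close> by one step \<open>t w\<close>; by the cone property its translates by
  multiples of \<open>t w\<close> are disjoint, so its measure is \<open>O(t)\<close>.\<close>
lemma layer_measure:
  fixes \<Omega> S :: "(real^'n) set"
  assumes cone: "graph_cone \<Omega> x0 r e \<delta>" and w: "w \<in> ball e \<delta>" and t: "t = r / (8 * real (Suc m))"
    and S: "S \<in> sets borel" "\<And>x. x \<in> S \<Longrightarrow> x \<notin> \<Omega> \<and> x + t *\<^sub>R w \<in> \<Omega> \<and> x + t *\<^sub>R w \<in> ball x0 (3 * r / 4)"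
  shows "emeasure lborel S \<le> ennreal (8 * t / r * measure lborel (ball x0 r))"
proof -
  have r: "r > 0" and t0: "t > 0" and nw: "norm w \<le> 2"
  proof -
    show "r > 0" using cone by (simp add: graph_cone_def)
    then show "t > 0" by (simp add: t)
    have "norm w \<le> norm e + norm (w - e)" by norm
    then show "norm w \<le> 2" using cone w by (simp add: graph_cone_def dist_norm norm_minus_commute)
  qed
  define T where "T k = (\<lambda>x. x + (real k * t) *\<^sub>R w) ` S" for k
  \<comment> \<open>The factor 8 in t serves here: the translates move by at most (m + 1) t * 2 =
    r/4 from a point within 3r/4 of x0, so all m + 1 of them stay in the ball of radius r.\<close>
  have near: "x + (s * t) *\<^sub>R w \<in> ball x0 r" if "x \<in> S" "0 \<le> s" "s \<le> real (Suc m)" for x s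
  proof -
    have "\<bar>s - 1\<bar> * (t * norm w) \<le> real (Suc m) * (t * 2)"
      using that nw t0 by (intro mult_mono) auto
    also have "\<dots> = r / 4"
    proof -
      have "real (Suc m) * t = r / 8" unfolding t by (simp del: of_nat_Suc)
      then show ?thesis by simp
    qed
    finally have *: "\<bar>s - 1\<bar> * (t * norm w) \<le> r / 4" .
    have "norm ((s * t) *\<^sub>R w - t *\<^sub>R w) \<le> r / 4"
    proof -
      have "(s * t) *\<^sub>R w - t *\<^sub>R w = ((s - 1) * t) *\<^sub>R w" by (simp add: algebra_simps)
      then have "norm ((s * t) *\<^sub>R w - t *\<^sub>R w) = \<bar>s - 1\<bar> * (t * norm w)" using t0 by (simp add: abs_mult)
      then show ?thesis using * by simp
    qed
    moreover have "dist x0 (x + t *\<^sub>R w) < 3 * r / 4" using S(2)[OF that(1)] by simp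
    moreover have "dist x0 (x + (s * t) *\<^sub>R w) \<le> dist x0 (x + t *\<^sub>R w) + norm ((s * t) *\<^sub>R w - t *\<^sub>R w)"
    proof -
      have "dist (x + t *\<^sub>R w) (x + (s * t) *\<^sub>R w) = norm ((s * t) *\<^sub>R w - t *\<^sub>R w)"
        by (subst dist_commute) (simp add: dist_norm)
      then show ?thesis using dist_triangle[of x0 "x + (s * t) *\<^sub>R w" "x + t *\<^sub>R w"] by simp
    qed
    ultimately show ?thesis by simp
  qed
  \<comment> \<open>If two translates met, then x = y + (l - k) t w with x, y in S. Since y + t w
    already lies in \<Omega>, the cone property would put x into \<Omega>.\<close>
  have disj: "T k \<inter> T l = {}" if "k < l" "l \<le> m" for k l
  proof (rule ccontr)
    assume "T k \<inter> T l \<noteq> {}"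
    then obtain x y where xy: "x \<in> S" "y \<in> S" "x + (real k * t) *\<^sub>R w = y + (real l * t) *\<^sub>R w"
      by (auto simp: T_def)
    have x: "x = (y + t *\<^sub>R w) + ((real l - real k - 1) * t) *\<^sub>R w"
      using xy(3) by (simp add: algebra_simps)
    have "x \<in> \<Omega>"
    proof (cases "l = Suc k")
      case True
      then have "x = y + t *\<^sub>R w" using x by simp
      then show ?thesis using S(2)[OF xy(2)] by simp
    next
      case False
      then have "(real l - real k - 1) * t > 0" using that t0 by (intro mult_pos_pos) auto
      moreover have "y + t *\<^sub>R w \<in> closure \<Omega>" using S(2)[OF xy(2)] closure_subset by blast
      moreover have "y + t *\<^sub>R w \<in> ball x0 r" using near[OF xy(2), of 1] by simp
      moreover have "(y + t *\<^sub>R w) + ((real l - real k - 1) * t) *\<^sub>R w \<in> ball x0 r"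
        using near[OF xy(1), of 0] x by simp
      ultimately show ?thesis using cone w unfolding graph_cone_def x[symmetric] using x by metis
    qed
    then show False using S(2)[OF xy(1)] by simp
  qed
  have "disjoint_family_on T {..m}"
    unfolding disjoint_family_on_def using disj by (metis Int_commute atMost_iff nat_neq_iff)
  then have "(\<Sum>k\<in>{..m}. emeasure lborel (T k)) = emeasure lborel (\<Union>k\<in>{..m}. T k)"
  proof (intro sum_emeasure)
    have "T k \<in> sets borel" for k unfolding T_def by (rule lborel_emeasure_translate(1)[OF S(1)])
    then show "T ` {..m} \<subseteq> sets lborel" by auto
  qed auto
  also have "\<dots> \<le> emeasure lborel (ball x0 r)"
    using near by (intro emeasure_mono) (auto simp: T_def)
  also have "\<dots> = ennreal (measure lborel (ball x0 r))"
    using emeasure_bounded_finite[OF bounded_ball[of x0 r]] by (simp add: emeasure_eq_ennreal_measure)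
  finally have "of_nat (Suc m) * emeasure lborel S \<le> ennreal (measure lborel (ball x0 r))"
    by (simp add: T_def lborel_emeasure_translate(2)[OF S(1)])
  then have "ennreal (8 * t / r) * (of_nat (Suc m) * emeasure lborel S) \<le> ennreal (8 * t / r) * ennreal (measure lborel (ball x0 r))"
    by (rule mult_left_mono) simp
  moreover have "ennreal (8 * t / r) * of_nat (Suc m) = 1"
    using r by (simp add: t ennreal_of_nat_eq_real_of_nat ennreal_mult[symmetric] del: of_nat_Suc)
  ultimately have "emeasure lborel S \<le> ennreal (8 * t / r) * ennreal (measure lborel (ball x0 r))"
    by (simp only: mult.assoc[symmetric] mult_1)
  also have "\<dots> = ennreal (8 * t / r * measure lborel (ball x0 r))"
    using r t0 by (intro ennreal_mult[symmetric]) auto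
  finally show ?thesis .
qed

text \<open>The integrand is sliced at the levels j \<epsilon>. By \<open>close\<close>, a slice at
  level c lies in the tube over the boundary points with |g| > c - \<epsilon>. Where this comparison
  gives too little, the plain bound O(t) for the measure of the layer is used, at the cost of a
  factor \<epsilon>. Both terms of the bound are linear in t, so they survive division by t.\<close>

lemma layer_integral:
  fixes \<Omega> :: "(real^'n) set" and G g :: "real^'n \<Rightarrow> real"
  assumes n: "CARD('n) \<ge> 2" and \<Omega>: "open \<Omega>"
    and cone: "graph_cone \<Omega> x0 r e \<delta>" and w: "w \<in> ball e \<delta>" and t: "t = r / (8 * real (Suc m))"
    and G: "G \<in> borel_measurable borel" "\<And>x. x \<notin> \<Omega> \<Longrightarrow> G x = 0" "\<And>x. G x \<noteq> 0 \<Longrightarrow> x \<in> ball x0 (3 * r / 4)"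
      "\<And>x. \<bar>G x\<bar> \<le> B"
    and g: "continuous_on (frontier \<Omega>) g" and \<epsilon>: "\<epsilon> > 0"
    and close: "\<And>x y. x \<in> \<Omega> \<Longrightarrow> y \<in> frontier \<Omega> \<Longrightarrow> dist x y \<le> 2 * t \<Longrightarrow> \<bar>G x - g y\<bar> \<le> \<epsilon>"
  shows "(\<integral>\<^sup>+x. ennreal \<bar>indicator (- \<Omega>) x * G (x + t *\<^sub>R w)\<bar> \<partial>lborel) \<le>
    ennreal (tube_const TYPE('n) * t) * (\<integral>\<^sup>+x\<in>frontier \<Omega>. ennreal \<bar>g x\<bar> \<partial>surface_measure) +
    ennreal (2 * \<epsilon> * (8 * t / r * measure lborel (ball x0 r)))"
proof -
  have r: "r > 0" and t0: "t > 0" and nw: "norm w \<le> 2"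
  proof -
    show "r > 0" using cone by (simp add: graph_cone_def)
    then show "t > 0" by (simp add: t)
    have "norm w \<le> norm e + norm (w - e)" by norm
    then show "norm w \<le> 2" using cone w by (simp add: graph_cone_def dist_norm norm_minus_commute)
  qed
  define F where "F x = \<bar>indicator (- \<Omega>) x * G (x + t *\<^sub>R w)\<bar>" for x
  have [measurable]: "G \<in> borel_measurable borel" by (rule G(1))
  have [measurable]: "\<Omega> \<in> sets borel" using \<Omega> by simp
  have F[measurable]: "F \<in> borel_measurable borel" unfolding F_def[abs_def] by measurable
  define L where "L c = {x. c < F x}" for c
  have Lb: "L c \<in> sets borel" for c unfolding L_def by measurable
  define A where "A c = {y \<in> frontier \<Omega>. c < \<bar>g y\<bar>}" for c
  have gm: "(\<lambda>x. if x \<in> frontier \<Omega> then g x else 0) \<in> borel_measurable borel"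
    using g by (intro borel_measurable_continuous_on_if) (auto simp: frontier_closed borel_closed)
  have Ab: "A c \<in> sets borel" if "c \<ge> 0" for c
  proof -
    have "A c = {y. c < \<bar>if y \<in> frontier \<Omega> then g y else 0\<bar>}" using that by (auto simp: A_def)
    then show ?thesis using gm by simp
  qed
  obtain N where N: "B \<le> real N * \<epsilon>" using ex_less_of_nat_mult[OF \<epsilon>, of B] by (auto intro: less_imp_le)
  have FB: "F x \<le> B" for x using G(4)[of "x + t *\<^sub>R w"] order_trans[OF abs_ge_zero G(4)[of x]] by (auto simp: F_def indicator_def)
  have Lnear: "x \<notin> \<Omega> \<and> x + t *\<^sub>R w \<in> \<Omega> \<and> x + t *\<^sub>R w \<in> ball x0 (3 * r / 4) \<and> F x = \<bar>G (x + t *\<^sub>R w)\<bar>" if "x \<in> L c" "c \<ge> 0" for x c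
  proof -
    have "F x \<noteq> 0" using that by (auto simp: L_def)
    then have "x \<notin> \<Omega>" "G (x + t *\<^sub>R w) \<noteq> 0" by (auto simp: F_def indicator_def split: if_splits)
    then show ?thesis using G(2)[of "x + t *\<^sub>R w"] G(3)[of "x + t *\<^sub>R w"] by (auto simp: F_def)
  qed
  let ?V = "8 * t / r * measure lborel (ball x0 r)"
  have small: "emeasure lborel (L c) \<le> ennreal ?V" if "c \<ge> 0" for c
    using Lnear[OF _ that] by (intro layer_measure[OF cone w t Lb]) auto
  \<comment> \<open>The segment from x, outside \<Omega>, to x + t w, inside, meets the frontier at
    some x + s w. Hence x lies in the tube over that point, at distance at most 2 t from where G is
    evaluated.\<close>
  have tubeL: "L c \<subseteq> tube t w (A (c - \<epsilon>))" if "c \<ge> 0" for c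
  proof
    fix x assume x: "x \<in> L c"
    note xn = Lnear[OF x that]
    then obtain s where s: "0 \<le> s" "s \<le> t" "x + s *\<^sub>R w \<in> frontier \<Omega>"
      using frontier_on_segment[of x \<Omega> t w] t0 \<Omega> by auto
    have "dist (x + t *\<^sub>R w) (x + s *\<^sub>R w) = (t - s) * norm w"
      using s by (simp add: dist_norm scaleR_left_diff_distrib[symmetric])
    also have "\<dots> \<le> t * 2" using s nw t0 by (intro mult_mono) auto
    finally have "\<bar>G (x + t *\<^sub>R w) - g (x + s *\<^sub>R w)\<bar> \<le> \<epsilon>" using xn s by (intro close) auto
    then have "c - \<epsilon> < \<bar>g (x + s *\<^sub>R w)\<bar>" using x xn by (auto simp: L_def)
    then have "x + s *\<^sub>R w \<in> A (c - \<epsilon>)" using s by (simp add: A_def)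
    moreover have "x = (x + s *\<^sub>R w) - s *\<^sub>R w" by simp
    ultimately show "x \<in> tube t w (A (c - \<epsilon>))" unfolding tube_def using s by blast
  qed
  let ?C = "ennreal (tube_const TYPE('n) * t)"
  have big: "emeasure lborel (L c) \<le> ?C * emeasure surface_measure (A (c - \<epsilon>))" if "c \<ge> \<epsilon>" for c
  proof -
    have "emeasure surface_measure (A (c - \<epsilon>)) = hausdorff_outer (CARD('n) - 1) (A (c - \<epsilon>))"
      unfolding surface_measure_def using n that by (intro emeasure_hausdorff_measure Ab) auto
    moreover have "c \<ge> 0" using that \<epsilon> by simp
    ultimately show ?thesis using tube_measure[OF n nw t0 Lb tubeL] by simp
  qed
  have "(\<integral>\<^sup>+x. ennreal (F x) \<partial>lborel) \<le> (\<integral>\<^sup>+x. (\<Sum>j<Suc (Suc N). ennreal \<epsilon> * indicator (L (real j * \<epsilon>)) x) \<partial>lborel)"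
  proof (intro nn_integral_mono)
    fix x
    have "F x \<le> real (Suc (Suc N)) * \<epsilon>" using FB[of x] N \<epsilon> by (simp add: algebra_simps)
    from staircase_upper[OF \<epsilon> this]
    have "ennreal (F x) \<le> ennreal (\<Sum>j<Suc (Suc N). \<epsilon> * of_bool (real j * \<epsilon> < F x))" by (rule ennreal_leI)
    also have "\<dots> = (\<Sum>j<Suc (Suc N). ennreal (\<epsilon> * of_bool (real j * \<epsilon> < F x)))"
      using \<epsilon> by (intro sum_ennreal[symmetric]) auto
    also have "\<dots> = (\<Sum>j<Suc (Suc N). ennreal \<epsilon> * indicator (L (real j * \<epsilon>)) x)"
      by (intro sum.cong) (auto simp: L_def indicator_def)
    finally show "ennreal (F x) \<le> (\<Sum>j<Suc (Suc N). ennreal \<epsilon> * indicator (L (real j * \<epsilon>)) x)" .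
  qed
  also have "\<dots> = (\<Sum>j<Suc (Suc N). ennreal \<epsilon> * emeasure lborel (L (real j * \<epsilon>)))"
    using Lb by (subst nn_integral_sum) (auto simp: nn_integral_cmult_indicator)
  \<comment> \<open>The two lowest levels are estimated by the measure of the layer. From level (j +
    2) \<epsilon> on, the boundary level is (j + 1) \<epsilon>, as \<open>staircase_lower\<close>
    requires. Boundary level 0 is avoided, since \<epsilon> times the measure of the set where g is
    nonzero is not controlled by the integral of |g|.\<close>
  also have "\<dots> = ennreal \<epsilon> * emeasure lborel (L 0) + (ennreal \<epsilon> * emeasure lborel (L \<epsilon>) + (\<Sum>j<N. ennreal \<epsilon> * emeasure lborel (L (real (Suc (Suc j)) * \<epsilon>))))"
    by (subst sum.lessThan_Suc_shift, subst sum.lessThan_Suc_shift) simp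
  also have "\<dots> \<le> ennreal \<epsilon> * ennreal ?V + (ennreal \<epsilon> * ennreal ?V + (\<Sum>j<N. ennreal \<epsilon> * (?C * emeasure surface_measure (A (real (Suc j) * \<epsilon>)))))"
  proof (intro add_mono mult_left_mono small sum_mono)
    fix j
    have "real (Suc (Suc j)) * \<epsilon> \<ge> \<epsilon>" using \<epsilon> by simp
    from big[OF this] show "emeasure lborel (L (real (Suc (Suc j)) * \<epsilon>)) \<le> ?C * emeasure surface_measure (A (real (Suc j) * \<epsilon>))"
      by (simp add: algebra_simps)
  qed (use \<epsilon> in auto)
  also have "(\<Sum>j<N. ennreal \<epsilon> * (?C * emeasure surface_measure (A (real (Suc j) * \<epsilon>)))) =
      ?C * (\<Sum>j<N. ennreal \<epsilon> * emeasure surface_measure (A (real (Suc j) * \<epsilon>)))"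
    by (simp add: sum_distrib_left mult_ac)
  finally have layers: "(\<integral>\<^sup>+x. ennreal (F x) \<partial>lborel) \<le> ennreal \<epsilon> * ennreal ?V + (ennreal \<epsilon> * ennreal ?V +
      ?C * (\<Sum>j<N. ennreal \<epsilon> * emeasure surface_measure (A (real (Suc j) * \<epsilon>))))" .
  have "(\<Sum>j<N. ennreal \<epsilon> * emeasure surface_measure (A (real (Suc j) * \<epsilon>))) =
      (\<integral>\<^sup>+x. (\<Sum>j<N. ennreal \<epsilon> * indicator (A (real (Suc j) * \<epsilon>)) x) \<partial>surface_measure)"
    using Ab \<epsilon> by (subst nn_integral_sum) (auto simp: nn_integral_cmult_indicator surface_measure_def)
  also have "\<dots> \<le> (\<integral>\<^sup>+x\<in>frontier \<Omega>. ennreal \<bar>g x\<bar> \<partial>surface_measure)"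
  proof (intro nn_integral_mono)
    fix x :: "real^'n"
    have "(\<Sum>j<N. ennreal \<epsilon> * indicator (A (real (Suc j) * \<epsilon>)) x) = 
        (\<Sum>j<N. ennreal (\<epsilon> * of_bool (real (Suc j) * \<epsilon> < \<bar>g x\<bar>))) * indicator (frontier \<Omega>) x"
      unfolding sum_distrib_right by (rule sum.cong[OF refl]) (auto simp: A_def indicator_def)
    also have "(\<Sum>j<N. ennreal (\<epsilon> * of_bool (real (Suc j) * \<epsilon> < \<bar>g x\<bar>))) = ennreal (\<Sum>j<N. \<epsilon> * of_bool (real (Suc j) * \<epsilon> < \<bar>g x\<bar>))"
      using \<epsilon> by (intro sum_ennreal) auto
    also have "\<dots> \<le> ennreal \<bar>g x\<bar>" by (intro ennreal_leI staircase_lower \<epsilon>) simp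
    finally show "(\<Sum>j<N. ennreal \<epsilon> * indicator (A (real (Suc j) * \<epsilon>)) x) \<le> ennreal \<bar>g x\<bar> * indicator (frontier \<Omega>) x"
      by (simp add: mult_right_mono)
  qed
  finally have "(\<integral>\<^sup>+x. ennreal (F x) \<partial>lborel) \<le> ennreal \<epsilon> * ennreal ?V + (ennreal \<epsilon> * ennreal ?V + ?C * (\<integral>\<^sup>+x\<in>frontier \<Omega>. ennreal \<bar>g x\<bar> \<partial>surface_measure))"
    by (intro order_trans[OF layers] add_left_mono mult_left_mono) auto
  also have "ennreal \<epsilon> * ennreal ?V + (ennreal \<epsilon> * ennreal ?V + ?C * (\<integral>\<^sup>+x\<in>frontier \<Omega>. ennreal \<bar>g x\<bar> \<partial>surface_measure)) =
      ?C * (\<integral>\<^sup>+x\<in>frontier \<Omega>. ennreal \<bar>g x\<bar> \<partial>surface_measure) + (ennreal \<epsilon> * ennreal ?V + ennreal \<epsilon> * ennreal ?V)"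
    by (simp only: add_ac)
  also have "ennreal \<epsilon> * ennreal ?V + ennreal \<epsilon> * ennreal ?V = ennreal (2 * \<epsilon> * ?V)"
  proof -
    have V: "?V \<ge> 0" using t0 r by simp
    have "ennreal \<epsilon> * ennreal ?V = ennreal (\<epsilon> * ?V)" using \<epsilon> V by (simp only: ennreal_mult'')
    moreover have "ennreal (\<epsilon> * ?V) + ennreal (\<epsilon> * ?V) = ennreal (\<epsilon> * ?V + \<epsilon> * ?V)"
    proof -
      have "0 \<le> \<epsilon> * ?V" using \<epsilon> r t0 by (intro mult_nonneg_nonneg) auto
      then show ?thesis by (subst ennreal_plus) (assumption | rule refl)+
    qed
    moreover have "\<epsilon> * ?V + \<epsilon> * ?V = 2 * \<epsilon> * ?V" by simp
    ultimately show ?thesis by (simp only:)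
  qed
  finally show ?thesis unfolding F_def .
qed

section \<open>Modulars and Luxemburg norms\<close>

lemma modular_cong_AE:
  "AE x in lebesgue_on \<Omega>. u x = v x \<Longrightarrow> modular \<Omega> r u = modular \<Omega> r v"
  unfolding modular_def by (intro nn_integral_cong_AE) (auto elim: eventually_mono)

lemma Lnorm_cong_AE:
  assumes "AE x in lebesgue_on \<Omega>. u x = v x" shows "Lnorm \<Omega> r u = Lnorm \<Omega> r v"
proof -
  have "modular \<Omega> r (\<lambda>x. u x / l) = modular \<Omega> r (\<lambda>x. v x / l)" for l
    by (rule modular_cong_AE) (use assms in \<open>auto elim: eventually_mono\<close>)
  then show ?thesis unfolding Lnorm_def by simp
qed

lemma modular_scale:
  assumes [measurable]: "u \<in> borel_measurable (lebesgue_on \<Omega>)" and l: "l > 0"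
  shows "modular \<Omega> (\<lambda>_. p) (\<lambda>x. u x / l) = ennreal (l powr (- p)) * modular \<Omega> (\<lambda>_. p) u"
proof -
  have "modular \<Omega> (\<lambda>_. p) (\<lambda>x. u x / l) = (\<integral>\<^sup>+x. ennreal (l powr (- p)) * ennreal (\<bar>u x\<bar> powr p) \<partial>lebesgue_on \<Omega>)"
    unfolding modular_def using l
    by (intro nn_integral_cong) (simp add: abs_divide powr_divide powr_minus_divide ennreal_mult[symmetric])
  also have "\<dots> = ennreal (l powr (- p)) * modular \<Omega> (\<lambda>_. p) u"
    unfolding modular_def by (rule nn_integral_cmult) simp
  finally show ?thesis .
qed

lemma modular_scale_le_1_iff:
  assumes "u \<in> borel_measurable (lebesgue_on \<Omega>)" "l > 0"
  shows "modular \<Omega> (\<lambda>_. p) (\<lambda>x. u x / l) \<le> 1 \<longleftrightarrow> modular \<Omega> (\<lambda>_. p) u \<le> ennreal (l powr p)"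
proof -
  have *: "ennreal (l powr p) * ennreal (l powr (- p)) = 1"
    using assms(2) by (simp add: ennreal_mult[symmetric] flip: powr_add)
  show ?thesis unfolding modular_scale[OF assms]
  proof
    assume "ennreal (l powr (- p)) * modular \<Omega> (\<lambda>_. p) u \<le> 1"
    then have "ennreal (l powr p) * (ennreal (l powr (- p)) * modular \<Omega> (\<lambda>_. p) u) \<le> ennreal (l powr p) * 1"
      by (rule mult_left_mono) simp
    then show "modular \<Omega> (\<lambda>_. p) u \<le> ennreal (l powr p)" by (simp add: mult.assoc[symmetric] *)
  next
    assume "modular \<Omega> (\<lambda>_. p) u \<le> ennreal (l powr p)"
    then have "ennreal (l powr (- p)) * modular \<Omega> (\<lambda>_. p) u \<le> ennreal (l powr (- p)) * ennreal (l powr p)"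
      by (rule mult_left_mono) simp
    then show "ennreal (l powr (- p)) * modular \<Omega> (\<lambda>_. p) u \<le> 1" by (simp add: mult.commute *)
  qed
qed

lemma Lnorm_le:
  assumes "u \<in> borel_measurable (lebesgue_on \<Omega>)" "l > 0" "modular \<Omega> (\<lambda>_. p) u \<le> ennreal (l powr p)"
  shows "Lnorm \<Omega> (\<lambda>_. p) u \<le> ennreal l"
  unfolding Lnorm_def using assms by (intro Inf_lower) (auto simp: modular_scale_le_1_iff)

lemma Lnorm_less_imp_modular:
  assumes u: "u \<in> borel_measurable (lebesgue_on \<Omega>)" and p: "p \<ge> 0" and l: "Lnorm \<Omega> (\<lambda>_. p) u < ennreal l"
  shows "modular \<Omega> (\<lambda>_. p) u \<le> ennreal (l powr p)"
proof -
  obtain k where k: "k > 0" "modular \<Omega> (\<lambda>_. p) (\<lambda>x. u x / k) \<le> 1" "ennreal k < ennreal l"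
    using l unfolding Lnorm_def Inf_less_iff by auto
  then have "modular \<Omega> (\<lambda>_. p) u \<le> ennreal (k powr p)" using modular_scale_le_1_iff[OF u] by blast
  also have "\<dots> \<le> ennreal (l powr p)"
    using k p by (intro ennreal_leI powr_mono2) (auto simp: ennreal_less_iff)
  finally show ?thesis .
qed

lemma Lnorm_tendsto_imp_modular_tendsto:
  assumes u: "\<And>k. u k \<in> borel_measurable (lebesgue_on \<Omega>)" and p: "p > 0"
    and lim: "(\<lambda>k. Lnorm \<Omega> (\<lambda>_. p) (u k)) \<longlonglongrightarrow> 0"
  shows "(\<lambda>k. modular \<Omega> (\<lambda>_. p) (u k)) \<longlonglongrightarrow> 0"
proof (rule order_tendstoI)
  fix a :: ennreal assume "0 < a"
  then obtain b where b: "0 < b" "ennreal b < a"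
    using dense[of 0 a] by (metis ennreal_cases ennreal_less_zero_iff top.not_eq_extremum order_less_le_trans top_greatest)
  define l where "l = b powr (1 / p)"
  have l: "l > 0" "l powr p = b" using b p by (auto simp: l_def powr_powr)
  have "\<forall>\<^sub>F k in sequentially. Lnorm \<Omega> (\<lambda>_. p) (u k) < ennreal l"
    using order_tendstoD(2)[OF lim, of "ennreal l"] l by simp
  then show "\<forall>\<^sub>F k in sequentially. modular \<Omega> (\<lambda>_. p) (u k) < a"
  proof eventually_elim
    case (elim k)
    from Lnorm_less_imp_modular[OF u _ elim] p b(2) show ?case unfolding l by (meson le_less_trans less_imp_le)
  qed
qed simp

lemma Lnorm_finite_iff:
  assumes u: "u \<in> borel_measurable (lebesgue_on \<Omega>)" and p: "p > 0"
  shows "Lnorm \<Omega> (\<lambda>_. p) u < \<infinity> \<longleftrightarrow> modular \<Omega> (\<lambda>_. p) u < \<infinity>"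
proof
  assume "Lnorm \<Omega> (\<lambda>_. p) u < \<infinity>"
  then obtain l where "Lnorm \<Omega> (\<lambda>_. p) u = ennreal l" "l \<ge> 0" by (cases "Lnorm \<Omega> (\<lambda>_. p) u") auto
  then have "Lnorm \<Omega> (\<lambda>_. p) u < ennreal (l + 1)" by (simp add: ennreal_less_iff)
  from Lnorm_less_imp_modular[OF u _ this] p have "modular \<Omega> (\<lambda>_. p) u \<le> ennreal ((l + 1) powr p)" by simp
  also have "\<dots> < \<infinity>" by simp
  finally show "modular \<Omega> (\<lambda>_. p) u < \<infinity>" .
next
  assume "modular \<Omega> (\<lambda>_. p) u < \<infinity>"
  then obtain M where M: "modular \<Omega> (\<lambda>_. p) u = ennreal M" "M \<ge> 0" by (cases "modular \<Omega> (\<lambda>_. p) u") auto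
  have "((M + 1) powr (1 / p)) powr p = M + 1" using p M by (simp add: powr_powr)
  then have "Lnorm \<Omega> (\<lambda>_. p) u \<le> ennreal ((M + 1) powr (1 / p))"
    using M by (intro Lnorm_le[OF u]) (auto intro: ennreal_leI)
  also have "\<dots> < \<infinity>" by simp
  finally show "Lnorm \<Omega> (\<lambda>_. p) u < \<infinity>" .
qed

text \<open>\<open>wD\<close> picks an arbitrary representative; a.e. uniqueness of weak derivatives
  allows the norm to be computed with any given one.\<close>

lemma W1_norm_eq:
  fixes \<Omega> :: "(real^'n) set"
  assumes \<Omega>: "open \<Omega>" and g: "\<And>i. weak_deriv \<Omega> u i (g i)"
  shows "W1_norm \<Omega> p u = Lnorm \<Omega> (\<lambda>_. p) u + (\<Sum>i\<in>UNIV. Lnorm \<Omega> (\<lambda>_. p) (g i))"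
proof -
  have "Lnorm \<Omega> (\<lambda>_. p) (wD \<Omega> i u) = Lnorm \<Omega> (\<lambda>_. p) (g i)" for i
  proof (rule Lnorm_cong_AE)
    have "weak_deriv \<Omega> u i (wD \<Omega> i u)" using g[of i] unfolding wD_def by (rule someI[of "weak_deriv \<Omega> u i"])
    then show "AE x in lebesgue_on \<Omega>. wD \<Omega> i u x = g i x" by (rule weak_deriv_unique[OF \<Omega> _ g])
  qed
  then show ?thesis by (simp add: W1_norm_def)
qed

section \<open>Comparison of exponents on bounded domains\<close>

lemma bounded_lebesgue_on_finite:
  assumes "open \<Omega>" "bounded \<Omega>"
  shows "emeasure (lebesgue_on \<Omega>) \<Omega> < \<infinity>"
proof -
  have "emeasure (lebesgue_on \<Omega>) \<Omega> = emeasure lborel \<Omega>"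
    using assms(1) by (simp add: emeasure_restrict_space)
  then show ?thesis using emeasure_bounded_finite[OF assms(2)] by simp
qed

text \<open>Split at the height where a^q = l. The free parameter l lets one inequality serve twice:
  l = 1 gives the inclusion of L^p in L^q, and small l the transfer of convergence to 0.\<close>

lemma powr_interpolate:
  fixes a p q l :: real
  assumes "0 < q" "q \<le> p" "a \<ge> 0" "l > 0"
  shows "a powr q \<le> l + l powr (1 - p / q) * a powr p"
proof (cases "a powr q \<le> l")
  case True
  then show ?thesis by (simp add: add_increasing2)
next
  case False
  then have a: "a > 0" using assms by (cases "a = 0") auto
  have "(a powr q) powr (1 - p / q) \<le> l powr (1 - p / q)"
    using False assms by (intro powr_mono2') (auto simp: divide_simps)
  then have "(a powr q) powr (1 - p / q) * a powr p \<le> l powr (1 - p / q) * a powr p"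
    by (intro mult_right_mono) auto
  moreover have "(a powr q) powr (1 - p / q) * a powr p = a powr q"
    using a assms by (simp add: powr_powr right_diff_distrib flip: powr_add)
  ultimately show ?thesis using assms by simp
qed

lemma modular_interpolate:
  fixes \<Omega> :: "(real^'n) set"
  assumes pq: "0 < q" "q \<le> p" and [measurable]: "u \<in> borel_measurable (lebesgue_on \<Omega>)" and l: "l > 0" and \<Omega>: "open \<Omega>"
  shows "modular \<Omega> (\<lambda>_. q) u \<le> ennreal l * emeasure (lebesgue_on \<Omega>) \<Omega> + ennreal (l powr (1 - p / q)) * modular \<Omega> (\<lambda>_. p) u"
proof -
  have "modular \<Omega> (\<lambda>_. q) u \<le> (\<integral>\<^sup>+x. ennreal l + ennreal (l powr (1 - p / q)) * ennreal (\<bar>u x\<bar> powr p) \<partial>lebesgue_on \<Omega>)"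
    unfolding modular_def
  proof (intro nn_integral_mono)
    fix x
    have "ennreal (\<bar>u x\<bar> powr q) \<le> ennreal (l + l powr (1 - p / q) * \<bar>u x\<bar> powr p)"
      using pq l by (intro ennreal_leI powr_interpolate) auto
    also have "\<dots> = ennreal l + ennreal (l powr (1 - p / q)) * ennreal (\<bar>u x\<bar> powr p)"
      using l by (simp add: ennreal_mult')
    finally show "ennreal (\<bar>u x\<bar> powr q) \<le> ennreal l + ennreal (l powr (1 - p / q)) * ennreal (\<bar>u x\<bar> powr p)" .
  qed
  also have "\<dots> = (\<integral>\<^sup>+x. ennreal l \<partial>lebesgue_on \<Omega>) + (\<integral>\<^sup>+x. ennreal (l powr (1 - p / q)) * ennreal (\<bar>u x\<bar> powr p) \<partial>lebesgue_on \<Omega>)"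
    by (rule nn_integral_add) auto
  also have "\<dots> = ennreal l * emeasure (lebesgue_on \<Omega>) \<Omega> + ennreal (l powr (1 - p / q)) * modular \<Omega> (\<lambda>_. p) u"
    unfolding modular_def by (subst nn_integral_cmult) auto
  finally show ?thesis .
qed

lemma Lvar_mono_exponent:
  fixes \<Omega> :: "(real^'n) set"
  assumes "0 < q" "q \<le> p" "u \<in> Lvar \<Omega> (\<lambda>_. p)" "open \<Omega>" "bounded \<Omega>"
  shows "u \<in> Lvar \<Omega> (\<lambda>_. q)"
proof -
  have u: "u \<in> borel_measurable (lebesgue_on \<Omega>)" "modular \<Omega> (\<lambda>_. p) u < \<infinity>" using assms(3) by (auto simp: Lvar_def)
  have "modular \<Omega> (\<lambda>_. q) u \<le> ennreal 1 * emeasure (lebesgue_on \<Omega>) \<Omega> + ennreal (1 powr (1 - p / q)) * modular \<Omega> (\<lambda>_. p) u"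
    using assms u by (intro modular_interpolate) auto
  also have "\<dots> < \<infinity>" using u(2) bounded_lebesgue_on_finite[OF assms(4,5)] by simp
  finally show ?thesis using u by (simp add: Lvar_def)
qed

lemma modular_tendsto_mono_exponent:
  fixes \<Omega> :: "(real^'n) set"
  assumes pq: "0 < q" "q \<le> p" and u: "\<And>k. u k \<in> borel_measurable (lebesgue_on \<Omega>)" and \<Omega>: "open \<Omega>" "bounded \<Omega>"
    and lim: "(\<lambda>k. modular \<Omega> (\<lambda>_. p) (u k)) \<longlonglongrightarrow> 0"
  shows "(\<lambda>k. modular \<Omega> (\<lambda>_. q) (u k)) \<longlonglongrightarrow> 0"
proof (rule order_tendstoI)
  fix a :: ennreal assume "0 < a"
  then obtain b where b: "0 < b" "ennreal b < a"
    using dense[of 0 a] by (metis ennreal_cases ennreal_less_zero_iff top.not_eq_extremum order_less_le_trans top_greatest)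
  obtain V where V: "emeasure (lebesgue_on \<Omega>) \<Omega> = ennreal V" "V \<ge> 0"
    using bounded_lebesgue_on_finite[OF \<Omega>] by (cases "emeasure (lebesgue_on \<Omega>) \<Omega>") auto
  \<comment> \<open>l is fixed first, so that the constant term l V is at most b/2; only then is the
    p-modular required to be below the c that makes the other term b/2.\<close>
  define l where "l = b / (2 * (V + 1))"
  have l: "l > 0" "l * V \<le> b / 2" using b V by (auto simp: l_def field_simps)
  define c where "c = (b / 2) / l powr (1 - p / q)"
  have c: "c > 0" "l powr (1 - p / q) * c = b / 2" using b l by (auto simp: c_def)
  have "\<forall>\<^sub>F k in sequentially. modular \<Omega> (\<lambda>_. p) (u k) < ennreal c"
    using order_tendstoD(2)[OF lim, of "ennreal c"] c by simp
  then show "\<forall>\<^sub>F k in sequentially. modular \<Omega> (\<lambda>_. q) (u k) < a"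
  proof eventually_elim
    case (elim k)
    have "modular \<Omega> (\<lambda>_. q) (u k) \<le> ennreal l * ennreal V + ennreal (l powr (1 - p / q)) * modular \<Omega> (\<lambda>_. p) (u k)"
      using modular_interpolate[OF pq u[of k] l(1) \<Omega>(1)] V by simp
    also have "\<dots> \<le> ennreal l * ennreal V + ennreal (l powr (1 - p / q)) * ennreal c"
      using elim by (intro add_left_mono mult_left_mono) auto
    also have "\<dots> = ennreal (l * V + l powr (1 - p / q) * c)"
      using l V c by (simp add: ennreal_mult)
    also have "\<dots> \<le> ennreal b" using l c by (intro ennreal_leI) auto
    finally show ?case using b(2) by (rule le_less_trans)
  qed
qed simp

lemma Lvar_1_iff_integrable:
  "u \<in> Lvar \<Omega> (\<lambda>_. 1) \<longleftrightarrow> integrable (lebesgue_on \<Omega>) u"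
  by (auto simp: Lvar_def modular_def integrable_iff_bounded)

section \<open>Integration by parts for functions with zero trace\<close>

lemma dist_segment_le:
  fixes x w x0 :: "'a::real_normed_vector"
  assumes "0 \<le> s" "s \<le> t" "norm w \<le> 2"
  shows "dist x0 (x + s *\<^sub>R w) \<le> dist x0 x + 2 * t" "dist x0 x \<le> dist x0 (x + s *\<^sub>R w) + 2 * t"
proof -
  have "norm (s *\<^sub>R w) \<le> t * 2" using assms by (auto intro!: mult_mono)
  then have "dist x (x + s *\<^sub>R w) \<le> 2 * t" by (simp add: dist_norm)
  then show "dist x0 (x + s *\<^sub>R w) \<le> dist x0 x + 2 * t" "dist x0 x \<le> dist x0 (x + s *\<^sub>R w) + 2 * t"
    using dist_triangle[of x0 "x + s *\<^sub>R w" x] dist_triangle[of x0 x "x + s *\<^sub>R w"] by (auto simp: dist_commute)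
qed

text \<open>The directional derivative of \<open>f \<eta>\<close> is the limit of the difference quotients along \<open>t w\<close>; by translation invariance
  their integrals cancel up to the layer treated in \<open>layer_integral\<close>.\<close>
lemma boundary_integral_bound:
  fixes \<Omega> :: "(real^'n) set"
  assumes n: "CARD('n) \<ge> 2" and \<Omega>: "open \<Omega>" "bounded \<Omega>"
    and cone: "graph_cone \<Omega> x0 r e \<delta>" and w: "w \<in> ball e \<delta>"
    and f: "C1_closure \<Omega> f" and \<eta>: "test_function UNIV \<eta>" "\<And>x. \<eta> x \<noteq> 0 \<Longrightarrow> x \<in> ball x0 (r / 2)"
  shows "ennreal \<bar>LINT x|lebesgue_on \<Omega>. (\<Sum>i\<in>UNIV. w $ i * (f x * D i \<eta> x + D i f x * \<eta> x))\<bar> \<le>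
    ennreal (tube_const TYPE('n)) * (\<integral>\<^sup>+x\<in>frontier \<Omega>. ennreal \<bar>f x * \<eta> x\<bar> \<partial>surface_measure)"
proof -
  have r: "r > 0" and nw: "norm w \<le> 2"
  proof -
    show "r > 0" using cone by (simp add: graph_cone_def)
    have "norm w \<le> norm e + norm (w - e)" by norm
    then show "norm w \<le> 2" using cone w by (simp add: graph_cone_def dist_norm norm_minus_commute)
  qed
  have tc: "tube_const TYPE('n) > 0" by (simp add: tube_const_def)
  have fc: "continuous_on (closure \<Omega>) f" and fd: "\<And>x. x \<in> \<Omega> \<Longrightarrow> f differentiable (at x)"
    using f by (auto simp: C1_closure_def)
  obtain h where h: "\<And>i. continuous_on (closure \<Omega>) (h i)" "\<And>i x. x \<in> \<Omega> \<Longrightarrow> h i x = D i f x"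
    using f unfolding C1_closure_def by metis
  have K: "compact (closure \<Omega>)" using \<Omega>(2) by (simp add: compact_closure)
  have c\<eta>: "continuous_on S \<eta>" "continuous_on S (D i \<eta>)" for S i
    using test_functionD(3,6)[OF \<eta>(1)] by (auto intro: continuous_on_subset)
  define g where "g x = f x * \<eta> x" for x
  have gc: "continuous_on (closure \<Omega>) g" unfolding g_def[abs_def] by (intro continuous_intros fc c\<eta>)
  define DG where "DG x = (\<Sum>i\<in>UNIV. w $ i * (f x * D i \<eta> x + D i f x * \<eta> x))" for x
  define DG' where "DG' x = (\<Sum>i\<in>UNIV. w $ i * (f x * D i \<eta> x + h i x * \<eta> x))" for x
  have DG': "DG x = DG' x" if "x \<in> \<Omega>" for x using h(2)[OF that] by (simp add: DG_def DG'_def)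
  have "continuous_on (closure \<Omega>) DG'" unfolding DG'_def[abs_def] by (intro continuous_intros fc c\<eta> h(1))
  then have "bounded (DG' ` closure \<Omega>)" by (intro compact_imp_bounded compact_continuous_image K)
  then obtain B1 where B1: "\<And>x. x \<in> closure \<Omega> \<Longrightarrow> \<bar>DG' x\<bar> \<le> B1" unfolding bounded_iff by (metis image_eqI real_norm_def)
  have "bounded (g ` closure \<Omega>)" by (intro compact_imp_bounded compact_continuous_image K gc)
  then obtain B where B: "\<And>x. x \<in> closure \<Omega> \<Longrightarrow> \<bar>g x\<bar> \<le> B" unfolding bounded_iff by (metis image_eqI real_norm_def)
  define G where "G x = (if x \<in> \<Omega> then g x else 0)" for x
  have GB: "\<bar>G x\<bar> \<le> \<bar>B\<bar>" for x using B[of x] closure_subset[of \<Omega>] by (auto simp: G_def)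
  have [measurable]: "\<Omega> \<in> sets borel" using \<Omega>(1) by simp
  have Gm[measurable]: "G \<in> borel_measurable borel"
    unfolding G_def using gc \<Omega>(1)
    by (intro borel_measurable_continuous_on_if) (auto intro: continuous_on_subset[OF _ closure_subset])
  have Gsupp: "x \<in> \<Omega> \<and> x \<in> ball x0 (r / 2)" if "G x \<noteq> 0" for x
    using that \<eta>(2)[of x] by (auto simp: G_def g_def split: if_splits)
  obtain R where R: "\<And>x. x \<in> \<Omega> \<Longrightarrow> norm x \<le> R" using \<Omega>(2) unfolding bounded_iff by blast
  have Gi: "integrable lborel G"
    using GB Gsupp R by (intro integrable_bounded_support[where B="\<bar>B\<bar>" and R=R]) auto
  have gdiff: "(G has_derivative (\<lambda>v. \<Sum>i\<in>UNIV. v $ i * (f x * D i \<eta> x + D i f x * \<eta> x))) (at x)" if x: "x \<in> \<Omega>" for x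
  proof -
    have d: "g differentiable (at x)" unfolding g_def[abs_def] using fd[OF x] test_functionD(2)[OF \<eta>(1)] by (intro differentiable_mult)
    have "D i g x = f x * D i \<eta> x + D i f x * \<eta> x" for i
      unfolding g_def[abs_def] by (rule D_mult[OF fd[OF x] test_functionD(2)[OF \<eta>(1)]])
    then have "(g has_derivative (\<lambda>v. \<Sum>i\<in>UNIV. v $ i * (f x * D i \<eta> x + D i f x * \<eta> x))) (at x)"
      using has_derivative_D_sum[OF d] by simp
    then show ?thesis by (rule has_derivative_transform_within_open[OF _ \<Omega>(1) x]) (simp add: G_def)
  qed
  have Gd: "G differentiable (at x)" "D i G x = f x * D i \<eta> x + D i f x * \<eta> x" if x: "x \<in> \<Omega>" for x i
    using gdiff[OF x] has_derivative_axis[OF gdiff[OF x], of i] by (auto simp: differentiable_def sum_axis_mult)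
  define t where "t m = r / (8 * real (Suc m))" for m
  have t: "t m > 0" "t m \<le> r / 8" for m
  proof -
    show "t m > 0" using r by (simp add: t_def)
    have "r * 1 \<le> r * real (Suc m)" using r by (intro mult_left_mono) auto
    then show "t m \<le> r / 8" unfolding t_def by (simp add: pos_divide_le_eq del: of_nat_Suc)
  qed
  have tlim: "t \<longlonglongrightarrow> 0"
  proof -
    have "(\<lambda>m. (r / 8) * inverse (real (Suc m))) \<longlonglongrightarrow> 0"
      by (rule tendsto_mult_right_zero[OF LIMSEQ_inverse_real_of_nat])
    moreover have "(r / 8) * inverse (real (Suc m)) = t m" for m
      unfolding t_def by (simp add: divide_simps del: of_nat_Suc)
    ultimately show ?thesis by (simp only:)
  qed
  define Q where "Q m x = (G (x + t m *\<^sub>R w) - G x) / t m" for m x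
  have Qm[measurable]: "Q m \<in> borel_measurable borel" for m unfolding Q_def[abs_def] by measurable
  have Gshift: "integrable lborel (\<lambda>x. G (x + a))" "(LINT x|lborel. G (x + a)) = integral\<^sup>L lborel G" for a
  proof -
    have "integrable (distr lborel borel ((+) a)) G" "integral\<^sup>L (distr lborel borel ((+) a)) G = integral\<^sup>L lborel G"
      using Gi by (simp_all add: lborel_distr_plus)
    then show "integrable lborel (\<lambda>x. G (x + a))" "(LINT x|lborel. G (x + a)) = integral\<^sup>L lborel G"
      by (simp_all add: integrable_distr_eq integral_distr add.commute)
  qed
  have Qi: "integrable lborel (Q m)" "integral\<^sup>L lborel (Q m) = 0" for m
    unfolding Q_def using Gi Gshift[of "t m *\<^sub>R w"] by auto
  define I where "I m = (LINT x|lborel. indicator \<Omega> x * Q m x)" for m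
  have indi: "integrable lborel (\<lambda>x. indicator A x * Q m x)" if "A \<in> sets borel" for A m
    using that Qi(1)[of m] by (intro integrable_mult_bounded[where B=1]) (auto simp: indicator_def)
  have Ieq: "I m = - (LINT x|lborel. indicator (- \<Omega>) x * Q m x)" for m
  proof -
    have "I m + (LINT x|lborel. indicator (- \<Omega>) x * Q m x) = (LINT x|lborel. indicator \<Omega> x * Q m x + indicator (- \<Omega>) x * Q m x)"
      unfolding I_def by (intro Bochner_Integration.integral_add[symmetric] indi) auto
    also have "\<dots> = integral\<^sup>L lborel (Q m)"
      by (intro Bochner_Integration.integral_cong) (auto simp: indicator_def)
    finally show ?thesis using Qi(2)[of m] by simp
  qed
  \<comment> \<open>Outside \<Omega> only the shifted value survives in the difference quotient, and
    it is nonzero only at points that t w carries into \<Omega>: the layer.\<close>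
  have Q_layer: "indicator (- \<Omega>) x * Q m x = (indicator (- \<Omega>) x * G (x + t m *\<^sub>R w)) / t m" for m x
    by (auto simp: indicator_def Q_def G_def)
  \<comment> \<open>The mean value theorem needs the whole segment in \<Omega>. Within 3r/4 of x0
    the cone property provides this, as the segment stays in the r-ball. Farther out both endpoints
    are outside the r/2-ball and G vanishes at them.\<close>
  have bound: "\<bar>indicator \<Omega> x * Q m x\<bar> \<le> \<bar>B1\<bar> * indicator (cball 0 R) x" for m x
  proof (cases "x \<in> \<Omega>")
    case x: True
    have "\<bar>Q m x\<bar> \<le> \<bar>B1\<bar>"
    proof (cases "dist x0 x < 3 * r / 4")
      case True
      have seg: "x + s *\<^sub>R w \<in> \<Omega>" if s: "0 \<le> s" "s \<le> t m" for s
      proof (cases "s = 0")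
        case False
        have "x \<in> ball x0 r" using True r by simp
        moreover have "x + s *\<^sub>R w \<in> ball x0 r" using dist_segment_le(1)[OF s nw, of x0 x] True t(2)[of m] r by simp
        ultimately show ?thesis using cone w s False x closure_subset[of \<Omega>] unfolding graph_cone_def by fastforce
      qed (use x in simp)
      have "\<exists>s. 0 < s \<and> s < t m \<and> G (x + t m *\<^sub>R w) - G (x + 0 *\<^sub>R w) = (t m - 0) * (\<Sum>i\<in>UNIV. w $ i * D i G (x + s *\<^sub>R w))"
        using t(1)[of m] by (intro MVT2 has_real_derivative_line Gd seg) auto
      then obtain s where s: "0 < s" "s < t m" "Q m x = (\<Sum>i\<in>UNIV. w $ i * D i G (x + s *\<^sub>R w))"
        using t(1)[of m] by (auto simp: Q_def)
      have y: "x + s *\<^sub>R w \<in> \<Omega>" using seg s by simp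
      have "Q m x = DG' (x + s *\<^sub>R w)" unfolding s(3) DG'[OF y, symmetric] DG_def Gd(2)[OF y] ..
      then show ?thesis using B1[of "x + s *\<^sub>R w"] y closure_subset[of \<Omega>] by auto
    next
      case False
      have "dist x0 (x + t m *\<^sub>R w) \<ge> r / 2"
        using dist_segment_le(2)[of "t m" "t m" w x0 x] t[of m] nw False by simp
      then have "G x = 0" "G (x + t m *\<^sub>R w) = 0" using Gsupp[of x] Gsupp[of "x + t m *\<^sub>R w"] False r by auto
      then show ?thesis by (simp add: Q_def)
    qed
    then show ?thesis using x R[OF x] by simp
  qed simp
  have lim: "(\<lambda>m. indicator \<Omega> x * Q m x) \<longlonglongrightarrow> indicator \<Omega> x * DG x" for x
  proof (cases "x \<in> \<Omega>")
    case True
    have "(\<lambda>m. Q m x) \<longlonglongrightarrow> (\<Sum>i\<in>UNIV. w $ i * D i G x)"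
      unfolding Q_def by (rule difference_quotient_tendsto[OF Gd(1)[OF True] t(1) tlim])
    then show ?thesis using True by (simp add: DG_def Gd(2)[OF True])
  qed simp
  have DGm: "(\<lambda>x. indicator \<Omega> x * DG x) \<in> borel_measurable borel"
    by (rule borel_measurable_LIMSEQ_real[OF lim]) measurable
  have Ilim: "I \<longlonglongrightarrow> (LINT x|lborel. indicator \<Omega> x * DG x)"
    unfolding I_def
  proof (rule integral_dominated_convergence[where w="\<lambda>x. \<bar>B1\<bar> * indicator (cball 0 R) x"])
    show "integrable lborel (\<lambda>x::real^'n. \<bar>B1\<bar> * indicator (cball 0 R) x)"
      by (intro integrable_mult_right integrable_real_indicator)
         (auto simp: emeasure_bounded_finite[OF bounded_cball, simplified])
  qed (use DGm lim bound in auto)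
  have DGI: "(LINT x|lborel. indicator \<Omega> x * DG x) = (LINT x|lebesgue_on \<Omega>. DG x)"
  proof -
    have "(LINT x|lborel. indicator \<Omega> x * DG x) = (LINT x|lebesgue_on \<Omega>. indicator \<Omega> x * DG x)"
      by (rule lebesgue_on_open_integral(1)[OF \<Omega>(1) DGm, symmetric]) simp
    also have "\<dots> = (LINT x|lebesgue_on \<Omega>. DG x)" by (intro Bochner_Integration.integral_cong) auto
    finally show ?thesis .
  qed
  let ?S = "\<integral>\<^sup>+x\<in>frontier \<Omega>. ennreal \<bar>g x\<bar> \<partial>surface_measure"
  let ?V = "8 / r * measure lborel (ball x0 r)"
  have V: "?V \<ge> 0" using r by simp
  have eps: "ennreal \<bar>LINT x|lborel. indicator \<Omega> x * DG x\<bar> \<le> ennreal (tube_const TYPE('n)) * ?S + ennreal (2 * \<epsilon> * ?V)" if \<epsilon>: "\<epsilon> > 0" for \<epsilon>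
  proof -
    have "uniformly_continuous_on (closure \<Omega>) g" by (rule compact_uniformly_continuous[OF gc K])
    then obtain d where d: "d > 0" "\<And>x y. x \<in> closure \<Omega> \<Longrightarrow> y \<in> closure \<Omega> \<Longrightarrow> dist y x < d \<Longrightarrow> dist (g y) (g x) < \<epsilon>"
      using \<epsilon> unfolding uniformly_continuous_on_def by metis
    \<comment> \<open>Half of d, because the layer estimate compares values at distance up to 2
      t.\<close>
    have ev: "\<forall>\<^sub>F m in sequentially. t m < d / 2" using order_tendstoD(2)[OF tlim, of "d / 2"] d(1) by simp
    have "\<forall>\<^sub>F m in sequentially. ennreal \<bar>I m\<bar> \<le> ennreal (tube_const TYPE('n)) * ?S + ennreal (2 * \<epsilon> * ?V)"
      using ev
    proof eventually_elim
      case (elim m)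
      have layer: "(\<integral>\<^sup>+x. ennreal \<bar>indicator (- \<Omega>) x * G (x + t m *\<^sub>R w)\<bar> \<partial>lborel) \<le>
          ennreal (tube_const TYPE('n) * t m) * ?S + ennreal (2 * \<epsilon> * (8 * t m / r * measure lborel (ball x0 r)))"
      proof (rule layer_integral[OF n \<Omega>(1) cone w t_def Gm _ _ GB _ \<epsilon>])
        show "x \<notin> \<Omega> \<Longrightarrow> G x = 0" for x by (simp add: G_def)
        show "G x \<noteq> 0 \<Longrightarrow> x \<in> ball x0 (3 * r / 4)" for x using Gsupp[of x] r by auto
        show "continuous_on (frontier \<Omega>) g" by (rule continuous_on_subset[OF gc]) (auto simp: frontier_def)
        show "\<bar>G x - g y\<bar> \<le> \<epsilon>" if "x \<in> \<Omega>" "y \<in> frontier \<Omega>" "dist x y \<le> 2 * t m" for x y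
        proof -
          have "dist (g x) (g y) < \<epsilon>"
            using that elim closure_subset[of \<Omega>] by (intro d(2)) (auto simp: frontier_def)
          then show ?thesis using that(1) by (simp add: G_def dist_real_def)
        qed
      qed
      have "ennreal \<bar>I m\<bar> = ennreal (norm (LINT x|lborel. (indicator (- \<Omega>) x * G (x + t m *\<^sub>R w)) / t m))"
        by (simp add: Ieq Q_layer)
      also have "\<dots> \<le> (\<integral>\<^sup>+x. norm ((indicator (- \<Omega>) x * G (x + t m *\<^sub>R w)) / t m) \<partial>lborel)"
        by (rule integral_norm_bound_ennreal) (use indi[of "- \<Omega>" m] in \<open>simp add: Q_layer\<close>)
      also have "\<dots> = (\<integral>\<^sup>+x. ennreal (1 / t m) * ennreal \<bar>indicator (- \<Omega>) x * G (x + t m *\<^sub>R w)\<bar> \<partial>lborel)"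
        using t(1)[of m] by (intro nn_integral_cong) (simp add: ennreal_mult[symmetric] abs_divide)
      also have "\<dots> = ennreal (1 / t m) * (\<integral>\<^sup>+x. ennreal \<bar>indicator (- \<Omega>) x * G (x + t m *\<^sub>R w)\<bar> \<partial>lborel)"
        by (rule nn_integral_cmult) measurable
      \<comment> \<open>Dividing by t removes it from both terms of the layer bound, so the estimate
        is uniform in m and passes to the limit.\<close>
      also have "\<dots> \<le> ennreal (1 / t m) * (ennreal (tube_const TYPE('n) * t m) * ?S + ennreal (2 * \<epsilon> * (8 * t m / r * measure lborel (ball x0 r))))"
        by (intro mult_left_mono layer) simp
      also have "\<dots> = ennreal (1 / t m) * ennreal (tube_const TYPE('n) * t m) * ?S + ennreal (1 / t m) * ennreal (2 * \<epsilon> * (8 * t m / r * measure lborel (ball x0 r)))"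
        by (simp only: distrib_left mult.assoc)
      also have "ennreal (1 / t m) * ennreal (tube_const TYPE('n) * t m) = ennreal (tube_const TYPE('n))"
        using t(1)[of m] tc by (simp add: ennreal_mult[symmetric])
      also have "ennreal (1 / t m) * ennreal (2 * \<epsilon> * (8 * t m / r * measure lborel (ball x0 r))) = ennreal (2 * \<epsilon> * ?V)"
        using t(1)[of m] r \<epsilon> by (simp add: ennreal_mult[symmetric] zero_le_mult_iff zero_le_divide_iff)
      finally show ?case .
    qed
    moreover have "(\<lambda>m. ennreal \<bar>I m\<bar>) \<longlonglongrightarrow> ennreal \<bar>LINT x|lborel. indicator \<Omega> x * DG x\<bar>"
      by (intro tendsto_ennrealI tendsto_rabs Ilim)
    ultimately show ?thesis by (intro tendsto_upperbound[of _ _ sequentially]) auto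
  qed
  have "ennreal \<bar>LINT x|lborel. indicator \<Omega> x * DG x\<bar> \<le> ennreal (tube_const TYPE('n)) * ?S"
  proof (rule ennreal_le_epsilon)
    fix \<epsilon> :: real assume \<epsilon>: "\<epsilon> > 0"
    \<comment> \<open>The error 2 \<epsilon>' V is brought below \<epsilon> by \<epsilon>' =
      \<epsilon>/(2 (V + 1)); the summand 1 avoids a case distinction on V = 0.\<close>
    have "2 * (c / (2 * (v + 1))) * v \<le> c" if "v \<ge> 0" "c > 0" for v c :: real using that by (simp add: field_simps)
    from this[OF V \<epsilon>] have "2 * (\<epsilon> / (2 * (?V + 1))) * ?V \<le> \<epsilon>" .
    moreover have "\<epsilon> / (2 * (?V + 1)) > 0" using V \<epsilon> by (intro divide_pos_pos) auto
    ultimately show "ennreal \<bar>LINT x|lborel. indicator \<Omega> x * DG x\<bar> \<le> ennreal (tube_const TYPE('n)) * ?S + ennreal \<epsilon>"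
      by (intro order_trans[OF eps[of "\<epsilon> / (2 * (?V + 1))"]] add_left_mono ennreal_leI)
  qed
  then have "ennreal \<bar>LINT x|lebesgue_on \<Omega>. DG x\<bar> \<le> ennreal (tube_const TYPE('n)) * ?S" unfolding DGI .
  then show ?thesis unfolding DG_def g_def .
qed

section \<open>Passage to the limit along C1 approximations\<close>

lemma C1_closure_weak_deriv:
  assumes "open \<Omega>" "C1_closure \<Omega> f"
  shows "weak_deriv \<Omega> f i (D i f)"
proof (rule weak_deriv_classical[OF assms(1)])
  show "x \<in> \<Omega> \<Longrightarrow> f differentiable (at x)" for x using assms(2) by (simp add: C1_closure_def)
  obtain h where h: "continuous_on (closure \<Omega>) h" "\<forall>x\<in>\<Omega>. h x = D i f x"
    using assms(2) unfolding C1_closure_def by blast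
  have "continuous_on \<Omega> h" using h(1) by (rule continuous_on_subset) (rule closure_subset)
  then show "continuous_on \<Omega> (D i f)"
    by (rule continuous_on_eq) (use h(2) in simp)
qed

lemma weak_deriv_measurable:
  fixes \<Omega> :: "(real^'n) set"
  assumes "open \<Omega>" "weak_deriv \<Omega> v i g"
  shows "v \<in> borel_measurable (lebesgue_on \<Omega>)" "g \<in> borel_measurable (lebesgue_on \<Omega>)"
  using assms loc_integrable_measurable by (auto simp: weak_deriv_def)

lemma tendsto_sum_0_imp_0:
  fixes f :: "nat \<Rightarrow> 'i \<Rightarrow> ennreal"
  assumes "(\<lambda>k. \<Sum>i\<in>A. f k i) \<longlonglongrightarrow> 0" "finite A" "i \<in> A"
  shows "(\<lambda>k. f k i) \<longlonglongrightarrow> 0"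
  by (rule tendsto_sandwich[OF _ _ tendsto_const assms(1)])
     (use assms in \<open>auto intro!: always_eventually member_le_sum\<close>)

lemma tendsto_add_0_imp_0:
  fixes f g :: "nat \<Rightarrow> ennreal"
  assumes "(\<lambda>k. f k + g k) \<longlonglongrightarrow> 0"
  shows "f \<longlonglongrightarrow> 0" "g \<longlonglongrightarrow> 0"
  by (rule tendsto_sandwich[OF _ _ tendsto_const assms]; auto intro!: always_eventually add_increasing add_increasing2)+

lemma W1_norm_tendsto_imp:
  fixes \<Omega> :: "(real^'n) set"
  assumes \<Omega>: "open \<Omega>" and p: "p > 0" and g: "\<And>k i. weak_deriv \<Omega> (u k) i (g k i)"
    and lim: "(\<lambda>k. W1_norm \<Omega> p (u k)) \<longlonglongrightarrow> 0"
  shows "(\<lambda>k. modular \<Omega> (\<lambda>_. p) (u k)) \<longlonglongrightarrow> 0" "(\<lambda>k. modular \<Omega> (\<lambda>_. p) (g k i)) \<longlonglongrightarrow> 0"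
proof -
  have *: "(\<lambda>k. Lnorm \<Omega> (\<lambda>_. p) (u k) + (\<Sum>i\<in>UNIV. Lnorm \<Omega> (\<lambda>_. p) (g k i))) \<longlonglongrightarrow> 0"
    using lim by (simp add: W1_norm_eq[OF \<Omega> g])
  show "(\<lambda>k. modular \<Omega> (\<lambda>_. p) (u k)) \<longlonglongrightarrow> 0"
    by (rule Lnorm_tendsto_imp_modular_tendsto[OF weak_deriv_measurable(1)[OF \<Omega> g] p tendsto_add_0_imp_0(1)[OF *]])
  show "(\<lambda>k. modular \<Omega> (\<lambda>_. p) (g k i)) \<longlonglongrightarrow> 0"
    by (rule Lnorm_tendsto_imp_modular_tendsto[OF weak_deriv_measurable(2)[OF \<Omega> g] p
          tendsto_sum_0_imp_0[OF tendsto_add_0_imp_0(2)[OF *]]]) auto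
qed

lemma tendsto_integral_mult_bounded:
  fixes u :: "nat \<Rightarrow> 'a \<Rightarrow> real"
  assumes b: "b \<in> borel_measurable M" "\<And>x. \<bar>b x\<bar> \<le> B"
    and u: "\<And>k. integrable M (u k)" "integrable M v"
    and lim: "(\<lambda>k. \<integral>\<^sup>+x. ennreal \<bar>u k x - v x\<bar> \<partial>M) \<longlonglongrightarrow> 0"
  shows "(\<lambda>k. LINT x|M. u k x * b x) \<longlonglongrightarrow> (LINT x|M. v x * b x)"
proof -
  have int: "integrable M (\<lambda>x. h x * b x)" if "integrable M h" for h
    using integrable_mult_bounded[OF that b] by (simp add: mult.commute)
  have "(\<lambda>k. ennreal \<bar>(LINT x|M. u k x * b x) - (LINT x|M. v x * b x)\<bar>) \<longlonglongrightarrow> 0"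
  proof (rule tendsto_sandwich[OF _ _ tendsto_const])
    have "(\<lambda>k. ennreal \<bar>B\<bar> * (\<integral>\<^sup>+x. ennreal \<bar>u k x - v x\<bar> \<partial>M)) \<longlonglongrightarrow> ennreal \<bar>B\<bar> * 0"
      by (intro ennreal_tendsto_cmult lim) simp
    then show "(\<lambda>k. ennreal \<bar>B\<bar> * (\<integral>\<^sup>+x. ennreal \<bar>u k x - v x\<bar> \<partial>M)) \<longlonglongrightarrow> 0" by simp
    have "ennreal \<bar>(LINT x|M. u k x * b x) - (LINT x|M. v x * b x)\<bar> \<le> ennreal \<bar>B\<bar> * (\<integral>\<^sup>+x. ennreal \<bar>u k x - v x\<bar> \<partial>M)" for k
    proof -
      have "(LINT x|M. u k x * b x) - (LINT x|M. v x * b x) = (LINT x|M. (u k x - v x) * b x)"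
        using int u by (subst Bochner_Integration.integral_diff[symmetric]) (auto simp: left_diff_distrib)
      then have "ennreal \<bar>(LINT x|M. u k x * b x) - (LINT x|M. v x * b x)\<bar> \<le> (\<integral>\<^sup>+x. norm ((u k x - v x) * b x) \<partial>M)"
        using integral_norm_bound_ennreal[OF int[of "\<lambda>x. u k x - v x"]] u by simp
      also have "\<dots> \<le> (\<integral>\<^sup>+x. ennreal \<bar>B\<bar> * ennreal \<bar>u k x - v x\<bar> \<partial>M)"
      proof (intro nn_integral_mono)
        fix x
        have "\<bar>b x\<bar> \<le> \<bar>B\<bar>" using b(2)[of x] by linarith
        then have "\<bar>u k x - v x\<bar> * \<bar>b x\<bar> \<le> \<bar>u k x - v x\<bar> * \<bar>B\<bar>" by (intro mult_left_mono) auto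
        then show "ennreal (norm ((u k x - v x) * b x)) \<le> ennreal \<bar>B\<bar> * ennreal \<bar>u k x - v x\<bar>"
          by (simp add: ennreal_mult[symmetric] abs_mult mult.commute ennreal_leI)
      qed
      also have "\<dots> = ennreal \<bar>B\<bar> * (\<integral>\<^sup>+x. ennreal \<bar>u k x - v x\<bar> \<partial>M)"
        using u by (intro nn_integral_cmult) auto
      finally show ?thesis .
    qed
    then show "\<forall>\<^sub>F k in sequentially. ennreal \<bar>(LINT x|M. u k x * b x) - (LINT x|M. v x * b x)\<bar> \<le> ennreal \<bar>B\<bar> * (\<integral>\<^sup>+x. ennreal \<bar>u k x - v x\<bar> \<partial>M)"
      by simp
  qed simp
  then have "(\<lambda>k. \<bar>(LINT x|M. u k x * b x) - (LINT x|M. v x * b x)\<bar>) \<longlonglongrightarrow> 0"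
    using tendsto_ennreal_iff[of "\<lambda>k. \<bar>(LINT x|M. u k x * b x) - (LINT x|M. v x * b x)\<bar>" sequentially 0] by simp
  then show ?thesis by (simp add: tendsto_rabs_zero_iff LIM_zero_iff)
qed

text \<open>For C1 approximations of v, \<open>boundary_integral_bound\<close> controls the
  integrated-by-parts expression by the L^1 norm of their boundary values, which tends to the trace,
  0. The limit expression is linear in w and so vanishes for every w in a ball.\<close>

lemma zero_trace_ibp:
  fixes \<Omega> :: "(real^'n) set"
  assumes n: "CARD('n) \<ge> 2" and \<Omega>: "open \<Omega>" "bounded \<Omega>"
    and cone: "graph_cone \<Omega> x0 r e \<delta>"
    and tr: "has_trace \<Omega> v (\<lambda>_. 0)" and g: "\<And>i. weak_deriv \<Omega> v i (g i)" and gi: "\<And>i. integrable (lebesgue_on \<Omega>) (g i)"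
    and \<eta>: "test_function UNIV \<eta>" "\<And>x. \<eta> x \<noteq> 0 \<Longrightarrow> x \<in> ball x0 (r / 2)"
  shows "(LINT x|lebesgue_on \<Omega>. v x * D i \<eta> x + g i x * \<eta> x) = 0"
proof -
  let ?M = "lebesgue_on \<Omega>"
  obtain f where f: "\<And>k. C1_closure \<Omega> (f k)" "(\<lambda>k. W1_norm \<Omega> 1 (\<lambda>x. f k x - v x)) \<longlonglongrightarrow> 0"
    "(\<lambda>k. \<integral>\<^sup>+x\<in>frontier \<Omega>. ennreal \<bar>f k x - 0\<bar> \<partial>surface_measure) \<longlonglongrightarrow> 0"
    using tr unfolding has_trace_def by blast
  have vi: "integrable ?M v"
    using tr by (simp add: has_trace_def W1_def Lvar_1_iff_integrable)
  have fw: "weak_deriv \<Omega> (f k) i (D i (f k))" for k i by (rule C1_closure_weak_deriv[OF \<Omega>(1) f(1)])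
  have dw: "weak_deriv \<Omega> (\<lambda>x. f k x - v x) i (\<lambda>x. D i (f k) x - g i x)" for k i
    using weak_deriv_add_scaled[where c="-1", OF \<Omega>(1) fw[of k i] g[of i]] by simp
  have fi: "integrable ?M (f k)" for k
  proof -
    have K: "compact (closure \<Omega>)" using \<Omega>(2) by (simp add: compact_closure)
    have "loc_integrable (closure \<Omega>) (f k)"
      using f(1)[of k] by (intro continuous_imp_loc_integrable) (simp add: C1_closure_def)
    then have "set_integrable lebesgue (closure \<Omega>) (f k)"
      using K unfolding loc_integrable_def set_integrable_def by (subst integrable_restrict_space[symmetric]) auto
    then have "set_integrable lebesgue \<Omega> (f k)"
      by (rule set_integrable_subset) (use \<Omega>(1) closure_subset in auto)
    then show ?thesis unfolding set_integrable_def using \<Omega>(1) by (subst integrable_restrict_space) auto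
  qed
  obtain h where h: "\<And>k i. continuous_on (closure \<Omega>) (h k i)" "\<And>k i x. x \<in> \<Omega> \<Longrightarrow> h k i x = D i (f k) x"
    using f(1) unfolding C1_closure_def by metis
  have Dfi: "integrable ?M (D i (f k))" for k i
  proof -
    have K: "compact (closure \<Omega>)" using \<Omega>(2) by (simp add: compact_closure)
    have "loc_integrable (closure \<Omega>) (h k i)"
      using h(1) by (intro continuous_imp_loc_integrable)
    then have "set_integrable lebesgue (closure \<Omega>) (h k i)"
      using K unfolding loc_integrable_def set_integrable_def by (subst integrable_restrict_space[symmetric]) auto
    then have "set_integrable lebesgue \<Omega> (h k i)"
      by (rule set_integrable_subset) (use \<Omega>(1) closure_subset in auto)
    then have "integrable ?M (h k i)" unfolding set_integrable_def using \<Omega>(1) by (subst integrable_restrict_space) auto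
    then show ?thesis by (subst Bochner_Integration.integrable_cong[where g="h k i", OF refl]) (auto simp: h(2))
  qed
  note lims = W1_norm_tendsto_imp[OF \<Omega>(1) _ dw f(2)]
  have flim: "(\<lambda>k. \<integral>\<^sup>+x. ennreal \<bar>f k x - v x\<bar> \<partial>?M) \<longlonglongrightarrow> 0"
    using lims(1) by (simp add: modular_def)
  have Dflim: "(\<lambda>k. \<integral>\<^sup>+x. ennreal \<bar>D i (f k) x - g i x\<bar> \<partial>?M) \<longlonglongrightarrow> 0" for i
    using lims(2)[of i] by (simp add: modular_def)
  obtain B where B: "B > 0" "\<And>x. \<bar>\<eta> x\<bar> \<le> B" using test_function_bounded[OF \<eta>(1)] by metis
  have "\<exists>B. \<forall>x. \<bar>D i \<eta> x\<bar> \<le> B" for i using test_function_bounded[OF test_function_D[OF \<eta>(1), of i]] by metis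
  then obtain B' where B': "\<And>i x. \<bar>D i \<eta> x\<bar> \<le> B' i" by metis
  have \<eta>m: "\<eta> \<in> borel_measurable ?M" "D i \<eta> \<in> borel_measurable ?M" for i
    using test_functionD(4,7)[OF \<eta>(1)] by (auto intro: borel_measurable_lebesgue_on)
  have int\<eta>: "integrable ?M (\<lambda>x. u x * D i \<eta> x)" "integrable ?M (\<lambda>x. u x * \<eta> x)" if "integrable ?M u" for u i
    using integrable_mult_bounded[OF that \<eta>m(2) B'] integrable_mult_bounded[OF that \<eta>m(1) B(2)] by (simp_all add: mult.commute)
  define c where "c i = (LINT x|?M. v x * D i \<eta> x) + (LINT x|?M. g i x * \<eta> x)" for i
  have L0: "(\<Sum>i\<in>UNIV. w $ i * c i) = 0" if w: "w \<in> ball e \<delta>" for w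
  proof -
    define L where "L k = (LINT x|?M. (\<Sum>i\<in>UNIV. w $ i * (f k x * D i \<eta> x + D i (f k) x * \<eta> x)))" for k
    have Leq: "L = (\<lambda>k. \<Sum>i\<in>UNIV. w $ i * ((LINT x|?M. f k x * D i \<eta> x) + (LINT x|?M. D i (f k) x * \<eta> x)))"
      unfolding L_def using int\<eta> fi Dfi by (simp add: fun_eq_iff)
    have "(\<lambda>k. \<Sum>i\<in>UNIV. w $ i * ((LINT x|?M. f k x * D i \<eta> x) + (LINT x|?M. D i (f k) x * \<eta> x))) \<longlonglongrightarrow> (\<Sum>i\<in>UNIV. w $ i * c i)"
      unfolding c_def
      by (intro tendsto_sum tendsto_mult tendsto_const tendsto_add
          tendsto_integral_mult_bounded[OF \<eta>m(2) B' fi vi flim] tendsto_integral_mult_bounded[OF \<eta>m(1) B(2) Dfi gi Dflim])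
    then have lim: "L \<longlonglongrightarrow> (\<Sum>i\<in>UNIV. w $ i * c i)" unfolding Leq .
    have "(\<lambda>k. ennreal \<bar>L k\<bar>) \<longlonglongrightarrow> 0"
    proof (rule tendsto_sandwich[OF _ _ tendsto_const])
      let ?C = "ennreal (tube_const TYPE('n)) * ennreal B"
      have "(\<lambda>k. ?C * (\<integral>\<^sup>+x\<in>frontier \<Omega>. ennreal \<bar>f k x - 0\<bar> \<partial>surface_measure)) \<longlonglongrightarrow> ?C * 0"
        by (intro ennreal_tendsto_cmult f(3)) (simp add: ennreal_mult_less_top)
      then show "(\<lambda>k. ?C * (\<integral>\<^sup>+x\<in>frontier \<Omega>. ennreal \<bar>f k x\<bar> \<partial>surface_measure)) \<longlonglongrightarrow> 0" by simp
      have "ennreal \<bar>L k\<bar> \<le> ?C * (\<integral>\<^sup>+x\<in>frontier \<Omega>. ennreal \<bar>f k x\<bar> \<partial>surface_measure)" for k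
      proof -
        have "continuous_on (frontier \<Omega>) (f k)"
          using f(1)[of k] by (auto simp: C1_closure_def frontier_def intro: continuous_on_subset)
        then have fm: "(\<lambda>x. if x \<in> frontier \<Omega> then f k x else 0) \<in> borel_measurable borel"
          by (intro borel_measurable_continuous_on_if) (auto simp: frontier_closed borel_closed)
        have eq: "ennreal \<bar>f k x\<bar> * indicator (frontier \<Omega>) x = ennreal \<bar>if x \<in> frontier \<Omega> then f k x else 0\<bar>" for x
          by (simp add: indicator_def)
        have "(\<lambda>x. ennreal \<bar>f k x\<bar> * indicator (frontier \<Omega>) x) \<in> borel_measurable surface_measure"
          unfolding eq surface_measure_def using fm by measurable
        note cm = nn_integral_cmult[OF this]
        have "ennreal \<bar>L k\<bar> \<le> ennreal (tube_const TYPE('n)) * (\<integral>\<^sup>+x\<in>frontier \<Omega>. ennreal \<bar>f k x * \<eta> x\<bar> \<partial>surface_measure)"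
          unfolding L_def by (rule boundary_integral_bound[OF n \<Omega> cone w f(1) \<eta>])
        also have "\<dots> \<le> ennreal (tube_const TYPE('n)) * (\<integral>\<^sup>+x. ennreal B * (ennreal \<bar>f k x\<bar> * indicator (frontier \<Omega>) x) \<partial>surface_measure)"
        proof (intro mult_left_mono nn_integral_mono)
          fix x
          have "ennreal \<bar>f k x * \<eta> x\<bar> \<le> ennreal (B * \<bar>f k x\<bar>)"
            using B(2)[of x] by (intro ennreal_leI) (simp add: abs_mult mult.commute mult_right_mono)
          also have "\<dots> = ennreal B * ennreal \<bar>f k x\<bar>" using B(1) by (simp add: ennreal_mult)
          finally show "ennreal \<bar>f k x * \<eta> x\<bar> * indicator (frontier \<Omega>) x \<le> ennreal B * (ennreal \<bar>f k x\<bar> * indicator (frontier \<Omega>) x)"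
            by (simp add: mult_right_mono mult.assoc[symmetric])
        qed simp
        also have "\<dots> = ?C * (\<integral>\<^sup>+x\<in>frontier \<Omega>. ennreal \<bar>f k x\<bar> \<partial>surface_measure)"
          unfolding cm by (simp only: mult.assoc)
        finally show ?thesis .
      qed
      then show "\<forall>\<^sub>F k in sequentially. ennreal \<bar>L k\<bar> \<le> ?C * (\<integral>\<^sup>+x\<in>frontier \<Omega>. ennreal \<bar>f k x\<bar> \<partial>surface_measure)" by simp
    qed simp
    then have "(\<lambda>k. \<bar>L k\<bar>) \<longlonglongrightarrow> 0"
      using tendsto_ennreal_iff[of "\<lambda>k. \<bar>L k\<bar>" sequentially 0] by simp
    then have "L \<longlonglongrightarrow> 0" by (simp add: tendsto_rabs_zero_iff)
    then show ?thesis using lim LIMSEQ_unique by blast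
  qed
  have d: "\<delta> > 0" using cone by (simp add: graph_cone_def)
  \<comment> \<open>The directions e and e + (\<delta>/2) \<open>axis i 1\<close> both lie in the
    ball; subtracting the two identities isolates the i-th component.\<close>
  have "(\<Sum>j\<in>UNIV. (e + (\<delta> / 2) *\<^sub>R axis i 1) $ j * c j) = 0"
    using d by (intro L0) (simp add: dist_norm)
  moreover have "(\<Sum>j\<in>UNIV. (e + (\<delta> / 2) *\<^sub>R axis i 1) $ j * c j) = (\<Sum>j\<in>UNIV. e $ j * c j) + (\<delta> / 2) * (\<Sum>j\<in>UNIV. axis i 1 $ j * c j)"
    by (simp add: distrib_right sum.distrib sum_distrib_left mult.assoc)
  moreover have "(\<Sum>j\<in>UNIV. e $ j * c j) = 0" using d by (intro L0) simp
  ultimately have "c i = 0" using d by (simp add: sum_axis_mult)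
  then show ?thesis
    unfolding c_def using int\<eta>(1)[OF vi] int\<eta>(2)[OF gi] by simp
qed

section \<open>Zero trace and approximation by test functions\<close>

text \<open>Approximability by test functions in W^{1,p}, stated through modulars and a given
  gradient g. In this form it is compatible with sums and with changes on null sets, and no
  representative chosen by \<open>wD\<close> interferes.\<close>

definition sobolev_approx :: "(real^'n) set \<Rightarrow> real \<Rightarrow> (real^'n \<Rightarrow> real) \<Rightarrow> ('n \<Rightarrow> real^'n \<Rightarrow> real) \<Rightarrow> bool" where
  "sobolev_approx \<Omega> p v g \<longleftrightarrow> (\<forall>\<epsilon>>0. \<exists>\<eta>. test_function \<Omega> \<eta> \<and> modular \<Omega> (\<lambda>_. p) (\<lambda>x. v x - \<eta> x) \<le> ennreal \<epsilon> \<and>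
     (\<forall>i. modular \<Omega> (\<lambda>_. p) (\<lambda>x. g i x - D i \<eta> x) \<le> ennreal \<epsilon>))"

lemma sobolev_approx_cong_AE:
  assumes "sobolev_approx \<Omega> p v g" "AE x in lebesgue_on \<Omega>. v x = v' x" "\<And>i. AE x in lebesgue_on \<Omega>. g i x = g' i x"
  shows "sobolev_approx \<Omega> p v' g'"
proof -
  have "modular \<Omega> (\<lambda>_. p) (\<lambda>x. v x - \<eta> x) = modular \<Omega> (\<lambda>_. p) (\<lambda>x. v' x - \<eta> x)" for \<eta>
    by (rule modular_cong_AE) (use assms(2) in \<open>auto elim: eventually_mono\<close>)
  moreover have "modular \<Omega> (\<lambda>_. p) (\<lambda>x. g i x - D i \<eta> x) = modular \<Omega> (\<lambda>_. p) (\<lambda>x. g' i x - D i \<eta> x)" for \<eta> i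
    by (rule modular_cong_AE) (use assms(3) in \<open>auto elim: eventually_mono\<close>)
  ultimately show ?thesis using assms(1) by (simp add: sobolev_approx_def)
qed

lemma modular_add_le:
  assumes "p \<ge> 0" "u \<in> borel_measurable (lebesgue_on \<Omega>)" "v \<in> borel_measurable (lebesgue_on \<Omega>)"
  shows "modular \<Omega> (\<lambda>_. p) (\<lambda>x. u x + v x) \<le> ennreal (2 powr p) * (modular \<Omega> (\<lambda>_. p) u + modular \<Omega> (\<lambda>_. p) v)"
  unfolding modular_def by (rule nn_integral_powr_add_le[OF assms])

lemma modular_minus: "modular \<Omega> r (\<lambda>x. v x - u x) = modular \<Omega> r (\<lambda>x. u x - v x)"
  unfolding modular_def by (simp add: abs_minus_commute)

lemma test_function_meas_on:
  assumes "test_function \<Omega> \<eta>"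
  shows "\<eta> \<in> borel_measurable (lebesgue_on \<Omega>')" "D i \<eta> \<in> borel_measurable (lebesgue_on \<Omega>')"
  using test_functionD(4,7)[OF assms] by (auto intro: borel_measurable_lebesgue_on)

lemma sobolev_approx_add:
  fixes \<Omega> :: "(real^'n) set"
  assumes p: "p \<ge> 1" and v: "v \<in> borel_measurable (lebesgue_on \<Omega>)" "v' \<in> borel_measurable (lebesgue_on \<Omega>)"
    and g: "\<And>i. g i \<in> borel_measurable (lebesgue_on \<Omega>)" "\<And>i. g' i \<in> borel_measurable (lebesgue_on \<Omega>)"
    and A: "sobolev_approx \<Omega> p v g" "sobolev_approx \<Omega> p v' g'"
  shows "sobolev_approx \<Omega> p (\<lambda>x. v x + v' x) (\<lambda>i x. g i x + g' i x)"
  unfolding sobolev_approx_def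
proof (intro allI impI)
  fix \<epsilon> :: real assume \<epsilon>: "\<epsilon> > 0"
  define e where "e = \<epsilon> / (2 * 2 powr p)"
  have e: "e > 0" "2 powr p * (e + e) = \<epsilon>" using \<epsilon> by (auto simp: e_def)
  obtain \<eta> where \<eta>: "test_function \<Omega> \<eta>" "modular \<Omega> (\<lambda>_. p) (\<lambda>x. v x - \<eta> x) \<le> ennreal e"
     "\<And>i. modular \<Omega> (\<lambda>_. p) (\<lambda>x. g i x - D i \<eta> x) \<le> ennreal e"
    using A(1) e(1) unfolding sobolev_approx_def by metis
  obtain \<eta>' where \<eta>': "test_function \<Omega> \<eta>'" "modular \<Omega> (\<lambda>_. p) (\<lambda>x. v' x - \<eta>' x) \<le> ennreal e"
     "\<And>i. modular \<Omega> (\<lambda>_. p) (\<lambda>x. g' i x - D i \<eta>' x) \<le> ennreal e"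
    using A(2) e(1) unfolding sobolev_approx_def by metis
  note meas = test_function_meas_on[OF \<eta>(1)] test_function_meas_on[OF \<eta>'(1)]
  have combine: "modular \<Omega> (\<lambda>_. p) (\<lambda>x. a x + b x) \<le> ennreal \<epsilon>"
    if "a \<in> borel_measurable (lebesgue_on \<Omega>)" "b \<in> borel_measurable (lebesgue_on \<Omega>)"
      "modular \<Omega> (\<lambda>_. p) a \<le> ennreal e" "modular \<Omega> (\<lambda>_. p) b \<le> ennreal e" for a b
  proof -
    have "modular \<Omega> (\<lambda>_. p) (\<lambda>x. a x + b x) \<le> ennreal (2 powr p) * (ennreal e + ennreal e)"
      using that p by (intro order_trans[OF modular_add_le] mult_left_mono add_mono) auto
    also have "ennreal e + ennreal e = ennreal (e + e)" using e(1) by (intro ennreal_plus[symmetric]) auto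
    also have "ennreal (2 powr p) * ennreal (e + e) = ennreal (2 powr p * (e + e))" using ennreal_mult'[of "2 powr p" "e + e"] by simp
    finally show ?thesis using e(2) by simp
  qed
  show "\<exists>\<eta>. test_function \<Omega> \<eta> \<and> modular \<Omega> (\<lambda>_. p) (\<lambda>x. (v x + v' x) - \<eta> x) \<le> ennreal \<epsilon> \<and>
     (\<forall>i. modular \<Omega> (\<lambda>_. p) (\<lambda>x. (g i x + g' i x) - D i \<eta> x) \<le> ennreal \<epsilon>)"
  proof (intro exI[of _ "\<lambda>x. \<eta> x + \<eta>' x"] conjI allI)
    show "test_function \<Omega> (\<lambda>x. \<eta> x + \<eta>' x)" by (rule test_function_add[OF \<eta>(1) \<eta>'(1)])
    have "modular \<Omega> (\<lambda>_. p) (\<lambda>x. (v x - \<eta> x) + (v' x - \<eta>' x)) \<le> ennreal \<epsilon>"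
      by (intro combine \<eta> \<eta>' borel_measurable_diff v meas)
    then show "modular \<Omega> (\<lambda>_. p) (\<lambda>x. (v x + v' x) - (\<eta> x + \<eta>' x)) \<le> ennreal \<epsilon>"
      by (simp add: algebra_simps)
    fix i
    have "modular \<Omega> (\<lambda>_. p) (\<lambda>x. (g i x - D i \<eta> x) + (g' i x - D i \<eta>' x)) \<le> ennreal \<epsilon>"
      by (intro combine \<eta> \<eta>' borel_measurable_diff g meas)
    moreover have "D i (\<lambda>x. \<eta> x + \<eta>' x) x = D i \<eta> x + D i \<eta>' x" for x
      by (rule D_add[OF test_functionD(2)[OF \<eta>(1)] test_functionD(2)[OF \<eta>'(1)]])
    ultimately show "modular \<Omega> (\<lambda>_. p) (\<lambda>x. (g i x + g' i x) - D i (\<lambda>x. \<eta> x + \<eta>' x) x) \<le> ennreal \<epsilon>"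
      by (simp add: algebra_simps)
  qed
qed

text \<open>The last hypothesis leaves room to shift the support \<open>S\<close> into \<open>\<Omega>\<close> by arbitrarily small vectors.\<close>
lemma mollify_into_domain:
  fixes \<Omega> S :: "(real^'n) set"
  assumes p: "p \<ge> 1" and S: "compact S"
    and U: "U \<in> borel_measurable borel" "\<And>x. x \<notin> S \<Longrightarrow> U x = 0" "(\<integral>\<^sup>+x. ennreal (\<bar>U x\<bar> powr p) \<partial>lborel) < \<infinity>" "integrable lborel U"
    and H: "\<And>i. H i \<in> borel_measurable borel" "\<And>i x. x \<notin> S \<Longrightarrow> H i x = 0" "\<And>i. (\<integral>\<^sup>+x. ennreal (\<bar>H i x\<bar> powr p) \<partial>lborel) < \<infinity>"
      "\<And>i. integrable lborel (H i)"
    and ibp: "\<And>\<eta> i. test_function UNIV \<eta> \<Longrightarrow> (LINT x|lborel. U x * D i \<eta> x + H i x * \<eta> x) = 0"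
    and room: "\<And>d. d > 0 \<Longrightarrow> \<exists>a \<rho>. \<rho> > 0 \<and> cball a \<rho> \<subseteq> ball 0 d \<and> (\<forall>y\<in>S. \<forall>z\<in>cball a \<rho>. y + z \<in> \<Omega>)"
    and \<epsilon>: "\<epsilon> > 0"
  shows "\<exists>\<eta>. test_function \<Omega> \<eta> \<and> (\<integral>\<^sup>+x. ennreal (\<bar>\<eta> x - U x\<bar> powr p) \<partial>lborel) \<le> ennreal \<epsilon> \<and>
     (\<forall>i. (\<integral>\<^sup>+x. ennreal (\<bar>D i \<eta> x - H i x\<bar> powr p) \<partial>lborel) \<le> ennreal \<epsilon>)"
proof -
  obtain R where R: "\<And>x. x \<in> S \<Longrightarrow> norm x \<le> R" using compact_imp_bounded[OF S] unfolding bounded_iff by blast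
  have p0: "p > 0" using p by simp
  have "U x \<noteq> 0 \<Longrightarrow> norm x \<le> R" for x using U(2) R by blast
  then obtain d0 where d0: "d0 > 0" "\<And>z. norm z < d0 \<Longrightarrow> (\<integral>\<^sup>+x. ennreal (\<bar>U (x - z) - U x\<bar> powr p) \<partial>lborel) \<le> ennreal \<epsilon>"
    using Lp_translation_continuous[OF p0 U(1,3) _ \<epsilon>] by blast
  have "\<exists>d>0. \<forall>z. norm z < d \<longrightarrow> (\<integral>\<^sup>+x. ennreal (\<bar>H i (x - z) - H i x\<bar> powr p) \<partial>lborel) \<le> ennreal \<epsilon>" for i
  proof -
    have "H i x \<noteq> 0 \<Longrightarrow> norm x \<le> R" for x using H(2) R by blast
    then show ?thesis using Lp_translation_continuous[OF p0 H(1,3) _ \<epsilon>, of i] by blast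
  qed
  then obtain \<delta> where \<delta>: "\<And>i. \<delta> i > 0" "\<And>i z. norm z < \<delta> i \<Longrightarrow> (\<integral>\<^sup>+x. ennreal (\<bar>H i (x - z) - H i x\<bar> powr p) \<partial>lborel) \<le> ennreal \<epsilon>"
    by metis
  define d where "d = min d0 (Min (range \<delta>))"
  have d: "d > 0" "d \<le> d0" "\<And>i. d \<le> \<delta> i" using d0(1) \<delta>(1) by (auto simp: d_def min_le_iff_disj)
  obtain a \<rho> where a: "\<rho> > 0" "cball a \<rho> \<subseteq> ball 0 d" "\<And>y z. y \<in> S \<Longrightarrow> z \<in> cball a \<rho> \<Longrightarrow> y + z \<in> \<Omega>"
    using room[OF d(1)] by blast
  \<comment> \<open>The kernel is centred at a, not at 0. Convolution with it smooths and at the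
    same time shifts the support by vectors near a, hence into \<Omega>.\<close>
  obtain k where k: "test_function UNIV k" "\<And>x. k x \<ge> 0" "\<And>x. k x \<noteq> 0 \<Longrightarrow> x \<in> ball a \<rho>" "integral\<^sup>L lborel k = 1"
    using kernel_exists[OF a(1), of a] by metis
  have small: "norm z < d" if "k z \<noteq> 0" for z
  proof -
    have "z \<in> cball a \<rho>" using k(3)[OF that] by auto
    then show ?thesis using a(2) by auto
  qed
  \<comment> \<open>Integration by parts on the whole space, tested with y \<mapsto> k(x - y), moves
    the derivative from the kernel to U. This is where differentiability of the zero extension
    across the boundary is used.\<close>
  have conv_eq: "conv (D i k) U x = conv k (H i) x" for i x
  proof -
    let ?\<eta> = "\<lambda>y. k (x + (-1) *\<^sub>R y)"
    have t: "test_function UNIV ?\<eta>"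
    proof -
      obtain R where R: "\<And>x. k x \<noteq> 0 \<Longrightarrow> norm x \<le> R" using test_function_support_cball[OF k(1)] by metis
      have "closure {y. ?\<eta> y \<noteq> 0} \<subseteq> cball x R"
        by (rule closure_minimal) (use R in \<open>auto simp: dist_norm\<close>)
      moreover have "Ck j ?\<eta>" for j by (rule Ck_affine[OF test_functionD(1)[OF k(1)]])
      ultimately show ?thesis using compact_closed_subset[OF compact_cball closed_closure] by (auto simp: test_function_def)
    qed
    have D\<eta>: "D i ?\<eta> y = - D i k (x - y)" for y
      using D_affine(2)[OF test_functionD(2)[OF k(1)], of i x "-1" y] by simp
    have "(LINT y|lborel. U y * D i ?\<eta> y + H i y * ?\<eta> y) = 0" by (rule ibp[OF t])
    also have "(LINT y|lborel. U y * D i ?\<eta> y + H i y * ?\<eta> y) = (LINT y|lborel. k (x - y) * H i y - D i k (x - y) * U y)"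
      by (intro Bochner_Integration.integral_cong refl) (simp only: D\<eta>, simp add: mult.commute)
    also have "\<dots> = conv k (H i) x - conv (D i k) U x"
      unfolding conv_def by (intro Bochner_Integration.integral_diff integrable_conv_integrand k(1) H(4) U(4) test_function_D)
    finally show ?thesis by simp
  qed
  let ?K = "{y + z |y z. y \<in> S \<and> z \<in> cball a \<rho>}"
  show ?thesis
  proof (intro exI[of _ "conv k U"] conjI allI)
    show "test_function \<Omega> (conv k U)"
    proof (rule test_function_conv[OF k(1) U(4)])
      show "compact ?K" by (rule compact_sums[OF S compact_cball])
      show "?K \<subseteq> \<Omega>" using a(3) by auto
      fix x y assume "k (x - y) \<noteq> 0" "U y \<noteq> 0"
      then have "y \<in> S" "x - y \<in> cball a \<rho>" using U(2) k(3)[of "x - y"] by (blast, auto)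
      then show "x \<in> ?K" by (intro CollectI exI[of _ y] exI[of _ "x - y"]) auto
    qed
    show "(\<integral>\<^sup>+x. ennreal (\<bar>conv k U x - U x\<bar> powr p) \<partial>lborel) \<le> ennreal \<epsilon>"
      by (rule conv_mollify[OF p U(4) k(1,2,4)], rule d0(2), rule less_le_trans[OF small d(2)])
    show "(\<integral>\<^sup>+x. ennreal (\<bar>D i (conv k U) x - H i x\<bar> powr p) \<partial>lborel) \<le> ennreal \<epsilon>" for i
      unfolding D_conv[OF k(1) U(4)] conv_eq
      by (rule conv_mollify[OF p H(4) k(1,2,4)], rule \<delta>(2), rule less_le_trans[OF small d(3)])
  qed
qed

section \<open>Approximation of localised pieces\<close>

lemma modular_mult_bounded:
  fixes b u :: "real^'n \<Rightarrow> real"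
  assumes p: "p \<ge> 1" and u: "modular \<Omega> (\<lambda>_. p) u < \<infinity>" "u \<in> borel_measurable (lebesgue_on \<Omega>)" and b: "\<And>x. \<bar>b x\<bar> \<le> C"
  shows "modular \<Omega> (\<lambda>_. p) (\<lambda>x. b x * u x) < \<infinity>"
proof -
  have "modular \<Omega> (\<lambda>_. p) (\<lambda>x. b x * u x) \<le> (\<integral>\<^sup>+x. ennreal (C powr p) * ennreal (\<bar>u x\<bar> powr p) \<partial>lebesgue_on \<Omega>)"
    unfolding modular_def
  proof (intro nn_integral_mono)
    fix x
    have "C \<ge> 0" using order_trans[OF abs_ge_zero b] by blast
    then have "\<bar>b x * u x\<bar> powr p \<le> C powr p * \<bar>u x\<bar> powr p"
      using b[of x] p by (simp add: abs_mult powr_mult mult_right_mono powr_mono2)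
    then show "ennreal (\<bar>b x * u x\<bar> powr p) \<le> ennreal (C powr p) * ennreal (\<bar>u x\<bar> powr p)"
      by (simp add: ennreal_mult[symmetric] ennreal_leI)
  qed
  also have "\<dots> = ennreal (C powr p) * modular \<Omega> (\<lambda>_. p) u"
    unfolding modular_def using u by (intro nn_integral_cmult) auto
  also have "\<dots> < \<infinity>" using u by (simp add: ennreal_mult_less_top)
  finally show ?thesis .
qed

lemma Lvar_mult_bounded:
  fixes b u :: "real^'n \<Rightarrow> real"
  assumes "p \<ge> 1" "u \<in> Lvar \<Omega> (\<lambda>_. p)" "b \<in> borel_measurable (lebesgue_on \<Omega>)" "\<And>x. \<bar>b x\<bar> \<le> C"
  shows "(\<lambda>x. b x * u x) \<in> Lvar \<Omega> (\<lambda>_. p)"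
  using assms modular_mult_bounded[of p \<Omega> u b C] by (auto simp: Lvar_def)

lemma Lvar_add:
  fixes u v :: "real^'n \<Rightarrow> real"
  assumes "p \<ge> 1" "u \<in> Lvar \<Omega> (\<lambda>_. p)" "v \<in> Lvar \<Omega> (\<lambda>_. p)"
  shows "(\<lambda>x. u x + v x) \<in> Lvar \<Omega> (\<lambda>_. p)"
proof -
  have "modular \<Omega> (\<lambda>_. p) (\<lambda>x. u x + v x) \<le> ennreal (2 powr p) * (modular \<Omega> (\<lambda>_. p) u + modular \<Omega> (\<lambda>_. p) v)"
    using assms by (intro modular_add_le) (auto simp: Lvar_def)
  also have "\<dots> < \<infinity>" using assms by (simp add: Lvar_def ennreal_mult_less_top)
  finally show ?thesis using assms by (auto simp add: Lvar_def)
qed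

text \<open>The hypothesis \<open>ibp\<close> admits \<eta> that do not vanish near the boundary. It
  thus says that \<zeta> v, extended by zero, has the product-rule expression as its weak gradient
  on the whole space, and \<open>mollify_into_domain\<close> applies to the extension.\<close>

lemma sobolev_approx_piece:
  fixes \<Omega> :: "(real^'n) set"
  assumes p: "p \<ge> 1" and \<Omega>: "open \<Omega>" "bounded \<Omega>"
    and v: "v \<in> Lvar \<Omega> (\<lambda>_. p)" and g: "\<And>i. g i \<in> Lvar \<Omega> (\<lambda>_. p)"
    and \<zeta>: "test_function UNIV \<zeta>"
    and ibp: "\<And>\<eta> i. test_function UNIV \<eta> \<Longrightarrow>
       (LINT x|lebesgue_on \<Omega>. v x * D i (\<lambda>x. \<eta> x * \<zeta> x) x + g i x * (\<eta> x * \<zeta> x)) = 0"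
    and room: "\<And>d. d > 0 \<Longrightarrow> \<exists>a \<rho>. \<rho> > 0 \<and> cball a \<rho> \<subseteq> ball 0 d \<and>
       (\<forall>y\<in>closure \<Omega> \<inter> closure {x. \<zeta> x \<noteq> 0}. \<forall>z\<in>cball a \<rho>. y + z \<in> \<Omega>)"
  shows "sobolev_approx \<Omega> p (\<lambda>x. \<zeta> x * v x) (\<lambda>i x. \<zeta> x * g i x + D i \<zeta> x * v x)"
proof -
  let ?M = "lebesgue_on \<Omega>"
  let ?S = "closure \<Omega> \<inter> closure {x. \<zeta> x \<noteq> 0}"
  obtain B where B: "B > 0" "\<And>x. \<bar>\<zeta> x\<bar> \<le> B" using test_function_bounded[OF \<zeta>] by metis
  have "\<exists>B. \<forall>x. \<bar>D i \<zeta> x\<bar> \<le> B" for i using test_function_bounded[OF test_function_D[OF \<zeta>, of i]] by metis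
  then obtain B' where B': "\<And>i x. \<bar>D i \<zeta> x\<bar> \<le> B' i" by metis
  have vm: "v \<in> borel_measurable ?M" and vp: "modular \<Omega> (\<lambda>_. p) v < \<infinity>" using v by (auto simp: Lvar_def)
  have gm: "g i \<in> borel_measurable ?M" and gp: "modular \<Omega> (\<lambda>_. p) (g i) < \<infinity>" for i using g by (auto simp: Lvar_def)
  have meas: "\<zeta> \<in> borel_measurable ?M" "D i \<zeta> \<in> borel_measurable ?M" for i using test_function_meas_on[OF \<zeta>] by auto
  note bdd = modular_mult_bounded[OF p]
  define u where "u x = \<zeta> x * v x" for x
  define h where "h i x = \<zeta> x * g i x + D i \<zeta> x * v x" for i x
  have um: "u \<in> borel_measurable ?M" unfolding u_def[abs_def] using vm meas by simp
  have hm: "h i \<in> borel_measurable ?M" for i unfolding h_def[abs_def] using vm gm meas by simp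
  have up: "modular \<Omega> (\<lambda>_. p) u < \<infinity>" unfolding u_def[abs_def] by (rule bdd[OF vp vm B(2)])
  have hp: "modular \<Omega> (\<lambda>_. p) (h i) < \<infinity>" for i
  proof -
    have "modular \<Omega> (\<lambda>_. p) (h i) \<le> ennreal (2 powr p) * (modular \<Omega> (\<lambda>_. p) (\<lambda>x. \<zeta> x * g i x) + modular \<Omega> (\<lambda>_. p) (\<lambda>x. D i \<zeta> x * v x))"
      unfolding h_def[abs_def] using p vm gm meas by (intro modular_add_le) auto
    also have "\<dots> < \<infinity>" using bdd[OF gp gm B(2)] bdd[OF vp vm B'] by (simp add: ennreal_mult_less_top)
    finally show ?thesis .
  qed
  have outside: "u x = 0" "h i x = 0" if "x \<notin> closure {x. \<zeta> x \<noteq> 0}" for x i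
    using that closure_subset[of "{x. \<zeta> x \<noteq> 0}"] D_zero_outside[OF that] by (auto simp: u_def h_def)
  have rep: "\<exists>U. U \<in> borel_measurable borel \<and> (\<forall>x. x \<notin> \<Omega> \<or> x \<notin> closure {x. \<zeta> x \<noteq> 0} \<longrightarrow> U x = 0) \<and>
      (AE x in ?M. U x = f x)"
    if fm: "f \<in> borel_measurable ?M" and f0: "\<And>x. x \<notin> closure {x. \<zeta> x \<noteq> 0} \<Longrightarrow> f x = 0" for f :: "real^'n \<Rightarrow> real"
  proof -
    obtain F where F: "F \<in> borel_measurable borel" "\<And>x. x \<notin> \<Omega> \<Longrightarrow> F x = 0" "AE x in ?M. F x = f x"
      using borel_representative[OF \<Omega>(1) fm] by blast
    show ?thesis
    proof (intro exI[of _ "\<lambda>x. indicator (closure {x. \<zeta> x \<noteq> 0}) x * F x"] conjI)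
      show "(\<lambda>x. indicator (closure {x. \<zeta> x \<noteq> 0}) x * F x) \<in> borel_measurable borel" using F(1) by measurable
      show "AE x in ?M. indicator (closure {x. \<zeta> x \<noteq> 0}) x * F x = f x"
        using F(3) by eventually_elim (use f0 in \<open>auto simp: indicator_def\<close>)
    qed (use F(2) in \<open>auto simp: indicator_def\<close>)
  qed
  obtain U where U: "U \<in> borel_measurable borel" "\<And>x. x \<notin> \<Omega> \<or> x \<notin> closure {x. \<zeta> x \<noteq> 0} \<Longrightarrow> U x = 0" "AE x in ?M. U x = u x"
    using rep[OF um outside(1)] by blast
  have "\<forall>i. \<exists>H. H \<in> borel_measurable borel \<and> (\<forall>x. x \<notin> \<Omega> \<or> x \<notin> closure {x. \<zeta> x \<noteq> 0} \<longrightarrow> H x = 0) \<and> (AE x in ?M. H x = h i x)"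
    by (intro allI rep[OF hm outside(2)])
  from choice[OF this] obtain H where H: "\<And>i. H i \<in> borel_measurable borel" "\<And>i x. x \<notin> \<Omega> \<or> x \<notin> closure {x. \<zeta> x \<noteq> 0} \<Longrightarrow> H i x = 0" "\<And>i. AE x in ?M. H i x = h i x"
    by blast
  have mod_eq: "(\<integral>\<^sup>+x. ennreal (\<bar>F x\<bar> powr p) \<partial>lborel) = modular \<Omega> (\<lambda>_. p) f"
    if "F \<in> borel_measurable borel" "\<And>x. x \<notin> \<Omega> \<Longrightarrow> F x = 0" "AE x in ?M. F x = f x" for F f
  proof -
    have "modular \<Omega> (\<lambda>_. p) f = modular \<Omega> (\<lambda>_. p) F"
      by (rule modular_cong_AE) (use that(3) in \<open>auto elim: eventually_mono\<close>)
    also have "\<dots> = (\<integral>\<^sup>+x. ennreal (\<bar>F x\<bar> powr p) \<partial>lborel)"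
      unfolding modular_def using that by (intro lebesgue_on_open_nn_integral \<Omega>) auto
    finally show ?thesis by simp
  qed
  have Ip: "integrable ?M f" if "f \<in> borel_measurable ?M" "modular \<Omega> (\<lambda>_. p) f < \<infinity>" for f
  proof -
    have "f \<in> Lvar \<Omega> (\<lambda>_. p)" using that by (simp add: Lvar_def)
    then have "f \<in> Lvar \<Omega> (\<lambda>_. 1)" by (rule Lvar_mono_exponent[rotated 2]) (use p \<Omega> in auto)
    then show ?thesis by (simp add: Lvar_1_iff_integrable)
  qed
  have Fi: "integrable lborel F"
    if "F \<in> borel_measurable borel" "\<And>x. x \<notin> \<Omega> \<Longrightarrow> F x = 0" "AE x in ?M. F x = f x" "f \<in> borel_measurable ?M" "modular \<Omega> (\<lambda>_. p) f < \<infinity>" for F f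
  proof -
    have "integrable ?M F"
      using integrable_cong_AE[of F ?M f] borel_measurable_lebesgue_on[OF that(1)] that Ip by blast
    then show ?thesis using lebesgue_on_open_integral(2)[OF \<Omega>(1) that(1,2)] by simp
  qed
  have Ui: "integrable lborel U" by (rule Fi[OF U(1) _ U(3) um up]) (use U(2) in auto)
  have Hi: "integrable lborel (H i)" for i by (rule Fi[OF H(1) _ H(3) hm hp]) (use H(2) in auto)
  have IBP: "(LINT x|lborel. U x * D i \<eta> x + H i x * \<eta> x) = 0" if \<eta>: "test_function UNIV \<eta>" for \<eta> i
  proof -
    have "(LINT x|lborel. U x * D i \<eta> x + H i x * \<eta> x) = (LINT x|?M. U x * D i \<eta> x + H i x * \<eta> x)"
      using U H test_functionD(4,7)[OF \<eta>] by (intro lebesgue_on_open_integral(1)[OF \<Omega>(1), symmetric]) auto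
    also have "\<dots> = (LINT x|?M. v x * D i (\<lambda>x. \<eta> x * \<zeta> x) x + g i x * (\<eta> x * \<zeta> x))"
    proof (rule integral_cong_AE)
      have D\<eta>\<zeta>: "D i (\<lambda>x. \<eta> x * \<zeta> x) x = \<eta> x * D i \<zeta> x + D i \<eta> x * \<zeta> x" for x
        by (rule D_mult[OF test_functionD(2)[OF \<eta>] test_functionD(2)[OF \<zeta>]])
      show "AE x in ?M. U x * D i \<eta> x + H i x * \<eta> x = v x * D i (\<lambda>x. \<eta> x * \<zeta> x) x + g i x * (\<eta> x * \<zeta> x)"
        using U(3) H(3)[of i] by eventually_elim (simp add: D\<eta>\<zeta> u_def h_def algebra_simps)
      have "test_function UNIV (\<lambda>x. \<eta> x * \<zeta> x)" by (rule test_function_mult[OF \<zeta> test_functionD(1)[OF \<eta>]])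
      then show "(\<lambda>x. v x * D i (\<lambda>x. \<eta> x * \<zeta> x) x + g i x * (\<eta> x * \<zeta> x)) \<in> borel_measurable ?M"
        using test_function_meas_on(2)[of UNIV "\<lambda>x. \<eta> x * \<zeta> x"] test_function_meas_on(1)[OF \<eta>] test_function_meas_on(1)[OF \<zeta>] vm gm
        by (intro borel_measurable_add borel_measurable_times) auto
      show "(\<lambda>x. U x * D i \<eta> x + H i x * \<eta> x) \<in> borel_measurable ?M"
        using U(1) H(1) test_functionD(4,7)[OF \<eta>] by (intro borel_measurable_lebesgue_on) auto
    qed
    also have "\<dots> = 0" by (rule ibp[OF \<eta>])
    finally show ?thesis .
  qed
  have "sobolev_approx \<Omega> p u h"
    unfolding sobolev_approx_def
  proof (intro allI impI)
    fix \<epsilon> :: real assume \<epsilon>: "\<epsilon> > 0"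
    have "\<exists>\<eta>. test_function \<Omega> \<eta> \<and> (\<integral>\<^sup>+x. ennreal (\<bar>\<eta> x - U x\<bar> powr p) \<partial>lborel) \<le> ennreal \<epsilon> \<and>
       (\<forall>i. (\<integral>\<^sup>+x. ennreal (\<bar>D i \<eta> x - H i x\<bar> powr p) \<partial>lborel) \<le> ennreal \<epsilon>)"
    proof (rule mollify_into_domain[where S="?S"])
      show "compact ?S" using \<zeta> \<Omega>(2) by (intro closed_Int_compact) (auto simp: test_function_def)
      show "U x = 0" if "x \<notin> ?S" for x using that U(2) closure_subset[of \<Omega>] by blast
      show "H i x = 0" if "x \<notin> ?S" for x i using that H(2) closure_subset[of \<Omega>] by blast
      show "(\<integral>\<^sup>+x. ennreal (\<bar>U x\<bar> powr p) \<partial>lborel) < \<infinity>" using mod_eq[OF U(1) _ U(3)] U(2) up by auto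
      show "(\<integral>\<^sup>+x. ennreal (\<bar>H i x\<bar> powr p) \<partial>lborel) < \<infinity>" for i using mod_eq[OF H(1) _ H(3)] H(2) hp by auto
      show "\<exists>a \<rho>. \<rho> > 0 \<and> cball a \<rho> \<subseteq> ball 0 d \<and> (\<forall>y\<in>?S. \<forall>z\<in>cball a \<rho>. y + z \<in> \<Omega>)" if "d > 0" for d
        by (rule room[OF that])
    qed (use p U(1) Ui H(1) Hi IBP \<epsilon> in auto)
    then obtain \<eta> where \<eta>: "test_function \<Omega> \<eta>" "(\<integral>\<^sup>+x. ennreal (\<bar>\<eta> x - U x\<bar> powr p) \<partial>lborel) \<le> ennreal \<epsilon>"
       "\<And>i. (\<integral>\<^sup>+x. ennreal (\<bar>D i \<eta> x - H i x\<bar> powr p) \<partial>lborel) \<le> ennreal \<epsilon>" by blast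
    have \<eta>0: "\<eta> x = 0" "D i \<eta> x = 0" if "x \<notin> \<Omega>" for x i
      using \<eta>(1) that closure_subset[of "{x. \<eta> x \<noteq> 0}"] D_zero_outside[of x \<eta> i] by (auto simp: test_function_def)
    have "modular \<Omega> (\<lambda>_. p) (\<lambda>x. u x - \<eta> x) \<le> ennreal \<epsilon>"
    proof -
      have "(\<integral>\<^sup>+x. ennreal (\<bar>U x - \<eta> x\<bar> powr p) \<partial>lborel) = modular \<Omega> (\<lambda>_. p) (\<lambda>x. u x - \<eta> x)"
      proof (rule mod_eq)
        show "AE x in ?M. U x - \<eta> x = u x - \<eta> x" using U(3) by eventually_elim simp
      qed (use U(1,2) \<eta>0 test_functionD(4)[OF \<eta>(1)] in auto)
      then show ?thesis using \<eta>(2) by (simp add: abs_minus_commute)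
    qed
    moreover have "modular \<Omega> (\<lambda>_. p) (\<lambda>x. h i x - D i \<eta> x) \<le> ennreal \<epsilon>" for i
    proof -
      have "(\<integral>\<^sup>+x. ennreal (\<bar>H i x - D i \<eta> x\<bar> powr p) \<partial>lborel) = modular \<Omega> (\<lambda>_. p) (\<lambda>x. h i x - D i \<eta> x)"
      proof (rule mod_eq)
        show "AE x in ?M. H i x - D i \<eta> x = h i x - D i \<eta> x" using H(3)[of i] by eventually_elim simp
      qed (use H(1,2) \<eta>0 test_functionD(7)[OF \<eta>(1)] in auto)
      then show ?thesis using \<eta>(3)[of i] by (simp add: abs_minus_commute)
    qed
    ultimately show "\<exists>\<eta>. test_function \<Omega> \<eta> \<and> modular \<Omega> (\<lambda>_. p) (\<lambda>x. u x - \<eta> x) \<le> ennreal \<epsilon> \<and>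
     (\<forall>i. modular \<Omega> (\<lambda>_. p) (\<lambda>x. h i x - D i \<eta> x) \<le> ennreal \<epsilon>)" using \<eta>(1) by blast
  qed
  then show ?thesis unfolding u_def h_def .
qed

section \<open>Assembling the pieces along the boundary\<close>

lemma weak_deriv_cong:
  fixes \<Omega> :: "(real^'n) set"
  assumes "\<And>x. x \<in> \<Omega> \<Longrightarrow> u x = v x" "weak_deriv \<Omega> u i g"
  shows "weak_deriv \<Omega> v i g"
proof -
  have "integrable (lebesgue_on K) v" if "integrable (lebesgue_on K) u" "K \<subseteq> \<Omega>" "compact K" for K
    using that assms(1) by (subst Bochner_Integration.integrable_cong[where g=u, OF refl]) auto
  then have "loc_integrable \<Omega> v" using assms(2) unfolding weak_deriv_def loc_integrable_def by blast
  moreover have "(LINT x|lebesgue_on \<Omega>. v x * D i \<eta> x) = (LINT x|lebesgue_on \<Omega>. u x * D i \<eta> x)" for \<eta>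
    using assms(1) by (intro Bochner_Integration.integral_cong) auto
  ultimately show ?thesis using assms(2) by (simp add: weak_deriv_def)
qed

lemma sobolev_approx_imp_W1_0:
  fixes \<Omega> :: "(real^'n) set"
  assumes \<Omega>: "open \<Omega>" and p: "p \<ge> 1" and v: "v \<in> Lvar \<Omega> (\<lambda>_. p)" and g: "\<And>i. g i \<in> Lvar \<Omega> (\<lambda>_. p)"
    and w: "\<And>i. weak_deriv \<Omega> v i (g i)" and A: "sobolev_approx \<Omega> p v g"
  shows "v \<in> W1_0 \<Omega> p"
proof -
  have "v \<in> W1 \<Omega> p" using v g w by (auto simp: W1_def)
  moreover have "\<exists>\<eta>. test_function \<Omega> \<eta> \<and> W1_norm \<Omega> p (\<lambda>x. v x - \<eta> x) < \<epsilon>" if \<epsilon>: "\<epsilon> > 0" for \<epsilon> :: ennreal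
  proof -
    obtain b where b: "0 < b" "ennreal b < \<epsilon>"
      using \<epsilon> dense[of 0 \<epsilon>] by (metis ennreal_cases ennreal_less_zero_iff top.not_eq_extremum order_less_le_trans top_greatest)
    define l where "l = b / (1 + CARD('n))"
    have l: "l > 0" "l + CARD('n) * l = b"
    proof -
      show "l > 0" using b by (simp add: l_def add_pos_pos)
      have "l + CARD('n) * l = (1 + CARD('n)) * l" by (simp add: algebra_simps)
      also have "\<dots> = b" by (simp add: l_def add_pos_pos less_imp_neq[symmetric])
      finally show "l + CARD('n) * l = b" .
    qed
    obtain \<eta> where \<eta>: "test_function \<Omega> \<eta>" "modular \<Omega> (\<lambda>_. p) (\<lambda>x. v x - \<eta> x) \<le> ennreal (l powr p)"
     "\<And>i. modular \<Omega> (\<lambda>_. p) (\<lambda>x. g i x - D i \<eta> x) \<le> ennreal (l powr p)"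
      using A l(1) unfolding sobolev_approx_def by (metis powr_gt_zero less_imp_neq)
    have wd: "weak_deriv \<Omega> (\<lambda>x. v x - \<eta> x) i (\<lambda>x. g i x - D i \<eta> x)" for i
      using weak_deriv_add_scaled[where c="-1", OF \<Omega> w[of i] weak_deriv_smooth[OF \<Omega> test_functionD(1)[OF \<eta>(1)], of i]] by simp
    have "W1_norm \<Omega> p (\<lambda>x. v x - \<eta> x) = Lnorm \<Omega> (\<lambda>_. p) (\<lambda>x. v x - \<eta> x) + (\<Sum>i\<in>UNIV. Lnorm \<Omega> (\<lambda>_. p) (\<lambda>x. g i x - D i \<eta> x))"
      by (rule W1_norm_eq[OF \<Omega> wd])
    also have "\<dots> \<le> ennreal l + (\<Sum>i\<in>(UNIV :: 'n set). ennreal l)"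
      by (intro add_mono sum_mono Lnorm_le l \<eta> weak_deriv_measurable[OF \<Omega> wd])
    also have "\<dots> = ennreal l + ennreal (CARD('n) * l)"
      using l by (simp add: ennreal_mult ennreal_of_nat_eq_real_of_nat)
    also have "\<dots> = ennreal (l + CARD('n) * l)" using l by (intro ennreal_plus[symmetric]) auto
    also have "\<dots> < \<epsilon>" using b(2) l(2) by simp
    finally show ?thesis using \<eta>(1) by blast
  qed
  ultimately show ?thesis by (simp add: W1_0_def)
qed

text \<open>The form in which a zero trace enters the covering argument. It is inherited by products
  of v with smooth functions, simply by moving the factor to the test function.\<close>

definition local_ibp :: "(real^'n) set \<Rightarrow> (real^'n \<Rightarrow> real) \<Rightarrow> (real^'n \<Rightarrow> real) \<Rightarrow> ('n \<Rightarrow> real^'n \<Rightarrow> real) \<Rightarrow> bool" where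
  "local_ibp \<Omega> r v g \<longleftrightarrow> (\<forall>x0\<in>frontier \<Omega>. \<forall>\<eta> i. test_function UNIV \<eta> \<longrightarrow> (\<forall>x. \<eta> x \<noteq> 0 \<longrightarrow> x \<in> ball x0 (r x0 / 2)) \<longrightarrow>
     (LINT x|lebesgue_on \<Omega>. v x * D i \<eta> x + g i x * \<eta> x) = 0)"

text \<open>Here v vanishes near the boundary, so a cut-off equal to 1 on the rest of the domain
  reproduces v. Its support is compact in \<Omega>, which leaves room for small shifts in all
  directions.\<close>

lemma sobolev_approx_interior:
  fixes \<Omega> :: "(real^'n) set"
  assumes p: "p \<ge> 1" and \<Omega>: "open \<Omega>" "bounded \<Omega>"
    and v: "v \<in> Lvar \<Omega> (\<lambda>_. p)" and g: "\<And>i. g i \<in> Lvar \<Omega> (\<lambda>_. p)" and w: "\<And>i. weak_deriv \<Omega> v i (g i)"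
    and N: "open N" "frontier \<Omega> \<subseteq> N" "\<And>x. x \<in> \<Omega> \<Longrightarrow> x \<in> N \<Longrightarrow> v x = 0"
  shows "sobolev_approx \<Omega> p v g"
proof -
  have "compact (closure \<Omega> - N)" using \<Omega>(2) N(1) by (intro compact_diff) (auto simp: compact_closure)
  moreover have "closure \<Omega> - N \<subseteq> \<Omega>" using N(2) \<Omega>(1) by (auto simp: frontier_def interior_open)
  ultimately obtain \<zeta> where \<zeta>: "test_function \<Omega> \<zeta>" "\<And>x. x \<in> closure \<Omega> - N \<Longrightarrow> \<zeta> x = 1"
    using cutoff_exists[OF _ \<Omega>(1)] by metis
  let ?K = "closure {x. \<zeta> x \<noteq> 0}"
  have K: "compact ?K" "?K \<subseteq> \<Omega>" using \<zeta>(1) by (auto simp: test_function_def)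
  have \<zeta>v: "\<zeta> x * v x = v x" if "x \<in> \<Omega>" for x
    using \<zeta>(2)[of x] N(3)[OF that] that closure_subset[of \<Omega>] by (cases "x \<in> N") auto
  have approx: "sobolev_approx \<Omega> p (\<lambda>x. \<zeta> x * v x) (\<lambda>i x. \<zeta> x * g i x + D i \<zeta> x * v x)"
  proof (rule sobolev_approx_piece[OF p \<Omega> v g test_function_UNIV[OF \<zeta>(1)]])
    fix \<eta> :: "real^'n \<Rightarrow> real" and i assume \<eta>: "test_function UNIV \<eta>"
    have t: "test_function \<Omega> (\<lambda>x. \<eta> x * \<zeta> x)" by (rule test_function_mult[OF \<zeta>(1) test_functionD(1)[OF \<eta>]])
    have l: "loc_integrable \<Omega> v" "loc_integrable \<Omega> (g i)" using w[of i] by (auto simp: weak_deriv_def)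
    have "(LINT x|lebesgue_on \<Omega>. v x * D i (\<lambda>x. \<eta> x * \<zeta> x) x + g i x * (\<eta> x * \<zeta> x)) =
       (LINT x|lebesgue_on \<Omega>. v x * D i (\<lambda>x. \<eta> x * \<zeta> x) x) + (LINT x|lebesgue_on \<Omega>. g i x * (\<eta> x * \<zeta> x))"
      by (intro Bochner_Integration.integral_add loc_integrable_test_function l \<Omega> t test_function_D)
    then show "(LINT x|lebesgue_on \<Omega>. v x * D i (\<lambda>x. \<eta> x * \<zeta> x) x + g i x * (\<eta> x * \<zeta> x)) = 0"
      using w[of i] t by (simp add: weak_deriv_def)
  next
    fix d :: real assume d: "d > 0"
    obtain \<rho> where \<rho>: "\<rho> > 0" "(\<Union>x\<in>?K. cball x \<rho>) \<subseteq> \<Omega>"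
      using compact_subset_open_imp_cball_epsilon_subset[OF K(1) \<Omega>(1) K(2)] by metis
    show "\<exists>a \<rho>. \<rho> > 0 \<and> cball a \<rho> \<subseteq> ball 0 d \<and> (\<forall>y\<in>closure \<Omega> \<inter> ?K. \<forall>z\<in>cball a \<rho>. y + z \<in> \<Omega>)"
    proof (intro exI[of _ "0 :: real^'n"] exI[of _ "min \<rho> (d / 2)"] conjI ballI)
      fix y z :: "real^'n" assume "y \<in> closure \<Omega> \<inter> ?K" "z \<in> cball 0 (min \<rho> (d / 2))"
      then have "y \<in> ?K" "y + z \<in> cball y \<rho>" by (auto simp: dist_norm)
      then show "y + z \<in> \<Omega>" using \<rho>(2) by blast
    qed (use d \<rho>(1) in auto)
  qed
  have "weak_deriv \<Omega> v i (\<lambda>x. \<zeta> x * g i x + D i \<zeta> x * v x)" for i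
    using weak_deriv_mult_smooth[OF \<Omega>(1) w[of i] test_functionD(1)[OF \<zeta>(1)]] \<zeta>v by (rule weak_deriv_cong[rotated])
  then have "AE x in lebesgue_on \<Omega>. \<zeta> x * g i x + D i \<zeta> x * v x = g i x" for i
    by (rule weak_deriv_unique[OF \<Omega>(1) _ w])
  moreover have "AE x in lebesgue_on \<Omega>. \<zeta> x * v x = v x" by (rule AE_I2) (simp add: \<zeta>v)
  ultimately show ?thesis
    by (intro sobolev_approx_cong_AE[OF approx])
qed

text \<open>The ball of radius t \<delta>/2 about t e consists of vectors t w with w in the
  \<delta>-ball about e. They have norm at most 2 t, so points within r/2 of x0 stay in the r-ball,
  where the cone property holds.\<close>

lemma graph_cone_room:
  fixes \<Omega> :: "(real^'n) set"
  assumes cone: "graph_cone \<Omega> x0 r e \<delta>" and d: "d > 0"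
  shows "\<exists>a \<rho>. \<rho> > 0 \<and> cball a \<rho> \<subseteq> ball 0 d \<and> (\<forall>y\<in>closure \<Omega> \<inter> ball x0 (r / 2). \<forall>z\<in>cball a \<rho>. y + z \<in> \<Omega>)"
proof -
  have c: "r > 0" "\<delta> > 0" "\<delta> \<le> 1" "norm e = 1" using cone by (auto simp: graph_cone_def)
  define t where "t = min (d / 4) (r / 4)"
  have t: "t > 0" "t \<le> d / 4" "t \<le> r / 4" using d c by (auto simp: t_def)
  have nz: "norm z \<le> 2 * t" if "z \<in> cball (t *\<^sub>R e) (t * \<delta> / 2)" for z
  proof -
    have "norm z \<le> norm (t *\<^sub>R e) + norm (z - t *\<^sub>R e)" using norm_triangle_ineq[of "t *\<^sub>R e" "z - t *\<^sub>R e"] by simp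
    also have "\<dots> \<le> t + t * 1"
    proof (intro add_mono)
      have "norm (z - t *\<^sub>R e) \<le> t * \<delta> / 2" using that by (simp add: dist_norm norm_minus_commute)
      also have "\<dots> \<le> t * \<delta>" using t c by simp
      also have "\<dots> \<le> t * 1" using t c by (intro mult_left_mono) auto
      finally show "norm (z - t *\<^sub>R e) \<le> t * 1" .
    qed (use c t in simp)
    finally show ?thesis by simp
  qed
  show ?thesis
  proof (intro exI[of _ "t *\<^sub>R e"] exI[of _ "t * \<delta> / 2"] conjI ballI)
    show "t * \<delta> / 2 > 0" using t c by simp
    show "cball (t *\<^sub>R e) (t * \<delta> / 2) \<subseteq> ball 0 d"
    proof
      fix z assume "z \<in> cball (t *\<^sub>R e) (t * \<delta> / 2)"
      from nz[OF this] show "z \<in> ball 0 d" using t d by simp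
    qed
    fix y z assume y: "y \<in> closure \<Omega> \<inter> ball x0 (r / 2)" and z: "z \<in> cball (t *\<^sub>R e) (t * \<delta> / 2)"
    define w where "w = (1 / t) *\<^sub>R z"
    have zw: "z = t *\<^sub>R w" using t by (simp add: w_def)
    have "dist e w = norm (t *\<^sub>R e - z) / t"
    proof -
      have "t *\<^sub>R e - z = t *\<^sub>R (e - w)" by (simp add: zw algebra_simps)
      then show ?thesis using t by (simp add: dist_norm)
    qed
    also have "\<dots> \<le> (t * \<delta> / 2) / t" using z t by (intro divide_right_mono) (auto simp: dist_norm)
    also have "\<dots> < \<delta>" using t c by simp
    finally have w: "w \<in> ball e \<delta>" by simp
    have "dist x0 (y + z) \<le> dist x0 y + norm z" using dist_triangle[of x0 "y + z" y] by (simp add: dist_norm)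
    also have "\<dots> < r" using y nz[OF z] t by auto
    finally have "y + z \<in> ball x0 r" by simp
    moreover have "y \<in> ball x0 r" using y c by auto
    ultimately show "y + z \<in> \<Omega>" using cone w t y unfolding graph_cone_def zw by blast
  qed
qed

text \<open>A partition of unity built one ball at a time. In v = \<chi>' v + (1 - \<chi>') v the
  first part sits in the half-radius ball about x, where the cone gives room to shift. The second
  part vanishes on the quarter-radius ball as well, so N grows and one ball fewer is left. The terms
  containing D \<chi>' cancel in the sum.\<close>

lemma sobolev_approx_cover:
  fixes \<Omega> :: "(real^'n) set"
  assumes p: "p \<ge> 1" and \<Omega>: "open \<Omega>" "bounded \<Omega>"
    and cone: "\<And>x0. x0 \<in> frontier \<Omega> \<Longrightarrow> graph_cone \<Omega> x0 (r x0) (e x0) (\<delta> x0)"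
    and F: "finite F" "F \<subseteq> frontier \<Omega>"
    and v: "v \<in> Lvar \<Omega> (\<lambda>_. p)" and g: "\<And>i. g i \<in> Lvar \<Omega> (\<lambda>_. p)" and w: "\<And>i. weak_deriv \<Omega> v i (g i)"
    and ibp: "local_ibp \<Omega> r v g"
    and N: "open N" "frontier \<Omega> \<subseteq> N \<union> (\<Union>x\<in>F. ball x (r x / 4))" "\<And>x. x \<in> \<Omega> \<Longrightarrow> x \<in> N \<Longrightarrow> v x = 0"
  shows "sobolev_approx \<Omega> p v g"
  using F v g w ibp N
proof (induction F arbitrary: v g N rule: finite_induct)
  case empty
  then show ?case by (intro sobolev_approx_interior[OF p \<Omega>, of v g N]) auto
next
  case (insert x F)
  have x: "x \<in> frontier \<Omega>" using insert.prems by simp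
  have r: "r x > 0" using cone[OF x] by (simp add: graph_cone_def)
  obtain \<chi>' where \<chi>: "test_function (ball x (r x / 2)) \<chi>'" "\<And>y. 0 \<le> \<chi>' y" "\<And>y. \<chi>' y \<le> 1" "\<And>y. y \<in> cball x (r x / 4) \<Longrightarrow> \<chi>' y = 1"
  proof -
    have "cball x (r x / 4) \<subseteq> ball x (r x / 2)" using r by auto
    then show ?thesis using cutoff_exists[OF compact_cball open_ball] that by metis
  qed
  have \<chi>supp: "closure {y. \<chi>' y \<noteq> 0} \<subseteq> ball x (r x / 2)" using \<chi>(1) by (simp add: test_function_def)
  have \<chi>U: "test_function UNIV \<chi>'" by (rule test_function_UNIV[OF \<chi>(1)])
  note v = insert.prems(2) and g = insert.prems(3) and w = insert.prems(4)
  have near: "sobolev_approx \<Omega> p (\<lambda>x. \<chi>' x * v x) (\<lambda>i x. \<chi>' x * g i x + D i \<chi>' x * v x)"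
  proof (rule sobolev_approx_piece[OF p \<Omega> v g \<chi>U])
    fix \<eta> :: "real^'n \<Rightarrow> real" and i assume \<eta>: "test_function UNIV \<eta>"
    have "test_function UNIV (\<lambda>x. \<eta> x * \<chi>' x)" by (rule test_function_mult[OF \<chi>U test_functionD(1)[OF \<eta>]])
    moreover have "\<eta> y * \<chi>' y \<noteq> 0 \<longrightarrow> y \<in> ball x (r x / 2)" for y
      using \<chi>supp closure_subset[of "{y. \<chi>' y \<noteq> 0}"] by auto
    ultimately show "(LINT x|lebesgue_on \<Omega>. v x * D i (\<lambda>x. \<eta> x * \<chi>' x) x + g i x * (\<eta> x * \<chi>' x)) = 0"
      using insert.prems(5) x unfolding local_ibp_def by blast
  next
    fix d :: real assume d: "d > 0"
    show "\<exists>a \<rho>. \<rho> > 0 \<and> cball a \<rho> \<subseteq> ball 0 d \<and> (\<forall>y\<in>closure \<Omega> \<inter> closure {x. \<chi>' x \<noteq> 0}. \<forall>z\<in>cball a \<rho>. y + z \<in> \<Omega>)"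
      using graph_cone_room[OF cone[OF x] d] \<chi>supp by blast
  qed
  define \<theta> where "\<theta> y = 1 - \<chi>' y" for y
  have \<theta>C: "Ck k \<theta>" for k unfolding \<theta>_def[abs_def] by (intro Ck_diff Ck_const test_functionD(1)[OF \<chi>U])
  have D\<theta>: "D i \<theta> y = - D i \<chi>' y" for i y
  proof -
    have "D i (\<lambda>y. 1 + (-1) * \<chi>' y) y = D i (\<lambda>_. 1) y + D i (\<lambda>y. (-1) * \<chi>' y) y"
      using Ck_cmult[OF test_functionD(1)[OF \<chi>U], of 1 "-1"] by (intro D_add) auto
    moreover have "D i (\<lambda>y. (-1) * \<chi>' y) y = (-1) * D i \<chi>' y + D i (\<lambda>_. -1) y * \<chi>' y"
      by (intro D_mult test_functionD(2)[OF \<chi>U]) auto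
    moreover have "D i (\<lambda>_. c) y = 0" for c by (rule has_derivative_axis[where F="\<lambda>_. 0"]) simp
    ultimately show ?thesis by (simp add: \<theta>_def[abs_def])
  qed
  obtain B where B: "\<And>y. \<bar>\<chi>' y\<bar> \<le> B" using test_function_bounded[OF \<chi>U] by metis
  have "\<exists>B. \<forall>y. \<bar>D i \<theta> y\<bar> \<le> B" for i
    using test_function_bounded[OF test_function_D[OF \<chi>U, of i]] unfolding D\<theta> abs_minus_cancel by metis
  then obtain B' where B': "\<And>i y. \<bar>D i \<theta> y\<bar> \<le> B' i" by metis
  have \<theta>m: "\<theta> \<in> borel_measurable (lebesgue_on \<Omega>)" "D i \<theta> \<in> borel_measurable (lebesgue_on \<Omega>)" for i
  proof -
    have "continuous_on UNIV \<theta>" "continuous_on UNIV (D i \<theta>)" using \<theta>C[of 0] \<theta>C[of 1] by auto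
    then show "\<theta> \<in> borel_measurable (lebesgue_on \<Omega>)" "D i \<theta> \<in> borel_measurable (lebesgue_on \<Omega>)"
      by (auto intro: borel_measurable_lebesgue_on borel_measurable_continuous_onI)
  qed
  have \<theta>1: "\<bar>\<theta> y\<bar> \<le> 1" for y using \<chi>(2,3)[of y] by (simp add: \<theta>_def)
  have v': "(\<lambda>y. \<theta> y * v y) \<in> Lvar \<Omega> (\<lambda>_. p)" by (rule Lvar_mult_bounded[OF p v \<theta>m(1) \<theta>1])
  have g': "(\<lambda>y. \<theta> y * g i y + D i \<theta> y * v y) \<in> Lvar \<Omega> (\<lambda>_. p)" for i
    by (intro Lvar_add[OF p] Lvar_mult_bounded[OF p g \<theta>m(1) \<theta>1] Lvar_mult_bounded[OF p v \<theta>m(2) B'])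
  have far: "sobolev_approx \<Omega> p (\<lambda>y. \<theta> y * v y) (\<lambda>i y. \<theta> y * g i y + D i \<theta> y * v y)"
  proof (rule insert.IH[where N="N \<union> ball x (r x / 4)"])
    show "F \<subseteq> frontier \<Omega>" using insert.prems by simp
    show "(\<lambda>y. \<theta> y * v y) \<in> Lvar \<Omega> (\<lambda>_. p)" by (rule v')
    show "(\<lambda>y. \<theta> y * g i y + D i \<theta> y * v y) \<in> Lvar \<Omega> (\<lambda>_. p)" for i by (rule g')
    show "weak_deriv \<Omega> (\<lambda>y. \<theta> y * v y) i (\<lambda>y. \<theta> y * g i y + D i \<theta> y * v y)" for i
      by (rule weak_deriv_mult_smooth[OF \<Omega>(1) w \<theta>C])
    show "local_ibp \<Omega> r (\<lambda>y. \<theta> y * v y) (\<lambda>i y. \<theta> y * g i y + D i \<theta> y * v y)"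
      unfolding local_ibp_def
    proof (intro ballI allI impI)
      fix x0 \<eta> i assume x0: "x0 \<in> frontier \<Omega>" and \<eta>: "test_function UNIV \<eta>" "\<forall>x. \<eta> x \<noteq> 0 \<longrightarrow> x \<in> ball x0 (r x0 / 2)"
      have t: "test_function UNIV (\<lambda>x. \<theta> x * \<eta> x)" by (rule test_function_mult[OF \<eta>(1) \<theta>C])
      have \<theta>d: "\<theta> differentiable (at y)" for y using \<theta>C[of 1] by simp
      have "(LINT y|lebesgue_on \<Omega>. \<theta> y * v y * D i \<eta> y + (\<theta> y * g i y + D i \<theta> y * v y) * \<eta> y) =
        (LINT y|lebesgue_on \<Omega>. v y * D i (\<lambda>x. \<theta> x * \<eta> x) y + g i y * (\<theta> y * \<eta> y))"
        by (intro Bochner_Integration.integral_cong refl)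
           (simp only: D_mult[OF \<theta>d test_functionD(2)[OF \<eta>(1)]], simp add: algebra_simps)
      also have "\<dots> = 0"
        using insert.prems(5) x0 t \<eta>(2) unfolding local_ibp_def by simp
      finally show "(LINT y|lebesgue_on \<Omega>. \<theta> y * v y * D i \<eta> y + (\<theta> y * g i y + D i \<theta> y * v y) * \<eta> y) = 0" .
    qed
    show "open (N \<union> ball x (r x / 4))" using insert.prems(6) by auto
    show "frontier \<Omega> \<subseteq> N \<union> ball x (r x / 4) \<union> (\<Union>x\<in>F. ball x (r x / 4))" using insert.prems(7) by auto
    show "\<theta> y * v y = 0" if "y \<in> \<Omega>" "y \<in> N \<union> ball x (r x / 4)" for y
      using that insert.prems(8)[of y] \<chi>(4)[of y] by (auto simp: \<theta>_def)
  qed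
  have vm: "v \<in> borel_measurable (lebesgue_on \<Omega>)" "g i \<in> borel_measurable (lebesgue_on \<Omega>)" for i
    using v g by (auto simp: Lvar_def)
  have "sobolev_approx \<Omega> p (\<lambda>y. \<chi>' y * v y + \<theta> y * v y) (\<lambda>i y. (\<chi>' y * g i y + D i \<chi>' y * v y) + (\<theta> y * g i y + D i \<theta> y * v y))"
    using vm test_function_meas_on[OF \<chi>U] \<theta>m by (intro sobolev_approx_add[OF p _ _ _ _ near far]) auto
  then show ?case
    by (rule sobolev_approx_cong_AE) (auto intro!: AE_I2 simp: \<theta>_def D\<theta> algebra_simps)
qed

text \<open>The trace is used only through \<open>local_ibp\<close>. Compactness of the frontier
  yields the finite cover by quarter-radius balls, and the induction starts with N empty.\<close>

theorem zero_trace_imp_W1_0: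
  fixes \<Omega> :: "(real^'n) set"
  assumes n: "CARD('n) \<ge> 2" and \<Omega>: "bounded_C1_domain \<Omega>" and p: "p \<ge> 1"
    and v: "v \<in> Lvar \<Omega> (\<lambda>_. p)" and g: "\<And>i. g i \<in> Lvar \<Omega> (\<lambda>_. p)" and w: "\<And>i. weak_deriv \<Omega> v i (g i)"
    and tr: "has_trace \<Omega> v (\<lambda>_. 0)"
  shows "v \<in> W1_0 \<Omega> p"
proof -
  have o: "open \<Omega>" "bounded \<Omega>" and bd: "C1_boundary \<Omega>" using \<Omega> by (auto simp: bounded_C1_domain_def)
  have "\<exists>r e \<delta>. graph_cone \<Omega> x0 r e \<delta>" if "x0 \<in> frontier \<Omega>" for x0
    using C1_boundary_graph_cone[OF bd that] by blast
  then obtain r e \<delta> where cone: "\<And>x0. x0 \<in> frontier \<Omega> \<Longrightarrow> graph_cone \<Omega> x0 (r x0) (e x0) (\<delta> x0)"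
    by metis
  have gi: "integrable (lebesgue_on \<Omega>) (g i)" for i
    using Lvar_mono_exponent[of 1 p "g i" \<Omega>] p g o by (simp add: Lvar_1_iff_integrable)
  have ibp: "local_ibp \<Omega> r v g"
    unfolding local_ibp_def
    using zero_trace_ibp[OF n o cone tr w gi] by blast
  have "compact (frontier \<Omega>)" using o(2) by (simp add: compact_frontier_bounded)
  moreover have "frontier \<Omega> \<subseteq> (\<Union>x\<in>frontier \<Omega>. ball x (r x / 4))"
    using cone by (force simp: graph_cone_def)
  ultimately obtain F where F: "F \<subseteq> frontier \<Omega>" "finite F" "frontier \<Omega> \<subseteq> (\<Union>x\<in>F. ball x (r x / 4))"
    using compactE_image[of "frontier \<Omega>" "frontier \<Omega>" "\<lambda>x. ball x (r x / 4)"] by auto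
  have "sobolev_approx \<Omega> p v g"
    by (rule sobolev_approx_cover[OF p o cone F(2,1) v g w ibp, of "{}"]) (use F(3) in auto)
  then show ?thesis by (rule sobolev_approx_imp_W1_0[OF o(1) p v g w])
qed

section \<open>Zero trace and Sobolev embedding for limits of test functions\<close>

lemma W1_0_sequence:
  fixes \<Omega> :: "(real^'n) set"
  assumes "v \<in> W1_0 \<Omega> p"
  obtains \<eta> where "\<And>k::nat. test_function \<Omega> (\<eta> k)" "(\<lambda>k. W1_norm \<Omega> p (\<lambda>x. v x - \<eta> k x)) \<longlonglongrightarrow> 0"
proof -
  have "\<exists>\<eta>. test_function \<Omega> \<eta> \<and> W1_norm \<Omega> p (\<lambda>x. v x - \<eta> x) < ennreal (inverse (real (Suc k)))" for k
  proof -
    have "ennreal (inverse (real (Suc k))) > 0" by simp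
    then show ?thesis using assms unfolding W1_0_def by blast
  qed
  then obtain \<eta> where \<eta>: "\<And>k. test_function \<Omega> (\<eta> k)" "\<And>k. W1_norm \<Omega> p (\<lambda>x. v x - \<eta> k x) < ennreal (inverse (real (Suc k)))"
    by metis
  have "(\<lambda>k. ennreal (inverse (real (Suc k)))) \<longlonglongrightarrow> ennreal 0"
    by (intro tendsto_ennrealI LIMSEQ_inverse_real_of_nat)
  then have lim: "(\<lambda>k. ennreal (inverse (real (Suc k)))) \<longlonglongrightarrow> 0" by simp
  have "(\<lambda>k. W1_norm \<Omega> p (\<lambda>x. v x - \<eta> k x)) \<longlonglongrightarrow> 0"
  proof (rule tendsto_sandwich[OF _ _ tendsto_const lim])
    show "\<forall>\<^sub>F k in sequentially. W1_norm \<Omega> p (\<lambda>x. v x - \<eta> k x) \<le> ennreal (inverse (real (Suc k)))"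
      by (intro always_eventually allI less_imp_le \<eta>(2))
  qed simp
  with \<eta>(1) show ?thesis by (rule that)
qed

lemma modular_tendsto_imp_Lnorm_tendsto:
  assumes u: "\<And>k. u k \<in> borel_measurable (lebesgue_on \<Omega>)" and p: "p > 0"
    and lim: "(\<lambda>k. modular \<Omega> (\<lambda>_. p) (u k)) \<longlonglongrightarrow> 0"
  shows "(\<lambda>k. Lnorm \<Omega> (\<lambda>_. p) (u k)) \<longlonglongrightarrow> 0"
proof (rule order_tendstoI)
  fix a :: ennreal assume "0 < a"
  then obtain b where b: "0 < b" "ennreal b < a"
    using dense[of 0 a] by (metis ennreal_cases ennreal_less_zero_iff top.not_eq_extremum order_less_le_trans top_greatest)
  have "\<forall>\<^sub>F k in sequentially. modular \<Omega> (\<lambda>_. p) (u k) < ennreal (b powr p)"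
    using order_tendstoD(2)[OF lim, of "ennreal (b powr p)"] b by simp
  then show "\<forall>\<^sub>F k in sequentially. Lnorm \<Omega> (\<lambda>_. p) (u k) < a"
  proof eventually_elim
    case (elim k)
    then have "Lnorm \<Omega> (\<lambda>_. p) (u k) \<le> ennreal b" by (intro Lnorm_le[OF u b(1)]) simp
    then show ?case using b(2) by (rule le_less_trans)
  qed
qed simp

lemma test_function_C1_closure: "test_function \<Omega> \<eta> \<Longrightarrow> C1_closure \<Omega>' \<eta>"
  unfolding C1_closure_def
proof (intro conjI ballI allI)
  assume \<eta>: "test_function \<Omega> \<eta>"
  show "continuous_on (closure \<Omega>') \<eta>" by (rule continuous_on_subset[OF test_functionD(3)[OF \<eta>]]) simp
  show "\<eta> differentiable (at x)" for x by (rule test_functionD(2)[OF \<eta>])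
  show "\<exists>h. continuous_on (closure \<Omega>') h \<and> (\<forall>x\<in>\<Omega>'. h x = D i \<eta> x)" for i
    by (rule exI[of _ "D i \<eta>"]) (use continuous_on_subset[OF test_functionD(6)[OF \<eta>]] in auto)
qed

text \<open>The approximating test functions can themselves be the C1 functions in
  \<open>has_trace\<close>: they vanish on the frontier, and on a bounded set convergence in W^{1,p}
  implies convergence in W^{1,1}.\<close>

theorem W1_0_imp_zero_trace:
  fixes \<Omega> :: "(real^'n) set"
  assumes \<Omega>: "open \<Omega>" "bounded \<Omega>" and p: "p \<ge> 1" and v: "v \<in> W1_0 \<Omega> p"
  shows "has_trace \<Omega> v (\<lambda>_. 0)"
proof -
  have vW: "v \<in> Lvar \<Omega> (\<lambda>_. p)" "\<forall>i. \<exists>g\<in>Lvar \<Omega> (\<lambda>_. p). weak_deriv \<Omega> v i g"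
    using v by (auto simp: W1_0_def W1_def)
  then obtain g where g: "\<And>i. g i \<in> Lvar \<Omega> (\<lambda>_. p)" "\<And>i. weak_deriv \<Omega> v i (g i)" by metis
  have mono: "u \<in> Lvar \<Omega> (\<lambda>_. 1)" if "u \<in> Lvar \<Omega> (\<lambda>_. p)" for u
    by (rule Lvar_mono_exponent[OF _ p that \<Omega>]) simp
  have W11: "v \<in> W1 \<Omega> 1" unfolding W1_def using mono vW(1) g by blast
  obtain \<eta> where \<eta>: "\<And>k::nat. test_function \<Omega> (\<eta> k)" "(\<lambda>k. W1_norm \<Omega> p (\<lambda>x. v x - \<eta> k x)) \<longlonglongrightarrow> 0"
    using W1_0_sequence[OF v] by blast
  have w\<eta>: "weak_deriv \<Omega> (\<eta> k) i (D i (\<eta> k))" for k i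
    by (rule weak_deriv_smooth[OF \<Omega>(1) test_functionD(1)[OF \<eta>(1)]])
  have d: "weak_deriv \<Omega> (\<lambda>x. v x - \<eta> k x) i (\<lambda>x. g i x - D i (\<eta> k) x)" for k i
    using weak_deriv_add_scaled[where c="-1", OF \<Omega>(1) g(2)[of i] w\<eta>[of k i]] by simp
  have d': "weak_deriv \<Omega> (\<lambda>x. \<eta> k x - v x) i (\<lambda>x. D i (\<eta> k) x - g i x)" for k i
    using weak_deriv_add_scaled[where c="-1", OF \<Omega>(1) w\<eta>[of k i] g(2)[of i]] by simp
  have pos: "p > 0" using p by simp
  note lims = W1_norm_tendsto_imp[OF \<Omega>(1) pos d \<eta>(2)]
  have "(\<lambda>k. Lnorm \<Omega> (\<lambda>_. 1) (\<lambda>x. \<eta> k x - v x)) \<longlonglongrightarrow> 0"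
  proof (rule modular_tendsto_imp_Lnorm_tendsto)
    show "(\<lambda>k. modular \<Omega> (\<lambda>_. 1) (\<lambda>x. \<eta> k x - v x)) \<longlonglongrightarrow> 0"
      using modular_tendsto_mono_exponent[OF _ p weak_deriv_measurable(1)[OF \<Omega>(1) d] \<Omega> lims(1)]
      by (simp add: modular_minus[of _ _ _ v])
  qed (use weak_deriv_measurable(1)[OF \<Omega>(1) d'] in auto)
  moreover have "(\<lambda>k. Lnorm \<Omega> (\<lambda>_. 1) (\<lambda>x. D i (\<eta> k) x - g i x)) \<longlonglongrightarrow> 0" for i
  proof (rule modular_tendsto_imp_Lnorm_tendsto)
    show "(\<lambda>k. modular \<Omega> (\<lambda>_. 1) (\<lambda>x. D i (\<eta> k) x - g i x)) \<longlonglongrightarrow> 0"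
      using modular_tendsto_mono_exponent[OF _ p weak_deriv_measurable(2)[OF \<Omega>(1) d] \<Omega> lims(2)]
      by (simp add: modular_minus[of _ _ _ "g i"])
  qed (use weak_deriv_measurable(2)[OF \<Omega>(1) d'] in auto)
  ultimately have "(\<lambda>k. Lnorm \<Omega> (\<lambda>_. 1) (\<lambda>x. \<eta> k x - v x) + (\<Sum>i\<in>UNIV. Lnorm \<Omega> (\<lambda>_. 1) (\<lambda>x. D i (\<eta> k) x - g i x))) \<longlonglongrightarrow> 0 + (\<Sum>i\<in>(UNIV :: 'n set). 0)"
    by (intro tendsto_add tendsto_sum)
  then have lim: "(\<lambda>k. W1_norm \<Omega> 1 (\<lambda>x. \<eta> k x - v x)) \<longlonglongrightarrow> 0"
    by (simp add: W1_norm_eq[OF \<Omega>(1) d'])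
  have fr0: "\<eta> k x = 0" if "x \<in> frontier \<Omega>" for k x
    using that \<eta>(1)[of k] \<Omega>(1) closure_subset[of "{x. \<eta> k x \<noteq> 0}"]
    by (auto simp: test_function_def frontier_def interior_open)
  have "(\<integral>\<^sup>+x\<in>frontier \<Omega>. ennreal \<bar>\<eta> k x - 0\<bar> \<partial>surface_measure) = (\<integral>\<^sup>+x. 0 \<partial>(surface_measure :: (real^'n) measure))" for k
    by (rule nn_integral_cong) (use fr0 in \<open>auto simp: indicator_def\<close>)
  then have "(\<lambda>k. \<integral>\<^sup>+x\<in>frontier \<Omega>. ennreal \<bar>\<eta> k x - 0\<bar> \<partial>surface_measure) \<longlonglongrightarrow> 0" by simp
  then show ?thesis
    unfolding has_trace_def using W11 lim test_function_C1_closure[OF \<eta>(1)]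
    by (auto simp: set_integrable_def intro!: exI[of _ \<eta>])
qed

text \<open>On a bounded set the gradients of the approximating test functions are also bounded in
  L^s, so \<open>sobolev_test_function\<close> bounds their L^q modulars, and Fatou's lemma along an
  a.e. convergent subsequence passes the bound to v. Working with s <= p keeps the result available
  for p >= n.\<close>

theorem sobolev_W1_0:
  fixes \<Omega> :: "(real^'n) set" and p s :: real
  assumes n: "CARD('n) \<ge> 2" and \<Omega>: "open \<Omega>" "bounded \<Omega>" and s: "1 < s" "s < CARD('n)" "s \<le> p"
    and v: "v \<in> W1_0 \<Omega> p"
  shows "v \<in> Lvar \<Omega> (\<lambda>_. CARD('n) * s / (CARD('n) - s))"
proof -
  define q where "q = CARD('n) * s / (CARD('n) - s)"
  have q: "q > 0" using s by (simp add: q_def)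
  have s1: "0 < s" "1 \<le> s" "p > 0" using s by auto
  have vW: "v \<in> Lvar \<Omega> (\<lambda>_. p)" "\<forall>i. \<exists>g\<in>Lvar \<Omega> (\<lambda>_. p). weak_deriv \<Omega> v i g"
    using v by (auto simp: W1_0_def W1_def)
  then obtain g where g: "\<And>i. g i \<in> Lvar \<Omega> (\<lambda>_. p)" "\<And>i. weak_deriv \<Omega> v i (g i)" by metis
  obtain \<eta> where \<eta>: "\<And>k::nat. test_function \<Omega> (\<eta> k)" "(\<lambda>k. W1_norm \<Omega> p (\<lambda>x. v x - \<eta> k x)) \<longlonglongrightarrow> 0"
    using W1_0_sequence[OF v] by blast
  have w\<eta>: "weak_deriv \<Omega> (\<eta> k) i (D i (\<eta> k))" for k i
    by (rule weak_deriv_smooth[OF \<Omega>(1) test_functionD(1)[OF \<eta>(1)]])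
  have d: "weak_deriv \<Omega> (\<lambda>x. v x - \<eta> k x) i (\<lambda>x. g i x - D i (\<eta> k) x)" for k i
    using weak_deriv_add_scaled[where c="-1", OF \<Omega>(1) g(2)[of i] w\<eta>[of k i]] by simp
  note lims = W1_norm_tendsto_imp[OF \<Omega>(1) s1(3) d \<eta>(2)]
  have vm: "v \<in> borel_measurable (lebesgue_on \<Omega>)" using vW by (simp add: Lvar_def)
  have gs: "g i \<in> Lvar \<Omega> (\<lambda>_. s)" for i by (rule Lvar_mono_exponent[OF s1(1) s(3) g(1) \<Omega>])
  have dlim: "(\<lambda>k. modular \<Omega> (\<lambda>_. s) (\<lambda>x. g i x - D i (\<eta> k) x)) \<longlonglongrightarrow> 0" for i
    by (rule modular_tendsto_mono_exponent[OF s1(1) s(3) weak_deriv_measurable(2)[OF \<Omega>(1) d] \<Omega> lims(2)])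
  have "\<forall>\<^sub>F k in sequentially. \<forall>i. modular \<Omega> (\<lambda>_. s) (\<lambda>x. g i x - D i (\<eta> k) x) < 1"
    by (intro eventually_all_finite order_tendstoD(2)[OF dlim]) simp
  then obtain K where K: "\<And>k i. k \<ge> K \<Longrightarrow> modular \<Omega> (\<lambda>_. s) (\<lambda>x. g i x - D i (\<eta> k) x) < 1"
    unfolding eventually_sequentially by blast
  \<comment> \<open>From K on, the gradient errors have s-modular below 1; the quasi-triangle
    inequality then gives each summand, and the sum dominates all i at once.\<close>
  define M where "M = enn2real (\<Sum>i\<in>UNIV. ennreal (2 powr s) * (1 + modular \<Omega> (\<lambda>_. s) (g i)))"
  have Mfin: "(\<Sum>i\<in>UNIV. ennreal (2 powr s) * (1 + modular \<Omega> (\<lambda>_. s) (g i))) = ennreal M" "M \<ge> 0"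
    using gs by (auto simp: M_def Lvar_def ennreal_mult_less_top less_top[symmetric] ennreal_mult_eq_top_iff)
  have Dbound: "(\<integral>\<^sup>+x. ennreal (\<bar>D i (\<eta> k) x\<bar> powr s) \<partial>lborel) \<le> ennreal M" if "k \<ge> K" for i k
  proof -
    have out: "D i (\<eta> k) x = 0" if "x \<notin> \<Omega>" for x
      using that \<eta>(1)[of k] D_zero_outside[of x "\<eta> k" i] by (auto simp: test_function_def)
    have m: "D i (\<eta> k) \<in> borel_measurable borel" using test_functionD(7)[OF \<eta>(1)] .
    have "(\<integral>\<^sup>+x. ennreal (\<bar>D i (\<eta> k) x\<bar> powr s) \<partial>lborel) = modular \<Omega> (\<lambda>_. s) (D i (\<eta> k))"
      unfolding modular_def using m out by (intro lebesgue_on_open_nn_integral[OF \<Omega>(1), symmetric]) auto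
    also have "modular \<Omega> (\<lambda>_. s) (D i (\<eta> k)) = modular \<Omega> (\<lambda>_. s) (\<lambda>x. (D i (\<eta> k) x - g i x) + g i x)" by simp
    also have "\<dots> \<le> ennreal (2 powr s) * (modular \<Omega> (\<lambda>_. s) (\<lambda>x. D i (\<eta> k) x - g i x) + modular \<Omega> (\<lambda>_. s) (g i))"
      using s1 gs[of i] test_function_meas_on(2)[OF \<eta>(1)] by (intro modular_add_le) (auto simp: Lvar_def)
    also have "\<dots> \<le> ennreal (2 powr s) * (1 + modular \<Omega> (\<lambda>_. s) (g i))"
      using K[OF that, of i] by (intro mult_left_mono add_right_mono) (auto simp: modular_minus[of _ _ _ "g i"])
    also have "\<dots> \<le> (\<Sum>i\<in>UNIV. ennreal (2 powr s) * (1 + modular \<Omega> (\<lambda>_. s) (g i)))"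
      by (rule member_le_sum) auto
    finally show ?thesis unfolding Mfin .
  qed
  define C where "C = ((s * (CARD('n) - 1) / (CARD('n) - s)) * (1 + M)) powr q"
  have bound: "modular \<Omega> (\<lambda>_. q) (\<eta> k) \<le> ennreal C" if "k \<ge> K" for k
  proof -
    have out: "\<eta> k x = 0" if "x \<notin> \<Omega>" for x
      using that \<eta>(1)[of k] closure_subset[of "{x. \<eta> k x \<noteq> 0}"] by (auto simp: test_function_def)
    have "modular \<Omega> (\<lambda>_. q) (\<eta> k) = (\<integral>\<^sup>+x. ennreal (\<bar>\<eta> k x\<bar> powr q) \<partial>lborel)"
      unfolding modular_def using test_functionD(4)[OF \<eta>(1)] out by (intro lebesgue_on_open_nn_integral[OF \<Omega>(1)]) auto
    also have "\<dots> \<le> ennreal C"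
      unfolding C_def q_def by (rule sobolev_test_function[OF n s(1,2) test_function_UNIV[OF \<eta>(1)] Mfin(2) Dbound[OF that]])
    finally show ?thesis .
  qed
  have lim1: "(\<lambda>k. modular \<Omega> (\<lambda>_. 1) (\<lambda>x. v x - \<eta> k x)) \<longlonglongrightarrow> 0"
    using s by (intro modular_tendsto_mono_exponent[OF _ _ weak_deriv_measurable(1)[OF \<Omega>(1) d] \<Omega> lims(1)]) auto
  have int: "integrable (lebesgue_on \<Omega>) (\<lambda>x. v x - \<eta> k x)" for k
  proof -
    have "v \<in> Lvar \<Omega> (\<lambda>_. 1)" by (rule Lvar_mono_exponent[OF _ _ vW(1) \<Omega>]) (use s in auto)
    then have "integrable (lebesgue_on \<Omega>) v" by (simp add: Lvar_1_iff_integrable)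
    moreover have "integrable (lebesgue_on \<Omega>) (\<eta> k)"
    proof -
      have out: "\<eta> k x = 0" if "x \<notin> \<Omega>" for x
        using that \<eta>(1)[of k] closure_subset[of "{x. \<eta> k x \<noteq> 0}"] by (auto simp: test_function_def)
      show ?thesis
        using lebesgue_on_open_integral(2)[OF \<Omega>(1) test_functionD(4)[OF \<eta>(1)], of k] out test_function_integrable[OF \<eta>(1)] by simp
    qed
    ultimately show ?thesis by simp
  qed
  have "(\<lambda>k. LINT x|lebesgue_on \<Omega>. norm (v x - \<eta> k x)) \<longlonglongrightarrow> 0"
  proof -
    have "ennreal (LINT x|lebesgue_on \<Omega>. norm (v x - \<eta> k x)) = modular \<Omega> (\<lambda>_. 1) (\<lambda>x. v x - \<eta> k x)" for k
      unfolding modular_def using int[of k] by (subst nn_integral_eq_integral[symmetric]) auto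
    then have "(\<lambda>k. ennreal (LINT x|lebesgue_on \<Omega>. norm (v x - \<eta> k x))) \<longlonglongrightarrow> ennreal 0" using lim1 by simp
    then show ?thesis by (subst (asm) tendsto_ennreal_iff) auto
  qed
  from tendsto_L1_AE_subseq[OF int this] obtain r where r: "strict_mono r"
    "AE x in lebesgue_on \<Omega>. (\<lambda>k. v x - \<eta> (r k) x) \<longlonglongrightarrow> 0" by blast
  have "modular \<Omega> (\<lambda>_. q) v = (\<integral>\<^sup>+x. liminf (\<lambda>k. ennreal (\<bar>\<eta> (r k) x\<bar> powr q)) \<partial>lebesgue_on \<Omega>)"
    unfolding modular_def
  proof (rule nn_integral_cong_AE)
    show "AE x in lebesgue_on \<Omega>. ennreal (\<bar>v x\<bar> powr q) = liminf (\<lambda>k. ennreal (\<bar>\<eta> (r k) x\<bar> powr q))"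
      using r(2)
    proof eventually_elim
      case (elim x)
      have "(\<lambda>k. v x - (v x - \<eta> (r k) x)) \<longlonglongrightarrow> v x - 0" by (intro tendsto_diff tendsto_const elim)
      then have "(\<lambda>k. \<eta> (r k) x) \<longlonglongrightarrow> v x" by simp
      then have "(\<lambda>k. \<bar>\<eta> (r k) x\<bar> powr q) \<longlonglongrightarrow> \<bar>v x\<bar> powr q"
        using q by (intro tendsto_powr' tendsto_rabs tendsto_const) auto
      then have "(\<lambda>k. ennreal (\<bar>\<eta> (r k) x\<bar> powr q)) \<longlonglongrightarrow> ennreal (\<bar>v x\<bar> powr q)" by (rule tendsto_ennrealI)
      then show ?case by (intro lim_imp_Liminf[symmetric]) auto
    qed
  qed
  also have "\<dots> \<le> liminf (\<lambda>k. modular \<Omega> (\<lambda>_. q) (\<eta> (r k)))"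
    unfolding modular_def
  proof (rule nn_integral_liminf)
    show "(\<lambda>x. ennreal (\<bar>\<eta> (r k) x\<bar> powr q)) \<in> borel_measurable (lebesgue_on \<Omega>)" for k
      using test_function_meas_on(1)[OF \<eta>(1)] by simp
  qed
  also have "\<dots> \<le> ennreal C"
  proof (rule Liminf_le)
    have "\<forall>\<^sub>F k in sequentially. r k \<ge> K"
      using filterlim_subseq[OF r(1)] by (auto simp: filterlim_at_top)
    then show "\<forall>\<^sub>F k in sequentially. modular \<Omega> (\<lambda>_. q) (\<eta> (r k)) \<le> ennreal C"
      by eventually_elim (rule bound)
  qed simp
  also have "\<dots> < \<infinity>" by simp
  finally show ?thesis using vm unfolding q_def[symmetric] by (simp add: Lvar_def)
qed

section \<open>Superposition operators on the nonlinear classes\<close>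

lemma modular_cong: "(\<And>x. x \<in> \<Omega> \<Longrightarrow> u x = v x) \<Longrightarrow> modular \<Omega> r u = modular \<Omega> r v"
  unfolding modular_def by (intro nn_integral_cong) auto

lemma Lvar_cong:
  assumes "\<And>x. x \<in> \<Omega> \<Longrightarrow> u x = v x" shows "u \<in> Lvar \<Omega> r \<longleftrightarrow> v \<in> Lvar \<Omega> r"
proof -
  have "u \<in> borel_measurable (lebesgue_on \<Omega>) \<longleftrightarrow> v \<in> borel_measurable (lebesgue_on \<Omega>)"
    using assms by (intro measurable_cong) auto
  then show ?thesis using modular_cong[of \<Omega> u v r] assms by (simp add: Lvar_def)
qed

lemma weak_deriv_cong_iff:
  fixes \<Omega> :: "(real^'n) set"
  assumes "\<And>x. x \<in> \<Omega> \<Longrightarrow> u x = v x" shows "weak_deriv \<Omega> u = weak_deriv \<Omega> v"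
  using assms weak_deriv_cong[of \<Omega> u v] weak_deriv_cong[of \<Omega> v u] by (intro ext iffI) auto

lemma weak_deriv_cong_deriv:
  fixes \<Omega> :: "(real^'n) set"
  assumes "\<And>x. x \<in> \<Omega> \<Longrightarrow> g x = h x" "weak_deriv \<Omega> u i g"
  shows "weak_deriv \<Omega> u i h"
proof -
  have "integrable (lebesgue_on K) h" if "integrable (lebesgue_on K) g" "K \<subseteq> \<Omega>" "compact K" for K
    using that assms(1) by (subst Bochner_Integration.integrable_cong[where g=g, OF refl]) auto
  then have "loc_integrable \<Omega> h" using assms(2) unfolding weak_deriv_def loc_integrable_def by blast
  moreover have "(LINT x|lebesgue_on \<Omega>. h x * \<eta> x) = (LINT x|lebesgue_on \<Omega>. g x * \<eta> x)" for \<eta>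
    using assms(1) by (intro Bochner_Integration.integral_cong) auto
  ultimately show ?thesis using assms(2) by (simp add: weak_deriv_def)
qed

lemma Lnorm_cong: "(\<And>x. x \<in> \<Omega> \<Longrightarrow> u x = v x) \<Longrightarrow> Lnorm \<Omega> r u = Lnorm \<Omega> r v"
proof -
  assume "\<And>x. x \<in> \<Omega> \<Longrightarrow> u x = v x"
  then have "modular \<Omega> r (\<lambda>x. u x / l) = modular \<Omega> r (\<lambda>x. v x / l)" for l by (intro modular_cong) auto
  then show ?thesis by (simp add: Lnorm_def)
qed

lemma W1_0_cong:
  fixes \<Omega> :: "(real^'n) set"
  assumes eq: "\<And>x. x \<in> \<Omega> \<Longrightarrow> u x = v x" and v: "v \<in> W1_0 \<Omega> p"
  shows "u \<in> W1_0 \<Omega> p"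
proof -
  have "W1_norm \<Omega> p (\<lambda>x. u x - \<eta> x) = W1_norm \<Omega> p (\<lambda>x. v x - \<eta> x)" for \<eta>
    using Lnorm_cong[of \<Omega> "\<lambda>x. u x - \<eta> x" "\<lambda>x. v x - \<eta> x"] weak_deriv_cong_iff[of \<Omega> "\<lambda>x. u x - \<eta> x" "\<lambda>x. v x - \<eta> x"] eq
    by (simp add: W1_norm_def wD_def)
  then show ?thesis
    using v Lvar_cong[of \<Omega> u v] weak_deriv_cong_iff[of \<Omega> u v] eq by (simp add: W1_0_def W1_def)
qed

lemma Lvar_mult_bounded_on:
  fixes b u :: "real^'n \<Rightarrow> real"
  assumes "p \<ge> 1" "u \<in> Lvar \<Omega> (\<lambda>_. p)" "b \<in> borel_measurable (lebesgue_on \<Omega>)" "\<And>x. x \<in> \<Omega> \<Longrightarrow> \<bar>b x\<bar> \<le> C"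
  shows "(\<lambda>x. b x * u x) \<in> Lvar \<Omega> (\<lambda>_. p)"
proof -
  have "(\<lambda>x. (if x \<in> \<Omega> then b x else 0) * u x) \<in> Lvar \<Omega> (\<lambda>_. p)"
  proof (rule Lvar_mult_bounded[OF assms(1,2)])
    show "(\<lambda>x. if x \<in> \<Omega> then b x else 0) \<in> borel_measurable (lebesgue_on \<Omega>)"
      using assms(3) by (subst measurable_cong[where g=b]) auto
    show "\<bar>if x \<in> \<Omega> then b x else 0\<bar> \<le> \<bar>C\<bar>" for x using assms(4)[of x] by auto
  qed
  then show ?thesis by (subst Lvar_cong[where v="\<lambda>x. (if x \<in> \<Omega> then b x else 0) * u x"]) auto
qed

text \<open>For |t| <= 1 the product is bounded by 1, from ln s <= s - 1 at s = 1/|t|. For |t| > 1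
  one uses ln |t| <= |t|^a / a with a = q/p - 1, which makes (|t| * |t|^a)^p equal to |t|^q.\<close>

lemma powr_mult_ln_bound:
  fixes t p q :: real
  assumes "0 < p" "p < q"
  shows "\<bar>t * ln \<bar>t\<bar>\<bar> powr p \<le> 1 + (q / p - 1) powr (- p) * \<bar>t\<bar> powr q"
proof (cases "\<bar>t\<bar> \<le> 1")
  case True
  have "\<bar>t * ln \<bar>t\<bar>\<bar> \<le> 1"
  proof (cases "t = 0")
    case False
    then have t: "\<bar>t\<bar> > 0" by simp
    have "ln (1 / \<bar>t\<bar>) \<le> 1 / \<bar>t\<bar> - 1" using t by (intro ln_le_minus_one) simp
    then have "\<bar>t\<bar> * (- ln \<bar>t\<bar>) \<le> \<bar>t\<bar> * (1 / \<bar>t\<bar> - 1)" using t by (intro mult_left_mono) (auto simp: ln_div)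
    also have "\<dots> \<le> 1" using t by (simp add: right_diff_distrib)
    finally show ?thesis using t True by (simp add: abs_mult abs_of_nonpos)
  qed simp
  then have "\<bar>t * ln \<bar>t\<bar>\<bar> powr p \<le> 1 powr p" using assms by (intro powr_mono2) auto
  then show ?thesis by (simp add: add_increasing2)
next
  case False
  define a where "a = q / p - 1"
  have a: "a > 0" using assms by (simp add: a_def)
  have t: "\<bar>t\<bar> > 1" using False by simp
  have "ln \<bar>t\<bar> \<le> \<bar>t\<bar> powr a / a" using t a by (intro ln_powr_bound) auto
  then have "\<bar>t * ln \<bar>t\<bar>\<bar> \<le> \<bar>t\<bar> * (\<bar>t\<bar> powr a / a)" using t mult_left_mono[of "ln \<bar>t\<bar>" "\<bar>t\<bar> powr a / a" "\<bar>t\<bar>"] by (simp add: abs_mult)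
  also have "\<dots> = \<bar>t\<bar> powr (q / p) / a" using t powr_mult_base[of "\<bar>t\<bar>" a] by (simp add: a_def)
  finally have "\<bar>t * ln \<bar>t\<bar>\<bar> powr p \<le> (\<bar>t\<bar> powr (q / p) / a) powr p" using assms by (intro powr_mono2) auto
  also have "\<dots> = a powr (- p) * \<bar>t\<bar> powr q"
    using assms a by (simp add: powr_divide powr_powr powr_minus_divide)
  finally show ?thesis unfolding a_def by simp
qed

lemma Lvar_mult_ln:
  fixes v :: "real^'n \<Rightarrow> real"
  assumes \<Omega>: "open \<Omega>" "bounded \<Omega>" and pq: "0 < p" "p < q" and v: "v \<in> Lvar \<Omega> (\<lambda>_. q)"
  shows "(\<lambda>x. v x * ln \<bar>v x\<bar>) \<in> Lvar \<Omega> (\<lambda>_. p)"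
proof -
  have [measurable]: "v \<in> borel_measurable (lebesgue_on \<Omega>)" and fin: "modular \<Omega> (\<lambda>_. q) v < \<infinity>" using v by (auto simp: Lvar_def)
  let ?c = "(q / p - 1) powr (- p)"
  have "modular \<Omega> (\<lambda>_. p) (\<lambda>x. v x * ln \<bar>v x\<bar>) \<le> (\<integral>\<^sup>+x. 1 + ennreal ?c * ennreal (\<bar>v x\<bar> powr q) \<partial>lebesgue_on \<Omega>)"
    unfolding modular_def
  proof (intro nn_integral_mono)
    fix x
    have "ennreal (\<bar>v x * ln \<bar>v x\<bar>\<bar> powr p) \<le> ennreal (1 + ?c * \<bar>v x\<bar> powr q)"
      by (intro ennreal_leI powr_mult_ln_bound pq)
    then show "ennreal (\<bar>v x * ln \<bar>v x\<bar>\<bar> powr p) \<le> 1 + ennreal ?c * ennreal (\<bar>v x\<bar> powr q)"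
      by (simp add: ennreal_mult')
  qed
  also have "\<dots> = emeasure (lebesgue_on \<Omega>) \<Omega> + ennreal ?c * modular \<Omega> (\<lambda>_. q) v"
    unfolding modular_def by (subst nn_integral_add) (auto simp: nn_integral_cmult)
  also have "\<dots> < \<infinity>" using bounded_lebesgue_on_finite[OF \<Omega>] fin by (simp add: ennreal_mult_less_top)
  finally show ?thesis by (simp add: Lvar_def)
qed

text \<open>A variable exponent has no exact scaling law, but its bounds q and C control the effect
  of l: multiplication by l costs at most max(1, l)^C, and division by l = (M + 1)^(1/q) >= 1 gains
  at least the factor M + 1.\<close>

lemma Lnorm_variable_finite_iff:
  fixes u c :: "real^'n \<Rightarrow> real"
  assumes [measurable]: "u \<in> borel_measurable (lebesgue_on \<Omega>)" "c \<in> borel_measurable (lebesgue_on \<Omega>)"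
    and q: "q > 0" "\<And>x. x \<in> \<Omega> \<Longrightarrow> q \<le> c x" "\<And>x. x \<in> \<Omega> \<Longrightarrow> c x \<le> C"
  shows "Lnorm \<Omega> c u < \<infinity> \<longleftrightarrow> modular \<Omega> c u < \<infinity>"
proof
  assume "Lnorm \<Omega> c u < \<infinity>"
  then obtain l where l: "l > 0" "modular \<Omega> c (\<lambda>x. u x / l) \<le> 1"
    unfolding Lnorm_def Inf_less_iff by auto
  have "modular \<Omega> c u \<le> (\<integral>\<^sup>+x. ennreal (max 1 l powr C) * ennreal (\<bar>u x / l\<bar> powr c x) \<partial>lebesgue_on \<Omega>)"
    unfolding modular_def
  proof (intro nn_integral_mono)
    fix x assume "x \<in> space (lebesgue_on \<Omega>)"
    then have x: "x \<in> \<Omega>" by simp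
    have "\<bar>u x\<bar> powr c x = (l * \<bar>u x / l\<bar>) powr c x" using l(1) by simp
    also have "\<dots> = l powr c x * \<bar>u x / l\<bar> powr c x" by (rule powr_mult)
    also have "\<dots> \<le> max 1 l powr C * \<bar>u x / l\<bar> powr c x"
    proof (rule mult_right_mono)
      have "l powr c x \<le> max 1 l powr c x" using l(1) q(1) q(2)[OF x] by (intro powr_mono2) auto
      also have "\<dots> \<le> max 1 l powr C" using q(3)[OF x] by (intro powr_mono) auto
      finally show "l powr c x \<le> max 1 l powr C" .
    qed simp
    finally show "ennreal (\<bar>u x\<bar> powr c x) \<le> ennreal (max 1 l powr C) * ennreal (\<bar>u x / l\<bar> powr c x)"
      by (simp add: ennreal_mult[symmetric] ennreal_leI)
  qed
  also have "\<dots> = ennreal (max 1 l powr C) * modular \<Omega> c (\<lambda>x. u x / l)"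
    unfolding modular_def by (rule nn_integral_cmult) measurable
  also have "\<dots> < \<infinity>" using l(2) by (simp add: ennreal_mult_less_top) (meson ennreal_one_less_top le_less_trans)
  finally show "modular \<Omega> c u < \<infinity>" .
next
  assume "modular \<Omega> c u < \<infinity>"
  then obtain M where M: "modular \<Omega> c u = ennreal M" "M \<ge> 0" by (cases "modular \<Omega> c u") auto
  define l where "l = (M + 1) powr (1 / q)"
  have l: "l \<ge> 1" "l powr q = M + 1" using M q by (auto simp: l_def powr_powr ge_one_powr_ge_zero)
  have "modular \<Omega> c (\<lambda>x. u x / l) \<le> (\<integral>\<^sup>+x. ennreal (1 / (M + 1)) * ennreal (\<bar>u x\<bar> powr c x) \<partial>lebesgue_on \<Omega>)"
    unfolding modular_def
  proof (intro nn_integral_mono)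
    fix x assume "x \<in> space (lebesgue_on \<Omega>)"
    then have x: "x \<in> \<Omega>" by simp
    have "\<bar>u x / l\<bar> powr c x = (1 / l powr c x) * \<bar>u x\<bar> powr c x" using l(1) by (simp add: abs_divide powr_divide)
    also have "\<dots> \<le> (1 / (M + 1)) * \<bar>u x\<bar> powr c x"
    proof (rule mult_right_mono)
      have "M + 1 \<le> l powr c x" unfolding l(2)[symmetric] using l(1) q(2)[OF x] by (intro powr_mono) auto
      moreover have "0 < M + 1" using M(2) by simp
      ultimately show "1 / l powr c x \<le> 1 / (M + 1)" by (intro divide_left_mono mult_pos_pos) auto
    qed simp
    finally show "ennreal (\<bar>u x / l\<bar> powr c x) \<le> ennreal (1 / (M + 1)) * ennreal (\<bar>u x\<bar> powr c x)"
      using M(2) by (simp add: ennreal_mult[symmetric] ennreal_leI)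
  qed
  also have "\<dots> = ennreal (1 / (M + 1)) * ennreal M"
    unfolding M(1)[symmetric] modular_def by (rule nn_integral_cmult) measurable
  also have "\<dots> = ennreal (M / (M + 1))" using M(2) by (simp add: ennreal_mult[symmetric])
  also have "\<dots> \<le> ennreal 1" using M(2) by (intro ennreal_leI) simp
  finally have "Lnorm \<Omega> c u \<le> ennreal l"
    unfolding Lnorm_def using l(1) by (intro Inf_lower) auto
  also have "\<dots> < \<infinity>" by simp
  finally show "Lnorm \<Omega> c u < \<infinity>" .
qed

text \<open>Bijectivity on a.e. classes is reduced to a pointwise inverse h and to membership of
  representatives. Well-definedness holds because the operator acts pointwise; measurability of the
  preimage is contained in \<open>BA\<close>.\<close>

lemma bij_betw_superpos:
  fixes \<Omega> :: "(real^'n) set"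
  assumes A: "A \<subseteq> borel_measurable (lebesgue_on \<Omega>)" and B: "B \<subseteq> borel_measurable (lebesgue_on \<Omega>)"
    and f: "\<And>u. u \<in> borel_measurable (lebesgue_on \<Omega>) \<Longrightarrow> (\<lambda>x. f x (u x)) \<in> borel_measurable (lebesgue_on \<Omega>)"
    and inv: "\<And>x t. x \<in> \<Omega> \<Longrightarrow> h x (f x t) = t" "\<And>x t. x \<in> \<Omega> \<Longrightarrow> f x (h x t) = t"
    and AB: "\<And>u. u \<in> A \<Longrightarrow> (\<lambda>x. f x (u x)) \<in> B" and BA: "\<And>v. v \<in> B \<Longrightarrow> (\<lambda>x. h x (v x)) \<in> A"
  shows "bij_betw (superpos \<Omega> f) (A // ae_rel \<Omega>) (B // ae_rel \<Omega>)"
proof -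
  let ?E = "ae_rel \<Omega>"
  have eq: "?E `` {u} = ?E `` {w} \<longleftrightarrow> (AE x in lebesgue_on \<Omega>. u x = w x)"
    if m: "u \<in> borel_measurable (lebesgue_on \<Omega>)" "w \<in> borel_measurable (lebesgue_on \<Omega>)" for u w
  proof
    assume "?E `` {u} = ?E `` {w}"
    moreover have "w \<in> ?E `` {w}" using m by (simp add: ae_rel_def)
    ultimately have "w \<in> ?E `` {u}" by simp
    then show "AE x in lebesgue_on \<Omega>. u x = w x" by (simp add: ae_rel_def)
  next
    assume uw: "AE x in lebesgue_on \<Omega>. u x = w x"
    have "(AE x in lebesgue_on \<Omega>. u x = y x) \<longleftrightarrow> (AE x in lebesgue_on \<Omega>. w x = y x)" for y
    proof
      assume "AE x in lebesgue_on \<Omega>. u x = y x" then show "AE x in lebesgue_on \<Omega>. w x = y x" using uw by eventually_elim simp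
    next
      assume "AE x in lebesgue_on \<Omega>. w x = y x" then show "AE x in lebesgue_on \<Omega>. u x = y x" using uw by eventually_elim simp
    qed
    then show "?E `` {u} = ?E `` {w}" using m by (auto simp: ae_rel_def)
  qed
  have sp: "superpos \<Omega> f (?E `` {u}) = ?E `` {\<lambda>x. f x (u x)}" if u: "u \<in> borel_measurable (lebesgue_on \<Omega>)" for u
  proof -
    have "?E `` {\<lambda>x. f x (w x)} = ?E `` {\<lambda>x. f x (u x)}" if "w \<in> ?E `` {u}" for w
    proof -
      have w: "w \<in> borel_measurable (lebesgue_on \<Omega>)" "AE x in lebesgue_on \<Omega>. u x = w x" using that by (auto simp: ae_rel_def)
      have "AE x in lebesgue_on \<Omega>. f x (w x) = f x (u x)" using w(2) by eventually_elim simp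
      then show ?thesis using eq[OF f[OF w(1)] f[OF u]] by simp
    qed
    moreover have "u \<in> ?E `` {u}" using u by (simp add: ae_rel_def)
    ultimately show ?thesis unfolding superpos_def by blast
  qed
  have inj: "?E `` {u} = ?E `` {w}" if u: "u \<in> borel_measurable (lebesgue_on \<Omega>)" and w: "w \<in> borel_measurable (lebesgue_on \<Omega>)"
    and fe: "?E `` {\<lambda>x. f x (u x)} = ?E `` {\<lambda>x. f x (w x)}" for u w
  proof -
    have "AE x in lebesgue_on \<Omega>. f x (u x) = f x (w x)" using fe eq[OF f[OF u] f[OF w]] by simp
    moreover have "AE x in lebesgue_on \<Omega>. x \<in> \<Omega>" by (rule AE_I2) simp
    ultimately have "AE x in lebesgue_on \<Omega>. u x = w x" by eventually_elim (metis inv(1))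
    then show ?thesis using eq[OF u w] by simp
  qed
  show ?thesis
  proof (rule bij_betw_imageI)
    show "inj_on (superpos \<Omega> f) (A // ?E)"
    proof (rule inj_onI)
      fix X Y assume "X \<in> A // ?E" "Y \<in> A // ?E" and s: "superpos \<Omega> f X = superpos \<Omega> f Y"
      then obtain u w where uw: "X = ?E `` {u}" "u \<in> A" "Y = ?E `` {w}" "w \<in> A" by (auto simp: quotient_def)
      then have m: "u \<in> borel_measurable (lebesgue_on \<Omega>)" "w \<in> borel_measurable (lebesgue_on \<Omega>)" using A by auto
      show "X = Y" using s uw inj[OF m] sp[OF m(1)] sp[OF m(2)] by simp
    qed
    show "superpos \<Omega> f ` (A // ?E) = B // ?E"
    proof (intro equalityI subsetI)
      fix Y assume "Y \<in> superpos \<Omega> f ` (A // ?E)"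
      then obtain u where u: "u \<in> A" "Y = superpos \<Omega> f (?E `` {u})" by (auto simp: quotient_def)
      then have "Y = ?E `` {\<lambda>x. f x (u x)}" using sp A by auto
      then show "Y \<in> B // ?E" using AB[OF u(1)] by (auto simp: quotient_def)
    next
      fix Y assume "Y \<in> B // ?E"
      then obtain v where v: "v \<in> B" "Y = ?E `` {v}" by (auto simp: quotient_def)
      let ?u = "\<lambda>x. h x (v x)"
      have u: "?u \<in> A" by (rule BA[OF v(1)])
      then have um: "?u \<in> borel_measurable (lebesgue_on \<Omega>)" using A by auto
      have "AE x in lebesgue_on \<Omega>. f x (?u x) = v x" by (rule AE_I2) (simp add: inv(2))
      then have "?E `` {\<lambda>x. f x (?u x)} = ?E `` {v}" using eq[OF f[OF um]] v(1) B by auto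
      then have "superpos \<Omega> f (?E `` {?u}) = Y" using sp[OF um] v(2) by simp
      then show "Y \<in> superpos \<Omega> f ` (A // ?E)" using u by (auto simp: quotient_def)
    qed
  qed
qed

section \<open>The common theorem behind (a) and (b)\<close>

lemma abs_abs_powr_mult: "\<bar>\<bar>t\<bar> powr a * t\<bar> = \<bar>t::real\<bar> powr (a + 1)"
  by (cases "t = 0") (auto simp: abs_mult powr_add)

text \<open>The signed power with weight a has modulus |t|^(a+1), so two signed powers are inverse
  to each other when the full exponents a + 1 and b + 1 are reciprocal.\<close>

lemma abs_powr_mult_inverse:
  fixes t a b :: real
  assumes "(a + 1) * (b + 1) = 1"
  shows "\<bar>\<bar>t\<bar> powr a * t\<bar> powr b * (\<bar>t\<bar> powr a * t) = t"
proof (cases "t = 0")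
  case False
  have "(a + 1) * b + a = 0" using assms by (simp add: algebra_simps)
  then have "(\<bar>t\<bar> powr (a + 1)) powr b * \<bar>t\<bar> powr a = 1"
    using False by (simp add: powr_powr powr_add[symmetric])
  then show ?thesis unfolding abs_abs_powr_mult by (simp add: mult.assoc[symmetric])
qed simp

lemma continuous_on_closure_bounded_measurable:
  fixes \<Omega> :: "(real^'n) set" and h :: "real^'n \<Rightarrow> real"
  assumes "open \<Omega>" "bounded \<Omega>" "continuous_on (closure \<Omega>) h"
  shows "h \<in> borel_measurable (lebesgue_on \<Omega>)" "\<exists>C. \<forall>x\<in>\<Omega>. \<bar>h x\<bar> \<le> C"
proof -
  have "continuous_on \<Omega> h" using assms(3) closure_subset by (rule continuous_on_subset)
  moreover have "\<Omega> \<in> sets lebesgue" using assms(1) by auto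
  ultimately show "h \<in> borel_measurable (lebesgue_on \<Omega>)" by (rule continuous_imp_measurable_on_sets_lebesgue)
  have "bounded (h ` closure \<Omega>)"
    using assms by (intro compact_imp_bounded compact_continuous_image) auto
  then show "\<exists>C. \<forall>x\<in>\<Omega>. \<bar>h x\<bar> \<le> C" using closure_subset[of \<Omega>] unfolding bounded_real by blast
qed

lemma C1_closure_bounded_measurable:
  fixes \<Omega> :: "(real^'n) set"
  assumes "open \<Omega>" "bounded \<Omega>" "C1_closure \<Omega> f"
  shows "f \<in> borel_measurable (lebesgue_on \<Omega>)" "\<exists>C. \<forall>x\<in>\<Omega>. \<bar>f x\<bar> \<le> C"
    "D i f \<in> borel_measurable (lebesgue_on \<Omega>)" "\<exists>C. \<forall>x\<in>\<Omega>. \<bar>D i f x\<bar> \<le> C"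
proof -
  have c: "continuous_on (closure \<Omega>) f" using assms(3) by (simp add: C1_closure_def)
  show "f \<in> borel_measurable (lebesgue_on \<Omega>)" "\<exists>C. \<forall>x\<in>\<Omega>. \<bar>f x\<bar> \<le> C"
    using continuous_on_closure_bounded_measurable[OF assms(1,2) c] by auto
  obtain h where h: "continuous_on (closure \<Omega>) h" "\<And>x. x \<in> \<Omega> \<Longrightarrow> h x = D i f x"
    using assms(3) unfolding C1_closure_def by blast
  note H = continuous_on_closure_bounded_measurable[OF assms(1,2) h(1)]
  show "D i f \<in> borel_measurable (lebesgue_on \<Omega>)"
    using H(1) by (subst measurable_cong[where g=h]) (auto simp: h(2))
  show "\<exists>C. \<forall>x\<in>\<Omega>. \<bar>D i f x\<bar> \<le> C" using H(2) h(2) by auto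
qed

text \<open>With v = |u|^r u the term with exponent q (r + 1) means that v lies in L^q, and the
  \<alpha>-modular of u is a modular of v. One direction reads L^q from the class, the other obtains
  it from \<open>emb\<close>; in both, q > p puts the logarithmic term in L^p, so that the gradient
  of v and the weighted gradient of u are in L^p together.\<close>

theorem bij_betw_weighted_class:
  fixes \<Omega> :: "(real^'n) set" and r \<alpha> :: "real^'n \<Rightarrow> real" and p q :: real
  assumes n: "CARD('n) \<ge> 2" and dom: "bounded_C1_domain \<Omega>" and r: "C1_closure \<Omega> r" "\<And>x. x \<in> \<Omega> \<Longrightarrow> 0 \<le> r x"
    and pq: "p \<ge> 1" "p < q" and emb: "W1_0 \<Omega> p \<subseteq> Lvar \<Omega> (\<lambda>_. q)"
  shows "bij_betw (superpos \<Omega> (\<lambda>x \<tau>. \<bar>\<tau>\<bar> powr r x * \<tau>))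
     (({u \<in> Lvar \<Omega> (\<lambda>_. 1). \<exists>G. (\<forall>i. weighted_deriv \<Omega> r u i (G i)) \<and>
          (\<Sum>i\<in>UNIV. Lnorm \<Omega> (\<lambda>_. p) (G i)) + Lnorm \<Omega> (\<lambda>x. q * (r x + 1)) u < \<infinity>}
        \<inter> Lvar \<Omega> \<alpha> \<inter> {u. has_trace \<Omega> (\<lambda>x. spow r x (u x)) (\<lambda>_. 0)}) // ae_rel \<Omega>)
     ((W1_0 \<Omega> p \<inter> Lvar \<Omega> (\<lambda>x. \<alpha> x / (r x + 1))) // ae_rel \<Omega>)"
    (is "bij_betw _ (?T // _) (?W // _)")
proof (rule bij_betw_superpos[where h = "\<lambda>x t. \<bar>t\<bar> powr (1 / (r x + 1) - 1) * t"])
  have \<Omega>: "open \<Omega>" "bounded \<Omega>" using dom by (auto simp: bounded_C1_domain_def)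
  note [measurable] = C1_closure_bounded_measurable(1,3)[OF \<Omega> r(1)]
  obtain C where C: "\<And>x. x \<in> \<Omega> \<Longrightarrow> \<bar>r x\<bar> \<le> C" using C1_closure_bounded_measurable(2)[OF \<Omega> r(1)] by blast
  have "\<forall>i. \<exists>M. \<forall>x\<in>\<Omega>. \<bar>D i r x\<bar> \<le> M" using C1_closure_bounded_measurable(4)[OF \<Omega> r(1)] by blast
  then obtain M where M: "\<And>i x. x \<in> \<Omega> \<Longrightarrow> \<bar>D i r x\<bar> \<le> M i" by metis
  have r1: "r x + 1 \<ge> 1" "r x + 1 > 0" "r x + 1 \<noteq> 0" if "x \<in> \<Omega>" for x using r(2)[OF that] by auto
  have p0: "p > 0" "q > 0" using pq by auto
  have b: "\<bar>1 / (r x + 1)\<bar> \<le> 1" "\<bar>D i r x / (r x + 1)\<bar> \<le> M i" if "x \<in> \<Omega>" for x i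
  proof -
    show "\<bar>1 / (r x + 1)\<bar> \<le> 1" using r1[OF that] by simp
    have "\<bar>D i r x\<bar> / (r x + 1) \<le> \<bar>D i r x\<bar> / 1" using r1[OF that] by (intro divide_left_mono) auto
    then show "\<bar>D i r x / (r x + 1)\<bar> \<le> M i" using M[OF that, of i] r1[OF that] by (simp add: abs_divide)
  qed
  show "?T \<subseteq> borel_measurable (lebesgue_on \<Omega>)" "?W \<subseteq> borel_measurable (lebesgue_on \<Omega>)"
    by (auto simp: Lvar_def)
  show "(\<lambda>x. \<bar>u x\<bar> powr r x * u x) \<in> borel_measurable (lebesgue_on \<Omega>)" if [measurable]: "u \<in> borel_measurable (lebesgue_on \<Omega>)" for u
    by measurable
  have hf: "\<bar>\<bar>t\<bar> powr r x * t\<bar> powr (1 / (r x + 1) - 1) * (\<bar>t\<bar> powr r x * t) = t" if "x \<in> \<Omega>" for x t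
    by (rule abs_powr_mult_inverse) (use r1[OF that] in simp)
  have fh: "\<bar>\<bar>t\<bar> powr (1 / (r x + 1) - 1) * t\<bar> powr r x * (\<bar>t\<bar> powr (1 / (r x + 1) - 1) * t) = t" if "x \<in> \<Omega>" for x t
    by (rule abs_powr_mult_inverse) (use r1[OF that] in simp)
  from hf fh show "\<And>x t. x \<in> \<Omega> \<Longrightarrow> \<bar>\<bar>t\<bar> powr r x * t\<bar> powr (1 / (r x + 1) - 1) * (\<bar>t\<bar> powr r x * t) = t"
    "\<And>x t. x \<in> \<Omega> \<Longrightarrow> \<bar>\<bar>t\<bar> powr (1 / (r x + 1) - 1) * t\<bar> powr r x * (\<bar>t\<bar> powr (1 / (r x + 1) - 1) * t) = t"
    by blast+
  have modul: "modular \<Omega> (\<lambda>x. a x / (r x + 1)) (\<lambda>x. \<bar>u x\<bar> powr r x * u x) = modular \<Omega> a u" for a u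
    unfolding modular_def abs_abs_powr_mult by (intro nn_integral_cong) (auto simp: powr_powr r1)
  have modul_q: "modular \<Omega> (\<lambda>_. q) (\<lambda>x. \<bar>u x\<bar> powr r x * u x) = modular \<Omega> (\<lambda>x. q * (r x + 1)) u" for u
    unfolding modular_def abs_abs_powr_mult by (intro nn_integral_cong) (auto simp: powr_powr mult.commute)
  have Lnorm_c: "Lnorm \<Omega> (\<lambda>x. q * (r x + 1)) u < \<infinity> \<longleftrightarrow> modular \<Omega> (\<lambda>x. q * (r x + 1)) u < \<infinity>"
    if "u \<in> borel_measurable (lebesgue_on \<Omega>)" for u
  proof (rule Lnorm_variable_finite_iff[OF that _ p0(2)])
    fix x assume x: "x \<in> \<Omega>"
    show "q \<le> q * (r x + 1)" using p0(2) r1(1)[OF x] by simp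
    show "q * (r x + 1) \<le> q * (C + 1)" using p0(2) C[OF x] by (intro mult_left_mono) auto
  qed measurable
  define L where "L v i x = D i r x / (r x + 1) * (v x * ln \<bar>v x\<bar>)" for v :: "real^'n \<Rightarrow> real" and i x
  \<comment> \<open>As ln |v| = (r + 1) ln |u|, the logarithmic term depends on v alone, up to a
    bounded factor.\<close>
  have L_eq: "D i r x * (\<bar>t\<bar> powr r x * t) * ln \<bar>t\<bar> = D i r x / (r x + 1) * ((\<bar>t\<bar> powr r x * t) * ln \<bar>\<bar>t\<bar> powr r x * t\<bar>)"
    if "x \<in> \<Omega>" for x i and t :: real
    unfolding abs_abs_powr_mult using r1[OF that] by (cases "t = 0") (auto simp: ln_powr)
  have L_Lvar: "L v i \<in> Lvar \<Omega> (\<lambda>_. p)" if "v \<in> Lvar \<Omega> (\<lambda>_. q)" for v i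
    unfolding L_def
    by (rule Lvar_mult_bounded_on[OF pq(1) Lvar_mult_ln[OF \<Omega> p0(1) pq(2) that] _ b(2)]) measurable
  show "(\<lambda>x. \<bar>u x\<bar> powr r x * u x) \<in> ?W" if "u \<in> ?T" for u
  proof -
    define v where "v = (\<lambda>x. \<bar>u x\<bar> powr r x * u x)"
    have spow: "(\<lambda>x. spow r x (u x)) = v" by (simp add: v_def spow_def fun_eq_iff)
    obtain G where u: "u \<in> Lvar \<Omega> (\<lambda>_. 1)" "u \<in> Lvar \<Omega> \<alpha>" and tr: "has_trace \<Omega> v (\<lambda>_. 0)"
      and G: "\<And>i. weighted_deriv \<Omega> r u i (G i)"
        "(\<Sum>i\<in>UNIV. Lnorm \<Omega> (\<lambda>_. p) (G i)) + Lnorm \<Omega> (\<lambda>x. q * (r x + 1)) u < \<infinity>"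
      using \<open>u \<in> ?T\<close> unfolding spow[symmetric] by blast
    have um[measurable]: "u \<in> borel_measurable (lebesgue_on \<Omega>)" using u by (simp add: Lvar_def)
    have vm[measurable]: "v \<in> borel_measurable (lebesgue_on \<Omega>)" unfolding v_def by measurable
    have "modular \<Omega> (\<lambda>_. q) v < \<infinity>" using G(2) Lnorm_c[OF um] unfolding v_def modul_q by simp
    then have vq: "v \<in> Lvar \<Omega> (\<lambda>_. q)" by (simp add: Lvar_def)
    have vp: "v \<in> Lvar \<Omega> (\<lambda>_. p)" by (rule Lvar_mono_exponent[OF p0(1) _ vq \<Omega>]) (use pq in simp)
    have wd: "weak_deriv \<Omega> v i (\<lambda>x. (r x + 1) * G i x + L v i x)" for i
    proof (rule weak_deriv_cong_deriv)
      show "weak_deriv \<Omega> v i (\<lambda>x. (r x + 1) * G i x + D i r x * spow r x (u x) * ln \<bar>u x\<bar>)"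
        using G(1)[of i] by (simp add: weighted_deriv_def spow)
    qed (simp add: L_def v_def spow_def L_eq)
    have G_Lvar: "G i \<in> Lvar \<Omega> (\<lambda>_. p)" for i
    proof -
      note [measurable] = weak_deriv_measurable(2)[OF \<Omega>(1) wd[of i]]
      have [measurable]: "L v i \<in> borel_measurable (lebesgue_on \<Omega>)" using L_Lvar[OF vq] by (simp add: Lvar_def)
      \<comment> \<open>The class does not assert that \<open>G i\<close> is measurable. It is
        recovered by solving the chain rule for it, since the complete weak derivative is
        measurable.\<close>
      have "(\<lambda>x. ((r x + 1) * G i x + L v i x - L v i x) / (r x + 1)) \<in> borel_measurable (lebesgue_on \<Omega>)" by measurable
      then have Gm: "G i \<in> borel_measurable (lebesgue_on \<Omega>)"
        by (subst measurable_cong[where g="\<lambda>x. ((r x + 1) * G i x + L v i x - L v i x) / (r x + 1)"]) (auto simp: r1)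
      have "Lnorm \<Omega> (\<lambda>_. p) (G i) \<le> (\<Sum>i\<in>UNIV. Lnorm \<Omega> (\<lambda>_. p) (G i))" by (rule member_le_sum) auto
      also have "\<dots> < \<infinity>" using G(2) by simp
      finally show ?thesis using Lnorm_finite_iff[OF Gm p0(1)] Gm by (simp add: Lvar_def)
    qed
    have "(\<lambda>x. (r x + 1) * G i x) \<in> Lvar \<Omega> (\<lambda>_. p)" for i
      by (rule Lvar_mult_bounded_on[OF pq(1) G_Lvar, where C="C + 1"]) (use C in \<open>force+\<close>)
    then have "v \<in> W1_0 \<Omega> p"
      using zero_trace_imp_W1_0[OF n dom pq(1) vp _ wd tr] Lvar_add[OF pq(1) _ L_Lvar[OF vq]] by blast
    moreover have "v \<in> Lvar \<Omega> (\<lambda>x. \<alpha> x / (r x + 1))"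
      using u(2) vm modul[of \<alpha> u] by (simp add: Lvar_def v_def)
    ultimately show ?thesis unfolding v_def by blast
  qed
  show "(\<lambda>x. \<bar>v x\<bar> powr (1 / (r x + 1) - 1) * v x) \<in> ?T" if v: "v \<in> ?W" for v
  proof -
    define u where "u = (\<lambda>x. \<bar>v x\<bar> powr (1 / (r x + 1) - 1) * v x)"
    have fu: "\<bar>u x\<bar> powr r x * u x = v x" if "x \<in> \<Omega>" for x using fh[OF that] by (simp add: u_def)
    have mcong: "modular \<Omega> a (\<lambda>x. \<bar>u x\<bar> powr r x * u x) = modular \<Omega> a v" for a
      by (rule modular_cong) (rule fu)
    have wcong: "weak_deriv \<Omega> (\<lambda>x. \<bar>u x\<bar> powr r x * u x) = weak_deriv \<Omega> v"
      by (rule weak_deriv_cong_iff) (rule fu)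
    have vq: "v \<in> Lvar \<Omega> (\<lambda>_. q)" and vW: "v \<in> W1_0 \<Omega> p" using v emb by auto
    then have vm[measurable]: "v \<in> borel_measurable (lebesgue_on \<Omega>)" by (simp add: Lvar_def)
    have um[measurable]: "u \<in> borel_measurable (lebesgue_on \<Omega>)" unfolding u_def by measurable
    have mc: "modular \<Omega> (\<lambda>x. q * (r x + 1)) u < \<infinity>"
      using vq mcong[of "\<lambda>_. q"] unfolding modul_q by (simp add: Lvar_def)
    have m\<alpha>: "u \<in> Lvar \<Omega> \<alpha>"
      using v mcong[of "\<lambda>x. \<alpha> x / (r x + 1)"] um unfolding modul by (simp add: Lvar_def)
    \<comment> \<open>Integrability of u itself comes from q (r + 1) >= 1 and the finite measure of
      \<Omega>.\<close>
    have "modular \<Omega> (\<lambda>_. 1) u \<le> (\<integral>\<^sup>+x. 1 + ennreal (\<bar>u x\<bar> powr (q * (r x + 1))) \<partial>lebesgue_on \<Omega>)"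
      unfolding modular_def
    proof (intro nn_integral_mono)
      fix x assume "x \<in> space (lebesgue_on \<Omega>)"
      then have x: "x \<in> \<Omega>" by simp
      have "1 * 1 \<le> q * (r x + 1)" using pq r1(1)[OF x] by (intro mult_mono) auto
      then have "\<bar>u x\<bar> powr 1 \<le> 1 + \<bar>u x\<bar> powr (q * (r x + 1))"
        using powr_mono[of 1 "q * (r x + 1)" "\<bar>u x\<bar>"] by (cases "\<bar>u x\<bar> \<le> 1") (auto intro: add_increasing2)
      then have "ennreal (\<bar>u x\<bar> powr 1) \<le> ennreal (1 + \<bar>u x\<bar> powr (q * (r x + 1)))" by (rule ennreal_leI)
      then show "ennreal (\<bar>u x\<bar> powr 1) \<le> 1 + ennreal (\<bar>u x\<bar> powr (q * (r x + 1)))" by simp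
    qed
    also have "\<dots> = emeasure (lebesgue_on \<Omega>) \<Omega> + modular \<Omega> (\<lambda>x. q * (r x + 1)) u"
      unfolding modular_def by (subst nn_integral_add) auto
    also have "\<dots> < \<infinity>" using bounded_lebesgue_on_finite[OF \<Omega>] mc by simp
    finally have u1: "u \<in> Lvar \<Omega> (\<lambda>_. 1)" using um by (simp add: Lvar_def)
    have spow: "(\<lambda>x. spow r x (u x)) = (\<lambda>x. \<bar>u x\<bar> powr r x * u x)" by (simp add: spow_def)
    have tr: "has_trace \<Omega> (\<lambda>x. spow r x (u x)) (\<lambda>_. 0)"
      unfolding spow by (rule W1_0_imp_zero_trace[OF \<Omega> pq(1) W1_0_cong[OF _ vW]]) (rule fu)
    have "\<forall>i. \<exists>g\<in>Lvar \<Omega> (\<lambda>_. p). weak_deriv \<Omega> v i g" using vW by (simp add: W1_0_def W1_def)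
    then obtain g where g: "\<And>i. g i \<in> Lvar \<Omega> (\<lambda>_. p)" "\<And>i. weak_deriv \<Omega> v i (g i)" by metis
    \<comment> \<open>The chain rule g = (r + 1) G + L v, solved for G; division by r + 1 >= 1 keeps
      it in L^p.\<close>
    define G where "G i x = 1 / (r x + 1) * (g i x + - 1 * L v i x)" for i x
    have G_Lvar: "G i \<in> Lvar \<Omega> (\<lambda>_. p)" for i
    proof -
      have "(\<lambda>x. - 1 * L v i x) \<in> Lvar \<Omega> (\<lambda>_. p)"
        by (rule Lvar_mult_bounded_on[OF pq(1) L_Lvar[OF vq], where C=1]) auto
      then have "(\<lambda>x. g i x + - 1 * L v i x) \<in> Lvar \<Omega> (\<lambda>_. p)" by (rule Lvar_add[OF pq(1) g(1)])
      then have "(\<lambda>x. 1 / (r x + 1) * (g i x + - 1 * L v i x)) \<in> Lvar \<Omega> (\<lambda>_. p)"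
        by (rule Lvar_mult_bounded_on[OF pq(1) _ _ b(1)]) measurable
      then show ?thesis by (simp add: G_def[abs_def])
    qed
    then have "Lnorm \<Omega> (\<lambda>_. p) (G i) < \<infinity>" for i
      using Lnorm_finite_iff[OF _ p0(1), of "G i" \<Omega>] by (simp add: Lvar_def)
    then have fin: "(\<Sum>i\<in>UNIV. Lnorm \<Omega> (\<lambda>_. p) (G i)) + Lnorm \<Omega> (\<lambda>x. q * (r x + 1)) u < \<infinity>"
      using Lnorm_c[OF um] mc by (simp add: less_top)
    have "weighted_deriv \<Omega> r u i (G i)" for i
      unfolding weighted_deriv_def spow
    proof (rule weak_deriv_cong_deriv)
      show "weak_deriv \<Omega> (\<lambda>x. \<bar>u x\<bar> powr r x * u x) i (g i)"
        using g(2)[of i] by (simp add: wcong)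
      show "g i x = (r x + 1) * G i x + D i r x * spow r x (u x) * ln \<bar>u x\<bar>" if "x \<in> \<Omega>" for x
        using L_eq[OF that, of i "u x"] r1[OF that] by (simp add: spow_def fu[OF that] G_def L_def)
    qed
    then show ?thesis using u1 m\<alpha> tr fin unfolding u_def[symmetric] by blast
  qed
qed

section \<open>Specialisation to \<open>T0\<close> and \<open>T0_tilde\<close>\<close>

lemma C1_closure_affine:
  assumes "C1_closure \<Omega> f"
  shows "C1_closure \<Omega> (\<lambda>x. a * f x + b)"
proof -
  have d: "((\<lambda>x. a * f x + b) has_derivative (\<lambda>h. a * frechet_derivative f (at x) h)) (at x)" if "x \<in> \<Omega>" for x
  proof -
    have "f differentiable (at x)" using assms that by (simp add: C1_closure_def)
    then have "(f has_derivative frechet_derivative f (at x)) (at x)" by (simp add: frechet_derivative_works)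
    then show ?thesis by (auto intro!: derivative_eq_intros)
  qed
  have D: "D i (\<lambda>x. a * f x + b) x = a * D i f x" if "x \<in> \<Omega>" for i x
    using frechet_derivative_at[OF d[OF that]] by (simp add: D_def fun_eq_iff)
  show ?thesis
    unfolding C1_closure_def
  proof (intro conjI allI ballI)
    show "continuous_on (closure \<Omega>) (\<lambda>x. a * f x + b)"
      using assms by (intro continuous_intros) (simp add: C1_closure_def)
    show "(\<lambda>x. a * f x + b) differentiable (at x)" if "x \<in> \<Omega>" for x
      using d[OF that] by (auto simp: differentiable_def)
    fix i
    obtain h where h: "continuous_on (closure \<Omega>) h" "\<And>x. x \<in> \<Omega> \<Longrightarrow> h x = D i f x"
      using assms unfolding C1_closure_def by blast
    show "\<exists>h. continuous_on (closure \<Omega>) h \<and> (\<forall>x\<in>\<Omega>. h x = D i (\<lambda>x. a * f x + b) x)"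
      by (rule exI[of _ "\<lambda>x. a * h x"]) (use h D in \<open>auto intro!: continuous_intros\<close>)
  qed
qed

text \<open>The set where f < m is open and null, hence empty. This turns \<rho> >= m almost
  everywhere into the pointwise nonnegativity of the weight exponents.\<close>

lemma AE_ge_imp_ge_everywhere:
  fixes f :: "'a::euclidean_space \<Rightarrow> real"
  assumes "open \<Omega>" "continuous_on \<Omega> f" "AE x in lebesgue_on \<Omega>. m \<le> f x" "x \<in> \<Omega>"
  shows "m \<le> f x"
proof (rule ccontr)
  define U where "U = \<Omega> \<inter> f -` {..<m}"
  have U: "open U" unfolding U_def using assms(1,2) by (simp add: continuous_open_preimage)
  assume "\<not> m \<le> f x"
  then have "U \<noteq> {}" using assms(4) by (auto simp: U_def)
  have "AE x in lebesgue. x \<in> \<Omega> \<longrightarrow> m \<le> f x"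
    using assms(1,3) by (simp add: AE_restrict_space_iff)
  then have "AE x in lebesgue. x \<notin> U" by eventually_elim (auto simp: U_def)
  then have "U \<in> null_sets lebesgue" using U by (subst AE_iff_null_sets) auto
  then show False using open_not_negligible[OF U \<open>U \<noteq> {}\<close>] by (simp add: negligible_iff_null_sets)
qed

theorem lemma4p2:
  fixes \<Omega> :: "(real^'n) set" and \<rho> \<phi> :: "real^'n \<Rightarrow> real" and m :: real
  assumes "CARD('n) \<ge> 2"
    and "bounded_C1_domain \<Omega>"
    and "C1_closure \<Omega> \<rho>"
    and "2 \<le> ess_inf \<Omega> \<rho>" and "ess_sup \<Omega> \<rho> < \<infinity>"
    and "m \<ge> 2" and "AE x in lebesgue_on \<Omega>. \<rho> x \<ge> m"
    and "conj_exp m < real CARD('n)"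
    and "\<phi> \<in> borel_measurable (lebesgue_on \<Omega>)"
    and "1 \<le> ess_inf \<Omega> \<phi>" and "ess_sup \<Omega> \<phi> < \<infinity>"
  shows "bij_betw (superpos \<Omega> (\<lambda>x \<tau>. \<bar>\<tau>\<bar> powr (\<rho> x - 2) * \<tau>))
           (T0 \<Omega> m \<rho> \<phi> // ae_rel \<Omega>)
           ((W1_0 \<Omega> (conj_exp m) \<inter>
               Lvar \<Omega> (\<lambda>x. (\<phi> x + psi m \<rho> x) / ((m - 1) * (psi m \<rho> x + 1)))) // ae_rel \<Omega>)
       \<and> bij_betw (superpos \<Omega> (\<lambda>x \<tau>. \<bar>\<tau>\<bar> powr (psi m \<rho> x) * \<tau>))
           (T0_tilde \<Omega> m \<rho> \<phi> // ae_rel \<Omega>)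
           ((W1_0 \<Omega> m \<inter>
               Lvar \<Omega> (\<lambda>x. (\<phi> x + psi m \<rho> x) / (psi m \<rho> x + 1))) // ae_rel \<Omega>)"
proof
  define n k where "n = real CARD('n)" and "k = conj_exp m"
  have n: "n \<ge> 2" using assms(1) by (simp add: n_def)
  have k: "1 < k" "k \<le> 2" "k < n" using assms(6,8) by (auto simp: k_def n_def conj_exp_def field_simps)
  have km: "k * (m - 1) = m" using assms(6) by (simp add: k_def conj_exp_def)
  have \<Omega>: "open \<Omega>" "bounded \<Omega>" using assms(2) by (auto simp: bounded_C1_domain_def)
  have "continuous_on \<Omega> \<rho>"
    using assms(3) closure_subset[of \<Omega>] by (auto simp: C1_closure_def intro: continuous_on_subset)
  from AE_ge_imp_ge_everywhere[OF \<Omega>(1) this assms(7)] have \<rho>: "m \<le> \<rho> x" if "x \<in> \<Omega>" for x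
    using that .
  have psi1: "(m - 1) * (psi m \<rho> x + 1) = \<rho> x - 1" for x
    using assms(6) by (simp add: psi_def field_simps)

  show "bij_betw (superpos \<Omega> (\<lambda>x \<tau>. \<bar>\<tau>\<bar> powr (\<rho> x - 2) * \<tau>)) (T0 \<Omega> m \<rho> \<phi> // ae_rel \<Omega>)
      ((W1_0 \<Omega> (conj_exp m) \<inter> Lvar \<Omega> (\<lambda>x. (\<phi> x + psi m \<rho> x) / ((m - 1) * (psi m \<rho> x + 1)))) // ae_rel \<Omega>)"
  proof -
    have crit: "crit_exp m \<rho> = (\<lambda>x. n * k / (n - k) * (\<rho> x - 2 + 1))"
      by (simp add: crit_exp_def n_def k_def fun_eq_iff)
    have "C1_closure \<Omega> (\<lambda>x. \<rho> x - 2)" using C1_closure_affine[OF assms(3), of 1 "-2"] by simp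
    moreover have "0 \<le> \<rho> x - 2" if "x \<in> \<Omega>" for x using \<rho>[OF that] assms(6) by simp
    moreover have "k < n * k / (n - k)" using k n by (simp add: pos_less_divide_eq algebra_simps)
    moreover have "W1_0 \<Omega> k \<subseteq> Lvar \<Omega> (\<lambda>_. n * k / (n - k))"
      using sobolev_W1_0[OF assms(1) \<Omega> k(1), of k] k(3) by (auto simp: n_def)
    ultimately show ?thesis
      using bij_betw_weighted_class[OF assms(1,2), of "\<lambda>x. \<rho> x - 2" k "n * k / (n - k)" "\<lambda>x. \<phi> x + psi m \<rho> x"] k(1)
      unfolding T0_def crit psi1 k_def[symmetric] by simp
  qed

  show "bij_betw (superpos \<Omega> (\<lambda>x \<tau>. \<bar>\<tau>\<bar> powr (psi m \<rho> x) * \<tau>)) (T0_tilde \<Omega> m \<rho> \<phi> // ae_rel \<Omega>)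
      ((W1_0 \<Omega> m \<inter> Lvar \<Omega> (\<lambda>x. (\<phi> x + psi m \<rho> x) / (psi m \<rho> x + 1))) // ae_rel \<Omega>)"
  proof -
    \<comment> \<open>The critical exponent is the same as in (a): k (m - 1) = m turns k (\<rho> -
      1) = k (m - 1) (\<psi> + 1) into m (\<psi> + 1).\<close>
    have crit: "crit_exp m \<rho> = (\<lambda>x. n * m / (n - k) * (psi m \<rho> x + 1))"
    proof
      fix x
      have "crit_exp m \<rho> x = n * (k * (\<rho> x - 1)) / (n - k)" by (simp add: crit_exp_def n_def k_def)
      also have "k * (\<rho> x - 1) = m * (psi m \<rho> x + 1)" by (simp only: psi1[symmetric] km mult.assoc[symmetric])
      finally show "crit_exp m \<rho> x = n * m / (n - k) * (psi m \<rho> x + 1)" by simp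
    qed
    have "psi m \<rho> = (\<lambda>x. 1 / (m - 1) * \<rho> x + - m / (m - 1))" by (simp add: psi_def fun_eq_iff diff_divide_distrib)
    then have C1: "C1_closure \<Omega> (psi m \<rho>)" using C1_closure_affine[OF assms(3)] by metis
    have pos: "0 \<le> psi m \<rho> x" if "x \<in> \<Omega>" for x using \<rho>[OF that] assms(6) by (simp add: psi_def)
    have less: "m < n * m / (n - k)" using k n assms(6) by (simp add: pos_less_divide_eq algebra_simps)
    \<comment> \<open>\<open>s\<close> is the exponent whose Sobolev conjugate is \<open>n m / (n - k)\<close>; it lies strictly between
      \<open>1\<close> and \<open>n\<close> even when \<open>m \<ge> n\<close>.\<close>
    define s where "s = n * m / (n - k + m)"
    have d: "n - k + m > 0" using k assms(6) by simp
    \<comment> \<open>The inequality 1 < s amounts to n m > n - k + m, that is, (n - 1) (m - 1) > 1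
      - k.\<close>
    have "1 * 1 \<le> (n - 1) * (m - 1)" using n assms(6) by (intro mult_mono) auto
    then have s1: "1 < s" using d k by (simp add: s_def pos_less_divide_eq algebra_simps)
    have s2: "s < n" using d k n by (simp add: s_def pos_divide_less_eq)
    have s3: "s \<le> m" using d k assms(6) by (simp add: s_def pos_divide_le_eq)
    have "n - s = n * (n - k) / (n - k + m)" using d by (simp add: s_def field_simps)
    then have "n * s / (n - s) = n * m / (n - k)" using d k n by (simp add: s_def)
    then have "W1_0 \<Omega> m \<subseteq> Lvar \<Omega> (\<lambda>_. n * m / (n - k))"
      using sobolev_W1_0[OF assms(1) \<Omega> s1 _ s3] s2 by (auto simp: n_def)
    then show ?thesis
      using bij_betw_weighted_class[OF assms(1,2) C1 pos _ less, of "\<lambda>x. \<phi> x + psi m \<rho> x"] assms(6)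
      unfolding T0_tilde_def crit by simp
  qed
qed

end
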